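(* In the change point model of the context, let $\mu^{(1)}-\mu^{(2)}=\Phi$ for a fixed continuous function $\Phi:[0,1]\to\mathbb R$, $\Phi\not\equiv0$. Suppose that assumptions A1), A2), A3) listed in the context hold for the supremum norm (and hence also for the $L^1$ and $L^2$ norms), that $X_{n,i}$ takes values in $C([0,1])$, and that $\mathbb E[|\epsilon_i(s)-\epsilon_i(t)|^2]^{1/2}\lesssim|s-t|^\alpha$ for all $s,t\in[0,1]$ and some $\alpha>1/2$. For $i\in\{1,2,\infty\}$ let $\hat T_n^{(i)}=\sqrt n\max_{s\in[0,1]}\|\mathbb U_n(s)\|_i$. Then, in distribution as $n\to\infty$, $$\hat T_n^{(1)}-\sqrt n\,\|\Phi\|_1\rightarrow A_1:=\int_{\{\Phi\ne0\}}\operatorname{sgn}(\Phi(t))\,(\mathbb W(s^* )-s^*\mathbb W(1))(t)\,dt+\int_{\{\Phi=0\}}\big|(\mathbb W(s^* )-s^*\mathbb W(1))(t)\big|\,dt,$$ $$\hat T_n^{(2)}-\sqrt n\,\|\Phi\|_2\rightarrow A_2:=\big\langle\mathbb W(s^* )-s^*\mathbb W(1),\,\Phi/\|\Phi\|_2\big\rangle,$$ $$\hat T_n^{(\infty)}-\sqrt n\,\|\Phi\|_\infty\rightarrow A_\infty:=\sup_{t\in\mathcal E}\operatorname{sgn}(\Phi(t))\,\big(\mathbb W(s^*,t)-s^*\mathbb W(1,t)\big),$$ where $\mathcal E=\{t\in[0,1]:|\Phi(t)|=\|\Phi\|_\infty\}$.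
   Context: $\|\cdot\|_1,\|\cdot\|_2,\|\cdot\|_\infty$ are the $L^1[0,1]$, $L^2[0,1]$ and supremum norms, $\langle\cdot,\cdot\rangle$ the $L^2[0,1]$ inner product. Model: $X_i=X_{n,i}=\mu_{n,i}+\epsilon_i$, $i=1,\dots,n$, where $(\epsilon_i)_{i\in\mathbb N}$ is a mean zero stationary sequence of random functions on $[0,1]$, and for $k^*=\lfloor ns^*\rfloor$ with $s^*\in(0,1)$, $\mu_{n,i}=\mu^{(1)}$ for $i\le k^*$ and $\mu_{n,i}=\mu^{(2)}$ for $i>k^*$. Assumptions (for the supremum norm): A1) $\mathbb E[\|\epsilon_i\|_\infty^{2+\delta}]<\infty$ for some $\delta>0$. A2) $(\epsilon_i)$ is $\beta$-mixing with coefficients $\beta(k)=\sup_j\mathbb E\big[\sup_{A\in\sigma(\epsilon_i,\,i\ge j+k)}|\mathbb P(A\mid\sigma(\epsilon_i,\,i\le j))-\mathbb P(A)|\big]$ satisfying $\beta(k)\le k^{-(1+\epsilon)(1+2/\delta)}$ and $\sum_{k\ge1}k^{1/(1/2-\tau)}\beta(k)^{\delta/(2+\delta)}<\infty$ for some $\epsilon>0$ and some $\tau\in(1/(2+2\delta),1/2)$. A3) $\int_0^1\sqrt{\mathbb E[\epsilon_i(t)^2]}\,dt<\infty$. Sums with non-integer bounds are linearly interpolated: $\sum_{i=1}^{x}a_i=\sum_{i=1}^{\lfloor x\rfloor}a_i+(x-\lfloor x\rfloor)a_{\lfloor x\rfloor+1}$, and $\mathbb U_n(s)=\frac1n\big(\sum_{i=1}^{ns}X_i-s\sum_{i=1}^nX_i\big)$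 for $s\in[0,1]$. $\mathbb W$ is a $C([0,1])$-valued Brownian motion (continuous, $\mathbb W(0)=0$, stationary independent centered Gaussian increments) such that the covariance of $\mathbb W(1)$ is the long run covariance $C(l,l')=\mathbb E[l(\epsilon_1)l'(\epsilon_1)]+\sum_{j\ge1}\big(\mathbb E[l(\epsilon_1)l'(\epsilon_{1+j})]+\mathbb E[l(\epsilon_{1+j})l'(\epsilon_1)]\big)$ of the error sequence, for continuous linear functionals $l,l'$; $\mathbb W(s,t)=(\mathbb W(s))(t)$. $a\lesssim b$ means $a\le cb$ for a constant $c>0$.
   Formalization: The statistics are centred by √n s*(1−s* )‖Φ‖ instead of √n‖Φ‖, since U_n(s* ) is about s*(1−s* )Φ; with zero errors the printed difference tends to −∞ while all limits are 0. The limits A_1, A_2, A_∞ are unchanged. *)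

theory Defs
  imports "HOL-Probability.Probability"
begin

section \<open>The Banach space C([0,1])\<close>

typedef unit_interval = "{0..1::real}"
  by (intro exI[of _ 0]) simp

setup_lifting type_definition_unit_interval

instantiation unit_interval :: metric_space
begin

lift_definition dist_unit_interval :: "unit_interval \<Rightarrow> unit_interval \<Rightarrow> real" is dist .

definition uniformity_unit_interval :: "(unit_interval \<times> unit_interval) filter"
  where "uniformity_unit_interval = (INF e\<in>{0<..}. principal {(x, y). dist x y < e})"

definition open_unit_interval :: "unit_interval set \<Rightarrow> bool"
  where "open_unit_interval S = (\<forall>x\<in>S. \<forall>\<^sub>F (x', y) in uniformity. x' = x \<longrightarrow> y \<in> S)"

instance
proof
  fix x y z :: unit_interval
  show "dist x y = 0 \<longleftrightarrow> x = y"
    by transfer simp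
  show "dist x y \<le> dist x z + dist y z"
    by transfer (rule dist_triangle2)
qed (rule uniformity_unit_interval_def open_unit_interval_def)+

end

text \<open>
  Since \<open>[0,1]\<close> is compact, the bounded continuous functions on it are all the continuous
  functions. Their \<^const>\<open>norm\<close> is the supremum norm (\<open>norm_C01\<close> below), \<^const>\<open>borel\<close> is the
  Borel sigma-algebra of that norm, and \<^const>\<open>bounded_linear\<close> describes the dual space.
\<close>

type_synonym C01 = "unit_interval \<Rightarrow>\<^sub>C real"

text \<open>The value at a real point; only used for points of \<open>[0,1]\<close>.\<close>

definition val_at :: "C01 \<Rightarrow> real \<Rightarrow> real" where
  "val_at f t = apply_bcontfun f (Abs_unit_interval t)"

lemma continuous_on_val_at: "continuous_on {0..1} (val_at f)"
proof -
  have "continuous_on {0..1} Abs_unit_interval"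
    by (auto simp: continuous_on_iff dist_unit_interval.rep_eq Abs_unit_interval_inverse)
  from continuous_on_compose2[OF continuous_on_apply_bcontfun[of UNIV f] this]
  have "continuous_on {0..1} (\<lambda>t. apply_bcontfun f (Abs_unit_interval t))"
    by simp
  then show ?thesis
    by (simp add: val_at_def[abs_def])
qed

lemma C01_of_continuous_on:
  assumes "continuous_on {0..1} g"
  shows "\<exists>f :: C01. \<forall>t\<in>{0..1}. val_at f t = g t"
proof -
  have "continuous_on UNIV Rep_unit_interval"
    by (auto simp: continuous_on_iff dist_unit_interval.rep_eq)
  then have "continuous_on UNIV (\<lambda>x. g (Rep_unit_interval x))"
    using Rep_unit_interval by (intro continuous_on_compose2[OF assms]) auto
  moreover have "range (\<lambda>x. g (Rep_unit_interval x)) \<subseteq> g ` {0..1}"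
    using Rep_unit_interval by auto
  moreover have "bounded (g ` {0..1})"
    by (intro compact_imp_bounded compact_continuous_image assms) auto
  ultimately have "(\<lambda>x. g (Rep_unit_interval x)) \<in> bcontfun"
    by (auto simp: bcontfun_def intro: bounded_subset)
  then show ?thesis
    by (intro exI[of _ "Bcontfun (\<lambda>x. g (Rep_unit_interval x))"])
       (auto simp: val_at_def Bcontfun_inverse Abs_unit_interval_inverse)
qed

lemma norm_C01: "norm f = (SUP t\<in>{0..1}. \<bar>val_at f t\<bar>)"
proof -
  have "(\<lambda>t. \<bar>val_at f t\<bar>) ` {0..1} = range (\<lambda>x. \<bar>apply_bcontfun f x\<bar>)"
  proof safe
    fix x show "\<bar>apply_bcontfun f x\<bar> \<in> (\<lambda>t. \<bar>val_at f t\<bar>) ` {0..1}"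
      using Rep_unit_interval[of x]
      by (intro image_eqI[of _ _ "Rep_unit_interval x"]) (auto simp: val_at_def Rep_unit_interval_inverse)
  qed (auto simp: val_at_def)
  then show ?thesis
    by (simp add: norm_bcontfun_def dist_bcontfun_def)
qed

definition L1_norm :: "C01 \<Rightarrow> real" where
  "L1_norm f = (LINT t:{0..1}|lborel. \<bar>val_at f t\<bar>)"

definition L2_inner :: "C01 \<Rightarrow> C01 \<Rightarrow> real" where
  "L2_inner f g = (LINT t:{0..1}|lborel. val_at f t * val_at g t)"

definition L2_norm :: "C01 \<Rightarrow> real" where
  "L2_norm f = sqrt (L2_inner f f)"


section \<open>Stationarity, mixing and long run covariance\<close>

text \<open>Sequences of random functions are indexed by \<open>1, 2, 3, \<dots>\<close>; index \<open>0\<close> is never used.\<close>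

definition stationary_seq :: "'w measure \<Rightarrow> (nat \<Rightarrow> 'w \<Rightarrow> C01) \<Rightarrow> bool" where
  "stationary_seq M e \<longleftrightarrow>
     (\<forall>h. distr M (Pi\<^sub>M {1..} (\<lambda>_. borel)) (\<lambda>\<omega>. \<lambda>i\<in>{1..}. e (i + h) \<omega>)
        = distr M (Pi\<^sub>M {1..} (\<lambda>_. borel)) (\<lambda>\<omega>. \<lambda>i\<in>{1..}. e i \<omega>))"

definition generated_sigma :: "'w measure \<Rightarrow> (nat \<Rightarrow> 'w \<Rightarrow> C01) \<Rightarrow> nat set \<Rightarrow> 'w measure" where
  "generated_sigma M e I = sigma (space M) (\<Union>i\<in>I. {e i -` B \<inter> space M |B. B \<in> sets borel})"

text \<open>
  The supremum over events in the definition of the mixing coefficients is over an uncountable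
  family of functions that are only determined up to null sets, so it is the essential supremum
  of that family: the almost surely smallest random variable dominating each member almost
  surely.
\<close>

definition is_ess_Sup :: "'w measure \<Rightarrow> ('w \<Rightarrow> real) set \<Rightarrow> ('w \<Rightarrow> real) \<Rightarrow> bool" where
  "is_ess_Sup M F g \<longleftrightarrow>
     g \<in> borel_measurable M \<and>
     (\<forall>f\<in>F. AE \<omega> in M. f \<omega> \<le> g \<omega>) \<and>
     (\<forall>h\<in>borel_measurable M. (\<forall>f\<in>F. AE \<omega> in M. f \<omega> \<le> h \<omega>) \<longrightarrow> (AE \<omega> in M. g \<omega> \<le> h \<omega>))"

definition ess_Sup :: "'w measure \<Rightarrow> ('w \<Rightarrow> real) set \<Rightarrow> 'w \<Rightarrow> real" where
  "ess_Sup M F = (SOME g. is_ess_Sup M F g)"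

text \<open>Existence, so that \<open>SOME\<close> in \<open>ess_Sup\<close> always picks a genuine essential supremum below.\<close>

lemma (in prob_space) ex_ess_Sup_bounded:
  assumes ne: "F \<noteq> {}"
    and meas: "\<And>f. f \<in> F \<Longrightarrow> f \<in> borel_measurable M"
    and bound: "\<And>f \<omega>. f \<in> F \<Longrightarrow> \<bar>f \<omega>\<bar> \<le> c"
  shows "\<exists>g. is_ess_Sup M F g"
proof -
  define s where "s G \<omega> = (SUP f\<in>G. f \<omega>)" for G :: "('a \<Rightarrow> real) set" and \<omega>
  define K where "K = {G. countable G \<and> G \<noteq> {} \<and> G \<subseteq> F}"
  have bdd: "bdd_above ((\<lambda>f. f \<omega>) ` G)" if "G \<subseteq> F" for G \<omega>
    using that bound by (intro bdd_aboveI[of _ c]) (auto simp: abs_le_iff)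
  have up: "f \<omega> \<le> s G \<omega>" if "G \<subseteq> F" "f \<in> G" for f G \<omega>
    unfolding s_def using that by (intro cSUP_upper bdd)
  have s_abs: "\<bar>s G \<omega>\<bar> \<le> c" if "G \<in> K" for G \<omega>
  proof -
    have "G \<subseteq> F" "G \<noteq> {}" using that by (auto simp: K_def)
    then obtain f where "f \<in> G" "f \<in> F" by blast
    then have "- c \<le> s G \<omega>" using bound[of f \<omega>] up[of G f \<omega>] \<open>G \<subseteq> F\<close> by (auto simp: abs_le_iff)
    moreover have "s G \<omega> \<le> c"
      unfolding s_def using \<open>G \<subseteq> F\<close> \<open>G \<noteq> {}\<close> bound by (intro cSUP_least) (auto simp: abs_le_iff)
    ultimately show ?thesis by (simp add: abs_le_iff)
  qed
  have s_meas: "s G \<in> borel_measurable M" if "G \<in> K" for G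
    unfolding s_def[abs_def] using that meas bdd
    by (intro borel_measurable_cSUP) (auto simp: K_def)
  have s_int: "integrable M (s G)" if "G \<in> K" for G
    using s_abs[OF that] by (intro integrable_const_bound[of _ c] s_meas that) auto
  have s_mono: "s G \<omega> \<le> s H \<omega>" if "G \<in> K" "H \<in> K" "G \<subseteq> H" for G H \<omega>
    unfolding s_def using that by (intro cSUP_subset_mono bdd) (auto simp: K_def)
  define S where "S = (SUP G\<in>K. expectation (s G))"
  have "expectation (s G) \<le> c" if "G \<in> K" for G
    using s_abs[OF that] integral_mono[OF s_int[OF that] integrable_const[of c]]
    by (auto simp: abs_le_iff prob_space)
  then have S_bdd: "bdd_above ((\<lambda>G. expectation (s G)) ` K)"
    by (intro bdd_aboveI[of _ c]) auto
  have S_up: "expectation (s G) \<le> S" if "G \<in> K" for G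
    unfolding S_def using that by (intro cSUP_upper S_bdd)
  obtain f0 where "f0 \<in> F" using ne by auto
  then have "K \<noteq> {}" by (auto simp: K_def intro!: exI[of _ "{f0}"])
  have "\<exists>G\<in>K. S - 1 / real (Suc n) < expectation (s G)" for n
    using less_cSUP_iff[OF \<open>K \<noteq> {}\<close> S_bdd, of "S - 1 / real (Suc n)"] by (simp add: S_def)
  then obtain G where G: "\<And>n. G n \<in> K" "\<And>n. S - 1 / real (Suc n) < expectation (s (G n))"
    by metis
  define H where "H = (\<Union>n. G n)"
  have H: "H \<in> K" using G(1) by (auto simp: K_def H_def)
  have "S - 1 / real (Suc n) \<le> expectation (s H)" for n
  proof -
    have "expectation (s (G n)) \<le> expectation (s H)"
      using G(1) H by (intro integral_mono s_int s_mono) (auto simp: H_def)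
    then show ?thesis using G(2)[of n] by linarith
  qed
  moreover have "(\<lambda>n. S - 1 / real (Suc n)) \<longlonglongrightarrow> S - 0"
    by (intro tendsto_intros LIMSEQ_Suc[OF lim_1_over_n])
  ultimately have "S \<le> expectation (s H)"
    by (intro LIMSEQ_le_const2[of _ S]) auto
  have "is_ess_Sup M F (s H)"
    unfolding is_ess_Sup_def
  proof (intro conjI ballI impI)
    fix f assume "f \<in> F"
    let ?H = "insert f H"
    have H': "?H \<in> K" using H \<open>f \<in> F\<close> by (auto simp: K_def)
    have "expectation (s ?H) = expectation (s H)"
      using S_up[OF H'] \<open>S \<le> expectation (s H)\<close>
        integral_mono[OF s_int[OF H] s_int[OF H'] s_mono[OF H H' subset_insertI]] by linarith
    then have "expectation (\<lambda>\<omega>. s ?H \<omega> - s H \<omega>) = 0"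
      using s_int H H' by simp
    moreover have "AE \<omega> in M. 0 \<le> s ?H \<omega> - s H \<omega>"
      using s_mono[OF H H'] by auto
    ultimately have "AE \<omega> in M. s ?H \<omega> - s H \<omega> = 0"
      using integral_nonneg_eq_0_iff_AE[of M "\<lambda>\<omega>. s ?H \<omega> - s H \<omega>"] s_int H H' by simp
    then show "AE \<omega> in M. f \<omega> \<le> s H \<omega>"
    proof eventually_elim
      case (elim \<omega>)
      then show ?case using up[of ?H f \<omega>] H' by (simp add: K_def)
    qed
  next
    fix h assume "\<forall>f\<in>F. AE \<omega> in M. f \<omega> \<le> h \<omega>"
    then have "AE \<omega> in M. \<forall>f\<in>H. f \<omega> \<le> h \<omega>"
      using H by (subst AE_ball_countable) (auto simp: K_def)
    then show "AE \<omega> in M. s H \<omega> \<le> h \<omega>"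
    proof eventually_elim
      case (elim \<omega>)
      then show ?case unfolding s_def using H by (intro cSUP_least) (auto simp: K_def)
    qed
  qed (rule s_meas[OF H])
  then show ?thesis by blast
qed

lemma (in prob_space) is_ess_Sup_ess_Sup:
  assumes ne: "F \<noteq> {}"
    and meas: "\<And>f. f \<in> F \<Longrightarrow> f \<in> borel_measurable M"
    and bound: "\<And>f. f \<in> F \<Longrightarrow> AE \<omega> in M. \<bar>f \<omega>\<bar> \<le> c"
  shows "is_ess_Sup M F (ess_Sup M F)"
proof -
  define T :: "('a \<Rightarrow> real) \<Rightarrow> 'a \<Rightarrow> real" where "T f \<omega> = max (- \<bar>c\<bar>) (min \<bar>c\<bar> (f \<omega>))" for f \<omega>
  have T_eq: "AE \<omega> in M. T f \<omega> = f \<omega>" if "f \<in> F" for f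
    using bound[OF that] by eventually_elim (auto simp: T_def)
  have T_le: "(AE \<omega> in M. T f \<omega> \<le> h \<omega>) \<longleftrightarrow> (AE \<omega> in M. f \<omega> \<le> h \<omega>)" if "f \<in> F" for f h
  proof
    assume "AE \<omega> in M. T f \<omega> \<le> h \<omega>"
    with T_eq[OF that] show "AE \<omega> in M. f \<omega> \<le> h \<omega>" by eventually_elim simp
  next
    assume "AE \<omega> in M. f \<omega> \<le> h \<omega>"
    with T_eq[OF that] show "AE \<omega> in M. T f \<omega> \<le> h \<omega>" by eventually_elim simp
  qed
  have "\<exists>g. is_ess_Sup M (T ` F) g"
  proof (rule ex_ess_Sup_bounded[of _ "\<bar>c\<bar>"])
    show "f \<in> borel_measurable M" if "f \<in> T ` F" for f
      using that meas by (auto simp: T_def[abs_def])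
    show "\<bar>f \<omega>\<bar> \<le> \<bar>c\<bar>" if "f \<in> T ` F" for f \<omega>
      using that by (auto simp: T_def)
  qed (use ne in auto)
  then have "\<exists>g. is_ess_Sup M F g"
    by (simp add: is_ess_Sup_def T_le)
  then show ?thesis
    unfolding ess_Sup_def by (rule someI_ex)
qed


definition beta_coeff :: "'w measure \<Rightarrow> (nat \<Rightarrow> 'w \<Rightarrow> C01) \<Rightarrow> nat \<Rightarrow> real" where
  "beta_coeff M e k =
     (SUP j\<in>{1..}. LINT \<omega>|M. ess_Sup M
        ((\<lambda>A \<omega>. \<bar>real_cond_exp M (generated_sigma M e {1..j}) (indicator A) \<omega> - measure M A\<bar>)
           ` sets (generated_sigma M e {j + k..})) \<omega>)"

definition long_run_cov ::
    "'w measure \<Rightarrow> (nat \<Rightarrow> 'w \<Rightarrow> C01) \<Rightarrow> (C01 \<Rightarrow> real) \<Rightarrow> (C01 \<Rightarrow> real) \<Rightarrow> real" where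
  "long_run_cov M e l l' =
     (LINT \<omega>|M. l (e 1 \<omega>) * l' (e 1 \<omega>)) +
     (\<Sum>j. (LINT \<omega>|M. l (e 1 \<omega>) * l' (e (1 + Suc j) \<omega>)) +
           (LINT \<omega>|M. l (e (1 + Suc j) \<omega>) * l' (e 1 \<omega>)))"


section \<open>Brownian motion in C([0,1])\<close>

text \<open>A degenerate (almost surely zero) random variable counts as Gaussian.\<close>

definition centered_gaussian :: "'v measure \<Rightarrow> ('v \<Rightarrow> real) \<Rightarrow> bool" where
  "centered_gaussian N Y \<longleftrightarrow>
     Y \<in> borel_measurable N \<and>
     ((AE \<omega> in N. Y \<omega> = 0) \<or> (\<exists>\<sigma>>0. distributed N lborel Y (normal_density 0 \<sigma>)))"

definition brownian_motion_C01 :: "'v measure \<Rightarrow> (real \<Rightarrow> 'v \<Rightarrow> C01) \<Rightarrow> bool" where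
  "brownian_motion_C01 N W \<longleftrightarrow>
     prob_space N \<and>
     (\<forall>s\<in>{0..1}. W s \<in> borel_measurable N) \<and>
     (\<forall>\<omega>\<in>space N. W 0 \<omega> = 0 \<and> continuous_on {0..1} (\<lambda>s. W s \<omega>)) \<and>
     (\<forall>s t. 0 \<le> s \<and> s \<le> t \<and> t \<le> 1 \<longrightarrow>
        distr N borel (\<lambda>\<omega>. W t \<omega> - W s \<omega>) = distr N borel (W (t - s))) \<and>
     (\<forall>m r. 0 \<le> r 0 \<and> mono_on {..m} r \<and> r m \<le> 1 \<longrightarrow>
        prob_space.indep_vars N (\<lambda>_. borel) (\<lambda>k \<omega>. W (r (Suc k)) \<omega> - W (r k) \<omega>) {..<m::nat}) \<and>
     (\<forall>s t l. 0 \<le> s \<and> s \<le> t \<and> t \<le> 1 \<and> bounded_linear l \<longrightarrow>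
        centered_gaussian N (\<lambda>\<omega>. l (W t \<omega> - W s \<omega>)))"


section \<open>Change point model and CUSUM statistics\<close>

definition change_point_model ::
    "real \<Rightarrow> C01 \<Rightarrow> C01 \<Rightarrow> (nat \<Rightarrow> 'w \<Rightarrow> C01) \<Rightarrow> nat \<Rightarrow> nat \<Rightarrow> 'w \<Rightarrow> C01" where
  "change_point_model s0 \<mu>1 \<mu>2 e n i \<omega> = (if i \<le> nat \<lfloor>real n * s0\<rfloor> then \<mu>1 else \<mu>2) + e i \<omega>"

text \<open>The sum of \<open>a 1, \<dots>, a x\<close>, linearly interpolated for non-integer \<open>x \<ge> 0\<close>.\<close>

definition interp_sum :: "(nat \<Rightarrow> C01) \<Rightarrow> real \<Rightarrow> C01" where
  "interp_sum a x = (\<Sum>i=1..nat \<lfloor>x\<rfloor>. a i) + (x - of_int \<lfloor>x\<rfloor>) *\<^sub>R a (nat \<lfloor>x\<rfloor> + 1)"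

definition cusum :: "(nat \<Rightarrow> nat \<Rightarrow> 'w \<Rightarrow> C01) \<Rightarrow> nat \<Rightarrow> real \<Rightarrow> 'w \<Rightarrow> C01" where
  "cusum X n s \<omega> =
     (1 / real n) *\<^sub>R (interp_sum (\<lambda>i. X n i \<omega>) (real n * s) - s *\<^sub>R (\<Sum>i=1..n. X n i \<omega>))"

text \<open>
  The statistic belonging to a norm \<open>\<nu>\<close>. The supremum is attained, \<open>s \<mapsto> cusum X n s \<omega>\<close> being
  continuous. Without noise, \<open>cusum X n s0\<close> is \<open>s0 * (1 - s0) *\<^sub>R (\<mu>1 - \<mu>2)\<close> up to \<open>O(1/n)\<close>, and its
  norm is the maximum over \<open>s\<close> to the same order; this is the centring of the statistic.
\<close>

definition cusum_stat ::
    "(C01 \<Rightarrow> real) \<Rightarrow> (nat \<Rightarrow> nat \<Rightarrow> 'w \<Rightarrow> C01) \<Rightarrow> nat \<Rightarrow> 'w \<Rightarrow> real" where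
  "cusum_stat \<nu> X n \<omega> = sqrt (real n) * (SUP s\<in>{0..1}. \<nu> (cusum X n s \<omega>))"

end

theory Submission
  imports Defs "HOL-Real_Asymp.Real_Asymp" "HOL-Library.Discrete_Functions"
begin

text \<open>
  Let \<open>k = \<lfloor>n s0\<rfloor>\<close> be the change point, \<open>S j\<close> the sum of the first \<open>j\<close> errors, \<open>\<nu>\<close> one of the three norms,
  \<open>r n = sqrt n * (k/n) * (1 - k/n)\<close> and \<open>Z n = (S k - (k/n) S n) / sqrt n\<close>. The statistic belonging to \<open>\<nu>\<close> is
  \<open>\<nu> (r n * \<Phi> + Z n)\<close> up to a term that vanishes in probability: away from the change point the norm of
  the mean decreases linearly, and by a law of large numbers in C([0,1]) the noise compensates this
  only for boundedly many indices.

  \<open>Z n\<close> converges weakly to the bridge \<open>W s0 - s0 W 1\<close>. For linear functionals this is a central limit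
  theorem by Bernstein's method, absolute regularity replacing blocks by independent ones in total
  variation. Tightness comes from chaining over dyadic grids, with Bernstein's inequality for the blocks.

  Finally, \<open>\<nu> (r \<Phi> + z) - r \<nu> \<Phi>\<close> is 1-Lipschitz in \<open>z\<close> and decreases, as \<open>r\<close> grows, to the derivative of \<open>\<nu>\<close>
  at \<open>\<Phi>\<close> in direction \<open>z\<close>. Because of the monotonicity, pointwise convergence is enough to pass to the
  limit in distribution.
\<close>

text \<open>Sums in C([0,1]) admit no useful moment inequality for the supremum norm, so every
  estimate goes through scalar functionals: piecewise linear interpolation isolates finitely many
  evaluations, and only its remainder needs a uniform bound. The errors have little more than two
  moments, which excludes high-moment bounds for increments. Truncation makes Bernstein's inequality
  available, and its exponential decay pays for the 2^k grid points of level k. For fixed n this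
  bound deteriorates as k grows. On the finest levels the crude bound n^2 for the second moment of a
  sum of n terms takes over; multiplied by the number of grid points it leaves 2^((1 - 2\<alpha>)
  k), which decays because \<alpha> > 1/2. A small increment must also give a small variance of the
  sum although covariances are summed over all lags. The bound min v w \<le> v^(1/4) w^(3/4)
  achieves both: w of order k^(-2) stays summable, and a power of the second moment v survives. The
  mean of the CUSUM process at the change point is s0 (1 - s0) \<Phi> up to rounding, which is where
  the factor in the centring comes from.\<close>

section \<open>Second countability of spaces of continuous functions on a compact metric
  space\<close>

class compact_metric_space = metric_space +
  assumes compact_UNIV: "compact UNIV"

text \<open>Total boundedness gives finite nets at all scales 1/(n+1). Closed balls are used because
  the cells of a compact-open basis must be compact, while their interiors still cover.\<close>

lemma countable_cball_cover:
  "\<exists>\<U>::'a::compact_metric_space set set. countable \<U> \<and> (\<forall>U\<in>\<U>. compact U) \<and>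
     (\<forall>x. \<forall>d>0. \<exists>U\<in>\<U>. x \<in> interior U \<and> U \<subseteq> ball x d)"
proof -
  have "\<forall>n::nat. \<exists>F::'a set. finite F \<and> UNIV \<subseteq> (\<Union>x\<in>F. ball x (1 / real (Suc n)))"
  proof
    fix n :: nat
    show "\<exists>F::'a set. finite F \<and> UNIV \<subseteq> (\<Union>x\<in>F. ball x (1 / real (Suc n)))"
      using compact_UNIV[where 'a='a] compact_imp_seq_compact[of "UNIV::'a set"]
        seq_compact_imp_totally_bounded[of "UNIV::'a set"] by (metis divide_pos_pos of_nat_0_less_iff zero_less_Suc zero_less_one)
  qed
  then obtain F :: "nat \<Rightarrow> 'a set" where F: "\<And>n. finite (F n)"
      "\<And>n. UNIV \<subseteq> (\<Union>x\<in>F n. ball x (1 / real (Suc n)))"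
    by metis
  define \<U> where "\<U> = (\<Union>n. (\<lambda>x. cball x (1 / real (Suc n))) ` F n)"
  have "countable \<U>"
    unfolding \<U>_def using F(1) by (intro countable_UN countable_image) (auto intro: countable_finite)
  moreover have "compact U" if "U \<in> \<U>" for U
  proof -
    have "closed U" using that by (auto simp: \<U>_def)
    then show ?thesis using compact_Int_closed[OF compact_UNIV, of U] by simp
  qed
  moreover have "\<exists>U\<in>\<U>. x \<in> interior U \<and> U \<subseteq> ball x d" if "d > 0" for x and d :: real
  proof -
    obtain n where n: "1 / real (Suc n) < d / 2"
      using reals_Archimedean[of "d/2"] half_gt_zero[OF \<open>d > 0\<close>] unfolding inverse_eq_divide by blast
    obtain y where y: "y \<in> F n" "x \<in> ball y (1 / real (Suc n))" using F(2)[of n] by blast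
    have "x \<in> interior (cball y (1 / real (Suc n)))"
      using y(2) by (meson ball_subset_cball interior_maximal open_ball subsetD)
    moreover have "cball y (1 / real (Suc n)) \<subseteq> ball x d"
    proof
      fix z assume "z \<in> cball y (1 / real (Suc n))"
      then have "dist x z \<le> dist y x + dist y z" "dist y z < d/2" "dist y x < d / 2"
        using y(2) n by (auto simp: dist_triangle3 dist_commute intro: dist_triangle)
      then show "z \<in> ball x d" by simp
    qed
    ultimately show ?thesis using y(1) by (auto simp: \<U>_def)
  qed
  ultimately show ?thesis by blast
qed

text \<open>Needed for measurability of sums and differences in C([0,1]): with second countability
  the Borel sets of a product are generated by rectangles. The basis is a countable form of the
  compact-open topology, \<open>W S\<close> prescribing for finitely many compact cells a basic open
  set that contains the image.\<close>

instance bcontfun :: (compact_metric_space, "{metric_space, second_countable_topology}") second_countable_topology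
proof
  obtain \<U> :: "'a set set" where \<U>: "countable \<U>" "\<And>U. U \<in> \<U> \<Longrightarrow> compact U"
      "\<And>x d. d > 0 \<Longrightarrow> \<exists>U\<in>\<U>. x \<in> interior U \<and> U \<subseteq> ball x d"
    using countable_cball_cover by metis
  obtain \<V> :: "'b set set" where \<V>: "countable \<V>" "topological_basis \<V>"
    using ex_countable_basis by blast
  define W :: "('a set \<times> 'b set) set \<Rightarrow> ('a \<Rightarrow>\<^sub>C 'b) set" where
    "W S = {f. \<forall>(U,V)\<in>S. apply_bcontfun f ` U \<subseteq> V}" for S
  define \<W> where "\<W> = W ` {S. finite S \<and> S \<subseteq> \<U> \<times> \<V>}"
  have "countable \<W>"
    unfolding \<W>_def using \<U>(1) \<V>(1) by (intro countable_image countable_Collect_finite_subset) auto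
  have "topological_basis \<W>"
  proof (rule topological_basisI)
    fix wt assume "wt \<in> \<W>"
    then obtain S where S: "finite S" "S \<subseteq> \<U> \<times> \<V>" "wt = W S" by (auto simp: \<W>_def)
    have "wt = (\<Inter>p\<in>S. {f. apply_bcontfun f ` fst p \<subseteq> snd p})"
      unfolding S(3) W_def case_prod_beta by blast
    moreover have "open {f. apply_bcontfun f ` fst p \<subseteq> snd p}" if "p \<in> S" for p
      unfolding open_dist
    proof safe
      fix f :: "'a \<Rightarrow>\<^sub>C 'b" assume f: "apply_bcontfun f ` fst p \<subseteq> snd p"
      have "compact (apply_bcontfun f ` fst p)"
        using \<U>(2) S(2) that by (intro compact_continuous_image) auto
      moreover have "open (snd p)" using S(2) that \<V>(2) topological_basis_open by fastforce
      ultimately obtain e where e: "e > 0" "(\<Union>x\<in>apply_bcontfun f ` fst p. ball x e) \<subseteq> snd p"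
        using compact_subset_open_imp_ball_epsilon_subset f by metis
      show "\<exists>e>0. \<forall>g. dist g f < e \<longrightarrow> g \<in> {f. apply_bcontfun f ` fst p \<subseteq> snd p}"
      proof (intro exI[of _ e] conjI allI impI e(1), safe)
        fix g x assume "dist g f < e" "x \<in> fst p"
        then have "dist (apply_bcontfun f x) (apply_bcontfun g x) < e"
          by (metis dist_commute dist_fun_lt_imp_dist_val_lt)
        then show "apply_bcontfun g x \<in> snd p"
          using e(2) \<open>x \<in> fst p\<close> by force
      qed
    qed
    ultimately show "open wt" using S(1) by auto
  next
    fix Q and f :: "'a \<Rightarrow>\<^sub>C 'b" assume "open Q" "f \<in> Q"
    then obtain r where r: "r > 0" "\<And>g. dist g f < r \<Longrightarrow> g \<in> Q" by (auto simp: open_dist)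
    \<comment> \<open>Two radii \<open>r/4\<close> add up to \<open>r/2\<close> on each cell, so the
      supremum distance stays strictly below \<open>r\<close>.\<close>
    have "\<exists>U V. U \<in> \<U> \<and> V \<in> \<V> \<and> x \<in> interior U \<and> apply_bcontfun f ` U \<subseteq> V \<and> V \<subseteq> ball (apply_bcontfun f x) (r/4)" for x
    proof -
      obtain V where V: "V \<in> \<V>" "apply_bcontfun f x \<in> V" "V \<subseteq> ball (apply_bcontfun f x) (r/4)"
        using topological_basisE[OF \<V>(2), of "ball (apply_bcontfun f x) (r/4)" "apply_bcontfun f x"] r(1) by auto
      have "open (apply_bcontfun f -` V)"
        using V(1) \<V>(2) topological_basis_open by (intro open_vimage) auto
      then obtain d where d: "d > 0" "ball x d \<subseteq> apply_bcontfun f -` V"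
        using V(2) open_contains_ball by (metis vimageI)
      obtain U where "U \<in> \<U>" "x \<in> interior U" "U \<subseteq> ball x d" using \<U>(3)[OF d(1)] by blast
      then show ?thesis using d(2) V by (intro exI[of _ U] exI[of _ V]) auto
    qed
    then obtain U V where UV: "\<And>x. U x \<in> \<U>" "\<And>x. V x \<in> \<V>" "\<And>x. x \<in> interior (U x)"
      "\<And>x. apply_bcontfun f ` (U x) \<subseteq> V x" "\<And>x. V x \<subseteq> ball (apply_bcontfun f x) (r/4)" by metis
    obtain X where X: "finite X" "UNIV \<subseteq> (\<Union>x\<in>X. interior (U x))"
    proof (rule compactE_image[OF compact_UNIV, of UNIV "\<lambda>x. interior (U x)"])
      show "UNIV \<subseteq> (\<Union>x. interior (U x))" using UV(3) by blast
    qed auto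
    have "f \<in> W ((\<lambda>x. (U x, V x)) ` X)" using UV(4) by (auto simp: W_def)
    moreover have "W ((\<lambda>x. (U x, V x)) ` X) \<subseteq> Q"
    proof
      fix g assume g: "g \<in> W ((\<lambda>x. (U x, V x)) ` X)"
      have "dist (apply_bcontfun g y) (apply_bcontfun f y) \<le> r/2" for y
      proof -
        obtain x where x: "x \<in> X" "y \<in> U x" using X(2) interior_subset by blast
        then have "apply_bcontfun g y \<in> ball (apply_bcontfun f x) (r/4)"
            "apply_bcontfun f y \<in> ball (apply_bcontfun f x) (r/4)"
          using g UV(4,5)[of x] by (auto simp: W_def subset_eq)
        then show ?thesis
          using dist_triangle3[of "apply_bcontfun g y" "apply_bcontfun f y" "apply_bcontfun f x"] by simp
      qed
      then have "dist g f \<le> r/2" by (rule dist_bound)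
      then show "g \<in> Q" using r by simp
    qed
    moreover have "W ((\<lambda>x. (U x, V x)) ` X) \<in> \<W>"
      using X(1) UV(1,2) by (auto simp: \<W>_def)
    ultimately show "\<exists>B'\<in>\<W>. f \<in> B' \<and> B' \<subseteq> Q" by blast
  qed
  then show "\<exists>B::('a \<Rightarrow>\<^sub>C 'b) set set. countable B \<and> open = generate_topology B"
    using \<open>countable \<W>\<close> topological_basis_imp_subbasis by blast
qed

instance unit_interval :: compact_metric_space
proof
  have "continuous_on {0..1} Abs_unit_interval"
    by (auto simp: continuous_on_iff dist_unit_interval.rep_eq Abs_unit_interval_inverse)
  then have "compact (Abs_unit_interval ` {0..1})" by (intro compact_continuous_image) auto
  moreover have "Abs_unit_interval ` {0..1} = UNIV"
    by (metis Abs_unit_interval_cases UNIV_eq_I image_eqI)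
  ultimately show "compact (UNIV :: unit_interval set)" by simp
qed

section \<open>Evaluation functionals\<close>

lemma val_at_simps [simp]:
  "val_at (f + g) t = val_at f t + val_at g t"
  "val_at (f - g) t = val_at f t - val_at g t"
  "val_at (- f) t = - val_at f t"
  "val_at (r *\<^sub>R f) t = r * val_at f t"
  "val_at 0 t = 0"
  by (simp_all add: val_at_def)

lemma val_at_sum [simp]: "val_at (sum f I) t = (\<Sum>i\<in>I. val_at (f i) t)"
  by (induction I rule: infinite_finite_induct) auto

lemma abs_val_at_le_norm: "\<bar>val_at f t\<bar> \<le> norm f"
  using norm_bounded[of f "Abs_unit_interval t"] by (simp add: val_at_def)

lemma norm_C01_le:
  assumes "\<And>t. t \<in> {0..1} \<Longrightarrow> \<bar>val_at f t\<bar> \<le> c"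
  shows "norm f \<le> c"
proof (rule norm_bound)
  fix x show "norm (apply_bcontfun f x) \<le> c"
    using assms[of "Rep_unit_interval x"] Rep_unit_interval[of x]
    by (simp add: val_at_def Rep_unit_interval_inverse)
qed

lemma C01_eqI: "(\<And>t. t \<in> {0..1} \<Longrightarrow> val_at f t = val_at g t) \<Longrightarrow> f = g"
  using norm_C01_le[of "f - g" 0] by auto

lemma bounded_linear_val_at: "bounded_linear (\<lambda>f. val_at f t)"
  using abs_val_at_le_norm by (intro bounded_linear_intro[of _ 1]) auto

lemma continuous_val_at [continuous_intros]:
  "continuous_on A f \<Longrightarrow> continuous_on A (\<lambda>x. val_at (f x) t)"
  by (rule bounded_linear.continuous_on[OF bounded_linear_val_at])

lemma measurable_val_at [measurable (raw)]:
  "f \<in> borel_measurable M \<Longrightarrow> (\<lambda>x. val_at (f x) t) \<in> borel_measurable M"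
  by (rule borel_measurable_continuous_on[OF continuous_val_at]) (rule continuous_on_id)


section \<open>Discretisation on dyadic grids\<close>

definition hat :: "nat \<Rightarrow> nat \<Rightarrow> real \<Rightarrow> real" where
  "hat N i t = max 0 (1 - \<bar>2 ^ N * t - real i\<bar>)"

text \<open>The tents \<open>hat N i\<close> already sum to one on [0,1]; dividing by their sum
  reduces the proof of the partition property to positivity of that sum. \<open>SOME\<close> selects
  the element of the function space with these values, which exists by
  \<open>C01_of_continuous_on\<close>.\<close>

definition grid_pu :: "nat \<Rightarrow> nat \<Rightarrow> C01" where
  "grid_pu N i = (SOME f. \<forall>t\<in>{0..1}. val_at f t = hat N i t / (\<Sum>j\<le>2 ^ N. hat N j t))"

definition grid :: "nat \<Rightarrow> nat \<Rightarrow> real" where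
  "grid N i = real i / 2 ^ N"

text \<open>Piecewise linear interpolation on the dyadic grid of level \<open>N\<close>, written as
  a finite-rank operator so that it depends visibly on finitely many evaluations.\<close>

definition disc :: "nat \<Rightarrow> C01 \<Rightarrow> C01" where
  "disc N x = (\<Sum>i\<le>2 ^ N. val_at x (grid N i) *\<^sub>R grid_pu N i)"

lemma dyadic_floor:
  fixes t :: real and N :: nat
  assumes "t \<in> {0..1}"
  defines "j \<equiv> nat \<lfloor>2 ^ N * t\<rfloor>"
  shows "real j \<le> 2 ^ N * t" "2 ^ N * t < real j + 1" "j \<le> 2 ^ N"
proof -
  have "0 \<le> 2 ^ N * t" using assms by auto
  then show 1: "real j \<le> 2 ^ N * t" "2 ^ N * t < real j + 1" unfolding j_def by linarith+
  have "real j \<le> 2 ^ N * 1" using assms(1) by (intro order_trans[OF 1(1)] mult_left_mono) auto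
  then show "j \<le> 2 ^ N" by (simp flip: of_nat_le_iff)
qed

lemma hat_nonneg: "hat N i t \<ge> 0" by (simp add: hat_def)

lemma sum_hat_pos: "t \<in> {0..1} \<Longrightarrow> (\<Sum>j\<le>2 ^ N. hat N j t) > 0"
proof (intro sum_pos2[of _ "nat \<lfloor>2 ^ N * t\<rfloor>"])
  assume "t \<in> {0..1}"
  from dyadic_floor[OF this, of N] show "hat N (nat \<lfloor>2 ^ N * t\<rfloor>) t > 0" "nat \<lfloor>2 ^ N * t\<rfloor> \<in> {..2 ^ N}"
    unfolding hat_def by simp_all linarith
qed (auto simp: hat_nonneg)

lemma val_at_grid_pu:
  assumes "t \<in> {0..1}"
  shows "val_at (grid_pu N i) t = hat N i t / (\<Sum>j\<le>2 ^ N. hat N j t)"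
proof -
  have "continuous_on {0..1} (\<lambda>t. hat N i t / (\<Sum>j\<le>2 ^ N. hat N j t))"
    using sum_hat_pos[of _ N] less_irrefl unfolding hat_def by (intro continuous_intros) fastforce
  from someI_ex[OF C01_of_continuous_on[OF this]] show ?thesis
    using assms by (simp add: grid_pu_def)
qed

lemma grid_pu_nonneg: "t \<in> {0..1} \<Longrightarrow> val_at (grid_pu N i) t \<ge> 0"
  using sum_hat_pos[of t N] by (simp add: val_at_grid_pu hat_nonneg)

lemma sum_grid_pu: "t \<in> {0..1} \<Longrightarrow> (\<Sum>i\<le>2 ^ N. val_at (grid_pu N i) t) = 1"
  using sum_hat_pos[of t N] by (simp add: val_at_grid_pu flip: sum_divide_distrib)

lemma grid_mem: "i \<le> 2 ^ N \<Longrightarrow> grid N i \<in> {0..1}"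
  by (simp add: grid_def)

lemma grid_pu_eq_0: "t \<in> {0..1} \<Longrightarrow> \<bar>2 ^ N * t - real i\<bar> \<ge> 1 \<Longrightarrow> val_at (grid_pu N i) t = 0"
  by (simp add: val_at_grid_pu hat_def)

lemma val_at_disc: "val_at (disc N x) t = (\<Sum>i\<le>2 ^ N. val_at x (grid N i) * val_at (grid_pu N i) t)"
  by (simp add: disc_def)

text \<open>By the partition of unity the error at \<open>t\<close> is a convex combination of the
  differences \<open>val_at x t - val_at x (grid N i)\<close>, and only tents that are nonzero at
  \<open>t\<close> carry weight.\<close>

lemma abs_diff_disc_le:
  assumes t: "t \<in> {0..1}"
    and "\<And>i. i \<le> 2 ^ N \<Longrightarrow> \<bar>2 ^ N * t - real i\<bar> < 1 \<Longrightarrow> \<bar>val_at x t - val_at x (grid N i)\<bar> \<le> c"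
  shows "\<bar>val_at (x - disc N x) t\<bar> \<le> c"
proof -
  have "val_at (x - disc N x) t = (\<Sum>i\<le>2 ^ N. (val_at x t - val_at x (grid N i)) * val_at (grid_pu N i) t)"
    using sum_grid_pu[OF t, of N]
    by (simp add: val_at_disc left_diff_distrib sum_subtractf flip: sum_distrib_left)
  also have "\<bar>\<dots>\<bar> \<le> (\<Sum>i\<le>2 ^ N. c * val_at (grid_pu N i) t)"
  proof (intro order_trans[OF sum_abs] sum_mono)
    fix i :: nat assume "i \<in> {..2 ^ N}"
    then show "\<bar>(val_at x t - val_at x (grid N i)) * val_at (grid_pu N i) t\<bar> \<le> c * val_at (grid_pu N i) t"
      using assms(2)[of i] grid_pu_eq_0[OF t, of N i] grid_pu_nonneg[OF t, of N i]
      by (cases "\<bar>2 ^ N * t - real i\<bar> < 1") (auto simp: abs_mult intro: mult_right_mono)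
  qed
  also have "\<dots> = c" using sum_grid_pu[OF t, of N] by (simp flip: sum_distrib_left)
  finally show ?thesis .
qed

lemma disc_simps [simp]:
  "disc N (x + y) = disc N x + disc N y"
  "disc N (x - y) = disc N x - disc N y"
  "disc N (r *\<^sub>R x) = r *\<^sub>R disc N x"
  "disc N 0 = 0"
  by (auto simp: disc_def scaleR_left_distrib scaleR_left_diff_distrib sum.distrib sum_subtractf scaleR_right.sum)

lemma norm_disc_le_sum: "norm (disc N x) \<le> (\<Sum>i\<le>2 ^ N. \<bar>val_at x (grid N i)\<bar>)"
proof (rule norm_C01_le)
  fix t :: real assume t: "t \<in> {0..1}"
  have "val_at (grid_pu N i) t \<le> 1" if "i \<le> 2 ^ N" for i
    using member_le_sum[of i "{..2 ^ N}" "\<lambda>i. val_at (grid_pu N i) t"] that sum_grid_pu[OF t, of N]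
      grid_pu_nonneg[OF t] by simp
  then show "\<bar>val_at (disc N x) t\<bar> \<le> (\<Sum>i\<le>2 ^ N. \<bar>val_at x (grid N i)\<bar>)"
    unfolding val_at_disc using grid_pu_nonneg[OF t]
    by (intro order_trans[OF sum_abs] sum_mono) (auto simp: abs_mult intro!: mult_left_le)
qed

lemma norm_diff_disc_le: "norm (x - disc N x) \<le> 2 * norm x"
proof (rule norm_C01_le, rule abs_diff_disc_le)
  fix t i show "\<bar>val_at x t - val_at x (grid N i)\<bar> \<le> 2 * norm x"
    using abs_val_at_le_norm[of x t] abs_val_at_le_norm[of x "grid N i"] by linarith
qed

lemma bounded_linear_disc: "bounded_linear (disc N)"
proof (rule bounded_linear_intro)
  show "norm (disc N x) \<le> norm x * 3" for x
    using norm_diff_disc_le[of x N] norm_triangle_ineq2[of "disc N x" x] by (simp add: norm_minus_commute)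
qed auto

lemma continuous_disc [continuous_intros]: "continuous_on A f \<Longrightarrow> continuous_on A (\<lambda>x. disc N (f x))"
  by (rule bounded_linear.continuous_on[OF bounded_linear_disc])

lemma measurable_disc [measurable (raw)]: "f \<in> borel_measurable M \<Longrightarrow> (\<lambda>x. disc N (f x)) \<in> borel_measurable M"
  by (rule borel_measurable_continuous_on[OF continuous_disc]) (rule continuous_on_id)

lemma disc_tendsto: "(\<lambda>N. disc N x) \<longlonglongrightarrow> x"
proof (rule metric_LIMSEQ_I)
  fix e :: real assume "e > 0"
  have "uniformly_continuous_on {0..1} (val_at x)"
    by (intro compact_uniformly_continuous continuous_on_val_at) auto
  then obtain d where d: "d > 0"
      "\<And>s t. s \<in> {0..1} \<Longrightarrow> t \<in> {0..1} \<Longrightarrow> dist s t < d \<Longrightarrow> dist (val_at x s) (val_at x t) < e / 2"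
    unfolding uniformly_continuous_on_def using \<open>e > 0\<close> by (metis half_gt_zero)
  obtain N0 where N0: "(1/2::real) ^ N0 < d" using d(1) real_arch_pow_inv[of d "1/2"] by auto
  show "\<exists>no. \<forall>n\<ge>no. dist (disc n x) x < e"
  proof (intro exI[of _ N0] allI impI)
    fix N assume "N \<ge> N0"
    then have N: "(1/2::real) ^ N < d" using N0 power_decreasing[of N0 N "1/2::real"] by linarith
    have "norm (x - disc N x) \<le> e / 2"
    proof (rule norm_C01_le, rule abs_diff_disc_le)
      fix t :: real and i :: nat assume t: "t \<in> {0..1}" "i \<le> 2 ^ N" "\<bar>2 ^ N * t - real i\<bar> < 1"
      have "dist t (grid N i) = \<bar>2 ^ N * t - real i\<bar> * (1/2) ^ N"
        by (simp add: grid_def dist_real_def abs_if field_simps power_divide)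
      also have "\<dots> < 1 * (1/2) ^ N" using t by (intro mult_strict_right_mono) auto
      finally show "\<bar>val_at x t - val_at x (grid N i)\<bar> \<le> e / 2"
        using d(2)[OF t(1) grid_mem[OF t(2)]] N by (simp add: dist_real_def less_imp_le)
    qed
    then show "dist (disc N x) x < e" using \<open>e > 0\<close> by (simp add: dist_norm norm_minus_commute)
  qed
qed

text \<open>Dyadic chaining: \<open>t\<close> is approached by its dyadic roundings from below,
  which move by at most one grid step from each level to the next. The bound \<open>T\<close> is on
  all partial sums, so no convergence of the series has to be supplied.\<close>

lemma norm_diff_disc_le_chaining:
  assumes inc: "\<And>k i. k \<ge> N \<Longrightarrow> i < 2 ^ k \<Longrightarrow> \<bar>val_at x (grid k (Suc i)) - val_at x (grid k i)\<bar> \<le> a k"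
    and T: "\<And>K. (\<Sum>k=N..K. a k) \<le> T"
  shows "norm (x - disc N x) \<le> T"
proof (rule norm_C01_le, rule abs_diff_disc_le)
  fix t :: real and i :: nat assume t: "t \<in> {0..1}" "i \<le> 2 ^ N" "\<bar>2 ^ N * t - real i\<bar> < 1"
  have a_nonneg: "a k \<ge> 0" if "k \<ge> N" for k
    using inc[OF that, of 0] by fastforce
  define j where "j k = nat \<lfloor>2 ^ k * t\<rfloor>" for k
  note j = dyadic_floor[OF t(1), folded j_def]
  \<comment> \<open>Rounding down at level \<open>k + 1\<close> gives the old grid point or its
    right neighbour on the finer grid.\<close>
  have step: "\<bar>val_at x (grid (Suc k) (j (Suc k))) - val_at x (grid k (j k))\<bar> \<le> a (Suc k)" if "k \<ge> N" for k
  proof -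
    have "real (j (Suc k)) < 2 * real (j k) + 2" "2 * real (j k) < real (j (Suc k)) + 1"
      using j(1,2)[of k] j(1,2)[of "Suc k"] by auto
    then have "j (Suc k) = 2 * j k \<or> j (Suc k) = Suc (2 * j k)" by linarith
    moreover have g: "grid k (j k) = grid (Suc k) (2 * j k)" by (simp add: grid_def)
    ultimately show ?thesis
      using inc[of "Suc k" "2 * j k"] j(3)[of "Suc k"] that a_nonneg[of "Suc k"] by (auto simp: g)
  qed
  have "\<bar>val_at x (grid K (j K)) - val_at x (grid N (j N))\<bar> \<le> (\<Sum>k=Suc N..K. a k)" if "K \<ge> N" for K
    using that
  proof (induction K rule: dec_induct)
    case (step K)
    then show ?case using \<open>\<And>k. k \<ge> N \<Longrightarrow> \<bar>_\<bar> \<le> a (Suc k)\<close>[of K] by (simp add: sum.cl_ivl_Suc)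
  qed simp
  \<comment> \<open>The comparison point may be either endpoint of the cell of \<open>t\<close>.
    This extra increment on level \<open>N\<close> is why the sum starts at \<open>N\<close> and not
    at \<open>Suc N\<close>.\<close>
  moreover have "\<bar>val_at x (grid N (j N)) - val_at x (grid N i)\<bar> \<le> a N"
  proof -
    have "i = j N \<or> i = Suc (j N)"  using j(1,2)[of N] t(3) by linarith
    then show ?thesis using inc[of N "j N"] t(2) a_nonneg[of N] by auto
  qed
  moreover have "(\<Sum>k=N..K. a k) = a N + (\<Sum>k=Suc N..K. a k)" if "K \<ge> N" for K
    using that by (simp add: sum.atLeast_Suc_atMost)
  ultimately have *: "\<bar>val_at x (grid K (j K)) - val_at x (grid N i)\<bar> \<le> T" if "K \<ge> N" for K
    using T[of K] that by (smt (verit))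
  have "(\<lambda>K. grid K (j K)) \<longlonglongrightarrow> t"
  proof (rule tendsto_sandwich[of "\<lambda>K. t - (1/2) ^ K" _ _ "\<lambda>K. t"])
    show "(\<lambda>K. t - (1/2) ^ K) \<longlonglongrightarrow> t"
      using tendsto_diff[OF tendsto_const LIMSEQ_power_zero[of "1/2::real"], of t] by simp
    show "\<forall>\<^sub>F K in sequentially. t - (1 / 2) ^ K \<le> grid K (j K)"
    proof (intro always_eventually allI)
      fix K show "t - (1 / 2) ^ K \<le> grid K (j K)"
        using j(2)[of K] by (simp add: grid_def divide_simps power_divide) (simp add: algebra_simps)
    qed
    show "\<forall>\<^sub>F K in sequentially. grid K (j K) \<le> t"
      using j(1) by (intro always_eventually) (auto simp: grid_def field_simps)
  qed auto
  then have "(\<lambda>K. val_at x (grid K (j K))) \<longlonglongrightarrow> val_at x t"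
    using j(3) grid_mem t(1)
    by (intro continuous_on_tendsto_compose[OF continuous_on_val_at[of x]] always_eventually) auto
  then have "(\<lambda>K. \<bar>val_at x (grid K (j K)) - val_at x (grid N i)\<bar>) \<longlonglongrightarrow> \<bar>val_at x t - val_at x (grid N i)\<bar>"
    by (intro tendsto_intros)
  then show "\<bar>val_at x t - val_at x (grid N i)\<bar> \<le> T"
    by (rule LIMSEQ_le_const2) (use * in blast)
qed

section \<open>Absolute regularity and products of laws\<close>

abbreviation borel2 :: "('a::topological_space \<times> 'b::topological_space) measure" where
  "borel2 \<equiv> borel \<Otimes>\<^sub>M borel"

abbreviation (in prob_space) sq_mean :: "('a \<Rightarrow> real) \<Rightarrow> real" where
  "sq_mean X \<equiv> expectation (\<lambda>w. (X w)\<^sup>2)"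

text \<open>The approximating sets have finitely many different sections
  \<open>V (\<phi> x)\<close>, because for them a dependence coefficient can be applied section by
  section. Induction over the generated sigma-algebra works for two measures at once; later these
  are a joint law and the product of its marginals.\<close>

lemma approx_pair_sets:
  fixes \<mu> \<nu> :: "('a::topological_space \<times> 'b::topological_space) measure"
  assumes fin: "finite_measure \<mu>" "finite_measure \<nu>"
    and sets: "sets \<mu> = sets borel2" "sets \<nu> = sets borel2"
    and C: "C \<in> sets borel2" and "e > 0"
  shows "\<exists>(\<phi> :: 'a \<Rightarrow> nat) V. \<phi> \<in> measurable borel (count_space UNIV) \<and> finite (range \<phi>) \<and> (\<forall>n. V n \<in> sets borel) \<and>
     measure \<mu> (sym_diff C {p. snd p \<in> V (\<phi> (fst p))}) + measure \<nu> (sym_diff C {p. snd p \<in> V (\<phi> (fst p))}) < e"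
proof -
  interpret \<mu>: finite_measure \<mu> by (rule fin)
  interpret \<nu>: finite_measure \<nu> by (rule fin)
  have [measurable_cong]: "sets \<mu> = sets borel2" "sets \<nu> = sets borel2" by (rule sets)+
  define m where "m A = measure \<mu> A + measure \<nu> A" for A
  define D :: "('a \<Rightarrow> nat) \<Rightarrow> (nat \<Rightarrow> 'b set) \<Rightarrow> ('a \<times> 'b) set" where "D \<phi> V = {p. snd p \<in> V (\<phi> (fst p))}" for \<phi> V
  define ok :: "('a \<Rightarrow> nat) \<Rightarrow> (nat \<Rightarrow> 'b set) \<Rightarrow> bool" where
    "ok \<phi> V \<longleftrightarrow> \<phi> \<in> measurable borel (count_space UNIV) \<and> finite (range \<phi>) \<and> (\<forall>n. V n \<in> sets borel)" for \<phi> V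
  define good where "good A \<longleftrightarrow> A \<in> sets borel2 \<and> (\<forall>e>0. \<exists>\<phi> V. ok \<phi> V \<and> m (sym_diff A (D \<phi> V)) < e)" for A
  have m_mono: "m A \<le> m B" if "A \<subseteq> B" "B \<in> sets borel2" for A B
    unfolding m_def using that by (intro add_mono \<mu>.finite_measure_mono \<nu>.finite_measure_mono) (auto simp: sets)
  have m_sub: "m (A \<union> B) \<le> m A + m B"
      if "A \<in> sets borel2" "B \<in> sets borel2" for A B
    unfolding m_def using that measure_Un_le[of A \<mu> B] measure_Un_le[of A \<nu> B]
    by (simp add: sets)
  have D_sets: "D \<phi> V \<in> sets borel2" if "ok \<phi> V" for \<phi> V
  proof -
    have [measurable]: "\<phi> \<in> measurable borel (count_space UNIV)" "\<And>n. V n \<in> sets borel"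
      using that by (auto simp: ok_def)
    have "D \<phi> V = {p \<in> space borel2. \<exists>n. \<phi> (fst p) = n \<and> snd p \<in> V n}"
      by (auto simp: D_def space_pair_measure)
    also have "\<dots> \<in> sets borel2" by measurable
    finally show ?thesis .
  qed
  have good_Un: "good (A \<union> B)" if AB: "good A" "good B" for A B
    unfolding good_def
  proof (intro conjI allI impI)
    have AB_sets: "A \<in> sets borel2" "B \<in> sets borel2" using AB by (auto simp: good_def)
    then show "A \<union> B \<in> sets borel2" by auto
    fix e :: real assume "e > 0"
    then obtain \<phi>1 V1 \<phi>2 V2 where 1: "ok \<phi>1 V1" "m (sym_diff A (D \<phi>1 V1)) < e/2"
      "ok \<phi>2 V2" "m (sym_diff B (D \<phi>2 V2)) < e/2"
      using AB half_gt_zero[of e] unfolding good_def by metis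
    \<comment> \<open>Both labels are coded in one number, so that the two section families can be
      read back and united.\<close>
    define \<phi> where "\<phi> x = prod_encode (\<phi>1 x, \<phi>2 x)" for x
    define V where "V n = V1 (fst (prod_decode n)) \<union> V2 (snd (prod_decode n))" for n
    have [measurable]: "\<phi>1 \<in> measurable borel (count_space UNIV)" "\<phi>2 \<in> measurable borel (count_space UNIV)"
      using 1 by (auto simp: ok_def)
    have "range \<phi> \<subseteq> prod_encode ` (range \<phi>1 \<times> range \<phi>2)" by (auto simp: \<phi>_def)
    then have "finite (range \<phi>)" using 1(1,3) by (metis finite_cartesian_product finite_imageI finite_subset ok_def)
    moreover have "\<phi> \<in> measurable borel (count_space UNIV)" unfolding \<phi>_def by measurable
    ultimately have ok: "ok \<phi> V" using 1 by (auto simp: ok_def V_def)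
    have D: "D \<phi> V = D \<phi>1 V1 \<union> D \<phi>2 V2" by (auto simp: D_def \<phi>_def V_def)
    have "m (sym_diff (A \<union> B) (D \<phi> V)) \<le> m (sym_diff A (D \<phi>1 V1) \<union> sym_diff B (D \<phi>2 V2))"
      unfolding D using D_sets[OF 1(1)] D_sets[OF 1(3)] AB_sets by (intro m_mono) auto
    also have "\<dots> < e" using m_sub[of "sym_diff A (D \<phi>1 V1)" "sym_diff B (D \<phi>2 V2)"] 1 D_sets[OF 1(1)] D_sets[OF 1(3)] AB_sets by auto
    finally show "\<exists>\<phi> V. ok \<phi> V \<and> m (sym_diff (A \<union> B) (D \<phi> V)) < e" using ok by blast
  qed
  have "C \<in> sigma_sets UNIV {a \<times> b | a b. a \<in> sets borel \<and> b \<in> sets borel}"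
    using C by (simp add: sets_pair_measure)
  then have "good C"
  proof (induction rule: sigma_sets.induct)
    case (Basic A)
    then obtain a b where A: "A = a \<times> b" "a \<in> sets borel" "b \<in> sets borel" by auto
    define \<phi> where "\<phi> x = (if x \<in> a then 1 else 0 :: nat)" for x
    have [measurable]: "a \<in> sets borel" by (rule A)
    have "\<phi> \<in> measurable borel (count_space UNIV)" unfolding \<phi>_def by measurable
    then have "ok \<phi> (\<lambda>n. if n = 1 then b else {})" using A
      by (auto simp: ok_def \<phi>_def intro: finite_subset[of _ "{0,1}"])
    moreover have "D \<phi> (\<lambda>n. if n = 1 then b else {}) = A" by (auto simp: D_def A \<phi>_def)
    ultimately show ?case unfolding good_def using A
      by (auto intro!: exI[of _ \<phi>] exI[of _ "(\<lambda>n. if n = 1 then b else {})"] simp: m_def)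
  next
    case Empty
    have "ok (\<lambda>_. 0) (\<lambda>_. {})" "D (\<lambda>_. 0) (\<lambda>_. {}) = {}" by (auto simp: ok_def D_def)
    then show ?case unfolding good_def by (auto intro!: exI[of _ "\<lambda>_. 0"] exI[of _ "\<lambda>_. {}"] simp: m_def)
  next
    case (Compl A)
    show ?case unfolding good_def
    proof (intro conjI allI impI)
      have A: "A \<in> sets borel2" using Compl by (auto simp: good_def)
      from sets.compl_sets[OF this] show "UNIV - A \<in> sets borel2" by (simp add: space_pair_measure)
      fix e :: real assume "e > 0"
      then obtain \<phi> V where 1: "ok \<phi> V" "m (sym_diff A (D \<phi> V)) < e"
        using Compl unfolding good_def by metis
      have "sym_diff (UNIV - A) (D \<phi> (\<lambda>n. UNIV - V n)) = sym_diff A (D \<phi> V)" by (auto simp: D_def)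
      moreover have "ok \<phi> (\<lambda>n. UNIV - V n)" using 1 by (auto simp: ok_def)
      ultimately show "\<exists>\<phi> V. ok \<phi> V \<and> m (sym_diff (UNIV - A) (D \<phi> V)) < e" using 1 by metis
    qed
  next
    case (Union A)
    \<comment> \<open>The number of labels has to stay finite, so finite unions come first;
      continuity from below of both measures then reaches the countable union.\<close>
    have gf: "good (\<Union>i<k. A i)" for k :: nat
    proof (induction k)
      case 0
      have "ok (\<lambda>_. 0) (\<lambda>_. {})" "D (\<lambda>_. 0) (\<lambda>_. {}) = {}" by (auto simp: ok_def D_def)
      then show ?case unfolding good_def by (auto intro!: exI[of _ "\<lambda>_. 0"] exI[of _ "\<lambda>_. {}"] simp: m_def)
    next
      case (Suc k)
      then show ?case using good_Un[OF Suc Union.IH[of k]] by (simp add: lessThan_Suc Un_commute)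
    qed
    have A: "A i \<in> sets borel2" for i using Union.IH by (auto simp: good_def)
    show ?case unfolding good_def
    proof (intro conjI allI impI)
      show U: "(\<Union>i. A i) \<in> sets borel2" using A by auto
      fix e :: real assume "e > 0"
      have "(\<lambda>k. m (\<Union>i<k. A i)) \<longlonglongrightarrow> m (\<Union>k. \<Union>i<k. A i)" unfolding m_def
        using A by (intro tendsto_add \<mu>.finite_Lim_measure_incseq \<nu>.finite_Lim_measure_incseq)
          (simp_all add: sets incseq_def UN_mono image_subset_iff sets.finite_UN)
      moreover have "(\<Union>k. \<Union>i<k. A i) = (\<Union>i. A i)" by auto
      ultimately have "(\<lambda>k. m (\<Union>i. A i) - m (\<Union>i<k. A i)) \<longlonglongrightarrow> m (\<Union>i. A i) - m (\<Union>i. A i)"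
        by (intro tendsto_intros) simp
      then have "eventually (\<lambda>k. m (\<Union>i. A i) - m (\<Union>i<k. A i) < e/2) sequentially"
        using \<open>e > 0\<close> by (intro order_tendstoD(2)) auto
      then obtain k where k: "m (\<Union>i. A i) - m (\<Union>i<k. A i) < e/2" by (auto simp: eventually_sequentially)
      obtain \<phi> V where 1: "ok \<phi> V" "m (sym_diff (\<Union>i<k. A i) (D \<phi> V)) < e/2"
        using gf[of k] half_gt_zero[OF \<open>e > 0\<close>] unfolding good_def by metis
      have "m ((\<Union>i. A i) - (\<Union>i<k. A i)) = m (\<Union>i. A i) - m (\<Union>i<k. A i)"
        unfolding m_def using A U \<mu>.finite_measure_Diff[of "\<Union>i. A i" "\<Union>i<k. A i"]
          \<nu>.finite_measure_Diff[of "\<Union>i. A i" "\<Union>i<k. A i"] by (simp add: sets UN_mono)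
      moreover have "m (sym_diff (\<Union>i. A i) (D \<phi> V)) \<le> m (sym_diff (\<Union>i<k. A i) (D \<phi> V) \<union> ((\<Union>i. A i) - (\<Union>i<k. A i)))"
        using A U D_sets[OF 1(1)] by (intro m_mono) auto
      moreover have "\<dots> \<le> m (sym_diff (\<Union>i<k. A i) (D \<phi> V)) + m ((\<Union>i. A i) - (\<Union>i<k. A i))"
        using A U D_sets[OF 1(1)] by (intro m_sub) auto
      ultimately have "m (sym_diff (\<Union>i. A i) (D \<phi> V)) < e" using k 1(2) by linarith
      then show "\<exists>\<phi> V. ok \<phi> V \<and> m (sym_diff (\<Union>i. A i) (D \<phi> V)) < e" using 1(1) by blast
    qed
  qed
  then show ?thesis using \<open>e > 0\<close> unfolding good_def ok_def D_def m_def by (simp add: conj_assoc)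
qed

section \<open>The mixing coefficient as a bound on the distance between joint law and product
  law\<close>

locale C01_process = prob_space M for M :: "'w measure" +
  fixes \<epsilon> :: "nat \<Rightarrow> 'w \<Rightarrow> C01"
  assumes rv: "i \<ge> 1 \<Longrightarrow> \<epsilon> i \<in> borel_measurable M"
begin

abbreviation \<S> :: "nat set \<Rightarrow> 'w measure" where "\<S> I \<equiv> generated_sigma M \<epsilon> I"

abbreviation \<beta> :: "nat \<Rightarrow> real" where "\<beta> k \<equiv> beta_coeff M \<epsilon> k"

lemma space_generated_sigma [simp]: "space (\<S> I) = space M"
  unfolding generated_sigma_def by (rule space_measure_of) auto

lemma sets_generated_sigma:
  "sets (\<S> I) = sigma_sets (space M) (\<Union>i\<in>I. {\<epsilon> i -` B \<inter> space M |B. B \<in> sets borel})"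
  unfolding generated_sigma_def by (rule sets_measure_of) auto

lemma subalgebra_generated_sigma:
  assumes "I \<subseteq> {1..}"
  shows "subalgebra M (\<S> I)"
proof -
  have "(\<Union>i\<in>I. {\<epsilon> i -` B \<inter> space M |B. B \<in> sets borel}) \<subseteq> sets M"
  proof safe
    fix i B assume "i \<in> I" "B \<in> sets (borel :: C01 measure)"
    then show "\<epsilon> i -` B \<inter> space M \<in> sets M" using assms rv[of i] by (auto intro: measurable_sets)
  qed
  then show ?thesis
    by (simp add: subalgebra_def sets_generated_sigma sets.sigma_sets_subset)
qed

lemma generated_sigma_mono: "I \<subseteq> J \<Longrightarrow> sets (\<S> I) \<subseteq> sets (\<S> J)"
  unfolding sets_generated_sigma by (intro sigma_sets_mono' UN_mono) blast+

lemma measurable_generated_sigma_mono: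
  assumes X: "X \<in> measurable (\<S> I) N" and "I \<subseteq> J"
  shows "X \<in> measurable (\<S> J) N"
proof -
  have "subalgebra (\<S> J) (\<S> I)"
    unfolding subalgebra_def space_generated_sigma using generated_sigma_mono[OF assms(2)] by blast
  then show ?thesis using X by (rule measurable_from_subalg)
qed

lemma measurable_generated_sigma_imp:
  "X \<in> measurable (\<S> I) N \<Longrightarrow> I \<subseteq> {1..} \<Longrightarrow> X \<in> measurable M N"
  by (rule measurable_from_subalg[OF subalgebra_generated_sigma])

lemma measurable_\<epsilon>_generated: "i \<in> I \<Longrightarrow> \<epsilon> i \<in> measurable (\<S> I) borel"
proof (rule measurableI)
  fix B :: "C01 set" assume "i \<in> I" "B \<in> sets borel"
  then have "\<epsilon> i -` B \<inter> space M \<in> (\<Union>i\<in>I. {\<epsilon> i -` B \<inter> space M |B. B \<in> sets borel})"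
    by (intro UN_I[of i] CollectI exI[of _ B] conjI refl)
  then show "\<epsilon> i -` B \<inter> space (\<S> I) \<in> sets (\<S> I)"
    unfolding sets_generated_sigma space_generated_sigma by (rule sigma_sets.Basic)
qed simp


text \<open>Unpacks the two suprema inside \<open>beta_coeff\<close>: a single integrable
  \<open>g\<close> dominates the deviations for all future events, so that different events may be
  used on different pieces of the past. The outer supremum is over a bounded family because each
  essential supremum is at most one almost surely.\<close>

lemma beta_dominating:
  assumes "j \<ge> 1"
  shows "\<exists>g. integrable M g \<and> (AE w in M. 0 \<le> g w) \<and> expectation g \<le> beta_coeff M \<epsilon> k \<and>
    (\<forall>A\<in>sets (\<S> {j + k..}).
       AE w in M. \<bar>real_cond_exp M (\<S> {1..j}) (indicator A) w - prob A\<bar> \<le> g w)"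
proof -
  define F where "F j = (\<lambda>A w. \<bar>real_cond_exp M (\<S> {1..j}) (indicator A) w - prob A\<bar>)
           ` sets (\<S> {j + k..})" for j
  define g where "g j = ess_Sup M (F j)" for j
  have *: "integrable M (g j) \<and> (AE w in M. 0 \<le> g j w) \<and> expectation (g j) \<le> 1 \<and>
    (\<forall>A\<in>sets (\<S> {j + k..}).
       AE w in M. \<bar>real_cond_exp M (\<S> {1..j}) (indicator A) w - prob A\<bar> \<le> g j w)"
    if j: "j \<ge> 1" for j
  proof -
    have sub: "subalgebra M (\<S> {1..j})" by (rule subalgebra_generated_sigma) auto
    interpret finite_measure_subalgebra M "\<S> {1..j}"
      by unfold_locales (rule sub)
    have A_sets: "A \<in> sets M" if "A \<in> sets (\<S> {j + k..})" for A
      using that subalgebra_generated_sigma[of "{j + k..}"] j by (auto simp: subalgebra_def)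
    have bnd: "AE w in M. \<bar>f w\<bar> \<le> 1" if f: "f \<in> F j" for f
    proof -
      obtain A where A: "A \<in> sets (\<S> {j + k..})"
        "f = (\<lambda>w. \<bar>real_cond_exp M (\<S> {1..j}) (indicator A) w - prob A\<bar>)"
        using f by (auto simp: F_def)
      have int: "integrable M (indicator A :: 'w \<Rightarrow> real)" using A_sets[OF A(1)]
        by (simp add: emeasure_eq_measure)
      have "AE w in M. real_cond_exp M (\<S> {1..j}) (indicator A) w \<ge> 0"
        using A_sets[OF A(1)] by (intro real_cond_exp_pos) auto
      moreover have "AE w in M. real_cond_exp M (\<S> {1..j}) (indicator A) w \<le> 1"
        using int by (intro real_cond_exp_le_c) (auto simp: indicator_def)
      ultimately show ?thesis
      proof eventually_elim
        case (elim w)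
        then show ?case unfolding A(2) using prob_le_1[of A] measure_nonneg[of M A] by linarith
      qed
    qed
    have mem: "f \<in> borel_measurable M" if f: "f \<in> F j" for f
    proof -
      obtain A where A: "f = (\<lambda>w. \<bar>real_cond_exp M (\<S> {1..j}) (indicator A) w - prob A\<bar>)"
        using f unfolding F_def by (rule imageE)
      show ?thesis unfolding A by (intro borel_measurable_abs borel_measurable_diff borel_measurable_cond_exp2 borel_measurable_const)
    qed
    have "{} \<in> sets (\<S> {j + k..})" by (rule sets.empty_sets)
    then have ne: "F j \<noteq> {}" unfolding F_def image_is_empty by (metis empty_iff)
    have ess: "is_ess_Sup M (F j) (g j)" unfolding g_def
      using is_ess_Sup_ess_Sup[of "F j" 1] ne mem bnd by blast
    have [measurable]: "g j \<in> borel_measurable M" using ess unfolding is_ess_Sup_def by blast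
    have up: "AE w in M. f w \<le> g j w" if "f \<in> F j" for f using ess that unfolding is_ess_Sup_def by blast
    obtain f where f: "f \<in> F j" using ne by auto
    have pos: "0 \<le> f w" for w using f unfolding F_def by (metis (no_types, lifting) abs_ge_zero imageE)
    from up[OF f] have nonneg: "AE w in M. 0 \<le> g j w"
    proof eventually_elim
      case (elim w)
      then show ?case using pos[of w] by linarith
    qed
    have "AE w in M. f w \<le> 1" if "f \<in> F j" for f using bnd[OF that] by eventually_elim simp
    then have le1: "AE w in M. g j w \<le> 1"
      using ess[unfolded is_ess_Sup_def, THEN conjunct2, THEN conjunct2, rule_format, of "\<lambda>_. 1"] by simp
    have int: "integrable M (g j)" using nonneg le1 by (intro integrable_const_bound[of _ 1]) auto
    moreover have "expectation (g j) \<le> 1" using integral_mono_AE[OF int integrable_const[of 1] le1] by (simp add: prob_space)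
    ultimately show ?thesis using nonneg up by (auto simp: F_def)
  qed
  have b: "beta_coeff M \<epsilon> k = (SUP j\<in>{1..}. expectation (g j))"
    unfolding beta_coeff_def g_def F_def by (rule refl)
  have "bdd_above ((\<lambda>j. expectation (g j)) ` {1..})" using * by (intro bdd_aboveI2[of _ _ 1]) simp
  then have "expectation (g j) \<le> beta_coeff M \<epsilon> k"
    unfolding b using assms by (intro cSUP_upper) auto
  then show ?thesis using *[OF assms] by blast
qed

lemma beta_coeff_nonneg: "\<beta> k \<ge> 0"
proof -
  obtain g where "AE w in M. 0 \<le> g w" "expectation g \<le> \<beta> k"
    using beta_dominating[of 1 k] by auto
  then show ?thesis using integral_nonneg_AE[of g M] by linarith
qed


text \<open>Where the label of \<open>X\<close> is \<open>n\<close>, the conditional probability of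
  \<open>Y \<in> V n\<close> differs from the unconditional one by at most \<open>g\<close>. These
  pieces partition the space, so the errors add up to the one integral of \<open>g\<close>, whatever
  the number of pieces.\<close>

lemma beta_simple_sets:
  fixes X :: "'w \<Rightarrow> 'a::topological_space" and Y :: "'w \<Rightarrow> 'b::topological_space"
  assumes j: "j \<ge> 1"
    and X: "X \<in> measurable (\<S> {1..j}) borel"
    and Y: "Y \<in> measurable (\<S> {j + k..}) borel"
    and \<phi>[measurable]: "\<phi> \<in> measurable borel (count_space (UNIV :: nat set))" "finite (range \<phi>)"
    and V[measurable]: "\<And>n. V n \<in> sets borel"
  shows "(\<Sum>n\<in>range \<phi>. prob {w \<in> space M. \<phi> (X w) = n \<and> Y w \<in> V n})
     - (\<Sum>n\<in>range \<phi>. prob {w \<in> space M. \<phi> (X w) = n} * prob {w \<in> space M. Y w \<in> V n}) \<le> \<beta> k"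
proof -
  let ?F = "\<S> {1..j}"
  obtain g where g: "integrable M g" "AE w in M. 0 \<le> g w" "expectation g \<le> \<beta> k"
    "\<And>A. A\<in>sets (\<S> {j + k..}) \<Longrightarrow>
       AE w in M. \<bar>real_cond_exp M ?F (indicator A) w - prob A\<bar> \<le> g w"
    using beta_dominating[OF j, of k] by blast
  have sub: "subalgebra M ?F" by (rule subalgebra_generated_sigma) auto
  interpret finite_measure_subalgebra M ?F
    by unfold_locales (rule sub)
  have "{1..j} \<subseteq> {1..}" "{j + k..} \<subseteq> {1..}" using j by auto
  then have [measurable]: "X \<in> borel_measurable M" "Y \<in> borel_measurable M"
    using measurable_generated_sigma_imp[OF X] measurable_generated_sigma_imp[OF Y] by blast+
  define A where "A n = {w \<in> space M. \<phi> (X w) = n}" for n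
  define B where "B n = {w \<in> space M. Y w \<in> V n}" for n
  have A: "A n \<in> sets ?F" for n
  proof -
    have "(\<lambda>w. \<phi> (X w)) -` {n} \<inter> space ?F \<in> sets ?F"
      by (rule measurable_sets[OF measurable_compose[OF X \<phi>(1)]]) simp
    also have "(\<lambda>w. \<phi> (X w)) -` {n} \<inter> space ?F = A n" unfolding A_def space_generated_sigma by blast
    finally show ?thesis .
  qed
  have B: "B n \<in> sets (\<S> {j + k..})" for n
    using measurable_sets[OF Y V[of n]] by (simp add: B_def vimage_def Int_def conj_commute)
  have [measurable]: "A n \<in> sets M" "B n \<in> sets M" for n unfolding A_def B_def by measurable
  have trm: "prob (A n \<inter> B n) - prob (A n) * prob (B n) \<le> (LINT w|M. indicator (A n) w * g w)" for n
  proof -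
    have i: "integrable M (real_cond_exp M ?F (indicator (B n)))"
      by (intro real_cond_exp_int) (simp add: emeasure_eq_measure)
    have "prob (A n \<inter> B n) = (\<integral>w\<in>A n. indicator (B n) w \<partial>M)"
      by (simp add: set_lebesgue_integral_def flip: indicator_inter_arith)
    also have "\<dots> = (\<integral>w\<in>A n. real_cond_exp M ?F (indicator (B n)) w \<partial>M)"
      by (intro real_cond_exp_intA A) (simp add: emeasure_eq_measure)
    finally have "prob (A n \<inter> B n) - prob (A n) * prob (B n) =
        (LINT w|M. indicator (A n) w * real_cond_exp M ?F (indicator (B n)) w) - (LINT w|M. indicator (A n) w * prob (B n))"
      by (simp add: set_lebesgue_integral_def)
    also have "\<dots> = (LINT w|M. indicator (A n) w * (real_cond_exp M ?F (indicator (B n)) w - prob (B n)))"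
      unfolding right_diff_distrib using integrable_real_mult_indicator[OF _ i, of "A n"]
      by (intro Bochner_Integration.integral_diff[symmetric] integrable_mult_left) (auto simp: emeasure_eq_measure mult.commute)
    also have "\<dots> \<le> (LINT w|M. indicator (A n) w * g w)"
    proof (intro integral_mono_AE)
      show "AE w in M. indicator (A n) w * (real_cond_exp M ?F (indicator (B n)) w - prob (B n)) \<le> indicator (A n) w * g w"
        using g(4)[OF B[of n]] by eventually_elim (auto simp: indicator_def)
      show "integrable M (\<lambda>w. indicator (A n) w * (real_cond_exp M ?F (indicator (B n)) w - prob (B n)))"
        using integrable_real_mult_indicator[of "A n" M "\<lambda>w. real_cond_exp M ?F (indicator (B n)) w - prob (B n)"] i
        by (simp add: mult.commute)
      show "integrable M (\<lambda>w. indicator (A n) w * g w)"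
        using integrable_real_mult_indicator[of "A n" M g] g(1) by (simp add: mult.commute)
    qed
    finally show ?thesis .
  qed
  have "(\<Sum>n\<in>range \<phi>. prob (A n \<inter> B n)) - (\<Sum>n\<in>range \<phi>. prob (A n) * prob (B n))
     \<le> (\<Sum>n\<in>range \<phi>. (LINT w|M. indicator (A n) w * g w))"
    unfolding sum_subtractf[symmetric] by (intro sum_mono trm)
  also have "\<dots> = (LINT w|M. (\<Sum>n\<in>range \<phi>. indicator (A n) w * g w))"
    using integrable_real_mult_indicator[of _ M g] g(1)
    by (intro Bochner_Integration.integral_sum[symmetric]) (simp add: mult.commute)
  also have "\<dots> = expectation g"
  proof (intro Bochner_Integration.integral_cong refl)
    fix w assume "w \<in> space M"
    then have "(\<Sum>n\<in>range \<phi>. indicator (A n) w * g w) = (\<Sum>n\<in>range \<phi>. if \<phi> (X w) = n then g w else 0)"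
      by (intro sum.cong) (auto simp: A_def)
    also have "\<dots> = g w" using \<phi>(2) by simp
    finally show "(\<Sum>n\<in>range \<phi>. indicator (A n) w * g w) = g w" .
  qed
  finally have "(\<Sum>n\<in>range \<phi>. prob (A n \<inter> B n)) - (\<Sum>n\<in>range \<phi>. prob (A n) * prob (B n)) \<le> \<beta> k"
    using g(3) by linarith
  moreover have "A n \<inter> B n = {w \<in> space M. \<phi> (X w) = n \<and> Y w \<in> V n}" for n
    by (auto simp: A_def B_def)
  ultimately show ?thesis by (simp add: A_def B_def)
qed


text \<open>Approximating \<open>C\<close> under both laws simultaneously by
  \<open>approx_pair_sets\<close> leaves finitely many rectangles, to which
  \<open>beta_simple_sets\<close> applies. The inequality is one-sided here; passing to the
  complement of \<open>C\<close> gives the other side.\<close>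

lemma beta_pair_le:
  fixes X :: "'w \<Rightarrow> 'a::topological_space" and Y :: "'w \<Rightarrow> 'b::topological_space"
  assumes j: "j \<ge> 1"
    and X: "X \<in> measurable (\<S> {1..j}) borel"
    and Y: "Y \<in> measurable (\<S> {j + k..}) borel"
    and C: "C \<in> sets borel2"
  defines "Q \<equiv> distr M borel2 (\<lambda>w. (X w, Y w))"
    and "R \<equiv> distr M borel X \<Otimes>\<^sub>M distr M borel Y"
  shows "measure Q C - measure R C \<le> \<beta> k"
proof (rule field_le_epsilon)
  fix e :: real assume "e > 0"
  have "{1..j} \<subseteq> {1..}" "{j + k..} \<subseteq> {1..}" using j by auto
  then have [measurable]: "X \<in> borel_measurable M" "Y \<in> borel_measurable M"
    using measurable_generated_sigma_imp[OF X] measurable_generated_sigma_imp[OF Y] by blast+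
  interpret X: prob_space "distr M borel X" by (rule prob_space_distr) simp
  interpret Y: prob_space "distr M borel Y" by (rule prob_space_distr) simp
  interpret XY: pair_prob_space "distr M borel X" "distr M borel Y" ..
  interpret Q: prob_space Q unfolding Q_def by (rule prob_space_distr) simp
  interpret R: prob_space R unfolding R_def by unfold_locales
  have sets: "sets Q = sets borel2" "sets R = sets borel2"
    unfolding Q_def R_def by (auto cong: sets_pair_measure_cong)
  obtain \<phi> V where approx: "\<phi> \<in> measurable borel (count_space (UNIV::nat set)) \<and> finite (range \<phi>) \<and> (\<forall>n. V n \<in> sets borel) \<and>
      measure Q (sym_diff C {p. snd p \<in> V (\<phi> (fst p))}) + measure R (sym_diff C {p. snd p \<in> V (\<phi> (fst p))}) < e"
    using approx_pair_sets[OF Q.finite_measure_axioms R.finite_measure_axioms sets C \<open>e > 0\<close>] by (elim exE)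
  then have \<phi>[measurable]: "\<phi> \<in> measurable borel (count_space (UNIV::nat set))" "finite (range \<phi>)"
    and V[measurable]: "\<And>n. V n \<in> sets borel" by simp_all
  define D where "D = {p. snd p \<in> V (\<phi> (fst p))}"
  define E where "E n = {x. \<phi> x = n} \<times> V n" for n
  have [measurable]: "{x. \<phi> x = n} \<in> sets borel" for n
    using measurable_sets[OF \<phi>(1), of "{n}"] by (simp add: vimage_def)
  have E[measurable]: "E n \<in> sets borel2" for n unfolding E_def by measurable
  have D_eq: "D = (\<Union>n\<in>range \<phi>. E n)" by (auto simp: D_def E_def)
  have disj: "disjoint_family_on E (range \<phi>)" by (auto simp: disjoint_family_on_def E_def)
  have D[measurable]: "D \<in> sets borel2" unfolding D_eq using \<phi>(2) by (rule sets.finite_UN) simp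
  have "measure Q D = (\<Sum>n\<in>range \<phi>. measure Q (E n))"
    unfolding D_eq using \<phi>(2) disj by (intro Q.finite_measure_finite_Union) (auto simp: sets)
  also have "\<dots> = (\<Sum>n\<in>range \<phi>. prob {w \<in> space M. \<phi> (X w) = n \<and> Y w \<in> V n})"
    unfolding Q_def by (subst measure_distr) (auto simp: E_def intro!: sum.cong arg_cong[where f=prob])
  finally have QD: "measure Q D = \<dots>" .
  have RE: "measure R (E n) = prob {w \<in> space M. \<phi> (X w) = n} * prob {w \<in> space M. Y w \<in> V n}" for n
  proof -
    have "measure R (E n) = measure (distr M borel X) {x. \<phi> x = n} * measure (distr M borel Y) (V n)"
      unfolding R_def E_def measure_def by (subst Y.emeasure_pair_measure_Times) (auto simp: enn2real_mult)
    also have "measure (distr M borel X) {x. \<phi> x = n} = prob {w \<in> space M. \<phi> (X w) = n}"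
      by (subst measure_distr) (auto intro!: arg_cong[where f=prob])
    also have "measure (distr M borel Y) (V n) = prob {w \<in> space M. Y w \<in> V n}"
      by (subst measure_distr) (auto intro!: arg_cong[where f=prob])
    finally show ?thesis .
  qed
  have RD: "measure R D = (\<Sum>n\<in>range \<phi>. measure R (E n))"
    unfolding D_eq using \<phi>(2) disj by (intro R.finite_measure_finite_Union) (auto simp: sets)
  have "measure Q D - measure R D \<le> \<beta> k"
    unfolding QD RD RE by (rule beta_simple_sets[OF j X Y \<phi> V])
  moreover have "measure Q C \<le> measure Q D + measure Q (sym_diff C D)"
    using C D by (intro order_trans[OF Q.finite_measure_mono measure_Un_le]) (auto simp: sets)
  moreover have "measure R D \<le> measure R C + measure R (sym_diff C D)"
    using C D by (intro order_trans[OF R.finite_measure_mono measure_Un_le]) (auto simp: sets)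
  ultimately show "measure Q C - measure R C \<le> \<beta> k + e"
    using approx unfolding D_def by linarith
qed

lemma beta_pair:
  fixes X :: "'w \<Rightarrow> 'a::topological_space" and Y :: "'w \<Rightarrow> 'b::topological_space"
  assumes j: "j \<ge> 1"
    and X: "X \<in> measurable (\<S> {1..j}) borel"
    and Y: "Y \<in> measurable (\<S> {j + k..}) borel"
    and C: "C \<in> sets borel2"
  defines "Q \<equiv> distr M borel2 (\<lambda>w. (X w, Y w))"
    and "R \<equiv> distr M borel X \<Otimes>\<^sub>M distr M borel Y"
  shows "\<bar>measure Q C - measure R C\<bar> \<le> \<beta> k"
proof -
  have "{1..j} \<subseteq> {1..}" "{j + k..} \<subseteq> {1..}" using j by auto
  then have [measurable]: "X \<in> borel_measurable M" "Y \<in> borel_measurable M"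
    using measurable_generated_sigma_imp[OF X] measurable_generated_sigma_imp[OF Y] by blast+
  interpret X: prob_space "distr M borel X" by (rule prob_space_distr) simp
  interpret Y: prob_space "distr M borel Y" by (rule prob_space_distr) simp
  interpret XY: pair_prob_space "distr M borel X" "distr M borel Y" ..
  interpret Q: prob_space Q unfolding Q_def by (rule prob_space_distr) simp
  interpret R: prob_space R unfolding R_def by unfold_locales
  have sets: "sets Q = sets borel2" "sets R = sets borel2"
    unfolding Q_def R_def by (auto cong: sets_pair_measure_cong)
  have "UNIV - C \<in> sets borel2" using sets.compl_sets[OF C] by (simp add: space_pair_measure)
  then have "measure Q (UNIV - C) - measure R (UNIV - C) \<le> \<beta> k"
    using beta_pair_le[OF j X Y] unfolding Q_def R_def by blast
  moreover have "space Q = UNIV" "space R = UNIV" by (auto simp: Q_def R_def space_pair_measure)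
  ultimately have "- (measure Q C - measure R C) \<le> \<beta> k"
    using Q.prob_compl[of C] R.prob_compl[of C] C by (simp add: sets)
  then show ?thesis using beta_pair_le[OF j X Y C] unfolding Q_def R_def by linarith
qed

end

section \<open>From bounds on probabilities to bounds on integrals\<close>

text \<open>\<open>h\<close> lies within 1/N of a staircase that is the average of the indicators of
  the level sets h \<ge> i/N. An average of N errors of size \<open>b\<close> is again at most
  \<open>b\<close>, so N can tend to infinity without loss.\<close>

lemma integral_diff_le_of_measure_diff_le:
  fixes h :: "'a \<Rightarrow> real"
  assumes "prob_space Q" "prob_space R" and sets: "sets Q = sets R"
    and h[measurable]: "h \<in> borel_measurable Q" and h01: "\<And>x. 0 \<le> h x" "\<And>x. h x \<le> 1"
    and diff: "\<And>C. C \<in> sets Q \<Longrightarrow> \<bar>measure Q C - measure R C\<bar> \<le> b"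
  shows "\<bar>integral\<^sup>L Q h - integral\<^sup>L R h\<bar> \<le> b"
proof (rule field_le_epsilon)
  interpret Q: prob_space Q by fact
  interpret R: prob_space R by fact
  have sp: "space Q = space R" using sets by (rule sets_eq_imp_space_eq)
  have [measurable]: "h \<in> borel_measurable R" using h measurable_cong_sets[OF sets refl] by blast
  fix e :: real assume "e > 0"
  obtain N :: nat where N: "N > 0" "1 / real N < e / 2"
    using reals_Archimedean[of "e/2"] \<open>e > 0\<close> by (metis inverse_eq_divide half_gt_zero zero_less_Suc)
  define S where "S i = {x \<in> space Q. real i / real N \<le> h x}" for i
  have [measurable]: "S i \<in> sets Q" for i unfolding S_def by measurable
  then have [measurable]: "S i \<in> sets R" for i by (simp add: sets)
  define H where "H x = (\<Sum>i\<in>{1..N}. indicator (S i) x) / real N" for x :: 'a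
  have H: "H x \<le> h x" "h x \<le> H x + 1 / real N" if "x \<in> space Q" for x
  proof -
    define m where "m = nat \<lfloor>real N * h x\<rfloor>"
    have m: "real m \<le> real N * h x" "real N * h x < real m + 1"
      using h01(1)[of x] unfolding m_def by (simp_all add: of_nat_nat)
    have "real N * h x \<le> real N * 1" using h01(2)[of x] by (intro mult_left_mono) auto
    then have "m \<le> N" using m(1) by linarith
    have "(\<Sum>i\<in>{1..N}. indicator (S i) x) = (\<Sum>i\<in>{1..N}. if i \<in> {1..m} then 1 else 0 :: real)"
    proof (intro sum.cong refl)
      fix i assume "i \<in> {1..N}"
      have "real i / real N \<le> h x \<longleftrightarrow> real i \<le> real N * h x" using N(1) by (simp add: field_simps)
      also have "\<dots> \<longleftrightarrow> i \<le> m" using m by linarith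
      finally show "indicator (S i) x = (if i \<in> {1..m} then 1 else 0 :: real)"
        using that \<open>i \<in> {1..N}\<close> by (simp add: S_def indicator_def)
    qed
    also have "\<dots> = (\<Sum>i\<in>{1..N} \<inter> {1..m}. 1)" by (rule sum.inter_restrict[symmetric]) simp
    also have "{1..N} \<inter> {1..m} = {1..m}" using \<open>m \<le> N\<close> by auto
    finally have Hx: "H x = real m / real N" by (simp add: H_def)
    show "H x \<le> h x" unfolding Hx using m(1) N(1) by (simp add: divide_le_eq mult.commute)
    show "h x \<le> H x + 1 / real N"
      unfolding Hx using m(2) N(1) by (simp add: le_divide_eq mult.commute flip: add_divide_distrib)
  qed
  have [measurable]: "H \<in> borel_measurable Q" "H \<in> borel_measurable R" unfolding H_def by measurable
  have H0: "0 \<le> H x" for x unfolding H_def by (simp add: sum_nonneg)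
  have H1: "H x \<le> 1" for x
  proof -
    have "(\<Sum>i\<in>{1..N}. indicator (S i) x) \<le> (\<Sum>i\<in>{1..N}. 1 :: real)" by (intro sum_mono) (simp add: indicator_def)
    then show ?thesis using N(1) by (simp add: H_def field_simps)
  qed
  have int: "integrable Q h" "integrable R h" "integrable Q H" "integrable R H"
    using h01 H0 H1 by (auto intro!: Q.integrable_const_bound[of _ 1] R.integrable_const_bound[of _ 1])
  have IH: "integral\<^sup>L Q H = (\<Sum>i\<in>{1..N}. measure Q (S i)) / real N" "integral\<^sup>L R H = (\<Sum>i\<in>{1..N}. measure R (S i)) / real N"
    unfolding H_def by (simp_all add: Q.emeasure_eq_measure R.emeasure_eq_measure sets.Int_space_eq2)
  have "\<bar>integral\<^sup>L Q H - integral\<^sup>L R H\<bar> = \<bar>\<Sum>i\<in>{1..N}. measure Q (S i) - measure R (S i)\<bar> / real N"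
    unfolding IH by (simp add: sum_subtractf flip: diff_divide_distrib)
  also have "\<dots> \<le> (\<Sum>i\<in>{1..N}. b) / real N"
    by (intro divide_right_mono order_trans[OF sum_abs] sum_mono diff) auto
  also have "\<dots> = b" using N(1) by simp
  finally have b: "\<bar>integral\<^sup>L Q H - integral\<^sup>L R H\<bar> \<le> b" .
  have "integral\<^sup>L Q H \<le> integral\<^sup>L Q h" "integral\<^sup>L R H \<le> integral\<^sup>L R h"
    using H sp by (auto intro!: integral_mono int)
  moreover have "integral\<^sup>L Q h \<le> integral\<^sup>L Q (\<lambda>x. H x + 1 / real N)" "integral\<^sup>L R h \<le> integral\<^sup>L R (\<lambda>x. H x + 1 / real N)"
    using H sp int by (intro integral_mono Bochner_Integration.integrable_add; simp)+
  ultimately show "\<bar>integral\<^sup>L Q h - integral\<^sup>L R h\<bar> \<le> b + e"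
    using b N(2) int by (simp add: Q.prob_space R.prob_space)
qed

text \<open>The affine image \<open>(h x + B) / (2 * B)\<close> has values in [0,1]; undoing the
  rescaling produces the factor \<open>2 * B\<close>.\<close>

lemma integral_diff_le_of_measure_diff_le':
  fixes h :: "'a \<Rightarrow> real"
  assumes Q: "prob_space Q" "prob_space R" and sets: "sets Q = sets R"
    and h[measurable]: "h \<in> borel_measurable Q" and hB: "\<And>x. \<bar>h x\<bar> \<le> B"
    and diff: "\<And>C. C \<in> sets Q \<Longrightarrow> \<bar>measure Q C - measure R C\<bar> \<le> b"
  shows "\<bar>integral\<^sup>L Q h - integral\<^sup>L R h\<bar> \<le> 2 * B * b"
proof (cases "B = 0")
  case True
  then have "h = (\<lambda>_. 0)" using hB by auto
  then show ?thesis using True by simp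
next
  case False
  interpret Q: prob_space Q by fact
  interpret R: prob_space R by fact
  have B: "B > 0" using False hB[of undefined] by linarith
  have [measurable]: "h \<in> borel_measurable R" using h measurable_cong_sets[OF sets refl] by blast
  have int: "integrable Q h" "integrable R h"
    using hB by (auto intro!: Q.integrable_const_bound[of _ B] R.integrable_const_bound[of _ B])
  have "\<bar>integral\<^sup>L Q (\<lambda>x. (h x + B) / (2 * B)) - integral\<^sup>L R (\<lambda>x. (h x + B) / (2 * B))\<bar> \<le> b"
  proof (rule integral_diff_le_of_measure_diff_le[OF Q sets _ _ _ diff])
    fix x show "0 \<le> (h x + B) / (2 * B)" "(h x + B) / (2 * B) \<le> 1" using hB[of x] B by (simp_all add: field_simps)
  qed measurable
  moreover have "integral\<^sup>L Q (\<lambda>x. (h x + B) / (2 * B)) = (integral\<^sup>L Q h + B) / (2 * B)"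
    "integral\<^sup>L R (\<lambda>x. (h x + B) / (2 * B)) = (integral\<^sup>L R h + B) / (2 * B)"
    using int by (simp_all add: Q.prob_space R.prob_space)
  ultimately show ?thesis using B
    by (simp add: diff_divide_distrib[symmetric] abs_divide divide_le_eq mult.commute mult.left_commute)
qed

lemma (in pair_prob_space) measure_pair_eq_integral:
  assumes [measurable]: "A \<in> sets (M1 \<Otimes>\<^sub>M M2)"
  shows "measure (M1 \<Otimes>\<^sub>M M2) A = (LINT y|M2. measure M1 ((\<lambda>x. (x, y)) -` A))"
    "(\<lambda>y. measure M1 ((\<lambda>x. (x, y)) -` A)) \<in> borel_measurable M2"
proof -
  have m: "(\<lambda>y. emeasure M1 ((\<lambda>x. (x, y)) -` A)) \<in> borel_measurable M2"
    by (rule measurable_emeasure_Pair2) fact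
  then show [measurable]: "(\<lambda>y. measure M1 ((\<lambda>x. (x, y)) -` A)) \<in> borel_measurable M2"
    unfolding measure_def by measurable
  have "ennreal (measure (M1 \<Otimes>\<^sub>M M2) A) = (\<integral>\<^sup>+y. emeasure M1 ((\<lambda>x. (x, y)) -` A) \<partial>M2)"
    by (simp add: emeasure_pair_measure_alt2 flip: P.emeasure_eq_measure)
  also have "\<dots> = (\<integral>\<^sup>+y. ennreal (measure M1 ((\<lambda>x. (x, y)) -` A)) \<partial>M2)"
    by (simp add: M1.emeasure_eq_measure)
  also have "\<dots> = ennreal (LINT y|M2. measure M1 ((\<lambda>x. (x, y)) -` A))"
    by (intro nn_integral_eq_integral M2.integrable_const_bound[of _ 1]) auto
  finally show "measure (M1 \<Otimes>\<^sub>M M2) A = (LINT y|M2. measure M1 ((\<lambda>x. (x, y)) -` A))"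
    by (simp add: integral_nonneg_AE)
qed

section \<open>Independent blocks and their comparison with mixing blocks\<close>

text \<open>Iterated convolution of the laws of \<open>T 0\<close>, ..., \<open>T (m - 1)\<close>.
  Working with the law of the sum avoids a product space that carries independent copies of the
  blocks.\<close>

primrec indep_sum_law :: "'w measure \<Rightarrow> (nat \<Rightarrow> 'w \<Rightarrow> 'b::{second_countable_topology, real_normed_vector}) \<Rightarrow> nat \<Rightarrow> 'b measure" where
  "indep_sum_law M T 0 = return borel 0"
| "indep_sum_law M T (Suc m) = distr (indep_sum_law M T m \<Otimes>\<^sub>M distr M borel (T m)) borel (\<lambda>(x, y). x + y)"

lemma sets_indep_sum_law [simp, measurable_cong]: "sets (indep_sum_law M T m) = sets borel"
  by (induction m) auto

lemma space_indep_sum_law [simp]: "space (indep_sum_law M T m) = UNIV"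
  using sets_eq_imp_space_eq[OF sets_indep_sum_law] by simp

lemma (in prob_space) prob_space_indep_sum_law:
  assumes "\<And>j. j < m \<Longrightarrow> T j \<in> borel_measurable M"
  shows "prob_space (indep_sum_law M T m)"
  using assms
proof (induction m)
  case 0
  then show ?case by (simp add: prob_space_return)
next
  case (Suc m)
  interpret \<nu>: prob_space "indep_sum_law M T m" using Suc by simp
  interpret X: prob_space "distr M borel (T m)" using Suc by (intro prob_space_distr) simp
  interpret P: pair_prob_space "indep_sum_law M T m" "distr M borel (T m)" ..
  show ?case by (simp, intro P.prob_space_distr) measurable
qed

text \<open>Meant for exponentials of additive functionals, for which the convolution becomes a
  product of one-block integrals. The nonnegative version serves moment generating functions, the
  complex one below serves characteristic functions.\<close>

lemma (in prob_space) nn_integral_indep_sum_law: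
  fixes F :: "'b::{second_countable_topology, real_normed_vector} \<Rightarrow> ennreal"
  assumes T: "\<And>j. j < m \<Longrightarrow> T j \<in> borel_measurable M"
    and F[measurable]: "F \<in> borel_measurable borel" and F0: "F 0 = 1" and F_add: "\<And>x y. F (x + y) = F x * F y"
  shows "(\<integral>\<^sup>+x. F x \<partial>indep_sum_law M T m) = (\<Prod>j<m. \<integral>\<^sup>+w. F (T j w) \<partial>M)"
  using T
proof (induction m)
  case 0
  then show ?case by (simp add: nn_integral_return F0)
next
  case (Suc m)
  interpret \<nu>: prob_space "indep_sum_law M T m" using Suc by (intro prob_space_indep_sum_law) simp
  have [measurable]: "T m \<in> borel_measurable M" using Suc by simp
  interpret X: prob_space "distr M borel (T m)" by (intro prob_space_distr) simp
  have "(\<integral>\<^sup>+x. F x \<partial>indep_sum_law M T (Suc m)) = (\<integral>\<^sup>+p. F (fst p) * F (snd p) \<partial>(indep_sum_law M T m \<Otimes>\<^sub>M distr M borel (T m)))"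
    by (simp add: nn_integral_distr split_beta F_add)
  also have "\<dots> = (\<integral>\<^sup>+x. \<integral>\<^sup>+y. F x * F y \<partial>distr M borel (T m) \<partial>indep_sum_law M T m)"
    by (subst X.nn_integral_fst[symmetric]) auto
  also have "\<dots> = (\<integral>\<^sup>+x. F x \<partial>indep_sum_law M T m) * (\<integral>\<^sup>+w. F (T m w) \<partial>M)"
    by (simp add: nn_integral_cmult nn_integral_multc nn_integral_distr)
  finally show ?case using Suc by simp
qed

lemma (in prob_space) integral_indep_sum_law:
  fixes F :: "'b::{second_countable_topology, real_normed_vector} \<Rightarrow> complex"
  assumes T: "\<And>j. j < m \<Longrightarrow> T j \<in> borel_measurable M"
    and F[measurable]: "F \<in> borel_measurable borel" and F0: "F 0 = 1" and F_add: "\<And>x y. F (x + y) = F x * F y"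
    and F_le: "\<And>x. norm (F x) \<le> 1"
  shows "(LINT x|indep_sum_law M T m. F x) = (\<Prod>j<m. LINT w|M. F (T j w))"
  using T
proof (induction m)
  case 0
  then show ?case by (simp add: integral_return F0)
next
  case (Suc m)
  interpret \<nu>: prob_space "indep_sum_law M T m" using Suc by (intro prob_space_indep_sum_law) simp
  have [measurable]: "T m \<in> borel_measurable M" using Suc by simp
  interpret X: prob_space "distr M borel (T m)" by (intro prob_space_distr) simp
  interpret P: pair_prob_space "indep_sum_law M T m" "distr M borel (T m)" ..
  have "norm (F x * F y) \<le> 1" for x y using F_le[of x] F_le[of y] by (simp add: norm_mult mult_le_one)
  then have int: "integrable (indep_sum_law M T m \<Otimes>\<^sub>M distr M borel (T m)) (\<lambda>(x,y). F x * F y)"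
    by (intro P.integrable_const_bound[of _ 1]) auto
  have "(LINT x|indep_sum_law M T (Suc m). F x) = (LINT p|(indep_sum_law M T m \<Otimes>\<^sub>M distr M borel (T m)). (case p of (x,y) \<Rightarrow> F x * F y))"
    by (simp add: integral_distr split_beta F_add)
  also have "\<dots> = (LINT x|indep_sum_law M T m. LINT y|distr M borel (T m). F x * F y)"
    using P.integral_fst[OF int] by simp
  also have "\<dots> = (LINT x|indep_sum_law M T m. F x) * (LINT w|M. F (T m w))"
    by (simp add: integral_distr)
  finally show ?case using Suc by simp
qed

context C01_process
begin

text \<open>The last block is replaced by an independent copy at the price \<beta> r; then the
  preceding sum is replaced by induction, conditionally on the value of that copy. Comparing only
  the law of the sum suffices, because all later events are conditions on the sum.\<close>

lemma block_sum_law: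
  fixes T :: "nat \<Rightarrow> 'w \<Rightarrow> 'b::{second_countable_topology, real_normed_vector}"
  assumes T: "\<And>j. T j \<in> measurable (\<S> {lo j..hi j}) borel"
    and lo: "\<And>j. 1 \<le> lo j" "\<And>j. lo j \<le> hi j" and gap: "\<And>j. hi j + r \<le> lo (Suc j)"
    and D: "D \<in> sets borel"
  shows "\<bar>prob {w \<in> space M. (\<Sum>j<m. T j w) \<in> D} - measure (indep_sum_law M T m) D\<bar> \<le> real m * \<beta> r"
  using D
proof (induction m arbitrary: D)
  case 0
  then show ?case by (simp add: measure_return indicator_def prob_space)
next
  case (Suc m)
  note [measurable] = Suc.prems
  have T_meas[measurable]: "T j \<in> borel_measurable M" for j
    using T[of j] by (rule measurable_generated_sigma_imp) (use lo(1)[of j] in auto)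
  interpret \<nu>: prob_space "indep_sum_law M T m" by (intro prob_space_indep_sum_law) simp
  interpret Y: prob_space "distr M borel (T m)" by (intro prob_space_distr) simp
  interpret P: pair_prob_space "indep_sum_law M T m" "distr M borel (T m)" ..
  let ?T = "distr M borel (T m)"
  let ?L = "indep_sum_law M T m"
  define X where "X w = (\<Sum>j<m. T j w)" for w
  have [measurable]: "X \<in> borel_measurable M" unfolding X_def by measurable
  interpret X: prob_space "distr M borel X" by (intro prob_space_distr) simp
  interpret XY: pair_prob_space "distr M borel X" "?T" ..
  define C where "C = {p :: 'b \<times> 'b. fst p + snd p \<in> D}"
  have C[measurable]: "C \<in> sets borel2"
  proof -
    have "(\<lambda>p. fst p + snd p) \<in> measurable borel2 (borel :: 'b measure)" by measurable
    from measurable_sets[OF this Suc.prems]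
    have "(\<lambda>p. fst p + snd p) -` D \<inter> space (borel \<Otimes>\<^sub>M (borel :: 'b measure)) \<in> sets borel2" .
    also have "(\<lambda>p. fst p + snd p) -` D \<inter> space (borel \<Otimes>\<^sub>M (borel :: 'b measure)) = C"
      by (auto simp: C_def space_pair_measure)
    finally show ?thesis .
  qed
  have law: "measure (indep_sum_law M T (Suc m)) D = measure (?L \<Otimes>\<^sub>M ?T) C"
    by (simp only: indep_sum_law.simps, subst measure_distr)
      (auto simp: C_def space_pair_measure split_beta Suc.prems intro!: arg_cong2[where f=measure])
  \<comment> \<open>The past of the last block must end at some index \<open>hi (m - 1)\<close>.
    Without a preceding block the sum \<open>X\<close> is the constant zero, and that case is
    settled at the end.\<close>
  have 1: "\<bar>prob {w \<in> space M. (\<Sum>j<Suc m. T j w) \<in> D} - measure (distr M borel X \<Otimes>\<^sub>M ?T) C\<bar>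
      \<le> \<beta> r" if "m > 0"
  proof -
    have hi_mono: "hi i \<le> hi j" if "i \<le> j" for i j
      using that
    proof (induction j rule: dec_induct)
      case (step j) then show ?case using gap[of j] lo(2)[of "Suc j"] by linarith
    qed simp
    have "T j \<in> measurable (\<S> {1..hi (m - 1)}) borel" if "j < m" for j
      using T[of j] by (rule measurable_generated_sigma_mono) (use that lo(1)[of j] hi_mono[of j "m - 1"] in auto)
    then have "X \<in> measurable (\<S> {1..hi (m - 1)}) borel"
      unfolding X_def by (intro borel_measurable_sum) auto
    moreover have "T m \<in> measurable (\<S> {hi (m - 1) + r..}) borel"
      using T[of m] by (rule measurable_generated_sigma_mono) (use gap[of "m - 1"] \<open>m > 0\<close> in auto)
    moreover have "hi (m - 1) \<ge> 1" using lo[of "m - 1"] by linarith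
    ultimately have "\<bar>measure (distr M borel2 (\<lambda>w. (X w, T m w))) C -
        measure (distr M borel X \<Otimes>\<^sub>M ?T) C\<bar> \<le> \<beta> r"
      by (intro beta_pair C)
    moreover have "measure (distr M borel2 (\<lambda>w. (X w, T m w))) C = prob {w \<in> space M. (\<Sum>j<Suc m. T j w) \<in> D}"
      using C by (subst measure_distr) (auto simp: C_def X_def intro!: arg_cong[where f=prob])
    ultimately show ?thesis by simp
  qed
  \<comment> \<open>At a fixed value \<open>y\<close> of the last block the section of
    \<open>C\<close> is a condition on the preceding sum; the induction bound is uniform in
    \<open>y\<close> and survives integration.\<close>
  have 2: "\<bar>measure (distr M borel X \<Otimes>\<^sub>M ?T) C - measure (?L \<Otimes>\<^sub>M ?T) C\<bar>
     \<le> real m * \<beta> r"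
  proof -
    have CX: "C \<in> sets (distr M borel X \<Otimes>\<^sub>M ?T)"
      and C\<nu>: "C \<in> sets (?L \<Otimes>\<^sub>M ?T)"
      by (simp_all cong: sets_pair_measure_cong)
    note X = XY.measure_pair_eq_integral[OF CX] and \<nu> = P.measure_pair_eq_integral[OF C\<nu>]
    have pt: "\<bar>measure (distr M borel X) ((\<lambda>x. (x, y)) -` C) - measure (?L) ((\<lambda>x. (x, y)) -` C)\<bar>
      \<le> real m * \<beta> r" for y
    proof -
      have "(\<lambda>x. (x, y)) -` C \<in> sets borel"
        using measurable_sets[OF _ C, of "\<lambda>x. (x, y)" borel] by simp
      moreover from this have "measure (distr M borel X) ((\<lambda>x. (x, y)) -` C) = prob {w \<in> space M. (\<Sum>j<m. T j w) \<in> (\<lambda>x. (x, y)) -` C}"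
        by (subst measure_distr) (auto simp: X_def intro!: arg_cong[where f=prob])
      ultimately show ?thesis using Suc.IH[of "(\<lambda>x. (x, y)) -` C"] by metis
    qed
    have i1: "integrable (?T) (\<lambda>y. measure (distr M borel X) ((\<lambda>x. (x, y)) -` C))"
      using X(2) by (intro Y.integrable_const_bound[of _ 1]) auto
    have i2: "integrable (?T) (\<lambda>y. measure (?L) ((\<lambda>x. (x, y)) -` C))"
      using \<nu>(2) by (intro Y.integrable_const_bound[of _ 1]) auto
    have "\<bar>LINT y|?T. measure (distr M borel X) ((\<lambda>x. (x, y)) -` C) - measure (?L) ((\<lambda>x. (x, y)) -` C)\<bar>
      \<le> (LINT y|?T. real m * \<beta> r)"
      using pt i1 i2 by (intro order_trans[OF integral_abs_bound] integral_mono) auto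
    then show ?thesis unfolding X(1) \<nu>(1) using i1 i2 by (simp add: Y.prob_space[unfolded space_distr space_borel])
  qed
  show ?case
  proof (cases "m = 0")
    case True
    have "measure (distr M borel X \<Otimes>\<^sub>M ?T) C = prob {w \<in> space M. T 0 w \<in> D}"
    proof -
      have CX: "C \<in> sets (distr M borel X \<Otimes>\<^sub>M ?T)" by (simp cong: sets_pair_measure_cong)
      have "measure (distr M borel X) ((\<lambda>x. (x, y)) -` C) = indicator D y" for y
        using measurable_sets[OF _ C, of "\<lambda>x. (x, y)" borel]
        by (subst measure_distr) (auto simp: X_def True C_def indicator_def prob_space)
      then show ?thesis using XY.measure_pair_eq_integral(1)[OF CX] True
        by (simp add: measure_distr) (auto intro!: arg_cong[where f=prob])
    qed
    then show ?thesis using 2 law beta_coeff_nonneg[of r] True by simp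
  next
    case False
    then show ?thesis using 1 2 law by (simp add: algebra_simps)
  qed
qed

end

section \<open>Covariances of a mixing sequence\<close>

text \<open>
  The polynomial mixing rate that follows from the summability condition in A2, because
  \<open>1 / (1/2 - \<tau>) > 2 + 2 / \<delta>\<close> there.
\<close>

definition mix_exp :: "real \<Rightarrow> real" where
  "mix_exp \<delta> = (2 + 2 / \<delta>) * (1 + 2 / \<delta>)"

locale mixing_sequence = C01_process M \<epsilon> for M :: "'w measure" and \<epsilon> +
  fixes \<delta> C\<beta> :: real
  assumes stationary: "stationary_seq M \<epsilon>"
    and \<delta>: "\<delta> > 0"
    and moment: "i \<ge> 1 \<Longrightarrow> integrable M (\<lambda>w. norm (\<epsilon> i w) powr (2 + \<delta>))"
    and beta_bound: "k \<ge> 1 \<Longrightarrow> \<beta> k \<le> C\<beta> * real k powr (- mix_exp \<delta>)"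
begin

lemma C\<beta>_nonneg: "C\<beta> \<ge> 0"
  using beta_bound[of 1] beta_coeff_nonneg[of 1] by simp

lemma rv' [measurable (raw)]: "i \<ge> 1 \<Longrightarrow> f \<in> borel_measurable borel \<Longrightarrow> (\<lambda>w. f (\<epsilon> i w)) \<in> borel_measurable M"
  by (rule measurable_compose[OF rv])

lemma stationary_pair:
  assumes "i \<ge> 1"
  shows "distr M borel2 (\<lambda>w. (\<epsilon> i w, \<epsilon> (i + k) w)) =
    distr M borel2 (\<lambda>w. (\<epsilon> 1 w, \<epsilon> (1 + k) w))"
proof -
  define P where "P h = distr M (Pi\<^sub>M {1..} (\<lambda>_. borel)) (\<lambda>w. \<lambda>i\<in>{1..}. \<epsilon> (i + h) w)" for h
  have "P h = distr M (Pi\<^sub>M {1..} (\<lambda>_. borel)) (\<lambda>w. \<lambda>i\<in>{1..}. \<epsilon> i w)" for h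
    using stationary unfolding stationary_seq_def P_def by blast
  then have eq: "P h = P 0" for h unfolding P_def by simp
  have m: "(\<lambda>w. \<lambda>i\<in>{1..}. \<epsilon> (i + h) w) \<in> measurable M (Pi\<^sub>M {1..} (\<lambda>_. borel))" for h
    using rv by (intro measurable_restrict) simp
  have "distr (P h) borel2 (\<lambda>x. (x 1, x (1 + k))) =
     distr M borel2 (\<lambda>w. (\<epsilon> (1 + h) w, \<epsilon> (1 + k + h) w))" for h
  proof -
    have "(\<lambda>x. (x 1, x (1 + k))) \<in> measurable (Pi\<^sub>M {1..} (\<lambda>_. borel :: C01 measure)) borel2"
      by (intro measurable_Pair measurable_component_singleton) simp_all
    from distr_distr[OF this m] show ?thesis unfolding P_def by (simp add: o_def)
  qed
  note d = this
  have "i - 1 + 1 = i" using assms by simp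
  then show ?thesis using d[of "i - 1"] d[of 0] eq[of "i - 1"] assms by (simp add: add.commute add.left_commute)
qed

lemma integral_pair:
  fixes g :: "C01 \<Rightarrow> C01 \<Rightarrow> real"
  assumes "i \<ge> 1" and g[measurable]: "(\<lambda>p. g (fst p) (snd p)) \<in> borel_measurable borel2"
  shows "(LINT w|M. g (\<epsilon> i w) (\<epsilon> (i + k) w)) = (LINT w|M. g (\<epsilon> 1 w) (\<epsilon> (1 + k) w))"
proof -
  have "(LINT w|M. g (\<epsilon> i w) (\<epsilon> (i + k) w)) =
    integral\<^sup>L (distr M borel2 (\<lambda>w. (\<epsilon> i w, \<epsilon> (i + k) w))) (\<lambda>p. g (fst p) (snd p))" if "i \<ge> 1" for i
    using that by (subst integral_distr) (auto intro!: measurable_Pair rv)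
  from this[OF assms(1)] this[of 1] show ?thesis by (simp add: stationary_pair[OF assms(1)])
qed

lemma integral_\<epsilon>:
  fixes g :: "C01 \<Rightarrow> real"
  assumes "i \<ge> 1" and g[measurable]: "g \<in> borel_measurable borel"
  shows "(LINT w|M. g (\<epsilon> i w)) = (LINT w|M. g (\<epsilon> 1 w))"
  using integral_pair[OF assms(1), of "\<lambda>x y. g x"] by simp

definition \<mu>p :: real where "\<mu>p = (LINT w|M. norm (\<epsilon> 1 w) powr (2 + \<delta>))"

lemma moment_eq: "i \<ge> 1 \<Longrightarrow> (LINT w|M. norm (\<epsilon> i w) powr (2 + \<delta>)) = \<mu>p"
  unfolding \<mu>p_def by (rule integral_\<epsilon>) auto

lemma \<mu>p_nonneg: "\<mu>p \<ge> 0" unfolding \<mu>p_def by simp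

lemma le_one_plus_powr:
  assumes "y \<ge> (0::real)" "q \<le> 2 + \<delta>" "q \<ge> 0"
  shows "y powr q \<le> 1 + y powr (2 + \<delta>)"
proof (cases "y \<le> 1")
  case True
  then have "y powr q \<le> 1" using assms by (simp add: powr_le1)
  then show ?thesis using powr_ge_zero[of y "2 + \<delta>"] by linarith
next
  case False
  then have "y powr q \<le> y powr (2 + \<delta>)" using assms by (intro powr_mono) auto
  then show ?thesis by simp
qed

lemma integrable_norm_sq: "i \<ge> 1 \<Longrightarrow> integrable M (\<lambda>w. (norm (\<epsilon> i w))\<^sup>2)"
  using le_one_plus_powr[of "norm (\<epsilon> i _)" 2] \<delta>
  by (intro Bochner_Integration.integrable_bound[OF Bochner_Integration.integrable_add[OF integrable_const[of 1] moment]])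
     auto

lemma integrable_norm: "i \<ge> 1 \<Longrightarrow> integrable M (\<lambda>w. norm (\<epsilon> i w))"
  using square_integrable_imp_integrable[OF _ integrable_norm_sq] by simp

lemma expectation_norm_le: "i \<ge> 1 \<Longrightarrow> (LINT w|M. norm (\<epsilon> i w)) \<le> 1 + \<mu>p"
proof -
  assume i: "i \<ge> 1"
  have "(LINT w|M. norm (\<epsilon> i w)) \<le> (LINT w|M. 1 + norm (\<epsilon> i w) powr (2 + \<delta>))"
    using le_one_plus_powr[of "norm (\<epsilon> i _)" 1] \<delta> i
    by (intro integral_mono integrable_norm Bochner_Integration.integrable_add moment) auto
  then show ?thesis using i by (simp add: moment moment_eq prob_space)
qed

lemma expectation_norm_sq_le: "i \<ge> 1 \<Longrightarrow> (LINT w|M. (norm (\<epsilon> i w))\<^sup>2) \<le> 1 + \<mu>p"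
proof -
  assume i: "i \<ge> 1"
  have "(LINT w|M. (norm (\<epsilon> i w))\<^sup>2) \<le> (LINT w|M. 1 + norm (\<epsilon> i w) powr (2 + \<delta>))"
    using le_one_plus_powr[of "norm (\<epsilon> i _)" 2] \<delta> i
    by (intro integral_mono integrable_norm_sq Bochner_Integration.integrable_add moment) auto
  then show ?thesis using i by (simp add: moment moment_eq prob_space)
qed

text \<open>One class of functionals for evaluations, bounded linear functionals, increments of
  truncated functions and the norm of the interpolation error. Linear growth is what the moments of
  the norm control, and cutting a functional to zero where the norm is large stays in the
  class.\<close>

definition dominated :: "real \<Rightarrow> (C01 \<Rightarrow> real) \<Rightarrow> bool" where
  "dominated K f \<longleftrightarrow> f \<in> borel_measurable borel \<and> (\<forall>x. \<bar>f x\<bar> \<le> K * norm x)"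

lemma dominatedD: "dominated K f \<Longrightarrow> f \<in> borel_measurable borel" "dominated K f \<Longrightarrow> \<bar>f x\<bar> \<le> K * norm x"
  by (auto simp: dominated_def)

lemma dominated_integrable:
  assumes "i \<ge> 1" "dominated K f"
  shows "integrable M (\<lambda>w. f (\<epsilon> i w))"
proof (rule Bochner_Integration.integrable_bound[of _ "\<lambda>w. K * norm (\<epsilon> i w)"])
  show "integrable M (\<lambda>w. K * norm (\<epsilon> i w))" using integrable_norm[OF assms(1)] by simp
  show "(\<lambda>w. f (\<epsilon> i w)) \<in> borel_measurable M" using dominatedD(1)[OF assms(2)] assms(1) by measurable
  show "AE w in M. norm (f (\<epsilon> i w)) \<le> norm (K * norm (\<epsilon> i w))"
    using dominatedD(2)[OF assms(2)] by (intro AE_I2) (metis abs_ge_self order_trans real_norm_def)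
qed

lemma dominated_integrable_mult:
  assumes "i \<ge> 1" "j \<ge> 1" "dominated K f" "dominated K g"
  shows "integrable M (\<lambda>w. f (\<epsilon> i w) * g (\<epsilon> j w))"
proof (rule Bochner_Integration.integrable_bound[of _ "\<lambda>w. K\<^sup>2 * ((norm (\<epsilon> i w))\<^sup>2 + (norm (\<epsilon> j w))\<^sup>2)"])
  show "integrable M (\<lambda>w. K\<^sup>2 * ((norm (\<epsilon> i w))\<^sup>2 + (norm (\<epsilon> j w))\<^sup>2))"
    using integrable_norm_sq assms(1,2) by simp
  show "(\<lambda>w. f (\<epsilon> i w) * g (\<epsilon> j w)) \<in> borel_measurable M"
    using dominatedD(1)[OF assms(3)] dominatedD(1)[OF assms(4)] assms(1,2) by measurable
  show "AE w in M. norm (f (\<epsilon> i w) * g (\<epsilon> j w)) \<le> norm (K\<^sup>2 * ((norm (\<epsilon> i w))\<^sup>2 + (norm (\<epsilon> j w))\<^sup>2))"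
  proof (rule AE_I2)
    fix w
    have "\<bar>f (\<epsilon> i w)\<bar> * \<bar>g (\<epsilon> j w)\<bar> \<le> (K * norm (\<epsilon> i w)) * (K * norm (\<epsilon> j w))"
      using dominatedD(2)[OF assms(3)] dominatedD(2)[OF assms(4)] by (intro mult_mono) (auto intro: order_trans[OF abs_ge_zero])
    also have "\<dots> = K\<^sup>2 * (norm (\<epsilon> i w) * norm (\<epsilon> j w))" by (simp add: power2_eq_square)
    also have "\<dots> \<le> K\<^sup>2 * ((norm (\<epsilon> i w))\<^sup>2 + (norm (\<epsilon> j w))\<^sup>2)"
      using sum_squares_bound[of "norm (\<epsilon> i w)" "norm (\<epsilon> j w)"] mult_nonneg_nonneg[of "norm (\<epsilon> i w)" "norm (\<epsilon> j w)"]
      by (intro mult_left_mono) (auto simp del: mult_nonneg_nonneg)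
    finally show "norm (f (\<epsilon> i w) * g (\<epsilon> j w)) \<le> norm (K\<^sup>2 * ((norm (\<epsilon> i w))\<^sup>2 + (norm (\<epsilon> j w))\<^sup>2))"
      by (simp add: abs_mult)
  qed
qed

text \<open>The covariance is the difference of the integrals of \<open>f x * g y\<close> under the
  joint law and under the product of the marginals, and \<open>beta_pair\<close> compares these on
  every set.\<close>

lemma cov_bounded:
  fixes f g :: "C01 \<Rightarrow> real"
  assumes i: "i \<ge> 1" and fg[measurable]: "f \<in> borel_measurable borel" "g \<in> borel_measurable borel"
    and F: "\<And>x. \<bar>f x\<bar> \<le> F" "\<And>x. \<bar>g x\<bar> \<le> F"
  shows "\<bar>(LINT w|M. f (\<epsilon> i w) * g (\<epsilon> (i + k) w)) - (LINT w|M. f (\<epsilon> i w)) * (LINT w|M. g (\<epsilon> (i + k) w))\<bar>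
    \<le> 2 * F\<^sup>2 * \<beta> k"
proof -
  have [measurable]: "\<epsilon> i \<in> borel_measurable M" "\<epsilon> (i + k) \<in> borel_measurable M" using rv i by auto
  interpret X: prob_space "distr M borel (\<epsilon> i)" by (intro prob_space_distr) simp
  interpret Y: prob_space "distr M borel (\<epsilon> (i + k))" by (intro prob_space_distr) simp
  interpret XY: pair_prob_space "distr M borel (\<epsilon> i)" "distr M borel (\<epsilon> (i + k))" ..
  define Q where "Q = distr M borel2 (\<lambda>w. (\<epsilon> i w, \<epsilon> (i + k) w))"
  define R where "R = distr M borel (\<epsilon> i) \<Otimes>\<^sub>M distr M borel (\<epsilon> (i + k))"
  define h where "h p = f (fst p) * g (snd p)" for p
  have [measurable]: "h \<in> borel_measurable borel2" unfolding h_def by measurable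
  have hF: "\<bar>h p\<bar> \<le> F\<^sup>2" for p
    using mult_mono[OF F(1)[of "fst p"] F(2)[of "snd p"]] F(1)[of "fst p"] by (auto simp: h_def abs_mult power2_eq_square)
  have sets: "sets Q = sets borel2" "sets R = sets borel2"
    unfolding Q_def R_def by (auto cong: sets_pair_measure_cong)
  have "\<bar>integral\<^sup>L Q h - integral\<^sup>L R h\<bar> \<le> 2 * F\<^sup>2 * \<beta> k"
  proof (rule integral_diff_le_of_measure_diff_le'[OF _ _ _ _ hF])
    show "prob_space Q" unfolding Q_def by (intro prob_space_distr) simp
    show "prob_space R" unfolding R_def by unfold_locales
    show "sets Q = sets R" using sets by simp
    show "h \<in> borel_measurable Q" unfolding measurable_cong_sets[OF sets(1) refl] by measurable
    show "\<bar>measure Q C - measure R C\<bar> \<le> \<beta> k" if "C \<in> sets Q" for C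
      unfolding Q_def R_def using i that by (intro beta_pair[of i] measurable_\<epsilon>_generated) (auto simp: sets)
  qed
  moreover have "integral\<^sup>L Q h = (LINT w|M. f (\<epsilon> i w) * g (\<epsilon> (i + k) w))"
    unfolding Q_def by (simp add: integral_distr h_def)
  moreover have "integral\<^sup>L R h = (LINT w|M. f (\<epsilon> i w)) * (LINT w|M. g (\<epsilon> (i + k) w))"
  proof -
    have int: "integrable R (\<lambda>(x, y). f x * g y)" unfolding R_def
      using hF by (intro XY.P.integrable_const_bound[of _ "F\<^sup>2"]) (auto simp: h_def)
    have "integral\<^sup>L R h = integral\<^sup>L R (\<lambda>(x, y). f x * g y)" by (intro Bochner_Integration.integral_cong) (auto simp: h_def)
    also have "\<dots> = (LINT x|distr M borel (\<epsilon> i). LINT y|distr M borel (\<epsilon> (i + k)). f x * g y)"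
      unfolding R_def using XY.integral_fst[OF int[unfolded R_def]] by simp
    also have "\<dots> = (LINT w|M. f (\<epsilon> i w)) * (LINT w|M. g (\<epsilon> (i + k) w))"
      by (simp add: integral_distr)
    finally show ?thesis .
  qed
  ultimately show ?thesis by simp
qed


definition cov_const :: real where
  "cov_const = 2 * C\<beta> + 2 * \<mu>p + 2 * \<mu>p * (1 + \<mu>p)"

lemma cov_const_nonneg: "cov_const \<ge> 0"
  unfolding cov_const_def using C\<beta>_nonneg \<mu>p_nonneg by simp

text \<open>The larger number \<open>m\<close> exceeds \<open>A\<close>, so in m^2 = m^(-\<delta>)
  m^(2+\<delta>) the first factor can be replaced by A^(-\<delta>).\<close>

lemma mult_truncation_error:
  fixes a b A :: real
  assumes "a \<ge> 0" "b \<ge> 0" "A > 0" "a > A \<or> b > A"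
  shows "a * b \<le> A powr (- \<delta>) * (a powr (2 + \<delta>) + b powr (2 + \<delta>))"
proof -
  define m where "m = max a b"
  have m: "m > A" "a \<le> m" "b \<le> m" "m \<ge> 0" using assms by (auto simp: m_def)
  have "a * b \<le> m * m" using assms m by (intro mult_mono) auto
  also have "\<dots> = m powr (- \<delta>) * m powr (2 + \<delta>)" using m assms(3) by (simp add: power2_eq_square flip: powr_add)
  also have "\<dots> \<le> A powr (- \<delta>) * m powr (2 + \<delta>)"
    using m assms(3) \<delta> by (intro mult_right_mono powr_mono2') auto
  also have "m powr (2 + \<delta>) \<le> a powr (2 + \<delta>) + b powr (2 + \<delta>)" by (auto simp: m_def max_def)
  finally show ?thesis by (simp add: mult_left_mono)
qed

text \<open>Truncation at A = k^(2/\<delta>) balances two errors: the tails contribute A^(-\<delta>)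
  = k^(-2), the bounded part contributes A^2 * \<beta> k, which is also of order k^(-2) because
  \<open>mix_exp \<delta>\<close> is at least 2 + 4/\<delta>.\<close>

lemma cov_decay:
  assumes i: "i \<ge> 1" and k: "k \<ge> 1" and f: "dominated K f" and g: "dominated K g"
  shows "\<bar>(LINT w|M. f (\<epsilon> i w) * g (\<epsilon> (i + k) w)) - (LINT w|M. f (\<epsilon> i w)) * (LINT w|M. g (\<epsilon> (i + k) w))\<bar>
    \<le> cov_const * K\<^sup>2 / (real k)\<^sup>2"
proof -
  define A where "A = real k powr (2 / \<delta>)"
  have A: "A \<ge> 1" "A > 0" using k \<delta> by (auto simp: A_def ge_one_powr_ge_zero)
  \<comment> \<open>The definition of \<open>dominated\<close> leaves the sign of \<open>K\<close>
    open. Evaluating the bound at the constant function one, whose norm is positive, settles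
    it.\<close>
  have K: "K \<ge> 0"
  proof (rule ccontr)
    assume "\<not> K \<ge> 0"
    moreover have "0 \<le> K * norm (const_bcontfun 1 :: C01)"
      using dominatedD(2)[OF f, of "const_bcontfun 1"] by linarith
    moreover have "norm (const_bcontfun 1 :: C01) \<ge> 1"
      using abs_val_at_le_norm[of "const_bcontfun 1" 0] by (simp add: val_at_def)
    then have "norm (const_bcontfun 1 :: C01) > 0" by linarith
    ultimately show False by (metis mult_neg_pos not_le)
  qed
  define tr where "tr h x = (if norm x \<le> A then h x else 0)" for h :: "C01 \<Rightarrow> real" and x
  have tr_meas: "tr h \<in> borel_measurable borel" if [measurable]: "h \<in> borel_measurable borel" for h
    unfolding tr_def by measurable
  have tr_le: "\<bar>tr h x\<bar> \<le> K * A" "\<bar>tr h x\<bar> \<le> K * norm x" if "dominated K h" for h x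
    using dominatedD(2)[OF that, of x] K A mult_left_mono[of "norm x" A K] by (auto simp: tr_def)
  have tr_dom: "dominated K (tr h)" if "dominated K h" for h
    using tr_meas[OF dominatedD(1)[OF that]] tr_le[OF that] by (simp add: dominated_def)
  let ?j = "i + k"
  have j: "?j \<ge> 1" using i by simp
  define a where "a w = norm (\<epsilon> i w)" for w
  define b where "b w = norm (\<epsilon> ?j w)" for w
  have ab_int: "integrable M (\<lambda>w. a w powr (2 + \<delta>))" "integrable M (\<lambda>w. b w powr (2 + \<delta>))"
    unfolding a_def b_def using moment i j by auto
  have ab_E: "(LINT w|M. a w powr (2 + \<delta>)) = \<mu>p" "(LINT w|M. b w powr (2 + \<delta>)) = \<mu>p"
    unfolding a_def b_def using moment_eq i j by auto
  have int: "integrable M (\<lambda>w. f (\<epsilon> i w) * g (\<epsilon> ?j w))" "integrable M (\<lambda>w. tr f (\<epsilon> i w) * tr g (\<epsilon> ?j w))"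
    using dominated_integrable_mult[OF i j] f g tr_dom by auto
  define t where "t = A powr (- \<delta>)"
  have t: "t = 1 / (real k)\<^sup>2"
    unfolding t_def A_def using \<delta> k by (simp add: powr_powr powr_minus_divide)
  have t0: "t \<ge> 0" by (simp add: t_def)
  have 1: "\<bar>(LINT w|M. f (\<epsilon> i w) * g (\<epsilon> ?j w)) - (LINT w|M. tr f (\<epsilon> i w) * tr g (\<epsilon> ?j w))\<bar> \<le> K\<^sup>2 * t * (2 * \<mu>p)"
  proof -
    have "\<bar>(LINT w|M. f (\<epsilon> i w) * g (\<epsilon> ?j w)) - (LINT w|M. tr f (\<epsilon> i w) * tr g (\<epsilon> ?j w))\<bar>
      = \<bar>LINT w|M. f (\<epsilon> i w) * g (\<epsilon> ?j w) - tr f (\<epsilon> i w) * tr g (\<epsilon> ?j w)\<bar>"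
      using int by simp
    also have "\<dots> \<le> (LINT w|M. K\<^sup>2 * t * (a w powr (2 + \<delta>) + b w powr (2 + \<delta>)))"
    proof (intro order_trans[OF integral_abs_bound] integral_mono)
      fix w
      show "\<bar>f (\<epsilon> i w) * g (\<epsilon> ?j w) - tr f (\<epsilon> i w) * tr g (\<epsilon> ?j w)\<bar> \<le> K\<^sup>2 * t * (a w powr (2 + \<delta>) + b w powr (2 + \<delta>))"
      proof (cases "a w \<le> A \<and> b w \<le> A")
        case True
        then show ?thesis using t0 by (simp add: tr_def a_def b_def)
      next
        case False
        then have "\<bar>f (\<epsilon> i w) * g (\<epsilon> ?j w) - tr f (\<epsilon> i w) * tr g (\<epsilon> ?j w)\<bar> = \<bar>f (\<epsilon> i w)\<bar> * \<bar>g (\<epsilon> ?j w)\<bar>"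
          by (auto simp: tr_def a_def b_def abs_mult)
        also have "\<dots> \<le> (K * a w) * (K * b w)"
          unfolding a_def b_def using dominatedD(2)[OF f] dominatedD(2)[OF g]
          by (intro mult_mono) (auto intro: order_trans[OF abs_ge_zero])
        also have "\<dots> = K\<^sup>2 * (a w * b w)" by (simp add: power2_eq_square)
        also have "\<dots> \<le> K\<^sup>2 * (t * (a w powr (2 + \<delta>) + b w powr (2 + \<delta>)))"
          unfolding t_def using False A
          by (intro mult_left_mono mult_truncation_error) (auto simp: a_def b_def)
        finally show ?thesis by (simp add: mult.assoc)
      qed
    qed (use int ab_int in auto)
    also have "\<dots> = K\<^sup>2 * t * (2 * \<mu>p)" using ab_int ab_E by simp
    finally show ?thesis .
  qed
  have 2: "\<bar>(LINT w|M. h (\<epsilon> l w)) - (LINT w|M. tr h (\<epsilon> l w))\<bar> \<le> K * t * \<mu>p"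
    if l: "l \<ge> 1" and h: "dominated K h" for h l
  proof -
    have int: "integrable M (\<lambda>w. h (\<epsilon> l w))" "integrable M (\<lambda>w. tr h (\<epsilon> l w))"
      using dominated_integrable[OF l] h tr_dom by auto
    have "\<bar>(LINT w|M. h (\<epsilon> l w)) - (LINT w|M. tr h (\<epsilon> l w))\<bar> = \<bar>LINT w|M. h (\<epsilon> l w) - tr h (\<epsilon> l w)\<bar>"
      using int by simp
    also have "\<dots> \<le> (LINT w|M. K * t * (norm (\<epsilon> l w) powr (2 + \<delta>)))"
    proof (intro order_trans[OF integral_abs_bound] integral_mono)
      fix w
      show "\<bar>h (\<epsilon> l w) - tr h (\<epsilon> l w)\<bar> \<le> K * t * (norm (\<epsilon> l w) powr (2 + \<delta>))"
      proof (cases "norm (\<epsilon> l w) \<le> A")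
        case True
        then show ?thesis using t0 K by (simp add: tr_def)
      next
        case False
        define y where "y = norm (\<epsilon> l w)"
        have y: "y > A" using False by (simp add: y_def)
        have "y = y powr (- \<delta>) * y powr (1 + \<delta>)" using y A by (simp flip: powr_add)
        also have "\<dots> \<le> A powr (- \<delta>) * y powr (2 + \<delta>)"
          using y A \<delta> by (intro mult_mono powr_mono2' powr_mono) auto
        finally have "y \<le> t * y powr (2 + \<delta>)" by (simp add: t_def)
        then have "K * y \<le> K * t * y powr (2 + \<delta>)" using K by (simp add: mult_left_mono mult.assoc)
        then show ?thesis using False dominatedD(2)[OF h, of "\<epsilon> l w"] by (simp add: tr_def y_def)
      qed
    qed (use int moment l in auto)
    also have "\<dots> = K * t * \<mu>p" using l by (simp add: moment moment_eq)
    finally show ?thesis .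
  qed
  have 3: "\<bar>LINT w|M. h (\<epsilon> l w)\<bar> \<le> K * (1 + \<mu>p)" if l: "l \<ge> 1" and h: "dominated K h" for h l
  proof -
    have "\<bar>LINT w|M. h (\<epsilon> l w)\<bar> \<le> (LINT w|M. K * norm (\<epsilon> l w))"
      using dominatedD(2)[OF h] dominated_integrable[OF l h] integrable_norm[OF l]
      by (intro order_trans[OF integral_abs_bound] integral_mono) auto
    also have "\<dots> \<le> K * (1 + \<mu>p)" using expectation_norm_le[OF l] K by (simp add: mult_left_mono)
    finally show ?thesis .
  qed
  have 4: "\<bar>(LINT w|M. tr f (\<epsilon> i w) * tr g (\<epsilon> ?j w)) - (LINT w|M. tr f (\<epsilon> i w)) * (LINT w|M. tr g (\<epsilon> ?j w))\<bar>
     \<le> 2 * C\<beta> * K\<^sup>2 * t"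
  proof -
    have "A\<^sup>2 * \<beta> k \<le> A\<^sup>2 * (C\<beta> * real k powr (- mix_exp \<delta>))"
      using beta_bound[OF k] by (intro mult_left_mono) auto
    also have "\<dots> = C\<beta> * (real k powr (4 / \<delta>) * real k powr (- mix_exp \<delta>))"
      using k by (simp add: A_def powr_power)
    also have "\<dots> = C\<beta> * real k powr (4 / \<delta> - mix_exp \<delta>)" by (simp flip: powr_add)
    also have "\<dots> \<le> C\<beta> * real k powr (-2)"
    proof (intro mult_left_mono powr_mono)
      have "mix_exp \<delta> = 2 + 6 / \<delta> + 4 / \<delta>\<^sup>2" using \<delta> by (simp add: mix_exp_def field_simps power2_eq_square)
      moreover have "4 / \<delta> \<le> 6 / \<delta>" "0 \<le> 4 / \<delta>\<^sup>2" using \<delta> by (simp_all add: divide_right_mono)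
      ultimately show "4 / \<delta> - mix_exp \<delta> \<le> - 2" by linarith
    qed (use k C\<beta>_nonneg in auto)
    also have "real k powr (-2) = t" using k by (simp add: t powr_minus_divide)
    finally have "A\<^sup>2 * \<beta> k \<le> C\<beta> * t" .
    then have "2 * (K * A)\<^sup>2 * \<beta> k \<le> 2 * C\<beta> * K\<^sup>2 * t"
      using mult_left_mono[of "A\<^sup>2 * \<beta> k" "C\<beta> * t" "2 * K\<^sup>2"] by (simp add: power_mult_distrib mult_ac)
    then show ?thesis
      using cov_bounded[OF i tr_meas tr_meas tr_le(1) tr_le(1), of f g k] f g dominatedD(1) by (meson order_trans)
  qed
  define x where "x = (LINT w|M. f (\<epsilon> i w))"
  define x' where "x' = (LINT w|M. tr f (\<epsilon> i w))"
  define y where "y = (LINT w|M. g (\<epsilon> ?j w))"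
  define y' where "y' = (LINT w|M. tr g (\<epsilon> ?j w))"
  have "\<bar>x * y - x' * y'\<bar> = \<bar>(x - x') * y + x' * (y - y')\<bar>" by (simp add: algebra_simps)
  also have "\<dots> \<le> \<bar>x - x'\<bar> * \<bar>y\<bar> + \<bar>x'\<bar> * \<bar>y - y'\<bar>" by (metis abs_mult abs_triangle_ineq)
  also have "\<dots> \<le> (K * t * \<mu>p) * (K * (1 + \<mu>p)) + (K * (1 + \<mu>p)) * (K * t * \<mu>p)"
    unfolding x_def x'_def y_def y'_def using K t0 \<mu>p_nonneg
    by (intro add_mono mult_mono 2 3 i j f g tr_dom mult_nonneg_nonneg) auto
  finally have "\<bar>x * y - x' * y'\<bar> \<le> 2 * \<mu>p * (1 + \<mu>p) * K\<^sup>2 * t" by (simp add: power2_eq_square algebra_simps)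
  then have "\<bar>(LINT w|M. f (\<epsilon> i w) * g (\<epsilon> ?j w)) - x * y\<bar> \<le> 2 * C\<beta> * K\<^sup>2 * t + K\<^sup>2 * t * (2 * \<mu>p) + 2 * \<mu>p * (1 + \<mu>p) * K\<^sup>2 * t"
    using 1 4 unfolding x'_def y'_def by linarith
  also have "\<dots> = cov_const * K\<^sup>2 / (real k)\<^sup>2" by (simp add: cov_const_def t algebra_simps add_divide_distrib)
  finally show ?thesis by (simp add: x_def y_def)
qed

end

section \<open>Variances of weighted sums\<close>

text \<open>A weighted geometric mean is at least the minimum. With weight 3/4 a covariance bound of
  order k^(-2) becomes k^(-3/2), still summable, and the factor v^(1/4) remembers the size of the
  second moment.\<close>

lemma min_le_powr_interpolation:
  fixes v q :: real
  assumes "v \<ge> 0" "q \<ge> 0"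
  shows "min v q \<le> v powr (1/4) * q powr (3/4)"
proof (cases "v \<le> q")
  case True
  have "v = v powr (1/4) * v powr (3/4)" using assms by (cases "v = 0") (simp_all flip: powr_add)
  also have "\<dots> \<le> v powr (1/4) * q powr (3/4)" using True assms by (intro mult_left_mono powr_mono2) auto
  finally show ?thesis using True by simp
next
  case False
  have "q = q powr (1/4) * q powr (3/4)" using assms by (cases "q = 0") (simp_all flip: powr_add)
  also have "\<dots> \<le> v powr (1/4) * q powr (3/4)" using False assms by (intro mult_right_mono powr_mono2) auto
  finally show ?thesis using False by simp
qed

text \<open>The absolute difference: truncated subtraction makes one of the summands zero.\<close>

definition lag :: "nat \<Rightarrow> nat \<Rightarrow> nat" where
  "lag i j = (i - j) + (j - i)"

text \<open>Around a fixed \<open>i\<close> each lag is attained by at most one index on either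
  side, hence the factor two.\<close>

lemma sum_lag_le:
  fixes u :: "nat \<Rightarrow> real"
  assumes "finite I" "summable u" "\<And>k. u k \<ge> 0"
  shows "(\<Sum>j\<in>I. u (lag i j)) \<le> 2 * suminf u"
proof -
  have "(\<Sum>j\<in>I. u (lag i j)) = (\<Sum>j\<in>I \<inter> {i..}. u (j - i)) + (\<Sum>j\<in>I \<inter> - {i..}. u (i - j))"
    using assms(1) by (subst sum.Int_Diff[of _ _ "{i..}"]) (auto simp: Diff_eq lag_def intro!: sum.cong arg_cong2[where f="(+)"])
  also have "(\<Sum>j\<in>I \<inter> {i..}. u (j - i)) = sum u ((\<lambda>j. j - i) ` (I \<inter> {i..}))"
    by (subst sum.reindex) (auto simp: inj_on_def)
  also have "\<dots> \<le> suminf u" using assms by (intro sum_le_suminf) auto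
  also have "(\<Sum>j\<in>I \<inter> - {i..}. u (i - j)) = sum u ((\<lambda>j. i - j) ` (I \<inter> - {i..}))"
    by (subst sum.reindex) (auto simp: inj_on_def)
  also have "\<dots> \<le> suminf u" using assms by (intro sum_le_suminf) auto
  finally show ?thesis by simp
qed

context mixing_sequence
begin

definition centred :: "(C01 \<Rightarrow> real) \<Rightarrow> nat \<Rightarrow> 'w \<Rightarrow> real" where
  "centred f i w = f (\<epsilon> i w) - (LINT w|M. f (\<epsilon> 1 w))"

abbreviation csum :: "(nat \<Rightarrow> real) \<Rightarrow> (C01 \<Rightarrow> real) \<Rightarrow> nat set \<Rightarrow> 'w \<Rightarrow> real" where
  "csum a f I w \<equiv> \<Sum>i\<in>I. a i * centred f i w"

abbreviation ccov :: "(C01 \<Rightarrow> real) \<Rightarrow> nat \<Rightarrow> (C01 \<Rightarrow> real) \<Rightarrow> nat \<Rightarrow> real" where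
  "ccov f i g j \<equiv> LINT w|M. centred f i w * centred g j w"

lemma integrable_dominated_sq: "i \<ge> 1 \<Longrightarrow> dominated K f \<Longrightarrow> integrable M (\<lambda>w. (f (\<epsilon> i w))\<^sup>2)"
  using dominated_integrable_mult[of i i K f f] by (simp add: power2_eq_square)

lemma integrable_centred_mult:
  assumes "i \<ge> 1" "j \<ge> 1" "dominated K f" "dominated K g"
  shows "integrable M (\<lambda>w. centred f i w * centred g j w)"
  unfolding centred_def left_diff_distrib right_diff_distrib
  using assms by (intro Bochner_Integration.integrable_diff dominated_integrable_mult integrable_mult_left integrable_mult_right
      dominated_integrable integrable_const)

lemma expectation_dominated:
  "i \<ge> 1 \<Longrightarrow> dominated K f \<Longrightarrow> (LINT w|M. f (\<epsilon> i w)) = (LINT w|M. f (\<epsilon> 1 w))"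
  by (rule integral_\<epsilon>) (auto dest: dominatedD)

lemma expectation_centred_mult:
  assumes "i \<ge> 1" "j \<ge> 1" "dominated K f" "dominated K g"
  shows "ccov f i g j =
    (LINT w|M. f (\<epsilon> i w) * g (\<epsilon> j w)) - (LINT w|M. f (\<epsilon> i w)) * (LINT w|M. g (\<epsilon> j w))"
proof -
  note i = dominated_integrable_mult[OF assms] dominated_integrable[OF assms(1,3)] dominated_integrable[OF assms(2,4)]
  define a where "a = (LINT w|M. f (\<epsilon> 1 w))"
  define b where "b = (LINT w|M. g (\<epsilon> 1 w))"
  have e: "(LINT w|M. f (\<epsilon> i w)) = a" "(LINT w|M. g (\<epsilon> j w)) = b"
    unfolding a_def b_def using assms expectation_dominated by blast+
  have "(\<lambda>w. centred f i w * centred g j w) = (\<lambda>w. f (\<epsilon> i w) * g (\<epsilon> j w) - b * f (\<epsilon> i w) - a * g (\<epsilon> j w) + a * b)"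
    by (auto simp: centred_def a_def b_def algebra_simps)
  then show ?thesis using i by (simp add: e prob_space)
qed

lemma centred_cov_decay:
  assumes "i \<ge> 1" "j \<ge> 1" "i \<noteq> j" "dominated K f" "dominated K g"
  shows "\<bar>LINT w|M. centred f i w * centred g j w\<bar> \<le> cov_const * K\<^sup>2 / (real (lag i j))\<^sup>2"
proof -
  have *: "\<bar>LINT w|M. centred f i w * centred g j w\<bar> \<le> cov_const * K\<^sup>2 / (real (lag i j))\<^sup>2"
    if "1 \<le> i" "i < j" "dominated K f" "dominated K g" for i j f g
  proof -
    have "j = i + lag i j" "lag i j \<ge> 1" using that by (auto simp: lag_def)
    then show ?thesis
      using cov_decay[of i "lag i j" K f g] expectation_centred_mult[of i j K f g] that by simp
  qed
  show ?thesis
  proof (cases "i < j")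
    case True then show ?thesis using * assms by blast
  next
    case False
    then have "\<bar>LINT w|M. centred g j w * centred f i w\<bar> \<le> cov_const * K\<^sup>2 / (real (lag j i))\<^sup>2"
      using *[of j i g f] assms by simp
    then show ?thesis by (simp add: mult.commute lag_def add.commute)
  qed
qed

lemma expectation_centred_sq_le:
  assumes "i \<ge> 1" "dominated K f"
  shows "sq_mean (centred f i) \<le> (LINT w|M. (f (\<epsilon> 1 w))\<^sup>2)"
proof -
  have "(LINT w|M. (f (\<epsilon> i w))\<^sup>2) = (LINT w|M. (f (\<epsilon> 1 w))\<^sup>2)"
    using dominatedD(1)[OF assms(2)] by (intro integral_\<epsilon> assms(1)) measurable
  then show ?thesis
    using expectation_centred_mult[OF assms(1,1,2,2)] by (simp add: power2_eq_square)
qed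

text \<open>The factor two and the series of k^(-3/2) stem from \<open>sum_lag_le\<close>; the two
  powers 3/4 stem from the diagonal and from the off-diagonal covariances in
  \<open>centred_cov_le\<close>.\<close>

definition var_const :: "real \<Rightarrow> real" where
  "var_const K = 2 * (((K\<^sup>2 * (1 + \<mu>p)) powr (3/4) + (cov_const * K\<^sup>2) powr (3/4)) *
     suminf (\<lambda>k. if k = 0 then 1 else real k powr (- (3/2))))"

lemma summable_u: "summable (\<lambda>k. if k = 0 then 1 else real k powr (- (3/2)))"
  by (rule summable_cong[THEN iffD1, OF _ summable_real_powr_iff[THEN iffD2, of "-3/2"]])
     (auto simp: eventually_at_top_dense intro: exI[of _ 0])

lemma var_const_nonneg: "var_const K \<ge> 0"
  unfolding var_const_def using summable_u
  by (intro mult_nonneg_nonneg add_nonneg_nonneg suminf_nonneg) auto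

lemma expectation_dominated_sq_le:
  assumes "dominated K f"
  shows "(LINT w|M. (f (\<epsilon> 1 w))\<^sup>2) \<le> K\<^sup>2 * (1 + \<mu>p)"
proof -
  have "(LINT w|M. (f (\<epsilon> 1 w))\<^sup>2) \<le> (LINT w|M. K\<^sup>2 * (norm (\<epsilon> 1 w))\<^sup>2)"
  proof (intro integral_mono integrable_dominated_sq[OF _ assms] integrable_mult_right integrable_norm_sq)
    fix w show "(f (\<epsilon> 1 w))\<^sup>2 \<le> K\<^sup>2 * (norm (\<epsilon> 1 w))\<^sup>2"
      using power_mono[OF dominatedD(2)[OF assms, of "\<epsilon> 1 w"], of 2] by (simp add: power_mult_distrib)
  qed auto
  also have "\<dots> \<le> K\<^sup>2 * (1 + \<mu>p)" using expectation_norm_sq_le[of 1] by (simp add: mult_left_mono)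
  finally show ?thesis .
qed

lemma centred_cov_le:
  assumes ij: "i \<ge> 1" "j \<ge> 1" and f: "dominated K f"
  defines "v \<equiv> (LINT w|M. (f (\<epsilon> 1 w))\<^sup>2)"
  shows "\<bar>LINT w|M. centred f i w * centred f j w\<bar> \<le>
    v powr (1/4) * (((K\<^sup>2 * (1 + \<mu>p)) powr (3/4) + (cov_const * K\<^sup>2) powr (3/4)) * (if lag i j = 0 then 1 else real (lag i j) powr (- (3/2))))"
proof -
  have v0: "v \<ge> 0" by (simp add: v_def)
  have le_v: "\<bar>LINT w|M. centred f i w * centred f j w\<bar> \<le> v"
  proof -
    have sq: "integrable M (\<lambda>w. (centred f l w)\<^sup>2)" if "l \<ge> 1" for l
      using integrable_centred_mult[OF that that f f] by (simp add: power2_eq_square)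
    have "\<bar>LINT w|M. centred f i w * centred f j w\<bar> \<le> (LINT w|M. ((centred f i w)\<^sup>2 + (centred f j w)\<^sup>2) / 2)"
    proof (intro order_trans[OF integral_abs_bound] integral_mono)
      fix w
      show "\<bar>centred f i w * centred f j w\<bar> \<le> ((centred f i w)\<^sup>2 + (centred f j w)\<^sup>2) / 2"
        using sum_squares_bound[of "\<bar>centred f i w\<bar>" "\<bar>centred f j w\<bar>"] by (simp add: abs_mult)
    qed (use integrable_centred_mult[OF ij f f] sq ij in auto)
    also have "\<dots> \<le> v" using sq ij expectation_centred_sq_le[OF ij(1) f] expectation_centred_sq_le[OF ij(2) f] by (simp add: v_def)
    finally show ?thesis .
  qed
  show ?thesis
  proof (cases "i = j")
    case True
    have "v = v powr (1/4) * v powr (3/4)" using v0 by (cases "v = 0") (simp_all flip: powr_add)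
    also have "\<dots> \<le> v powr (1/4) * ((K\<^sup>2 * (1 + \<mu>p)) powr (3/4) + (cov_const * K\<^sup>2) powr (3/4))"
      using v0 expectation_dominated_sq_le[OF f]
      by (intro mult_left_mono add_increasing2 powr_mono2) (auto simp: v_def)
    finally show ?thesis using le_v True by (simp add: lag_def)
  next
    case False
    define k where "k = lag i j"
    have k: "k > 0" using False by (auto simp: k_def lag_def)
    have "\<bar>LINT w|M. centred f i w * centred f j w\<bar> \<le> min v (cov_const * K\<^sup>2 / (real k)\<^sup>2)"
      using le_v centred_cov_decay[OF ij False f f] by (simp add: k_def)
    also have "\<dots> \<le> v powr (1/4) * (cov_const * K\<^sup>2 / (real k)\<^sup>2) powr (3/4)"
      using v0 cov_const_nonneg by (intro min_le_powr_interpolation) auto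
    also have "(cov_const * K\<^sup>2 / (real k)\<^sup>2) powr (3/4) = (cov_const * K\<^sup>2) powr (3/4) * real k powr (- (3/2))"
      using k cov_const_nonneg by (simp add: powr_divide powr_powr powr_minus_divide flip: powr_numeral)
    also have "\<dots> \<le> ((K\<^sup>2 * (1 + \<mu>p)) powr (3/4) + (cov_const * K\<^sup>2) powr (3/4)) * real k powr (- (3/2))"
      by (intro mult_right_mono) auto
    finally show ?thesis using k by (simp add: k_def mult_left_mono)
  qed
qed

text \<open>Expanding the square leaves covariances with bounded weights, and
  \<open>centred_cov_le\<close> makes them summable in the lag. The surviving power 1/4 of the
  second moment of \<open>f\<close> is what later makes normalised sums of increments over short
  intervals small.\<close>

lemma variance_sum_le:
  assumes I: "finite I" "I \<subseteq> {1..}" and a: "\<And>i. i \<in> I \<Longrightarrow> \<bar>a i\<bar> \<le> 1" and f: "dominated K f"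
  shows "sq_mean (csum a f I) \<le>
     var_const K * real (card I) * (LINT w|M. (f (\<epsilon> 1 w))\<^sup>2) powr (1/4)"
proof -
  define v where "v = (LINT w|M. (f (\<epsilon> 1 w))\<^sup>2)"
  define D where "D = (K\<^sup>2 * (1 + \<mu>p)) powr (3/4) + (cov_const * K\<^sup>2) powr (3/4)"
  define u where "u k = (if k = 0 then 1 else real k powr (- (3/2)))" for k :: nat
  have D0: "D \<ge> 0" by (simp add: D_def)
  have int: "integrable M (\<lambda>w. centred f i w * centred f j w)" if "i \<in> I" "j \<in> I" for i j
  proof -
    have "i \<ge> 1" "j \<ge> 1" using that I(2) by auto
    then show ?thesis by (rule integrable_centred_mult[OF _ _ f f])
  qed
  have "sq_mean (csum a f I) =
      (LINT w|M. (\<Sum>i\<in>I. \<Sum>j\<in>I. (a i * a j) * (centred f i w * centred f j w)))"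
    by (simp add: power2_eq_square sum_product mult_ac)
  also have "\<dots> = (\<Sum>i\<in>I. \<Sum>j\<in>I. (a i * a j) * ccov f i f j)"
    using int by (simp add: Bochner_Integration.integral_sum Bochner_Integration.integrable_sum)
  also have "\<dots> \<le> (\<Sum>i\<in>I. \<Sum>j\<in>I. v powr (1/4) * (D * u (lag i j)))"
  proof (intro sum_mono)
    fix i j assume ij: "i \<in> I" "j \<in> I"
    have "(a i * a j) * ccov f i f j \<le>
        \<bar>a i * a j\<bar> * \<bar>LINT w|M. centred f i w * centred f j w\<bar>"
      by (metis abs_ge_self abs_mult)
    also have "\<dots> \<le> 1 * \<bar>LINT w|M. centred f i w * centred f j w\<bar>"
      using mult_le_one[OF a[OF ij(1)] abs_ge_zero a[OF ij(2)]] by (intro mult_right_mono) (simp_all add: abs_mult)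
    also have "\<dots> \<le> v powr (1/4) * (D * u (lag i j))"
      unfolding mult_1 v_def D_def u_def using ij I(2) by (intro centred_cov_le f) auto
    finally show "(a i * a j) * ccov f i f j \<le> v powr (1/4) * (D * u (lag i j))" .
  qed
  also have "\<dots> = v powr (1/4) * D * (\<Sum>i\<in>I. \<Sum>j\<in>I. u (lag i j))" by (simp only: sum_distrib_left mult.assoc)
  also have "\<dots> \<le> v powr (1/4) * D * (\<Sum>i\<in>I. 2 * suminf u)"
    using summable_u I(1) D0 unfolding u_def by (intro mult_left_mono sum_mono sum_lag_le) auto
  also have "\<dots> = var_const K * real (card I) * v powr (1/4)"
    by (simp add: var_const_def D_def u_def[abs_def])
  finally show ?thesis by (simp add: v_def)
qed

end

section \<open>Laws of large numbers in C([0,1])\<close>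

text \<open>Comparison with the telescoping sum of 2/k - 2/(k+1) = 2/(k (k+1)), whose terms are at
  least 1/k^2.\<close>

lemma sum_inverse_squares_le:
  assumes "K \<ge> 1"
  shows "(\<Sum>k=K..n. 1 / (real k)\<^sup>2) \<le> 2 / real K"
proof -
  have tele: "(\<Sum>k=K..n. 2 / real k - 2 / real (Suc k)) \<le> 2 / real K"
  proof (cases "n \<ge> K")
    case True
    then have "(\<Sum>k=K..n. 2 / real k - 2 / real (Suc k)) = 2 / real K - 2 / real (Suc n)"
      by (induction n rule: dec_induct) simp_all
    then show ?thesis by simp
  qed simp
  have "1 / (real k)\<^sup>2 \<le> 2 / real k - 2 / real (Suc k)" if "k \<ge> K" for k
  proof -
    have k: "real k \<ge> 1" using that assms by simp
    have "2 / real k - 2 / real (Suc k) = 2 / (real k * (real k + 1))" using k by (simp add: field_simps)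
    also have "\<dots> \<ge> 2 / (real k * (2 * real k))" using k by (intro divide_left_mono mult_left_mono mult_pos_pos) auto
    finally show ?thesis using k by (simp add: power2_eq_square)
  qed
  then have "(\<Sum>k=K..n. 1 / (real k)\<^sup>2) \<le> (\<Sum>k=K..n. 2 / real k - 2 / real (Suc k))" by (intro sum_mono) simp
  then show ?thesis using tele by linarith
qed

context mixing_sequence
begin

definition cheb_const :: "real \<Rightarrow> real" where
  "cheb_const K = var_const K * (K\<^sup>2 * (1 + \<mu>p)) powr (1/4)"

lemma cheb_const_nonneg: "cheb_const K \<ge> 0"
  unfolding cheb_const_def using var_const_nonneg by simp

lemma variance_sum_le':
  assumes I: "finite I" "I \<subseteq> {1..}" and a: "\<And>i. i \<in> I \<Longrightarrow> \<bar>a i\<bar> \<le> 1" and f: "dominated K f"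
  shows "sq_mean (csum a f I) \<le> cheb_const K * real (card I)"
proof -
  have "(LINT w|M. (f (\<epsilon> 1 w))\<^sup>2) powr (1/4) \<le> (K\<^sup>2 * (1 + \<mu>p)) powr (1/4)"
    using expectation_dominated_sq_le[OF f] by (intro powr_mono2) auto
  then have "var_const K * real (card I) * (LINT w|M. (f (\<epsilon> 1 w))\<^sup>2) powr (1/4) \<le>
      var_const K * real (card I) * (K\<^sup>2 * (1 + \<mu>p)) powr (1/4)"
    using var_const_nonneg by (intro mult_left_mono) auto
  moreover have "sq_mean (csum a f I) \<le>
     var_const K * real (card I) * (LINT w|M. (f (\<epsilon> 1 w))\<^sup>2) powr (1/4)"
    by (rule variance_sum_le[OF I _ f]) (rule a)
  ultimately show ?thesis by (simp add: cheb_const_def mult_ac)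
qed

lemma centred_measurable:
  "i \<ge> 1 \<Longrightarrow> dominated K f \<Longrightarrow> centred f i \<in> borel_measurable M"
  unfolding centred_def using dominatedD(1) by measurable

lemma integrable_sum_centred_sq:
  assumes I: "finite I" "I \<subseteq> {1..}" and f: "dominated K f"
  shows "integrable M (\<lambda>w. (csum a f I w)\<^sup>2)"
proof -
  have int: "integrable M (\<lambda>w. centred f i w * centred f j w)" if "i \<in> I" "j \<in> I" for i j
  proof -
    have "i \<ge> 1" "j \<ge> 1" using that I(2) by auto
    then show ?thesis by (rule integrable_centred_mult[OF _ _ f f])
  qed
  have "(\<lambda>w. (csum a f I w)\<^sup>2) = (\<lambda>w. \<Sum>i\<in>I. \<Sum>j\<in>I. (a i * a j) * (centred f i w * centred f j w))"
    by (simp add: power2_eq_square sum_product mult_ac)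
  then show ?thesis using int by (simp add: Bochner_Integration.integrable_sum)
qed

lemma sum_centred_measurable:
  assumes I: "finite I" "I \<subseteq> {1..}" and f: "dominated K f"
  shows "(\<lambda>w. \<Sum>i\<in>I. a i * centred f i w) \<in> borel_measurable M"
proof (intro borel_measurable_sum borel_measurable_times borel_measurable_const)
  fix i assume "i \<in> I"
  then show "centred f i \<in> borel_measurable M" using I(2) by (intro centred_measurable[OF _ f]) auto
qed

lemma markov_sq:
  fixes X :: "'w \<Rightarrow> real"
  assumes [measurable]: "X \<in> borel_measurable M" and "integrable M (\<lambda>w. (X w)\<^sup>2)" "t > 0"
  shows "prob {w \<in> space M. \<bar>X w\<bar> \<ge> t} \<le> sq_mean X / t\<^sup>2"
proof -
  have "prob {w \<in> space M. \<bar>X w\<bar> \<ge> t} = prob {w \<in> space M. (X w)\<^sup>2 \<ge> t\<^sup>2}"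
    using assms(3) abs_le_square_iff[of t] by (intro arg_cong[where f=prob]) auto
  also have "\<dots> \<le> sq_mean X / t\<^sup>2"
    using assms by (intro integral_Markov_inequality_measure[of _ _ "{}"]) auto
  finally show ?thesis .
qed

lemma chebyshev_centred:
  assumes I: "finite I" "I \<subseteq> {1..}" and a: "\<And>i. i \<in> I \<Longrightarrow> \<bar>a i\<bar> \<le> 1" and f: "dominated K f" and "t > 0"
  shows "prob {w \<in> space M. \<bar>csum a f I w\<bar> \<ge> t} \<le> cheb_const K * real (card I) / t\<^sup>2"
  using markov_sq[OF sum_centred_measurable[OF I f] integrable_sum_centred_sq[OF I f] \<open>t > 0\<close>, of a]
    variance_sum_le'[of I a K f, OF I a f] \<open>t > 0\<close> by (meson divide_right_mono order_trans zero_le_power2)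

lemma dominated_disc: "dominated 2 (\<lambda>x. norm (x - disc N x))"
  unfolding dominated_def using norm_diff_disc_le by simp

lemma dominated_val_at: "dominated 1 (\<lambda>x. val_at x t)"
  unfolding dominated_def using abs_val_at_le_norm by simp

lemma expectation_disc_tendsto: "(\<lambda>N. (LINT w|M. norm (\<epsilon> 1 w - disc N (\<epsilon> 1 w)))) \<longlonglongrightarrow> 0"
proof -
  have [measurable]: "\<epsilon> 1 \<in> borel_measurable M" by (rule rv) simp
  have "(\<lambda>N. (LINT w|M. norm (\<epsilon> 1 w - disc N (\<epsilon> 1 w)))) \<longlonglongrightarrow> (LINT w|M. 0)"
  proof (rule integral_dominated_convergence[where w="\<lambda>w. 2 * norm (\<epsilon> 1 w)"])
    show "AE w in M. (\<lambda>N. norm (\<epsilon> 1 w - disc N (\<epsilon> 1 w))) \<longlonglongrightarrow> 0"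
    proof (rule AE_I2)
      fix w
      have "(\<lambda>N. norm (\<epsilon> 1 w - disc N (\<epsilon> 1 w))) \<longlonglongrightarrow> norm (\<epsilon> 1 w - \<epsilon> 1 w)"
        by (intro tendsto_intros disc_tendsto)
      then show "(\<lambda>N. norm (\<epsilon> 1 w - disc N (\<epsilon> 1 w))) \<longlonglongrightarrow> 0" by simp
    qed
  qed (use norm_diff_disc_le integrable_norm[of 1] in auto)
  then show ?thesis by simp
qed

end

locale centred_mixing_sequence = mixing_sequence +
  assumes mean_zero: "i \<ge> 1 \<Longrightarrow> t \<in> {0..1} \<Longrightarrow> (LINT w|M. val_at (\<epsilon> i w) t) = 0"
begin

lemma centred_val_at: "t \<in> {0..1} \<Longrightarrow> centred (\<lambda>x. val_at x t) i w = val_at (\<epsilon> i w) t"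
  using mean_zero[of 1 t] by (simp add: centred_def)

lemma measurable_sum_\<epsilon>: "I \<subseteq> {1..} \<Longrightarrow> (\<lambda>w. \<Sum>i\<in>I. \<epsilon> i w) \<in> borel_measurable M"
  by (intro borel_measurable_sum rv) auto

text \<open>For \<open>N\<close> large the mean interpolation error of one summand is below c/4. The
  interpolated sum is controlled at finitely many grid points, and the interpolation error of the
  sum by the centred sum of \<open>h\<close> plus its mean. Each of the three contributions is at
  most a quarter of \<open>c * real m\<close>, and Chebyshev's inequality is applied to real-valued
  sums only.\<close>

lemma norm_sum_tail:
  assumes "c > 0"
  shows "\<exists>C\<ge>0. \<forall>I m. finite I \<and> I \<subseteq> {1..} \<and> card I \<le> m \<and> m \<ge> 1 \<longrightarrow>
    prob {w \<in> space M. norm (\<Sum>i\<in>I. \<epsilon> i w) > c * real m} \<le> C / real m"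
proof -
  obtain N where N: "(LINT w|M. norm (\<epsilon> 1 w - disc N (\<epsilon> 1 w))) < c / 4"
    using order_tendstoD(2)[OF expectation_disc_tendsto, of "c/4"] assms by (auto simp: eventually_sequentially)
  define h where "h x = norm (x - disc N x)" for x
  \<comment> \<open>The number of grid points: each gets the share \<open>c / (4 * d)\<close>, so
    the interpolated sum has norm at most a quarter of \<open>c * real m\<close>.\<close>
  define d where "d = real (2 ^ N + 1)"
  have d: "d > 0" unfolding d_def by linarith
  define C where "C = d * (cheb_const 1 / (c / (4 * d))\<^sup>2) + cheb_const 2 / (c / 4)\<^sup>2"
  have "C \<ge> 0" unfolding C_def using d cheb_const_nonneg by simp
  moreover have "prob {w \<in> space M. norm (\<Sum>i\<in>I. \<epsilon> i w) > c * real m} \<le> C / real m"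
    if I: "finite I" "I \<subseteq> {1..}" "card I \<le> m" "m \<ge> 1" for I m
  proof -
    have m: "real m > 0" using I(4) by simp
    have cheb: "prob {w \<in> space M. \<bar>\<Sum>i\<in>I. centred f i w\<bar> \<ge> x * real m} \<le> cheb_const K / x\<^sup>2 / real m"
      if "dominated K f" "x > 0" for K f x
    proof -
      have "prob {w \<in> space M. \<bar>\<Sum>i\<in>I. centred f i w\<bar> \<ge> x * real m} \<le> cheb_const K * real (card I) / (x * real m)\<^sup>2"
        using chebyshev_centred[OF I(1,2) _ that(1), of "\<lambda>_. 1" "x * real m"] that(2) m by simp
      also have "\<dots> \<le> cheb_const K * real m / (x * real m)\<^sup>2"
        using I(3) cheb_const_nonneg by (intro divide_right_mono mult_left_mono) auto
      also have "\<dots> = cheb_const K / x\<^sup>2 / real m" using m by (simp add: power2_eq_square)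
      finally show ?thesis .
    qed
    define G where "G t = {w \<in> space M. \<bar>\<Sum>i\<in>I. centred (\<lambda>x. val_at x (grid N t)) i w\<bar> \<ge> c / (4 * d) * real m}" for t
    define H where "H = {w \<in> space M. \<bar>\<Sum>i\<in>I. centred h i w\<bar> \<ge> c / 4 * real m}"
    have h: "dominated 2 h" unfolding h_def by (rule dominated_disc)
    have G: "G t \<in> events" for t
      using sum_centred_measurable[OF I(1,2) dominated_val_at, of "\<lambda>_. 1" "grid N t"] unfolding G_def by simp
    have H: "H \<in> events"
      using sum_centred_measurable[OF I(1,2) h, of "\<lambda>_. 1"] unfolding H_def by simp
    have "{w \<in> space M. norm (\<Sum>i\<in>I. \<epsilon> i w) > c * real m} \<subseteq> (\<Union>t\<in>{..2^N}. G t) \<union> H"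
    proof (rule subsetI, rule ccontr)
      fix w assume wt: "w \<in> {w \<in> space M. norm (\<Sum>i\<in>I. \<epsilon> i w) > c * real m}" "w \<notin> (\<Union>t\<in>{..2^N}. G t) \<union> H"
      define S where "S = (\<Sum>i\<in>I. \<epsilon> i w)"
      have "\<bar>val_at S (grid N t)\<bar> \<le> c / (4 * d) * real m" if t: "t \<le> 2 ^ N" for t
      proof -
        have "val_at S (grid N t) = (\<Sum>i\<in>I. centred (\<lambda>x. val_at x (grid N t)) i w)"
          using grid_mem[OF t] by (simp add: S_def centred_val_at)
        moreover have "w \<notin> G t" using wt(2) t by blast
        ultimately show ?thesis using wt(1) unfolding G_def by (simp add: not_le less_imp_le)
      qed
      then have "norm (disc N S) \<le> (\<Sum>t\<le>(2::nat)^N. c / (4 * d) * real m)"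
        by (intro order_trans[OF norm_disc_le_sum] sum_mono) simp
      also have "\<dots> = d * (c / (4 * d) * real m)" unfolding sum_constant by (simp add: d_def)
      also have "\<dots> = c / 4 * real m" using d by simp
      finally have 1: "norm (disc N S) \<le> c / 4 * real m" .
      have "disc N S = (\<Sum>i\<in>I. disc N (\<epsilon> i w))"
        unfolding S_def using I(1) by (induction I rule: finite_induct) auto
      then have "norm (S - disc N S) \<le> (\<Sum>i\<in>I. h (\<epsilon> i w))"
        unfolding S_def h_def by (simp flip: sum_subtractf add: norm_sum)
      also have "\<dots> = (\<Sum>i\<in>I. centred h i w) + real (card I) * (LINT w|M. h (\<epsilon> 1 w))"
        by (simp add: centred_def sum_subtractf)
      also have "real (card I) * (LINT w|M. h (\<epsilon> 1 w)) \<le> real m * (c / 4)"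
        using I(3) N by (intro mult_mono) (auto simp: h_def)
      also have "(\<Sum>i\<in>I. centred h i w) \<le> c / 4 * real m" using wt by (auto simp: H_def)
      finally have "norm (S - disc N S) \<le> c / 4 * real m + real m * (c / 4)" by simp
      with 1 have "norm S \<le> 3 * (c * real m) / 4"
        using norm_triangle_ineq[of "disc N S" "S - disc N S"] by (simp add: mult.commute)
      moreover have "norm S > c * real m" using wt by (simp add: S_def)
      moreover have "c * real m > 0" using assms m by simp
      ultimately show False by linarith
    qed
    then have "prob {w \<in> space M. norm (\<Sum>i\<in>I. \<epsilon> i w) > c * real m} \<le> prob ((\<Union>t\<in>{..2^N}. G t) \<union> H)"
      using G H by (intro finite_measure_mono) auto
    also have "\<dots> \<le> prob (\<Union>t\<in>{..2^N}. G t) + prob H"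
      using G H by (intro measure_Un_le) auto
    also have "prob (\<Union>t\<in>{..2^N}. G t) \<le> (\<Sum>t\<in>{..2^N}. prob (G t))"
      using G by (intro measure_UNION_le) auto
    also have "\<dots> \<le> (\<Sum>t\<in>{..2^N::nat}. cheb_const 1 / (c / (4 * d))\<^sup>2 / real m)"
      unfolding G_def using assms d by (intro sum_mono cheb dominated_val_at) auto
    also have "prob H \<le> cheb_const 2 / (c/4)\<^sup>2 / real m"
      unfolding H_def using assms by (intro cheb h) auto
    finally show ?thesis by (simp add: C_def d_def add_divide_distrib)
  qed
  ultimately show ?thesis by blast
qed

text \<open>The bounds C/m of \<open>norm_sum_tail\<close> are not summable over m, but they are
  along squares; between consecutive squares the sum of the norms suffices. The family
  \<open>J\<close> is abstract so that windows growing to the left and to the right of the change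
  point are covered alike.\<close>

lemma norm_sum_max_tail:
  assumes "c > 0"
  shows "\<exists>C\<ge>0. \<forall>(J :: nat \<Rightarrow> nat set) K n. K \<ge> 1 \<and>
      (\<forall>m. finite (J m) \<and> J m \<subseteq> {1..} \<and> card (J m) \<le> m) \<and> (\<forall>l m. l \<le> m \<longrightarrow> J l \<subseteq> J m \<and> card (J m - J l) \<le> m - l) \<longrightarrow>
    prob {w \<in> space M. \<exists>m\<in>{K\<^sup>2..n}. norm (\<Sum>i\<in>J m. \<epsilon> i w) > c * real m} \<le> C / real K"
proof -
  obtain C where C: "C \<ge> 0" "\<And>I m. finite I \<Longrightarrow> I \<subseteq> {1..} \<Longrightarrow> card I \<le> m \<Longrightarrow> m \<ge> 1 \<Longrightarrow>
    prob {w \<in> space M. norm (\<Sum>i\<in>I. \<epsilon> i w) > c / 2 * real m} \<le> C / real m"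
    using norm_sum_tail[of "c/2"] assms by auto
  \<comment> \<open>At most 3k indices separate consecutive squares, so the sum of their norms has
    second moment at most 9 k^2 (1 + \<mu>p); Markov's inequality at the threshold c k^2 / 2 leaves
    36 (1 + \<mu>p) / (c^2 k^2).\<close>
  define D where "D = 36 * (1 + \<mu>p) / c\<^sup>2"
  have D: "D \<ge> 0" using \<mu>p_nonneg by (simp add: D_def)
  have "prob {w \<in> space M. \<exists>m\<in>{K\<^sup>2..n}. norm (\<Sum>i\<in>J m. \<epsilon> i w) > c * real m} \<le> (2 * (C + D)) / real K"
    if K: "K \<ge> 1" and J: "\<And>m. finite (J m)" "\<And>m. J m \<subseteq> {1..}" "\<And>m. card (J m) \<le> m"
      "\<And>l m. l \<le> m \<Longrightarrow> J l \<subseteq> J m" "\<And>l m. l \<le> m \<Longrightarrow> card (J m - J l) \<le> m - l" for J :: "nat \<Rightarrow> nat set" and K n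
  proof -
    define A where "A k = {w \<in> space M. norm (\<Sum>i\<in>J (k\<^sup>2). \<epsilon> i w) > c / 2 * real (k\<^sup>2)}" for k
    define B where "B k = {w \<in> space M. \<bar>\<Sum>i\<in>J ((Suc k)\<^sup>2) - J (k\<^sup>2). norm (\<epsilon> i w)\<bar> \<ge> c / 2 * real (k\<^sup>2)}" for k
    have [measurable]: "(\<lambda>w. \<Sum>i\<in>J m. \<epsilon> i w) \<in> borel_measurable M" for m by (rule measurable_sum_\<epsilon>[OF J(2)])
    have meas2: "(\<lambda>w. \<Sum>i\<in>J m - J l. norm (\<epsilon> i w)) \<in> borel_measurable M" for m l
      using J(2)[of m] by (intro borel_measurable_sum borel_measurable_norm rv) auto
    have AB: "A k \<in> events" "B k \<in> events" for k
      unfolding A_def B_def using meas2 by simp_all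
    have A: "prob (A k) \<le> C / (real k)\<^sup>2" if "k \<ge> 1" for k
      unfolding A_def using C(2)[OF J(1,2,3), of "k\<^sup>2"] that by simp
    have B: "prob (B k) \<le> D / (real k)\<^sup>2" if k: "k \<ge> 1" for k
    proof -
      define I where "I = J ((Suc k)\<^sup>2) - J (k\<^sup>2)"
      have I: "finite I" "I \<subseteq> {1..}" using J(1,2) by (auto simp: I_def)
      have "card I \<le> (Suc k)\<^sup>2 - k\<^sup>2" unfolding I_def by (rule J(5)) (simp add: power_mono)
      also have "\<dots> = 2 * k + 1" by (simp add: power2_eq_square)
      finally have cI: "real (card I) \<le> 3 * real k" using k by linarith
      have sq: "(\<Sum>i\<in>I. norm (\<epsilon> i w))\<^sup>2 \<le> real (card I) * (\<Sum>i\<in>I. (norm (\<epsilon> i w))\<^sup>2)" for w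
        using Cauchy_Schwarz_ineq_sum[of "\<lambda>_. 1" "\<lambda>i. norm (\<epsilon> i w)" I] by simp
      have ge1: "i \<ge> 1" if "i \<in> I" for i using that I(2) by auto
      have int1: "integrable M (\<lambda>w. real (card I) * (\<Sum>i\<in>I. (norm (\<epsilon> i w))\<^sup>2))"
        using integrable_norm_sq[OF ge1] by (intro integrable_mult_right Bochner_Integration.integrable_sum) auto
      have [measurable]: "(\<lambda>w. \<Sum>i\<in>I. norm (\<epsilon> i w)) \<in> borel_measurable M" unfolding I_def by (rule meas2)
      have int2: "integrable M (\<lambda>w. (\<Sum>i\<in>I. norm (\<epsilon> i w))\<^sup>2)"
      proof (rule Bochner_Integration.integrable_bound[OF int1])
        show "AE w in M. norm ((\<Sum>i\<in>I. norm (\<epsilon> i w))\<^sup>2) \<le> norm (real (card I) * (\<Sum>i\<in>I. (norm (\<epsilon> i w))\<^sup>2))"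
        proof (rule AE_I2)
          fix w show "norm ((\<Sum>i\<in>I. norm (\<epsilon> i w))\<^sup>2) \<le> norm (real (card I) * (\<Sum>i\<in>I. (norm (\<epsilon> i w))\<^sup>2))"
            unfolding real_norm_def abs_power2 using sq[of w] by (rule order_trans[OF _ abs_ge_self])
        qed
      qed measurable
      have "(LINT w|M. (\<Sum>i\<in>I. norm (\<epsilon> i w))\<^sup>2) \<le> (LINT w|M. real (card I) * (\<Sum>i\<in>I. (norm (\<epsilon> i w))\<^sup>2))"
        by (intro integral_mono int1 int2 sq)
      also have "\<dots> = real (card I) * (\<Sum>i\<in>I. (LINT w|M. (norm (\<epsilon> i w))\<^sup>2))"
        using integrable_norm_sq[OF ge1] by (simp add: Bochner_Integration.integral_sum)
      also have "\<dots> \<le> real (card I) * (\<Sum>i\<in>I. 1 + \<mu>p)"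
        using expectation_norm_sq_le[OF ge1] by (intro mult_left_mono sum_mono) auto
      also have "\<dots> = (real (card I))\<^sup>2 * (1 + \<mu>p)" by (simp add: power2_eq_square)
      also have "\<dots> \<le> (3 * real k)\<^sup>2 * (1 + \<mu>p)" using cI \<mu>p_nonneg by (intro mult_right_mono power_mono) auto
      finally have E: "(LINT w|M. (\<Sum>i\<in>I. norm (\<epsilon> i w))\<^sup>2) \<le> (3 * real k)\<^sup>2 * (1 + \<mu>p)" .
      have pos: "c / 2 * real (k\<^sup>2) > 0" using k assms by simp
      have "prob (B k) \<le> (LINT w|M. (\<Sum>i\<in>I. norm (\<epsilon> i w))\<^sup>2) / (c / 2 * real (k\<^sup>2))\<^sup>2"
        unfolding B_def I_def[symmetric] using int2 pos by (intro markov_sq) auto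
      also have "\<dots> \<le> ((3 * real k)\<^sup>2 * (1 + \<mu>p)) / (c / 2 * real (k\<^sup>2))\<^sup>2"
        using E by (intro divide_right_mono) auto
      also have "\<dots> = D / (real k)\<^sup>2" using k assms by (simp add: D_def power2_eq_square field_simps)
      finally show ?thesis .
    qed
    have "{w \<in> space M. \<exists>m\<in>{K\<^sup>2..n}. norm (\<Sum>i\<in>J m. \<epsilon> i w) > c * real m} \<subseteq> (\<Union>k\<in>{K..n}. A k \<union> B k)"
    proof safe
      fix w m assume wt: "w \<in> space M" "m \<in> {K\<^sup>2..n}" "norm (\<Sum>i\<in>J m. \<epsilon> i w) > c * real m"
      define k where "k = floor_sqrt m"
      have k: "k\<^sup>2 \<le> m" "m < (Suc k)\<^sup>2" unfolding k_def by (rule floor_sqrt_power2_le, rule Suc_floor_sqrt_power2_gt)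
      have "K \<le> k" unfolding k_def using wt(2) by (simp add: le_floor_sqrtI)
      moreover have "k \<le> n" using k(1) wt(2) by (metis atLeastAtMost_iff floor_sqrt_le k_def le_trans)
      moreover have "w \<in> A k \<union> B k"
      proof (rule ccontr)
        assume "w \<notin> A k \<union> B k"
        then have 1: "norm (\<Sum>i\<in>J (k\<^sup>2). \<epsilon> i w) \<le> c / 2 * real (k\<^sup>2)" "(\<Sum>i\<in>J ((Suc k)\<^sup>2) - J (k\<^sup>2). norm (\<epsilon> i w)) < c / 2 * real (k\<^sup>2)"
          using wt(1) by (auto simp: A_def B_def)
        have "(\<Sum>i\<in>J m. \<epsilon> i w) = (\<Sum>i\<in>J m - J (k\<^sup>2). \<epsilon> i w) + (\<Sum>i\<in>J (k\<^sup>2). \<epsilon> i w)"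
          using J(1,4) k by (intro sum.subset_diff) auto
        then have "norm (\<Sum>i\<in>J m. \<epsilon> i w) \<le> norm (\<Sum>i\<in>J m - J (k\<^sup>2). \<epsilon> i w) + norm (\<Sum>i\<in>J (k\<^sup>2). \<epsilon> i w)"
          by (metis norm_triangle_ineq)
        also have "norm (\<Sum>i\<in>J m - J (k\<^sup>2). \<epsilon> i w) \<le> (\<Sum>i\<in>J m - J (k\<^sup>2). norm (\<epsilon> i w))" by (rule norm_sum)
        also have "\<dots> \<le> (\<Sum>i\<in>J ((Suc k)\<^sup>2) - J (k\<^sup>2). norm (\<epsilon> i w))"
          using J(1) J(4)[of m "(Suc k)\<^sup>2"] k by (intro sum_mono2) auto
        finally have "norm (\<Sum>i\<in>J m. \<epsilon> i w) \<le> c * real (k\<^sup>2)" using 1 by linarith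
        also have "\<dots> \<le> c * real m" using k(1) assms by (intro mult_left_mono) (auto simp flip: of_nat_power)
        finally show False using wt(3) by simp
      qed
      ultimately show "w \<in> (\<Union>k\<in>{K..n}. A k \<union> B k)" by auto
    qed
    then have "prob {w \<in> space M. \<exists>m\<in>{K\<^sup>2..n}. norm (\<Sum>i\<in>J m. \<epsilon> i w) > c * real m} \<le> prob (\<Union>k\<in>{K..n}. A k \<union> B k)"
      using AB by (intro finite_measure_mono) auto
    also have "\<dots> \<le> (\<Sum>k\<in>{K..n}. prob (A k \<union> B k))" using AB by (intro measure_UNION_le) auto
    also have "\<dots> \<le> (\<Sum>k\<in>{K..n}. (C + D) * (1 / (real k)\<^sup>2))"
    proof (intro sum_mono)
      fix k assume "k \<in> {K..n}"
      then have "prob (A k) + prob (B k) \<le> C / (real k)\<^sup>2 + D / (real k)\<^sup>2" using A B K by (intro add_mono) auto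
      then show "prob (A k \<union> B k) \<le> (C + D) * (1 / (real k)\<^sup>2)"
        using measure_Un_le[OF AB] by (simp add: add_divide_distrib) (meson order_trans)
    qed
    also have "\<dots> \<le> (C + D) * (2 / real K)"
      unfolding sum_distrib_left[symmetric] using C(1) D by (intro mult_left_mono sum_inverse_squares_le K) auto
    finally show ?thesis by (simp add: mult.commute)
  qed
  then show ?thesis using C(1) D by (intro exI[of _ "2 * (C + D)"]) simp
qed

end

section \<open>Tightness of the partial sums\<close>

lemma exp_le_quadratic:
  fixes x :: real
  assumes "\<bar>x\<bar> \<le> 1"
  shows "exp x \<le> 1 + x + x\<^sup>2"
proof (cases "x \<ge> 0")
  case True
  then show ?thesis using assms exp_bound[of x] by simp
next
  case False
  define y where "y = - x"
  have y: "y > 0" using False by (simp add: y_def)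
  have p: "1 + y + y\<^sup>2 / 2 > 0" using y by (simp add: add_pos_nonneg)
  have "exp x = inverse (exp y)" by (simp add: y_def exp_minus)
  also have "\<dots> \<le> inverse (1 + y + y\<^sup>2 / 2)"
    using y p exp_lower_Taylor_quadratic[of y] by (intro le_imp_inverse_le) auto
  also have "\<dots> \<le> 1 - y + y\<^sup>2"
  proof -
    have "(1 - y + y\<^sup>2) * (1 + y + y\<^sup>2 / 2) = 1 + (y\<^sup>2 / 2 + y ^ 3 / 2 + y ^ 4 / 2)"
      by (simp add: field_simps power2_eq_square power3_eq_cube power4_eq_xxxx)
    also have "\<dots> \<ge> 1" using y by simp
    finally show ?thesis using p by (simp add: inverse_eq_divide divide_le_eq)
  qed
  finally show ?thesis by (simp add: y_def)
qed

lemma (in prob_space) mgf_le: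
  fixes X :: "'a \<Rightarrow> real"
  assumes [measurable]: "X \<in> borel_measurable M" and B: "\<And>w. \<bar>X w\<bar> \<le> B" and "l \<ge> 0" "l * B \<le> 1"
    and mean: "expectation X = 0"
  shows "(\<integral>\<^sup>+w. ennreal (exp (l * X w)) \<partial>M) \<le> ennreal (exp (l\<^sup>2 * sq_mean X))"
proof -
  have lX: "\<bar>l * X w\<bar> \<le> 1" for w
    using mult_left_mono[OF B[of w] \<open>l \<ge> 0\<close>] assms(3,4) by (simp add: abs_mult)
  have B2: "(X w)\<^sup>2 \<le> B\<^sup>2" for w using power_mono[OF B[of w], of 2] by simp
  have int: "integrable M X" "integrable M (\<lambda>w. (X w)\<^sup>2)"
    using B B2 by (auto intro: integrable_const_bound[of _ B] integrable_const_bound[of _ "B\<^sup>2"])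
  have inte: "integrable M (\<lambda>w. exp (l * X w))"
    using lX by (intro integrable_const_bound[of _ "exp 1"]) (auto simp: abs_le_iff)
  have "(LINT w|M. exp (l * X w)) \<le> (LINT w|M. 1 + l * X w + (l * X w)\<^sup>2)"
    using int inte lX by (intro integral_mono exp_le_quadratic) (auto simp: power_mult_distrib)
  also have "\<dots> = 1 + l\<^sup>2 * sq_mean X"
    using int mean by (simp add: power_mult_distrib prob_space)
  also have "\<dots> \<le> exp (l\<^sup>2 * sq_mean X)" by (rule exp_ge_add_one_self)
  finally show ?thesis using inte by (simp add: nn_integral_eq_integral)
qed

text \<open>Chernoff's bound, with exp x \<le> 1 + x + x^2 for each block. The parameter
  \<open>l\<close> stays free within l B \<le> 1, so that it can be balanced later against the
  variance.\<close>

lemma (in prob_space) bernstein_indep_sum_law: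
  fixes T :: "nat \<Rightarrow> 'a \<Rightarrow> 'b::{second_countable_topology, real_normed_vector}" and F :: "'b \<Rightarrow> real"
  assumes T[measurable]: "\<And>j. T j \<in> borel_measurable M"
    and F[measurable]: "F \<in> borel_measurable borel" and F0: "F 0 = 0" and F_add: "\<And>x y. F (x + y) = F x + F y"
    and int: "\<And>j. integrable M (\<lambda>w. F (T j w))"
    and B: "\<And>j w. \<bar>F (T j w) - (LINT w|M. F (T j w))\<bar> \<le> B" and l: "l \<ge> 0" "l * B \<le> 1"
  shows "measure (indep_sum_law M T m) {x. F x - (\<Sum>j<m. (LINT w|M. F (T j w))) \<ge> y}
    \<le> exp (- l * y + l\<^sup>2 * (\<Sum>j<m. (LINT w|M. (F (T j w) - (LINT w|M. F (T j w)))\<^sup>2)))"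
proof -
  interpret \<nu>: prob_space "indep_sum_law M T m" by (intro prob_space_indep_sum_law) simp
  define b where "b j = (LINT w|M. F (T j w))" for j
  define V where "V j = (LINT w|M. (F (T j w) - b j)\<^sup>2)" for j
  have mgf: "(\<integral>\<^sup>+w. ennreal (exp (l * (F (T j w) - b j))) \<partial>M) \<le> ennreal (exp (l\<^sup>2 * V j))" for j
    unfolding V_def using B[of j] l int[of j] by (intro mgf_le[of _ B]) (auto simp: b_def prob_space)
  have "emeasure (indep_sum_law M T m) {x. F x - (\<Sum>j<m. b j) \<ge> y} \<le>
    (\<integral>\<^sup>+x. ennreal (exp (- l * y)) * (ennreal (exp (- l * (\<Sum>j<m. b j))) * ennreal (exp (l * F x))) \<partial>indep_sum_law M T m)"
  proof -
    have "emeasure (indep_sum_law M T m) {x. F x - (\<Sum>j<m. b j) \<ge> y} = (\<integral>\<^sup>+x. indicator {x. F x - (\<Sum>j<m. b j) \<ge> y} x \<partial>indep_sum_law M T m)"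
      by (subst nn_integral_indicator) auto
    also have "\<dots> \<le> (\<integral>\<^sup>+x. ennreal (exp (- l * y)) * (ennreal (exp (- l * (\<Sum>j<m. b j))) * ennreal (exp (l * F x))) \<partial>indep_sum_law M T m)"
    proof (intro nn_integral_mono)
      fix x
      have "l * y \<le> l * (F x - (\<Sum>j<m. b j))" if "F x - (\<Sum>j<m. b j) \<ge> y" using that l(1) by (rule mult_left_mono)
      then have "(1::real) \<le> exp (- l * y) * (exp (- l * (\<Sum>j<m. b j)) * exp (l * F x))" if "F x - (\<Sum>j<m. b j) \<ge> y"
        using that by (simp add: algebra_simps flip: exp_add)
      then have "1 \<le> ennreal (exp (- l * y)) * (ennreal (exp (- l * (\<Sum>j<m. b j))) * ennreal (exp (l * F x)))" if "F x - (\<Sum>j<m. b j) \<ge> y"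
        using that by (simp add: ennreal_mult[symmetric])
      then show "indicator {x. F x - (\<Sum>j<m. b j) \<ge> y} x \<le>
        ennreal (exp (- l * y)) * (ennreal (exp (- l * (\<Sum>j<m. b j))) * ennreal (exp (l * F x)))"
        by (simp add: indicator_def)
    qed
    finally show ?thesis .
  qed
  also have "\<dots> = ennreal (exp (- l * y)) * (ennreal (exp (- l * (\<Sum>j<m. b j))) * (\<Prod>j<m. \<integral>\<^sup>+w. ennreal (exp (l * F (T j w))) \<partial>M))"
    by (subst nn_integral_indep_sum_law[symmetric])
       (auto simp: nn_integral_cmult F0 F_add distrib_left exp_add ennreal_mult)
  also have "ennreal (exp (- l * (\<Sum>j<m. b j))) * (\<Prod>j<m. \<integral>\<^sup>+w. ennreal (exp (l * F (T j w))) \<partial>M) =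
     (\<Prod>j<m. \<integral>\<^sup>+w. ennreal (exp (l * (F (T j w) - b j))) \<partial>M)"
  proof -
    have "ennreal (exp (- l * (\<Sum>j<m. b j))) = (\<Prod>j<m. ennreal (exp (- l * b j)))"
      by (simp add: sum_distrib_left exp_sum prod_ennreal flip: sum_negf)
    also have "\<dots> * (\<Prod>j<m. \<integral>\<^sup>+w. ennreal (exp (l * F (T j w))) \<partial>M) = (\<Prod>j<m. \<integral>\<^sup>+w. ennreal (exp (- l * b j)) * ennreal (exp (l * F (T j w))) \<partial>M)"
      by (simp add: prod.distrib nn_integral_cmult)
    also have "\<dots> = (\<Prod>j<m. \<integral>\<^sup>+w. ennreal (exp (l * (F (T j w) - b j))) \<partial>M)"
      by (intro prod.cong refl nn_integral_cong) (simp add: algebra_simps flip: ennreal_mult exp_add)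
    finally show ?thesis .
  qed
  also have "ennreal (exp (- l * y)) * (\<Prod>j<m. \<integral>\<^sup>+w. ennreal (exp (l * (F (T j w) - b j))) \<partial>M) \<le>
     ennreal (exp (- l * y)) * (\<Prod>j<m. ennreal (exp (l\<^sup>2 * V j)))"
    using mgf by (intro mult_left_mono, induction m) (auto intro: mult_mono)
  also have "\<dots> = ennreal (exp (- l * y + l\<^sup>2 * (\<Sum>j<m. V j)))"
    by (simp add: prod_ennreal sum_distrib_left exp_add exp_sum prod_nonneg del: exp_add_commuting flip: ennreal_mult)
       (simp add: exp_diff exp_sum exp_minus field_simps)
  finally show ?thesis
    by (simp add: \<nu>.emeasure_eq_measure V_def b_def)
qed

text \<open>Large functions are replaced by zero instead of being rescaled: the norm never grows,
  and nothing changes on the event that no norm exceeds \<open>L\<close>.\<close>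

definition trunc :: "real \<Rightarrow> C01 \<Rightarrow> C01" where
  "trunc L x = (if norm x \<le> L then x else 0)"

lemma trunc_measurable [measurable]: "trunc L \<in> borel_measurable borel"
  unfolding trunc_def by measurable

lemma norm_trunc_le: "L \<ge> 0 \<Longrightarrow> norm (trunc L x) \<le> L" "norm (trunc L x) \<le> norm x"
  by (auto simp: trunc_def)

text \<open>A periodic arrangement with period \<open>P\<close> and offset \<open>z\<close>. For
  \<open>P = q + r\<close>, offset zero and length \<open>q\<close> give the blocks, offset
  \<open>q\<close> and length \<open>r\<close> the gaps between them.\<close>

definition blk :: "nat \<Rightarrow> nat \<Rightarrow> nat \<Rightarrow> nat \<Rightarrow> nat set" where
  "blk z P q j = {z + j * P + 1..z + j * P + q}"

lemma blk_facts: "finite (blk z P q j)" "blk z P q j \<subseteq> {1..}" "card (blk z P q j) = q"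
  by (auto simp: blk_def)

context C01_process
begin

lemma blk_sum_law:
  fixes g :: "nat \<Rightarrow> C01 \<Rightarrow> 'b::{second_countable_topology, real_normed_vector}" and z q r m :: nat
  assumes g: "\<And>i. g i \<in> borel_measurable borel" and q: "q \<ge> 1"
    and D: "D \<in> sets borel"
  defines "T \<equiv> (\<lambda>j w. \<Sum>i\<in>blk z (q + r) q j. g i (\<epsilon> i w))"
  shows "\<bar>prob {w \<in> space M. (\<Sum>j<m. T j w) \<in> D} - measure (indep_sum_law M T m) D\<bar> \<le> real m * \<beta> r"
proof (rule block_sum_law[OF _ _ _ _ D])
  show "T j \<in> measurable (generated_sigma M \<epsilon> {z + j * (q + r) + 1..z + j * (q + r) + q}) borel" for j
    unfolding T_def blk_def
    by (intro borel_measurable_sum measurable_compose[OF measurable_\<epsilon>_generated g])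
qed (use q in auto)

lemma blk_measurable:
  fixes g :: "nat \<Rightarrow> C01 \<Rightarrow> 'b::{second_countable_topology, real_normed_vector}"
  assumes g: "\<And>i. g i \<in> borel_measurable borel"
  shows "(\<lambda>w. \<Sum>i\<in>blk z P q j. g i (\<epsilon> i w)) \<in> borel_measurable M"
  using rv by (intro borel_measurable_sum measurable_compose[OF _ g]) (auto simp: blk_def)

end

locale hoelder_mixing_sequence = centred_mixing_sequence +
  fixes \<alpha> c :: real
  assumes \<alpha>: "\<alpha> > 1 / 2" and c: "c > 0"
    and hoelder: "s \<in> {0..1} \<Longrightarrow> t \<in> {0..1} \<Longrightarrow>
      (LINT w|M. (val_at (\<epsilon> 1 w) t - val_at (\<epsilon> 1 w) s)\<^sup>2) \<le> c\<^sup>2 * \<bar>t - s\<bar> powr (2 * \<alpha>)"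
begin

definition tinc :: "real \<Rightarrow> real \<Rightarrow> real \<Rightarrow> C01 \<Rightarrow> real" where
  "tinc L s t x = val_at (trunc L x) t - val_at (trunc L x) s"

lemma tinc_dominated: "dominated 2 (tinc L s t)"
  unfolding dominated_def
proof (intro conjI allI)
  show "tinc L s t \<in> borel_measurable borel" unfolding tinc_def by measurable
  fix x show "\<bar>tinc L s t x\<bar> \<le> 2 * norm x"
    using abs_val_at_le_norm[of "trunc L x" t] abs_val_at_le_norm[of "trunc L x" s] norm_trunc_le(2)[of L x]
    unfolding tinc_def by linarith
qed

lemma tinc_le: "L \<ge> 0 \<Longrightarrow> \<bar>tinc L s t x\<bar> \<le> 2 * L"
  using abs_val_at_le_norm[of "trunc L x" t] abs_val_at_le_norm[of "trunc L x" s] norm_trunc_le(1)[of L x]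
  unfolding tinc_def by linarith

lemma integrable_incr_sq: "i \<ge> 1 \<Longrightarrow> integrable M (\<lambda>w. (val_at (\<epsilon> i w) t - val_at (\<epsilon> i w) s)\<^sup>2)"
proof (rule integrable_dominated_sq[of _ 2 "\<lambda>x. val_at x t - val_at x s"])
  show "dominated 2 (\<lambda>x. val_at x t - val_at x s)"
    unfolding dominated_def
  proof (intro conjI allI)
    fix x show "\<bar>val_at x t - val_at x s\<bar> \<le> 2 * norm x"
      using abs_val_at_le_norm[of x t] abs_val_at_le_norm[of x s] by linarith
  qed measurable
qed

lemma tinc_sq_le:
  assumes "s \<in> {0..1}" "t \<in> {0..1}" "\<bar>t - s\<bar> \<le> h"
  shows "(LINT w|M. (tinc L s t (\<epsilon> 1 w))\<^sup>2) \<le> c\<^sup>2 * h powr (2 * \<alpha>)"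
proof -
  have "(LINT w|M. (tinc L s t (\<epsilon> 1 w))\<^sup>2) \<le> (LINT w|M. (val_at (\<epsilon> 1 w) t - val_at (\<epsilon> 1 w) s)\<^sup>2)"
    by (intro integral_mono integrable_dominated_sq[OF _ tinc_dominated] integrable_incr_sq) (auto simp: tinc_def trunc_def)
  also have "\<dots> \<le> c\<^sup>2 * \<bar>t - s\<bar> powr (2 * \<alpha>)" by (rule hoelder[OF assms(1,2)])
  also have "\<dots> \<le> c\<^sup>2 * h powr (2 * \<alpha>)" using assms(3) \<alpha> by (intro mult_left_mono powr_mono2) auto
  finally show ?thesis .
qed

text \<open>Truncation destroys the mean zero property. The bias is the mean of what is cut off, and
  there norm x is at most L^(-(1+\<delta>)) times its power 2 + \<delta>.\<close>

lemma tinc_mean_le: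
  assumes "s \<in> {0..1}" "t \<in> {0..1}" "L > 0"
  shows "\<bar>LINT w|M. tinc L s t (\<epsilon> 1 w)\<bar> \<le> 2 * \<mu>p * L powr (- (1 + \<delta>))"
proof -
  have int: "integrable M (\<lambda>w. tinc L s t (\<epsilon> 1 w))" by (rule dominated_integrable[OF _ tinc_dominated]) simp
  have intv: "integrable M (\<lambda>w. val_at (\<epsilon> 1 w) t)" for t by (rule dominated_integrable[OF _ dominated_val_at]) simp
  have "(LINT w|M. tinc L s t (\<epsilon> 1 w)) = (LINT w|M. tinc L s t (\<epsilon> 1 w) - (val_at (\<epsilon> 1 w) t - val_at (\<epsilon> 1 w) s))"
    using int intv mean_zero[of 1] assms by simp
  also have "\<bar>\<dots>\<bar> \<le> (LINT w|M. 2 * L powr (- (1 + \<delta>)) * norm (\<epsilon> 1 w) powr (2 + \<delta>))"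
  proof (intro order_trans[OF integral_abs_bound] integral_mono)
    fix w
    define x where "x = \<epsilon> 1 w"
    show "\<bar>tinc L s t (\<epsilon> 1 w) - (val_at (\<epsilon> 1 w) t - val_at (\<epsilon> 1 w) s)\<bar> \<le> 2 * L powr (- (1 + \<delta>)) * norm (\<epsilon> 1 w) powr (2 + \<delta>)"
      unfolding x_def[symmetric]
    proof (cases "norm x \<le> L")
      case False
      then have "\<bar>tinc L s t x - (val_at x t - val_at x s)\<bar> \<le> 2 * norm x"
        using abs_val_at_le_norm[of x t] abs_val_at_le_norm[of x s] by (simp add: tinc_def trunc_def)
      also have "norm x = norm x powr (- (1 + \<delta>)) * norm x powr (2 + \<delta>)"
        using False assms(3) by (simp flip: powr_add)
      also have "\<dots> \<le> L powr (- (1 + \<delta>)) * norm x powr (2 + \<delta>)"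
        using False assms(3) \<delta> by (intro mult_right_mono powr_mono2') auto
      finally show "\<bar>tinc L s t x - (val_at x t - val_at x s)\<bar> \<le> 2 * L powr (- (1 + \<delta>)) * norm x powr (2 + \<delta>)" by simp
    qed (simp add: tinc_def trunc_def)
  qed (use int intv moment[of 1] in auto)
  also have "\<dots> = 2 * \<mu>p * L powr (- (1 + \<delta>))" by (simp add: \<mu>p_def)
  finally show ?thesis .
qed

definition tblk :: "real \<Rightarrow> (nat \<Rightarrow> real) \<Rightarrow> nat \<Rightarrow> nat \<Rightarrow> nat \<Rightarrow> nat \<Rightarrow> 'a \<Rightarrow> C01" where
  "tblk L a z P q j w = (\<Sum>i\<in>blk z P q j. a i *\<^sub>R trunc L (\<epsilon> i w))"

lemma tblk_measurable: "tblk L a z P q j \<in> borel_measurable M"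
  unfolding tblk_def by (rule blk_measurable[where g="\<lambda>i x. a i *\<^sub>R trunc L x"]) measurable

lemma tblk_incr: "val_at (tblk L a z P q j w) t - val_at (tblk L a z P q j w) s = (\<Sum>i\<in>blk z P q j. a i * tinc L s t (\<epsilon> i w))"
  by (simp add: tblk_def tinc_def sum_subtractf right_diff_distrib)

text \<open>Half of the threshold \<open>2 * y\<close> absorbs the bias left by truncation, the
  other half is the deviation in \<open>bernstein_indep_sum_law\<close>. The two terms of the
  minimum are the Gaussian and the exponential regime; the factor two in front accounts for both
  signs.\<close>

lemma tblk_bernstein:
  assumes a: "\<And>i. \<bar>a i\<bar> \<le> 1" and q: "q \<ge> 1" and L: "L > 0"
    and st: "s \<in> {0..1}" "t \<in> {0..1}" "\<bar>t - s\<bar> \<le> h"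
    and y: "y > 0" and V: "real m * real q * var_const 2 * (c\<^sup>2 * h powr (2 * \<alpha>)) powr (1/4) \<le> V" "V > 0"
    and bias: "real m * real q * (2 * \<mu>p * L powr (- (1 + \<delta>))) \<le> y"
  shows "measure (indep_sum_law M (tblk L a z P q) m) {x. \<bar>val_at x t - val_at x s\<bar> \<ge> 2 * y}
    \<le> 2 * exp (- min (y\<^sup>2 / (4 * V)) (y / (8 * real q * L)))"
proof -
  have [measurable]: "tblk L a z P q j \<in> borel_measurable M" for j by (rule tblk_measurable)
  define T where "T = tblk L a z P q"
  have [measurable]: "T j \<in> borel_measurable M" for j by (simp add: T_def)
  interpret \<nu>: prob_space "indep_sum_law M T m" by (intro prob_space_indep_sum_law) simp
  have main: "measure (indep_sum_law M T m) {x. val_at x t - val_at x s \<ge> 2 * y} \<le> exp (- min (y\<^sup>2 / (4 * V)) (y / (8 * real q * L)))"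
    if st: "s \<in> {0..1}" "t \<in> {0..1}" "\<bar>t - s\<bar> \<le> h" for s t
  proof -
    define F where "F x = val_at x t - val_at x s" for x
    define e where "e = (LINT w|M. tinc L s t (\<epsilon> 1 w))"
    have FT: "F (T j w) = (\<Sum>i\<in>blk z P q j. a i * tinc L s t (\<epsilon> i w))" for j w
      unfolding F_def T_def by (rule tblk_incr)
    have i1: "i \<ge> 1" if "i \<in> blk z P q j" for i j using that by (auto simp: blk_def)
    have int1: "integrable M (\<lambda>w. tinc L s t (\<epsilon> i w))" if "i \<ge> 1" for i by (rule dominated_integrable[OF that tinc_dominated])
    have int: "integrable M (\<lambda>w. F (T j w))" for j
      unfolding FT using int1[OF i1] by (intro Bochner_Integration.integrable_sum integrable_mult_right) auto
    have E: "(LINT w|M. F (T j w)) = (\<Sum>i\<in>blk z P q j. a i * e)" for j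
    proof -
      have "(LINT w|M. F (T j w)) = (\<Sum>i\<in>blk z P q j. (LINT w|M. a i * tinc L s t (\<epsilon> i w)))"
        unfolding FT using int1[OF i1] by (intro Bochner_Integration.integral_sum integrable_mult_right)
      also have "\<dots> = (\<Sum>i\<in>blk z P q j. a i * e)"
        unfolding e_def using expectation_dominated[OF i1 tinc_dominated] by (intro sum.cong refl) simp
      finally show ?thesis .
    qed
    have diff: "F (T j w) - (LINT w|M. F (T j w)) = (\<Sum>i\<in>blk z P q j. a i * centred (tinc L s t) i w)" for j w
      unfolding E unfolding FT centred_def e_def by (simp add: sum_subtractf right_diff_distrib)
    \<comment> \<open>A truncated increment and its mean are each at most 2 L, and a block has
      \<open>q\<close> terms.\<close>
    define B where "B = 4 * real q * L"
    have B0: "B > 0" using q L by (simp add: B_def)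
    have B: "\<bar>F (T j w) - (LINT w|M. F (T j w))\<bar> \<le> B" for j w
    proof -
      have "\<bar>e\<bar> \<le> 2 * L" unfolding e_def using tinc_le[of L] L int1[of 1]
        by (intro order_trans[OF integral_abs_bound] integral_le_const) auto
      then have "\<bar>centred (tinc L s t) i w\<bar> \<le> 4 * L" for i
        using tinc_le[of L s t "\<epsilon> i w"] L unfolding centred_def e_def by linarith
      then have "\<bar>a i * centred (tinc L s t) i w\<bar> \<le> 1 * (4 * L)" for i
        unfolding abs_mult using a[of i] by (intro mult_mono) auto
      then have "\<bar>\<Sum>i\<in>blk z P q j. a i * centred (tinc L s t) i w\<bar> \<le> (\<Sum>i\<in>blk z P q j. 1 * (4 * L))"
        by (intro order_trans[OF sum_abs] sum_mono)
      then show ?thesis unfolding diff by (simp add: blk_facts B_def)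
    qed
    define Vj where "Vj j = (LINT w|M. (F (T j w) - (LINT w|M. F (T j w)))\<^sup>2)" for j
    have Vj: "Vj j \<le> real q * var_const 2 * (c\<^sup>2 * h powr (2 * \<alpha>)) powr (1/4)" for j
    proof -
      have "Vj j \<le> var_const 2 * real (card (blk z P q j)) * (LINT w|M. (tinc L s t (\<epsilon> 1 w))\<^sup>2) powr (1/4)"
        unfolding Vj_def diff by (rule variance_sum_le[OF blk_facts(1,2) a tinc_dominated])
      also have "\<dots> \<le> var_const 2 * real q * (c\<^sup>2 * h powr (2 * \<alpha>)) powr (1/4)"
        unfolding blk_facts(3) using var_const_nonneg tinc_sq_le[OF st] by (intro mult_left_mono powr_mono2) auto
      finally show ?thesis by (simp add: mult_ac)
    qed
    \<comment> \<open>The minimiser y / (2 V) of the exponent - l y + l^2 V, cut off at 1/B, the end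
      of the admissible range. In either case the quadratic term costs at most half of l y.\<close>
    define l where "l = min (y / (2 * V)) (1 / B)"
    have l: "l \<ge> 0" "l * B \<le> 1" "2 * V * l \<le> y"
      using y V(2) B0 by (auto simp: l_def min_def field_simps)
    have sumE: "(\<Sum>j<m. (LINT w|M. F (T j w))) \<le> y"
    proof -
      have e': "\<bar>e\<bar> \<le> 2 * \<mu>p * L powr (- (1 + \<delta>))" unfolding e_def by (rule tinc_mean_le[OF st(1,2) L])
      have "a i * e \<le> 1 * (2 * \<mu>p * L powr (- (1 + \<delta>)))" for i
        using mult_mono[OF a[of i] e'] abs_ge_self[of "a i * e"] by (simp add: abs_mult)
      then have "(\<Sum>j<m. (LINT w|M. F (T j w))) \<le> (\<Sum>j<m. \<Sum>i\<in>blk z P q j. 1 * (2 * \<mu>p * L powr (- (1 + \<delta>))))"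
        unfolding E by (intro sum_mono)
      also have "\<dots> \<le> y" using bias by (simp add: blk_facts mult_ac)
      finally show ?thesis .
    qed
    have "measure (indep_sum_law M T m) {x. F x \<ge> 2 * y} \<le> measure (indep_sum_law M T m) {x. F x - (\<Sum>j<m. (LINT w|M. F (T j w))) \<ge> y}"
    proof (intro \<nu>.finite_measure_mono subsetI)
      have [measurable]: "F \<in> borel_measurable borel" unfolding F_def by measurable
      show "{x. F x - (\<Sum>j<m. (LINT w|M. F (T j w))) \<ge> y} \<in> \<nu>.events" by simp
      fix x assume "x \<in> {x. F x \<ge> 2 * y}"
      then show "x \<in> {x. F x - (\<Sum>j<m. (LINT w|M. F (T j w))) \<ge> y}" using sumE by simp
    qed
    also have "\<dots> \<le> exp (- l * y + l\<^sup>2 * (\<Sum>j<m. Vj j))"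
      unfolding Vj_def
    proof (rule bernstein_indep_sum_law[where F=F and T=T and B=B])
      show "F \<in> borel_measurable borel" unfolding F_def by measurable
    qed (use int B l(1,2) in \<open>simp_all add: F_def\<close>)
    also have "\<dots> \<le> exp (- l * y + l\<^sup>2 * V)"
    proof -
      have "(\<Sum>j<m. Vj j) \<le> (\<Sum>j<m. real q * var_const 2 * (c\<^sup>2 * h powr (2 * \<alpha>)) powr (1/4))" by (intro sum_mono Vj)
      also have "\<dots> \<le> V" using V(1) by (simp add: mult_ac)
      finally show ?thesis by (simp add: mult_left_mono)
    qed
    also have "\<dots> \<le> exp (- (l * y / 2))"
    proof -
      have "l * (2 * V * l) \<le> l * y" using l by (intro mult_left_mono) auto
      then show ?thesis by (simp add: power2_eq_square mult_ac)
    qed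
    also have "l * y / 2 = min (y\<^sup>2 / (4 * V)) (y / (8 * real q * L))"
    proof -
      have "min a b * (y / 2) = min (a * (y / 2)) (b * (y / 2))" for a b
        using y by (auto simp: min_def)
      from this[of "y / (2 * V)" "1 / B"] show ?thesis by (simp add: l_def power2_eq_square B_def mult_ac)
    qed
    finally show ?thesis by (simp add: F_def)
  qed
  have "{x. \<bar>val_at x t - val_at x s\<bar> \<ge> 2 * y} = {x. val_at x t - val_at x s \<ge> 2 * y} \<union> {x. val_at x s - val_at x t \<ge> 2 * y}"
    by (auto simp: abs_if)
  then have "measure (indep_sum_law M T m) {x. \<bar>val_at x t - val_at x s\<bar> \<ge> 2 * y} \<le>
      measure (indep_sum_law M T m) {x. val_at x t - val_at x s \<ge> 2 * y} + measure (indep_sum_law M T m) {x. val_at x s - val_at x t \<ge> 2 * y}"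
    by (simp add: measure_Un_le)
  also have "\<dots> \<le> 2 * exp (- min (y\<^sup>2 / (4 * V)) (y / (8 * real q * L)))"
    using main[OF st] main[OF st(2,1)] st(3) by (simp add: abs_minus_commute)
  finally show ?thesis by (simp add: T_def)
qed

end

section \<open>Alternating blocks and increments over one dyadic level\<close>

lemma sum_blocks:
  fixes g :: "nat \<Rightarrow> 'b::comm_monoid_add"
  shows "(\<Sum>i\<in>{1..m * (q + r)}. g i) = (\<Sum>j<m. \<Sum>i\<in>blk 0 (q + r) q j. g i) + (\<Sum>j<m. \<Sum>i\<in>blk q (q + r) r j. g i)"
proof (induction m)
  case (Suc m)
  have "{1..Suc m * (q + r)} = {1..m * (q + r)} \<union> (blk 0 (q + r) q m \<union> blk q (q + r) r m)"
    by (auto simp: blk_def)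
  moreover have "{1..m * (q + r)} \<inter> (blk 0 (q + r) q m \<union> blk q (q + r) r m) = {}" "blk 0 (q + r) q m \<inter> blk q (q + r) r m = {}"
    by (auto simp: blk_def)
  ultimately have "(\<Sum>i\<in>{1..Suc m * (q + r)}. g i) =
     (\<Sum>i\<in>{1..m * (q + r)}. g i) + ((\<Sum>i\<in>blk 0 (q + r) q m. g i) + (\<Sum>i\<in>blk q (q + r) r m. g i))"
    by (simp add: sum.union_disjoint blk_facts(1))
  then show ?case using Suc by (simp add: ac_simps)
qed simp

context mixing_sequence
begin

lemma prob_norm_gt:
  assumes "L > 0"
  shows "prob {w \<in> space M. \<exists>i\<in>{1..n}. norm (\<epsilon> i w) > L} \<le> real n * (\<mu>p * L powr (- (2 + \<delta>)))"
proof -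
  have [measurable]: "\<epsilon> i \<in> borel_measurable M" if "i \<in> {1..n}" for i using that by (intro rv) auto
  have one: "prob {w \<in> space M. norm (\<epsilon> i w) > L} \<le> \<mu>p * L powr (- (2 + \<delta>))" if i: "i \<in> {1..n}" for i
  proof -
    have [measurable]: "\<epsilon> i \<in> borel_measurable M" using i by (intro rv) auto
    have "prob {w \<in> space M. norm (\<epsilon> i w) > L} \<le> prob {w \<in> space M. norm (\<epsilon> i w) powr (2 + \<delta>) \<ge> L powr (2 + \<delta>)}"
    proof (intro finite_measure_mono subsetI)
      fix w assume "w \<in> {w \<in> space M. norm (\<epsilon> i w) > L}"
      then show "w \<in> {w \<in> space M. norm (\<epsilon> i w) powr (2 + \<delta>) \<ge> L powr (2 + \<delta>)}"
        using assms \<delta> by (auto intro: powr_mono2)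
    qed measurable
    also have "\<dots> \<le> (LINT w|M. norm (\<epsilon> i w) powr (2 + \<delta>)) / (L powr (2 + \<delta>))"
      using moment[of i] i assms by (intro integral_Markov_inequality_measure[of _ _ "{}"]) auto
    also have "\<dots> = \<mu>p * L powr (- (2 + \<delta>))" unfolding powr_minus_divide[of L "2 + \<delta>"] using moment_eq[of i] i by simp
    finally show ?thesis .
  qed
  have "{w \<in> space M. \<exists>i\<in>{1..n}. norm (\<epsilon> i w) > L} = (\<Union>i\<in>{1..n}. {w \<in> space M. norm (\<epsilon> i w) > L})" by blast
  also have "prob \<dots> \<le> (\<Sum>i\<in>{1..n}. prob {w \<in> space M. norm (\<epsilon> i w) > L})"
    by (intro measure_UNION_le) auto
  also have "\<dots> \<le> (\<Sum>i\<in>{1..n}. \<mu>p * L powr (- (2 + \<delta>)))" by (intro sum_mono one)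
  finally show ?thesis by simp
qed

definition wsum :: "(nat \<Rightarrow> real) \<Rightarrow> nat \<Rightarrow> 'w \<Rightarrow> C01" where
  "wsum a n w = (\<Sum>i\<in>{1..n}. a i *\<^sub>R \<epsilon> i w)"

lemma wsum_measurable [measurable]: "wsum a n \<in> borel_measurable M"
  unfolding wsum_def by (intro borel_measurable_sum borel_measurable_scaleR borel_measurable_const rv) auto

definition dinc :: "nat \<Rightarrow> nat \<Rightarrow> C01 \<Rightarrow> real" where
  "dinc k i x = \<bar>val_at x (grid k (Suc i)) - val_at x (grid k i)\<bar>"

lemma dinc_measurable [measurable]: "dinc k i \<in> borel_measurable borel"
  unfolding dinc_def by measurable

lemma dinc_add: "dinc k i (x + y) \<le> dinc k i x + dinc k i y"
  unfolding dinc_def by simp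

end

lemma grid_step:
  assumes "i < 2 ^ k"
  shows "grid k i \<in> {0..1}" "grid k (Suc i) \<in> {0..1}" "\<bar>grid k (Suc i) - grid k i\<bar> = 1 / 2 ^ k"
  using assms by (auto intro!: grid_mem simp del: atLeastAtMost_iff) (simp add: grid_def field_simps)

context hoelder_mixing_sequence
begin

text \<open>The conditions at all levels and all grid points form one Borel set of values of the
  block sum, so passing to independent blocks costs \<open>real m * \<beta> r\<close> once and not
  once for each grid point. A union bound is applied afterwards, under the law of the independent
  sum.\<close>

lemma tblk_level_prob:
  assumes a: "\<And>i. \<bar>a i\<bar> \<le> 1" and q: "q \<ge> 1" and L: "L > 0" and K: "finite K"
    and y: "\<And>k. k \<in> K \<Longrightarrow> y k > 0"
    and V: "\<And>k. k \<in> K \<Longrightarrow> real m * real q * var_const 2 * (c\<^sup>2 * (1 / 2 ^ k) powr (2 * \<alpha>)) powr (1/4) \<le> V k" "\<And>k. k \<in> K \<Longrightarrow> V k > 0"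
    and bias: "\<And>k. k \<in> K \<Longrightarrow> real m * real q * (2 * \<mu>p * L powr (- (1 + \<delta>))) \<le> y k"
  shows "prob {w \<in> space M. \<exists>k\<in>K. \<exists>i<2 ^ k. dinc k i (\<Sum>j<m. tblk L a z (q + r) q j w) \<ge> 2 * y k}
    \<le> (\<Sum>k\<in>K. 2 ^ k * (2 * exp (- min ((y k)\<^sup>2 / (4 * V k)) (y k / (8 * real q * L))))) + real m * \<beta> r"
proof -
  define T where "T = tblk L a z (q + r) q"
  have [measurable]: "T j \<in> borel_measurable M" for j unfolding T_def by (rule tblk_measurable)
  interpret \<nu>: prob_space "indep_sum_law M T m" by (intro prob_space_indep_sum_law) simp
  define E where "E k i = {x. dinc k i x \<ge> 2 * y k}" for k i
  define D where "D = (\<Union>k\<in>K. \<Union>i\<in>{..<2 ^ k}. E k i)"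
  have E: "E k i \<in> sets borel" for k i unfolding E_def by measurable
  then have D: "D \<in> sets borel" unfolding D_def using K by (intro sets.finite_UN) auto
  have eq: "{w \<in> space M. \<exists>k\<in>K. \<exists>i<2 ^ k. dinc k i (\<Sum>j<m. T j w) \<ge> 2 * y k} = {w \<in> space M. (\<Sum>j<m. T j w) \<in> D}"
    by (auto simp: D_def E_def)
  have "\<bar>prob {w \<in> space M. (\<Sum>j<m. T j w) \<in> D} - measure (indep_sum_law M T m) D\<bar> \<le> real m * \<beta> r"
    unfolding T_def tblk_def[abs_def] by (rule blk_sum_law[where g="\<lambda>i x. a i *\<^sub>R trunc L x", OF _ q D]) measurable
  moreover have "measure (indep_sum_law M T m) D \<le> (\<Sum>k\<in>K. 2 ^ k * (2 * exp (- min ((y k)\<^sup>2 / (4 * V k)) (y k / (8 * real q * L)))))"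
  proof -
    have "measure (indep_sum_law M T m) D \<le> (\<Sum>k\<in>K. measure (indep_sum_law M T m) (\<Union>i\<in>{..<2 ^ k}. E k i))"
      unfolding D_def using K E by (intro measure_UNION_le sets.finite_UN) auto
    also have "\<dots> \<le> (\<Sum>k\<in>K. \<Sum>i\<in>{..<2 ^ k}. measure (indep_sum_law M T m) (E k i))"
      using E by (intro sum_mono measure_UNION_le) auto
    also have "\<dots> \<le> (\<Sum>k\<in>K. \<Sum>i\<in>{..<2 ^ k::nat}. 2 * exp (- min ((y k)\<^sup>2 / (4 * V k)) (y k / (8 * real q * L))))"
    proof (intro sum_mono)
      fix k i assume k: "k \<in> K" and i: "i \<in> {..<2 ^ k::nat}"
      have i: "i < 2 ^ k" using i by simp
      show "measure (indep_sum_law M T m) (E k i) \<le> 2 * exp (- min ((y k)\<^sup>2 / (4 * V k)) (y k / (8 * real q * L)))"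
        unfolding E_def T_def dinc_def
        using grid_step(3)[OF i] by (intro tblk_bernstein[OF a q L grid_step(1,2)[OF i] _ y[OF k] V(1)[OF k] V(2)[OF k] bias[OF k]]) simp
    qed
    finally show ?thesis by simp
  qed
  ultimately show ?thesis unfolding T_def[symmetric] eq by linarith
qed

text \<open>Gaps and blocks have equal length \<open>q\<close>, so the sum splits into two families
  of separated blocks that are treated alike: hence the factor two and the threshold 4 y = 2 y + 2
  y. The last term bounds the event on which truncation changes the sum.\<close>

lemma coarse_prob:
  assumes a: "\<And>i. \<bar>a i\<bar> \<le> 1" "\<And>i. i > n \<Longrightarrow> a i = 0" and m: "n \<le> m * (q + q)"
    and q: "q \<ge> 1" and L: "L > 0" and K: "finite K"
    and y: "\<And>k. k \<in> K \<Longrightarrow> y k > 0"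
    and V: "\<And>k. k \<in> K \<Longrightarrow> real m * real q * var_const 2 * (c\<^sup>2 * (1 / 2 ^ k) powr (2 * \<alpha>)) powr (1/4) \<le> V k" "\<And>k. k \<in> K \<Longrightarrow> V k > 0"
    and bias: "\<And>k. k \<in> K \<Longrightarrow> real m * real q * (2 * \<mu>p * L powr (- (1 + \<delta>))) \<le> y k"
  shows "prob {w \<in> space M. \<exists>k\<in>K. \<exists>i<2 ^ k. dinc k i (wsum a n w) \<ge> 4 * y k}
    \<le> 2 * ((\<Sum>k\<in>K. 2 ^ k * (2 * exp (- min ((y k)\<^sup>2 / (4 * V k)) (y k / (8 * real q * L))))) + real m * \<beta> q)
       + real n * (\<mu>p * L powr (- (2 + \<delta>)))"
proof -
  let ?R = "{w \<in> space M. \<exists>k\<in>K. \<exists>i<2 ^ k. dinc k i (wsum a n w) \<ge> 4 * y k}"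
  define U where "U z w = (\<Sum>j<m. tblk L a z (q + q) q j w)" for z w
  define A where "A z = {w \<in> space M. \<exists>k\<in>K. \<exists>i<2 ^ k. dinc k i (U z w) \<ge> 2 * y k}" for z
  define H where "H = {w \<in> space M. \<exists>i\<in>{1..n}. norm (\<epsilon> i w) > L}"
  have [measurable]: "U z \<in> borel_measurable M" for z unfolding U_def by (intro borel_measurable_sum tblk_measurable)
  have Aev: "A z \<in> events" for z
  proof -
    have "A z = (\<Union>k\<in>K. \<Union>i\<in>{..<2 ^ k}. {w \<in> space M. dinc k i (U z w) \<ge> 2 * y k})" by (auto simp: A_def)
    also have "\<dots> \<in> events" using K by (intro sets.finite_UN) auto
    finally show ?thesis .
  qed
  have Hev: "H \<in> events"
  proof -
    have "{w \<in> space M. norm (\<epsilon> i w) > L} \<in> events" if "i \<in> {1..n}" for i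
    proof -
      have [measurable]: "\<epsilon> i \<in> borel_measurable M" using that by (intro rv) auto
      show ?thesis by measurable
    qed
    then have "(\<Union>i\<in>{1..n}. {w \<in> space M. norm (\<epsilon> i w) > L}) \<in> events" by (intro sets.finite_UN) auto
    moreover have "H = (\<Union>i\<in>{1..n}. {w \<in> space M. norm (\<epsilon> i w) > L})" by (auto simp: H_def)
    ultimately show ?thesis by simp
  qed
  have "?R \<subseteq> A 0 \<union> A q \<union> H"
  proof (rule subsetI, rule ccontr)
    fix w assume wt: "w \<in> ?R" "w \<notin> A 0 \<union> A q \<union> H"
    then obtain k i where k: "k \<in> K" "i < 2 ^ k" "dinc k i (wsum a n w) \<ge> 4 * y k" by auto
    have "norm (\<epsilon> i w) \<le> L" if "i \<in> {1..n}" for i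
    proof (rule ccontr)
      assume "\<not> norm (\<epsilon> i w) \<le> L"
      then have "w \<in> H" unfolding H_def using wt(1) that by (auto simp: not_le)
      then show False using wt(2) by blast
    qed
    then have "wsum a n w = (\<Sum>i\<in>{1..n}. a i *\<^sub>R trunc L (\<epsilon> i w))"
      unfolding wsum_def by (intro sum.cong) (simp_all add: trunc_def)
    also have "\<dots> = (\<Sum>i\<in>{1..m * (q + q)}. a i *\<^sub>R trunc L (\<epsilon> i w))"
      using m a(2) by (intro sum.mono_neutral_left) auto
    also have "\<dots> = U 0 w + U q w" unfolding sum_blocks U_def tblk_def ..
    finally have "dinc k i (wsum a n w) \<le> dinc k i (U 0 w) + dinc k i (U q w)" using dinc_add by simp
    moreover have "dinc k i (U 0 w) < 2 * y k" "dinc k i (U q w) < 2 * y k" using wt k(1,2) by (force simp: A_def)+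
    ultimately show False using k(3) by linarith
  qed
  then have "prob ?R \<le> prob (A 0 \<union> A q \<union> H)"
    using Aev Hev by (intro finite_measure_mono) auto
  also have "\<dots> \<le> prob (A 0) + prob (A q) + prob H"
    using measure_Un_le[of "A 0 \<union> A q" M H] measure_Un_le[of "A 0" M "A q"] Aev Hev by auto
  finally show ?thesis
    using tblk_level_prob[of a q L K y m V 0 q] tblk_level_prob[of a q L K y m V q q] prob_norm_gt[OF L, of n] assms
    unfolding A_def U_def H_def by simp
qed

text \<open>Cauchy-Schwarz alone bounds the second moment of an increment of the sum by n^2 times
  that of a single error. Compared with the order n this loses a factor n, affordable on grids that
  are fine compared with n.\<close>

lemma fine_prob:
  assumes a: "\<And>i. \<bar>a i\<bar> \<le> 1" and y: "y > 0"
  shows "prob {w \<in> space M. \<exists>i<2 ^ k. dinc k i (wsum a n w) \<ge> y} \<le> 2 ^ k * ((real n)\<^sup>2 * (c\<^sup>2 * (1 / 2 ^ k) powr (2 * \<alpha>)) / y\<^sup>2)"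
proof -
  have one: "prob {w \<in> space M. dinc k i (wsum a n w) \<ge> y} \<le> (real n)\<^sup>2 * (c\<^sup>2 * (1 / 2 ^ k) powr (2 * \<alpha>)) / y\<^sup>2"
    if i: "i < 2 ^ k" for i
  proof -
    define s where "s = grid k i"
    define t where "t = grid k (Suc i)"
    have st: "s \<in> {0..1}" "t \<in> {0..1}" "\<bar>t - s\<bar> = 1 / 2 ^ k" unfolding s_def t_def using grid_step[OF i] by auto
    define X where "X w = val_at (wsum a n w) t - val_at (wsum a n w) s" for w
    define I where "I j w = (val_at (\<epsilon> j w) t - val_at (\<epsilon> j w) s)" for j w
    have [measurable]: "X \<in> borel_measurable M" unfolding X_def by measurable
    have Isq: "sq_mean (I j) \<le> c\<^sup>2 * (1 / 2 ^ k) powr (2 * \<alpha>)" if "j \<ge> 1" for j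
    proof -
      have "sq_mean (I j) = sq_mean (I 1)" unfolding I_def
        using integral_\<epsilon>[OF that, of "\<lambda>x. (val_at x t - val_at x s)\<^sup>2"] by simp
      also have "\<dots> \<le> c\<^sup>2 * \<bar>t - s\<bar> powr (2 * \<alpha>)" unfolding I_def by (rule hoelder[OF st(1,2)])
      finally show ?thesis using st(3) by simp
    qed
    have Iint: "integrable M (\<lambda>w. (I j w)\<^sup>2)" if "j \<ge> 1" for j unfolding I_def by (rule integrable_incr_sq[OF that])
    have X: "(X w)\<^sup>2 \<le> real n * (\<Sum>j\<in>{1..n}. (I j w)\<^sup>2)" for w
    proof -
      have "X w = (\<Sum>j\<in>{1..n}. a j * I j w)" by (simp add: X_def I_def wsum_def sum_subtractf right_diff_distrib)
      then have "(X w)\<^sup>2 \<le> (\<Sum>j\<in>{1..n}. (a j)\<^sup>2) * (\<Sum>j\<in>{1..n}. (I j w)\<^sup>2)"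
        by (simp add: Cauchy_Schwarz_ineq_sum)
      also have "(\<Sum>j\<in>{1..n}. (a j)\<^sup>2) \<le> (\<Sum>j\<in>{1..n}. 1)"
        using a by (intro sum_mono) (simp add: abs_square_le_1)
      finally show ?thesis by (simp add: mult_right_mono sum_nonneg)
    qed
    have int1: "integrable M (\<lambda>w. real n * (\<Sum>j\<in>{1..n}. (I j w)\<^sup>2))"
      using Iint by (intro integrable_mult_right Bochner_Integration.integrable_sum) auto
    have int2: "integrable M (\<lambda>w. (X w)\<^sup>2)"
    proof (rule Bochner_Integration.integrable_bound[OF int1])
      show "AE w in M. norm ((X w)\<^sup>2) \<le> norm (real n * (\<Sum>j\<in>{1..n}. (I j w)\<^sup>2))"
      proof (rule AE_I2)
        fix w show "norm ((X w)\<^sup>2) \<le> norm (real n * (\<Sum>j\<in>{1..n}. (I j w)\<^sup>2))"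
          unfolding real_norm_def abs_power2 using X[of w] by (rule order_trans[OF _ abs_ge_self])
      qed
    qed measurable
    have "sq_mean X \<le> real n * (\<Sum>j\<in>{1..n}. sq_mean (I j))"
      using integral_mono[OF int2 int1 X] Iint by (simp add: Bochner_Integration.integral_sum)
    also have "\<dots> \<le> real n * (\<Sum>j\<in>{1..n}. c\<^sup>2 * (1 / 2 ^ k) powr (2 * \<alpha>))"
      by (intro mult_left_mono sum_mono Isq) auto
    finally have "sq_mean X \<le> (real n)\<^sup>2 * (c\<^sup>2 * (1 / 2 ^ k) powr (2 * \<alpha>))" by (simp add: power2_eq_square)
    moreover have "prob {w \<in> space M. \<bar>X w\<bar> \<ge> y} \<le> sq_mean X / y\<^sup>2"
      by (rule markov_sq[OF _ int2 y]) measurable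
    ultimately show ?thesis
      unfolding dinc_def X_def[symmetric] s_def[symmetric] t_def[symmetric] by (meson divide_right_mono order_trans zero_le_power2)
  qed
  have "{w \<in> space M. \<exists>i<2 ^ k. dinc k i (wsum a n w) \<ge> y} = (\<Union>i\<in>{..<2 ^ k}. {w \<in> space M. dinc k i (wsum a n w) \<ge> y})" by auto
  also have "prob \<dots> \<le> (\<Sum>i\<in>{..<2 ^ k}. prob {w \<in> space M. dinc k i (wsum a n w) \<ge> y})" by (intro measure_UNION_le) auto
  also have "\<dots> \<le> (\<Sum>i\<in>{..<2 ^ k::nat}. (real n)\<^sup>2 * (c\<^sup>2 * (1 / 2 ^ k) powr (2 * \<alpha>)) / y\<^sup>2)" by (intro sum_mono one) simp
  finally show ?thesis by simp
qed

end

section \<open>Choice of the exponents and summation over all levels\<close>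

lemma summable_pow2_exp:
  fixes \<phi> A :: real
  assumes "\<phi> > 0" "A > 0"
  shows "summable (\<lambda>k::nat. 4 * 2 ^ k * exp (- (2 powr (\<phi> * real k)) / A))"
proof (rule summable_comparison_test_bigo)
  show "summable (\<lambda>k. norm ((1/2) ^ k :: real))" by (simp add: summable_geometric)
  show "(\<lambda>k. 4 * 2 ^ k * exp (- (2 powr (\<phi> * real k)) / A)) \<in> O(\<lambda>k. (1/2) ^ k)"
    using assms by real_asymp
qed

lemma summable_two_powr:
  fixes \<phi> :: real
  assumes "\<phi> > 0"
  shows "summable (\<lambda>k::nat. 2 powr (- \<phi> * real k))"
proof -
  have "(2::real) powr (- \<phi>) < 1" using assms powr_less_mono[of "- \<phi>" 0 2] by simp
  then have "summable (\<lambda>k. (2 powr (- \<phi>)) ^ k :: real)" by (intro summable_geometric) simp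
  then show ?thesis by (simp add: powr_power mult.commute)
qed

lemma two_powr_half: "(1 / 2 ^ k) powr x = 2 powr (- x * real k)"
  by (simp add: powr_divide powr_powr powr_minus_divide flip: powr_realpow) (simp add: mult.commute)

context hoelder_mixing_sequence
begin

text \<open>
  The errors are truncated at \<open>n powr \<l>\<close> and the sums cut into blocks of length \<open>n powr \<rho>\<close>; increments
  over the grid of mesh \<open>2 powr - k\<close> have to be of order \<open>2 powr (- \<theta> * k) * sqrt n\<close>. Bernstein's inequality
  covers the levels with \<open>2 ^ k \<le> n powr \<kappa>\<close>, Markov's inequality the finer ones.
\<close>

definition \<gamma> :: real where "\<gamma> = \<delta> / (16 * (2 + \<delta>))"
definition \<rho> :: real where "\<rho> = 3 * \<delta> / (8 * (2 + \<delta>))"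
definition \<l> :: real where "\<l> = 1 / (2 + \<delta>) + \<gamma>"
text \<open>At 2^k = n^\<kappa> one has n = 2^((2\<alpha> - 1) k / 4): beyond this level a surplus
  factor n uses up only a quarter of the exponent gained from Hoelder continuity.\<close>

definition \<kappa> :: real where "\<kappa> = 4 / (2 * \<alpha> - 1)"
text \<open>The three bounds serve, in this order, the fine levels, the Gaussian term and the
  exponential term of Bernstein's inequality on the coarse levels.\<close>

definition \<theta> :: real where "\<theta> = min ((2 * \<alpha> - 1) / 8) (min (\<alpha> / 8) (\<gamma> / (2 * \<kappa>)))"
definition \<phi> :: real where "\<phi> = min (\<alpha> / 4) (\<gamma> / (2 * \<kappa>))"

lemma param_pos: "\<gamma> > 0" "\<rho> > 0" "\<l> > 0" "\<kappa> > 0" "\<theta> > 0" "\<phi> > 0"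
  using \<delta> \<alpha> by (auto simp: \<gamma>_def \<rho>_def \<l>_def \<kappa>_def \<theta>_def \<phi>_def add_pos_pos)

text \<open>Exponent balances. Block length times truncation level is below sqrt n by the factor
  n^\<gamma>; the number of blocks n^(1-\<rho>) times the mixing rate at n^\<rho> is at most
  n^(-1/8); n times the tail probability beyond the truncation level is of order n^(-\<delta>/16);
  and the accumulated truncation bias is again below sqrt n by n^\<gamma>.\<close>

lemma param_facts:
  "\<rho> + \<l> = 1 / 2 - \<gamma>" "\<rho> * (1 + mix_exp \<delta>) \<ge> 9 / 8" "1 - \<l> * (2 + \<delta>) = - \<delta> / 16" "1 - \<l> * (1 + \<delta>) \<le> 1 / 2 - \<gamma>" "\<rho> \<le> 1"
proof -
  have d: "2 + \<delta> > 0" "\<delta> > 0" using \<delta> by auto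
  define D where "D = 2 + \<delta>"
  have D: "D > 0" "\<delta> = D - 2" using d by (simp_all add: D_def)
  have p: "\<gamma> = (D - 2) / (16 * D)" "\<rho> = 3 * (D - 2) / (8 * D)" "\<l> = 1 / D + (D - 2) / (16 * D)"
    by (simp_all add: \<gamma>_def \<rho>_def \<l>_def D_def)
  show "\<rho> + \<l> = 1 / 2 - \<gamma>" unfolding p using D(1) by (simp add: field_simps)
  have "1 - \<l> * D = - (D - 2) / 16" unfolding p using D(1) by (simp add: field_simps)
  then show "1 - \<l> * (2 + \<delta>) = - \<delta> / 16" by (simp add: D_def)
  show "\<rho> \<le> 1" using d by (simp add: \<rho>_def field_simps)
  have "1 / (2 + \<delta>) = 16 / (16 * (2 + \<delta>))" using d by (simp add: field_simps)
  then have "\<l> = (16 + \<delta>) / (16 * (2 + \<delta>))" unfolding \<l>_def \<gamma>_def by (simp only: add_divide_distrib)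
  then have "\<l> * (1 + \<delta>) = (1 + \<delta>) * (16 + \<delta>) / (16 * (2 + \<delta>))" by (simp add: mult.commute)
  then have "1 / 2 - \<gamma> - (1 - \<l> * (1 + \<delta>)) = 1 / 2 - \<delta> / (16 * (2 + \<delta>)) - (1 - (1 + \<delta>) * (16 + \<delta>) / (16 * (2 + \<delta>)))"
    by (simp add: \<gamma>_def)
  also have "\<dots> = ((1 + \<delta>) * (16 + \<delta>) - \<delta>) / (16 * (2 + \<delta>)) - 8 * (2 + \<delta>) / (16 * (2 + \<delta>))"
    using d by (simp add: diff_divide_distrib)
  also have "\<dots> = (\<delta> * (8 + \<delta>)) / (16 * (2 + \<delta>))"
    unfolding diff_divide_distrib[symmetric] by (simp add: algebra_simps)
  also have "\<dots> \<ge> 0" using d by simp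
  finally show "1 - \<l> * (1 + \<delta>) \<le> 1 / 2 - \<gamma>" by simp
  have "1 + mix_exp \<delta> \<ge> 3 * (\<delta> + 2) / \<delta>"
  proof -
    have "1 + mix_exp \<delta> = 3 * (\<delta> + 2) / \<delta> + 4 / \<delta>\<^sup>2" using d by (simp add: mix_exp_def field_simps power2_eq_square)
    then show ?thesis by simp
  qed
  then have "\<rho> * (1 + mix_exp \<delta>) \<ge> \<rho> * (3 * (\<delta> + 2) / \<delta>)" using param_pos by (intro mult_left_mono) auto
  also have "\<rho> * (3 * (\<delta> + 2) / \<delta>) = 9 / 8"
  proof -
    have "\<rho> = 3 * \<delta> / (8 * D)" by (simp add: \<rho>_def D_def)
    then have "\<rho> * (3 * D / \<delta>) = 9 / 8" using D(1) d by simp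
    then show ?thesis by (simp add: D_def add.commute)
  qed
  finally show "\<rho> * (1 + mix_exp \<delta>) \<ge> 9 / 8" .
qed

definition wth :: "nat \<Rightarrow> nat \<Rightarrow> real" where
  "wth n k = 2 powr (- \<theta> * real k) * sqrt (real n)"

definition V0 :: real where "V0 = 2 * var_const 2 * (c\<^sup>2) powr (1/4) + 1"

lemma V0_pos: "V0 > 0"
  unfolding V0_def using var_const_nonneg by (simp add: add_nonneg_pos)

text \<open>The first term bounds the fine levels, the second the coarse ones; its factor 4 counts
  the two families of blocks and the two signs of an increment.\<close>

definition lev :: "nat \<Rightarrow> real" where
  "lev k = c\<^sup>2 * 2 powr (- ((2 * \<alpha> - 1) / 2) * real k) + 4 * 2 ^ k * exp (- (2 powr (\<phi> * real k)) / max (4 * V0) 16)"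

lemma summable_lev: "summable lev"
  unfolding lev_def[abs_def] using \<alpha> param_pos
  by (intro summable_add summable_mult summable_two_powr summable_pow2_exp) auto

lemma lev_nonneg: "lev k \<ge> 0" by (simp add: lev_def)

text \<open>Up to a constant \<open>fine_prob\<close> gives n * 2^((1 - 2\<alpha> + 2\<theta>) k).
  Beyond level n^\<kappa> the factor n is at most 2^((2\<alpha> - 1) k / 4), and with \<theta> \<le>
  (2\<alpha> - 1)/8 the exponent that remains is at most - (2\<alpha> - 1) k / 2.\<close>

lemma fine_level:
  assumes a: "\<And>i. \<bar>a i\<bar> \<le> 1" and n: "n \<ge> 1" and k: "real n powr \<kappa> < 2 ^ k"
  shows "prob {w \<in> space M. \<exists>i<2 ^ k. dinc k i (wsum a n w) \<ge> 4 * wth n k} \<le> lev k"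
proof -
  have y: "4 * wth n k > 0" using n by (simp add: wth_def)
  have n0: "real n > 0" using n by simp
  have "real n = (real n powr \<kappa>) powr (1 / \<kappa>)" using param_pos n0 by (simp add: powr_powr)
  also have "\<dots> \<le> (2 ^ k) powr (1 / \<kappa>)" using k param_pos by (intro powr_mono2) auto
  also have "\<dots> = 2 powr ((2 * \<alpha> - 1) / 4 * real k)" by (simp add: \<kappa>_def powr_powr mult.commute flip: powr_realpow)
  finally have nle: "real n \<le> 2 powr ((2 * \<alpha> - 1) / 4 * real k)" .
  have sq: "(4 * wth n k)\<^sup>2 = 16 * (2 powr (- 2 * \<theta> * real k) * real n)"
    by (simp add: wth_def power_mult_distrib powr_power mult_ac)
  have "prob {w \<in> space M. \<exists>i<2 ^ k. dinc k i (wsum a n w) \<ge> 4 * wth n k} \<le>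
      2 ^ k * ((real n)\<^sup>2 * (c\<^sup>2 * (1 / 2 ^ k) powr (2 * \<alpha>)) / (4 * wth n k)\<^sup>2)"
    by (rule fine_prob[OF a y])
  also have "\<dots> = c\<^sup>2 / 16 * (2 ^ k * 2 powr (- (2 * \<alpha>) * real k) * 2 powr (2 * \<theta> * real k)) * real n"
    unfolding sq two_powr_half using n0 by (simp add: power2_eq_square powr_minus_divide mult_ac)
  also have "2 ^ k * 2 powr (- (2 * \<alpha>) * real k) * 2 powr (2 * \<theta> * real k) = (2::real) powr ((1 - 2 * \<alpha> + 2 * \<theta>) * real k)"
    by (simp add: algebra_simps flip: powr_realpow powr_add)
  also have "c\<^sup>2 / 16 * (2::real) powr ((1 - 2 * \<alpha> + 2 * \<theta>) * real k) * real n \<le>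
     c\<^sup>2 / 16 * (2::real) powr ((1 - 2 * \<alpha> + 2 * \<theta>) * real k) * 2 powr ((2 * \<alpha> - 1) / 4 * real k)"
    using nle by (intro mult_left_mono) auto
  also have "\<dots> = c\<^sup>2 / 16 * 2 powr ((1 - 2 * \<alpha> + 2 * \<theta> + (2 * \<alpha> - 1) / 4) * real k)"
    by (simp add: algebra_simps flip: powr_add)
  also have "\<dots> \<le> c\<^sup>2 * 2 powr (- ((2 * \<alpha> - 1) / 2) * real k)"
  proof -
    have "\<theta> \<le> (2 * \<alpha> - 1) / 8" unfolding \<theta>_def by (rule min.cobounded1)
    then have "1 - 2 * \<alpha> + 2 * \<theta> + (2 * \<alpha> - 1) / 4 \<le> - ((2 * \<alpha> - 1) / 2)" by (simp add: field_simps)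
    then have "2 powr ((1 - 2 * \<alpha> + 2 * \<theta> + (2 * \<alpha> - 1) / 4) * real k) \<le> 2 powr (- ((2 * \<alpha> - 1) / 2) * real k)"
      by (intro powr_mono mult_right_mono) auto
    then show ?thesis by (intro mult_mono) auto
  qed
  also have "\<dots> \<le> lev k" by (simp add: lev_def)
  finally show ?thesis .
qed

definition qn :: "nat \<Rightarrow> nat" where "qn n = nat \<lceil>real n powr \<rho>\<rceil>"

lemma qn:
  assumes "n \<ge> 1"
  shows "qn n \<ge> 1" "real n powr \<rho> \<le> real (qn n)" "real (qn n) \<le> 2 * real n powr \<rho>" "qn n \<le> n"
proof -
  have 1: "real n powr \<rho> \<ge> 1" using assms param_pos by (simp add: ge_one_powr_ge_zero)
  have 2: "real n powr \<rho> \<le> real n" using assms powr_mono[of \<rho> 1 "real n"] param_facts(5) by simp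
  show "real n powr \<rho> \<le> real (qn n)" unfolding qn_def by linarith
  then show "qn n \<ge> 1" using 1 by linarith
  show "real (qn n) \<le> 2 * real n powr \<rho>" unfolding qn_def using 1 by linarith
  show "qn n \<le> n" unfolding qn_def using 2 by (simp add: nat_le_iff ceiling_le_iff)
qed

text \<open>Collects the errors that are paid once for all coarse levels: independence of the
  blocks, for both families, and the truncation event.\<close>

definition rem :: "nat \<Rightarrow> real" where
  "rem n = 2 * (C\<beta> * (real n powr (- 1 / 8) + real n powr (- \<rho> * mix_exp \<delta>))) + \<mu>p * real n powr (- \<delta> / 16)"

lemma rem_tendsto: "rem \<longlonglongrightarrow> 0"
proof -
  have mp: "mix_exp \<delta> > 0" using \<delta> by (simp add: mix_exp_def add_pos_pos)
  have *: "(\<lambda>n. real n powr (- x)) \<longlonglongrightarrow> 0" if "x > 0" for x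
    using tendsto_neg_powr[of "- x" "\<lambda>n. real n" sequentially] that filterlim_real_sequentially by simp
  have "(\<lambda>n. 2 * (C\<beta> * (real n powr (- (1 / 8)) + real n powr (- (\<rho> * mix_exp \<delta>)))) + \<mu>p * real n powr (- (\<delta> / 16)))
    \<longlonglongrightarrow> 2 * (C\<beta> * (0 + 0)) + \<mu>p * 0"
    using \<delta> mp param_pos by (intro tendsto_intros *) auto
  then show ?thesis by (simp add: rem_def[abs_def])
qed

text \<open>On coarse levels n^\<gamma> is at least 2^(\<gamma> k / \<kappa>). One half of this
  exponent outweighs the grid weight 2^(-\<theta> k); the other half is left for the Bernstein
  exponent, or absorbs the constant 4 \<mu>p of the bias, which is why \<open>N\<close> must be
  large.\<close>

lemma coarse_levels:
  assumes a: "\<And>i. \<bar>a i\<bar> \<le> 1" "\<And>i. i > n \<Longrightarrow> a i = 0" and n: "n \<ge> 1"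
    and K: "finite K" "\<And>k. k \<in> K \<Longrightarrow> k \<ge> N \<and> 2 ^ k \<le> real n powr \<kappa>"
    and N: "4 * \<mu>p \<le> 2 powr (\<gamma> / (2 * \<kappa>) * real N)"
  shows "prob {w \<in> space M. \<exists>k\<in>K. \<exists>i<2 ^ k. dinc k i (wsum a n w) \<ge> 4 * wth n k} \<le> (\<Sum>k\<in>K. lev k) + rem n"
proof -
  define q where "q = qn n"
  define L where "L = real n powr \<l>"
  \<comment> \<open>One period more than fits into \<open>n\<close>, so that every index is covered;
    the overhang is harmless because the weights vanish beyond \<open>n\<close>.\<close>
  define m where "m = n div (q + q) + 1"
  define b where "b = mix_exp \<delta>"
  note q = qn[OF n, folded q_def]
  have n0: "real n > 0" "real n \<ge> 1" using n by auto
  have L: "L > 0" using n0 by (simp add: L_def)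
  have nL: "real n * L powr (- x) = real n powr (1 - \<l> * x)" for x
    unfolding L_def powr_powr using n0 by (simp add: powr_diff powr_minus_divide)
  have m1: "n \<le> m * (q + q)"
  proof -
    have "n = (n div (q + q)) * (q + q) + n mod (q + q)" by (simp only: div_mult_mod_eq)
    also have "n mod (q + q) \<le> q + q" using q(1) by (intro less_imp_le mod_less_divisor) auto
    finally show ?thesis by (simp add: m_def)
  qed
  have "(n div (q + q)) * (q + q) \<le> n" by (rule div_times_less_eq_dividend)
  then have mq: "m * q \<le> 2 * n" using q(4) by (simp add: m_def algebra_simps)
  then have mq': "real m * real q \<le> 2 * real n" by (simp flip: of_nat_mult)
  have mle: "real m \<le> real n / real q + 1"
  proof -
    have "real (n div (q + q)) \<le> real n / real (q + q)" by (rule of_nat_div_le_of_nat)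
    also have "\<dots> \<le> real n / real q" using q(1) by (intro divide_left_mono) auto
    finally show ?thesis by (simp add: m_def)
  qed
  have nlarge: "2 powr (real k / \<kappa>) \<le> real n" if "k \<in> K" for k
  proof -
    have "2 powr (real k / \<kappa>) = (2 ^ k) powr (1 / \<kappa>)" by (simp add: powr_powr flip: powr_realpow)
    also have "\<dots> \<le> (real n powr \<kappa>) powr (1 / \<kappa>)" using K(2)[OF that] param_pos by (intro powr_mono2) auto
    also have "\<dots> = real n" using param_pos n0 by (simp add: powr_powr)
    finally show ?thesis .
  qed
  have \<theta>le: "\<theta> \<le> \<gamma> / (2 * \<kappa>)" "\<theta> \<le> \<alpha> / 8" unfolding \<theta>_def by linarith+
  have ngam: "2 powr (\<gamma> / \<kappa> * real k) \<le> real n powr \<gamma>" if "k \<in> K" for k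
    using powr_mono2[OF _ _ nlarge[OF that], of \<gamma>] param_pos by (simp add: powr_powr mult.commute)
  have decomp: "\<gamma> / \<kappa> = \<gamma> / (2 * \<kappa>) + \<gamma> / (2 * \<kappa>)" by (simp add: field_simps)
  define V where "V k = real n * (V0 * 2 powr (- (\<alpha> / 2) * real k))" for k :: nat
  have "prob {w \<in> space M. \<exists>k\<in>K. \<exists>i<2 ^ k. dinc k i (wsum a n w) \<ge> 4 * wth n k}
    \<le> 2 * ((\<Sum>k\<in>K. 2 ^ k * (2 * exp (- min ((wth n k)\<^sup>2 / (4 * V k)) (wth n k / (8 * real q * L))))) + real m * \<beta> q)
       + real n * (\<mu>p * L powr (- (2 + \<delta>)))"
  proof (rule coarse_prob[OF a m1 q(1) L K(1)])
    fix k assume k: "k \<in> K"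
    show "wth n k > 0" using n0 by (simp add: wth_def)
    show "V k > 0" using n0 V0_pos by (simp add: V_def)
    have "(c\<^sup>2 * (1 / 2 ^ k) powr (2 * \<alpha>)) powr (1/4) = (c\<^sup>2) powr (1/4) * 2 powr (- (\<alpha> / 2) * real k)"
      by (simp add: two_powr_half powr_mult powr_powr)
    then have "real m * real q * var_const 2 * (c\<^sup>2 * (1 / 2 ^ k) powr (2 * \<alpha>)) powr (1/4) =
       (real m * real q) * (var_const 2 * (c\<^sup>2) powr (1/4) * 2 powr (- (\<alpha> / 2) * real k))" by simp
    also have "\<dots> \<le> (2 * real n) * (var_const 2 * (c\<^sup>2) powr (1/4) * 2 powr (- (\<alpha> / 2) * real k))"
      using mq' var_const_nonneg by (intro mult_right_mono) auto
    also have "\<dots> \<le> V k" unfolding V_def V0_def by (simp add: algebra_simps)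
    finally show "real m * real q * var_const 2 * (c\<^sup>2 * (1 / 2 ^ k) powr (2 * \<alpha>)) powr (1/4) \<le> V k" .
    have "real m * real q * (2 * \<mu>p * L powr (- (1 + \<delta>))) \<le> (2 * real n) * (2 * \<mu>p * L powr (- (1 + \<delta>)))"
      using mq' \<mu>p_nonneg by (intro mult_right_mono) auto
    also have "\<dots> = 4 * \<mu>p * real n powr (1 - \<l> * (1 + \<delta>))"
      using nL[of "1 + \<delta>"] by simp
    also have "\<dots> \<le> 4 * \<mu>p * real n powr (1 / 2 - \<gamma>)"
      using n0 param_facts(4) \<mu>p_nonneg by (intro mult_left_mono powr_mono) auto
    also have "\<dots> = 4 * \<mu>p / real n powr \<gamma> * sqrt (real n)"
      using n0 by (simp add: powr_diff powr_half_sqrt)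
    also have "\<dots> \<le> 2 powr (- \<theta> * real k) * sqrt (real n)"
    proof (intro mult_right_mono)
      have "4 * \<mu>p \<le> 2 powr (\<gamma> / (2 * \<kappa>) * real k)"
        using K(2)[OF k] param_pos by (intro order_trans[OF N] powr_mono mult_left_mono) auto
      moreover have "2 powr (\<theta> * real k) \<le> 2 powr (\<gamma> / (2 * \<kappa>) * real k)"
        using \<theta>le(1) by (intro powr_mono mult_right_mono) auto
      ultimately have "4 * \<mu>p * 2 powr (\<theta> * real k) \<le> 2 powr (\<gamma> / (2 * \<kappa>) * real k) * 2 powr (\<gamma> / (2 * \<kappa>) * real k)"
        by (intro mult_mono) auto
      also have "\<dots> = 2 powr (\<gamma> / (2 * \<kappa>) * real k + \<gamma> / (2 * \<kappa>) * real k)" by (simp only: powr_add)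
      also have "\<dots> = 2 powr (\<gamma> / \<kappa> * real k)" unfolding decomp by (simp only: distrib_right)
      also have "\<dots> \<le> real n powr \<gamma>" by (rule ngam[OF k])
      finally show "4 * \<mu>p / real n powr \<gamma> \<le> 2 powr (- \<theta> * real k)"
        using n0 by (simp add: powr_minus_divide field_simps)
    qed simp
    finally show "real m * real q * (2 * \<mu>p * L powr (- (1 + \<delta>))) \<le> wth n k" by (simp add: wth_def)
  qed
  also have "\<dots> \<le> 2 * ((\<Sum>k\<in>K. 2 ^ k * (2 * exp (- (2 powr (\<phi> * real k)) / max (4 * V0) 16))) + C\<beta> * (real n powr (- 1 / 8) + real n powr (- \<rho> * b)))
       + \<mu>p * real n powr (- \<delta> / 16)"
  proof (intro add_mono mult_left_mono sum_mono)
    fix k assume k: "k \<in> K"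
    have "2 powr (\<phi> * real k) / max (4 * V0) 16 \<le> (wth n k)\<^sup>2 / (4 * V k)"
    proof -
      have "2 powr (\<phi> * real k) / max (4 * V0) 16 \<le> 2 powr ((\<alpha> / 2 - 2 * \<theta>) * real k) / (4 * V0)"
      proof -
        have "\<phi> \<le> \<alpha> / 2 - 2 * \<theta>" using \<theta>le(2) unfolding \<phi>_def by linarith
        then show ?thesis using V0_pos by (intro frac_le powr_mono mult_right_mono) auto
      qed
      also have "\<dots> = 2 powr (- 2 * \<theta> * real k) * 2 powr (\<alpha> / 2 * real k) / (4 * V0)"
        by (simp add: algebra_simps flip: powr_add)
      also have "\<dots> = (wth n k)\<^sup>2 / (4 * V k)"
      proof -
        have "(wth n k)\<^sup>2 = 2 powr (- 2 * \<theta> * real k) * real n"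
          by (simp add: wth_def power_mult_distrib powr_power mult_ac)
        then show ?thesis using n0 by (simp add: V_def powr_minus_divide)
      qed
      finally show ?thesis .
    qed
    moreover have "2 powr (\<phi> * real k) / max (4 * V0) 16 \<le> wth n k / (8 * real q * L)"
    proof -
      have "2 powr (\<phi> * real k) / max (4 * V0) 16 \<le> 2 powr ((\<gamma> / \<kappa> - \<theta>) * real k) / 16"
      proof -
        have "\<phi> \<le> \<gamma> / \<kappa> - \<theta>" using \<theta>le(1) decomp unfolding \<phi>_def by linarith
        then show ?thesis by (intro frac_le powr_mono mult_right_mono) auto
      qed
      also have "\<dots> = 2 powr (- \<theta> * real k) * 2 powr (\<gamma> / \<kappa> * real k) / 16"
        by (simp add: algebra_simps flip: powr_add)
      also have "\<dots> \<le> 2 powr (- \<theta> * real k) * real n powr \<gamma> / 16"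
        using ngam[OF k] by (intro divide_right_mono mult_left_mono) auto
      also have "\<dots> = wth n k / (16 * real n powr (1 / 2 - \<gamma>))"
        using n0 by (simp add: wth_def powr_diff powr_half_sqrt)
      also have "\<dots> \<le> wth n k / (8 * real q * L)"
      proof (intro divide_left_mono)
        have "8 * real q * L \<le> 8 * (2 * real n powr \<rho>) * L" using q(3) L by (intro mult_right_mono) auto
        also have "\<dots> = 16 * real n powr (1 / 2 - \<gamma>)" by (simp add: L_def flip: param_facts(1) powr_add)
        finally show "8 * real q * L \<le> 16 * real n powr (1 / 2 - \<gamma>)" .
      qed (use q L n0 in \<open>auto simp: wth_def\<close>)
      finally show ?thesis .
    qed
    ultimately show "exp (- min ((wth n k)\<^sup>2 / (4 * V k)) (wth n k / (8 * real q * L))) \<le> exp (- (2 powr (\<phi> * real k)) / max (4 * V0) 16)"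
      by simp
  next
    have bq: "\<beta> q \<le> C\<beta> * real n powr (- \<rho> * b)"
    proof -
      have "\<beta> q \<le> C\<beta> * real q powr (- b)" unfolding b_def by (rule beta_bound[OF q(1)])
      also have "\<dots> \<le> C\<beta> * (real n powr \<rho>) powr (- b)"
        using q(2) n0 C\<beta>_nonneg \<delta> by (intro mult_left_mono powr_mono2') (auto simp: b_def mix_exp_def)
      finally show ?thesis by (simp add: powr_powr)
    qed
    have "real m \<le> real n powr (1 - \<rho>) + 1"
    proof -
      have "real n / real q \<le> real n / real n powr \<rho>" using q n0 by (intro divide_left_mono) auto
      also have "\<dots> = real n powr (1 - \<rho>)" using n0 by (simp add: powr_diff)
      finally show ?thesis using mle by simp
    qed
    then have "real m * \<beta> q \<le> (real n powr (1 - \<rho>) + 1) * (C\<beta> * real n powr (- \<rho> * b))"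
      using bq beta_coeff_nonneg by (intro mult_mono) auto
    also have "\<dots> = C\<beta> * (real n powr (1 - \<rho> - \<rho> * b) + real n powr (- \<rho> * b))"
      by (simp add: algebra_simps flip: powr_add)
    also have "\<dots> \<le> C\<beta> * (real n powr (- 1 / 8) + real n powr (- \<rho> * b))"
      using n0 C\<beta>_nonneg param_facts(2) by (intro mult_left_mono add_right_mono powr_mono) (auto simp: b_def algebra_simps)
    finally show "real m * \<beta> q \<le> C\<beta> * (real n powr (- 1 / 8) + real n powr (- \<rho> * b))" .
  next
    have "real n * L powr (- (2 + \<delta>)) = real n powr (1 - \<l> * (2 + \<delta>))"
      by (rule nL)
    then show "real n * (\<mu>p * L powr (- (2 + \<delta>))) \<le> \<mu>p * real n powr (- \<delta> / 16)"
      unfolding param_facts(3) mult.left_commute[of "real n" \<mu>p] by (rule ssubst) (rule order_refl)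
  qed auto
  also have "\<dots> \<le> (\<Sum>k\<in>K. lev k) + rem n"
  proof -
    have "2 * (\<Sum>k\<in>K. 2 ^ k * (2 * exp (- (2 powr (\<phi> * real k)) / max (4 * V0) 16))) \<le> (\<Sum>k\<in>K. lev k)"
      unfolding sum_distrib_left lev_def by (intro sum_mono) simp
    then show ?thesis by (simp add: rem_def b_def)
  qed
  finally show ?thesis .
qed


text \<open>The finitely many coarse levels are treated jointly, so that \<open>rem n\<close> enters
  once; the fine levels are summed one by one. Both parts are bounded by the tail of the same
  convergent series, hence the factor two.\<close>

lemma all_levels:
  assumes a: "\<And>i. \<bar>a i\<bar> \<le> 1" "\<And>i. i > n \<Longrightarrow> a i = 0" and n: "n \<ge> 1"
    and N: "4 * \<mu>p \<le> 2 powr (\<gamma> / (2 * \<kappa>) * real N)"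
  shows "prob {w \<in> space M. \<exists>k\<ge>N. \<exists>i<2 ^ k. dinc k i (wsum a n w) \<ge> 4 * wth n k} \<le> 2 * (\<Sum>k. lev (k + N)) + rem n"
proof -
  let ?R = "{w \<in> space M. \<exists>k\<ge>N. \<exists>i<2 ^ k. dinc k i (wsum a n w) \<ge> 4 * wth n k}"
  define E where "E k = {w \<in> space M. \<exists>i<2 ^ k. dinc k i (wsum a n w) \<ge> 4 * wth n k}" for k
  have E[measurable]: "E k \<in> events" for k
  proof -
    have "E k = (\<Union>i\<in>{..<2 ^ k}. {w \<in> space M. dinc k i (wsum a n w) \<ge> 4 * wth n k})" by (auto simp: E_def)
    also have "\<dots> \<in> events" by (intro sets.finite_UN) auto
    finally show ?thesis .
  qed
  define K where "K = {k. k \<ge> N \<and> 2 ^ k \<le> real n powr \<kappa>}"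
  have "K \<subseteq> {..nat \<lceil>real n powr \<kappa>\<rceil>}"
  proof
    fix k assume "k \<in> K"
    then have "2 ^ k \<le> real n powr \<kappa>" by (simp add: K_def)
    then have "real k \<le> real n powr \<kappa>" using of_nat_less_two_power[of k, where 'a=real] by linarith
    then show "k \<in> {..nat \<lceil>real n powr \<kappa>\<rceil>}" by (simp add: nat_le_iff le_nat_iff) linarith
  qed
  then have K: "finite K" by (rule finite_subset) simp
  \<comment> \<open>The coarse levels are blanked out, so that countable subadditivity applies to a
    sequence starting at level \<open>N\<close>.\<close>
  define F where "F k = (if k + N \<in> K then {} else E (k + N))" for k
  have F: "F k \<in> events" for k by (simp add: F_def)
  have Fle: "prob (F k) \<le> lev (k + N)" for k
  proof (cases "k + N \<in> K")
    case False
    then have "real n powr \<kappa> < 2 ^ (k + N)" by (simp add: K_def)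
    then show ?thesis using fine_level[OF a(1) n] False by (simp add: F_def E_def)
  qed (simp add: F_def lev_nonneg)
  have slev: "summable (\<lambda>k. lev (k + N))" by (rule summable_ignore_initial_segment[OF summable_lev])
  have sF: "summable (\<lambda>k. prob (F k))"
    by (rule summable_comparison_test'[OF slev]) (simp add: Fle)
  have "?R \<subseteq> (\<Union>k\<in>K. E k) \<union> (\<Union>k. F k)"
  proof
    fix w assume "w \<in> ?R"
    then obtain k where k: "k \<ge> N" "w \<in> E k" by (auto simp: E_def)
    show "w \<in> (\<Union>k\<in>K. E k) \<union> (\<Union>k. F k)"
    proof (cases "k \<in> K")
      case False
      then have "w \<in> F (k - N)" using k by (simp add: F_def)
      then show ?thesis by blast
    qed (use k in blast)
  qed
  then have "prob ?R \<le> prob ((\<Union>k\<in>K. E k) \<union> (\<Union>k. F k))"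
    using K F by (intro finite_measure_mono) (auto intro!: sets.Un sets.finite_UN sets.countable_UN)
  also have "\<dots> \<le> prob (\<Union>k\<in>K. E k) + prob (\<Union>k. F k)"
    using K F by (intro measure_Un_le) auto
  also have "prob (\<Union>k. F k) \<le> (\<Sum>k. prob (F k))"
    using F sF by (intro finite_measure_subadditive_countably) auto
  also have "\<dots> \<le> (\<Sum>k. lev (k + N))" by (intro suminf_le Fle sF slev)
  also have "prob (\<Union>k\<in>K. E k) \<le> (\<Sum>k\<in>K. lev k) + rem n"
  proof -
    have "(\<Union>k\<in>K. E k) = {w \<in> space M. \<exists>k\<in>K. \<exists>i<2 ^ k. dinc k i (wsum a n w) \<ge> 4 * wth n k}" by (auto simp: E_def)
    moreover have "prob {w \<in> space M. \<exists>k\<in>K. \<exists>i<2 ^ k. dinc k i (wsum a n w) \<ge> 4 * wth n k} \<le> (\<Sum>k\<in>K. lev k) + rem n"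
      by (rule coarse_levels[OF a n K _ N]) (simp_all add: K_def)
    ultimately show ?thesis by simp
  qed
  also have "(\<Sum>k\<in>K. lev k) \<le> (\<Sum>k. lev (k + N))"
  proof -
    have "(\<Sum>k\<in>K. lev k) = (\<Sum>k\<in>(\<lambda>k. k - N) ` K. lev (k + N))"
      by (subst sum.reindex) (auto simp: K_def inj_on_def)
    also have "\<dots> \<le> (\<Sum>k. lev (k + N))" using slev K by (intro sum_le_suminf) (auto simp: lev_nonneg)
    finally show ?thesis .
  qed
  finally show ?thesis by simp
qed

text \<open>Outside one exceptional event all increments from level \<open>N\<close> on are below
  the geometric sequence \<open>4 * wth n k\<close>, and chaining sums it to a multiple of
  2^(-\<theta> N) sqrt n. The statement is uniform in the weights because those of the CUSUM process
  change with \<open>n\<close>.\<close>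

lemma wsum_tight:
  assumes "e > 0" "\<eta> > 0"
  shows "\<exists>N0. \<forall>N\<ge>N0. \<exists>n0. \<forall>n\<ge>n0. \<forall>a. (\<forall>i. \<bar>a i\<bar> \<le> 1) \<and> (\<forall>i>n. a i = 0) \<longrightarrow>
    prob {w \<in> space M. norm (wsum a n w - disc N (wsum a n w)) > e * sqrt (real n)} \<le> \<eta>"
proof -
  define wt where "wt = (2::real) powr (- \<theta>)"
  have wt: "0 < wt" "wt < 1" using param_pos powr_less_mono[of "- \<theta>" 0 2] by (simp_all add: wt_def)
  obtain N1 where N1: "\<And>N. N \<ge> N1 \<Longrightarrow> norm (\<Sum>k. lev (k + N)) < \<eta> / 4"
    using suminf_exist_split[OF _ summable_lev, of "\<eta>/4"] assms(2) by auto
  have "((\<lambda>N. 4 * wt ^ N / (1 - wt)) \<longlongrightarrow> 4 * 0 / (1 - wt)) sequentially"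
    using wt by (intro tendsto_intros LIMSEQ_power_zero) auto
  then have "eventually (\<lambda>N. 4 * wt ^ N / (1 - wt) < e) sequentially"
    using assms(1) by (intro order_tendstoD(2)) auto
  then obtain N2 where N2: "\<And>N. N \<ge> N2 \<Longrightarrow> 4 * wt ^ N / (1 - wt) < e" by (auto simp: eventually_sequentially)
  have "filterlim (\<lambda>N. 2 powr (\<gamma> / (2 * \<kappa>) * real N)) at_top sequentially"
  proof -
    have "filterlim (\<lambda>N. 2 powr (x * real N)) at_top sequentially" if "x > 0" for x :: real
      using that by real_asymp
    moreover have "\<gamma> / (2 * \<kappa>) > 0" using param_pos by simp
    ultimately show ?thesis by blast
  qed
  then have "eventually (\<lambda>N. 4 * \<mu>p \<le> 2 powr (\<gamma> / (2 * \<kappa>) * real N)) sequentially"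
    by (simp add: filterlim_at_top)
  then obtain N3 where N3: "\<And>N. N \<ge> N3 \<Longrightarrow> 4 * \<mu>p \<le> 2 powr (\<gamma> / (2 * \<kappa>) * real N)" by (auto simp: eventually_sequentially)
  have "eventually (\<lambda>n. rem n < \<eta> / 2) sequentially" using rem_tendsto assms(2) by (intro order_tendstoD(2)) auto
  then obtain n1 where n1: "\<And>n. n \<ge> n1 \<Longrightarrow> rem n < \<eta> / 2" by (auto simp: eventually_sequentially)
  show ?thesis
  proof (rule exI[of _ "max N1 (max N2 N3)"], intro allI impI, rule exI[of _ "max n1 1"], intro allI impI)
    fix N n and a :: "nat \<Rightarrow> real"
    assume N: "max N1 (max N2 N3) \<le> N" and n: "max n1 1 \<le> n" and a: "(\<forall>i. \<bar>a i\<bar> \<le> 1) \<and> (\<forall>i>n. a i = 0)"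
  let ?R = "{w \<in> space M. \<exists>k\<ge>N. \<exists>i<2 ^ k. dinc k i (wsum a n w) \<ge> 4 * wth n k}"
  let ?T = "{w \<in> space M. norm (wsum a n w - disc N (wsum a n w)) > e * sqrt (real n)}"
    have "?T \<subseteq>
      ?R"
    proof (rule subsetI, rule ccontr)
      fix w assume w1: "w \<in> ?T"
        "w \<notin> ?R"
      have wth: "wth n k = wt ^ k * sqrt (real n)" for k
        by (simp add: wth_def wt_def powr_power mult.commute)
      have geo: "(\<Sum>k=N..K. wt ^ k) \<le> wt ^ N / (1 - wt)" for K
      proof (cases "N \<le> K")
        case True
        have "(\<Sum>k=N..K. wt ^ k) = (wt ^ N - wt ^ Suc K) / (1 - wt)" using wt True by (simp add: sum_gp)
        also have "\<dots> \<le> wt ^ N / (1 - wt)" using wt by (intro divide_right_mono) auto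
        finally show ?thesis .
      qed (use wt in simp)
      have "norm (wsum a n w - disc N (wsum a n w)) \<le> 4 * sqrt (real n) * (wt ^ N / (1 - wt))"
      proof (rule norm_diff_disc_le_chaining[where a="\<lambda>k. 4 * wth n k"])
        fix k i assume "N \<le> k" "i < (2::nat) ^ k"
        then have "dinc k i (wsum a n w) < 4 * wth n k" using w1 by force
        then show "\<bar>val_at (wsum a n w) (grid k (Suc i)) - val_at (wsum a n w) (grid k i)\<bar> \<le> 4 * wth n k"
          by (simp add: dinc_def)
      next
        fix K
        have "(\<Sum>k=N..K. 4 * wth n k) = 4 * sqrt (real n) * (\<Sum>k=N..K. wt ^ k)"
          by (simp add: wth sum_distrib_left mult_ac)
        also have "\<dots> \<le> 4 * sqrt (real n) * (wt ^ N / (1 - wt))" by (intro mult_left_mono geo) auto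
        finally show "(\<Sum>k=N..K. 4 * wth n k) \<le> 4 * sqrt (real n) * (wt ^ N / (1 - wt))" .
      qed
      also have "\<dots> = 4 * wt ^ N / (1 - wt) * sqrt (real n)" by simp
      also have "\<dots> \<le> e * sqrt (real n)" using N2[of N] N by (intro mult_right_mono) auto
      finally show False using w1(1) by simp
    qed
    moreover have "?R \<in> events"
    proof -
      have "?R =
        (\<Union>k\<in>{N..}. \<Union>i\<in>{..<2 ^ k}. {w \<in> space M. dinc k i (wsum a n w) \<ge> 4 * wth n k})" by auto
      also have "\<dots> \<in> events" by (intro sets.countable_UN' sets.finite_UN) auto
      finally show ?thesis .
    qed
    ultimately have "prob ?T \<le>
      prob ?R" by (rule finite_measure_mono)
    also have "\<dots> \<le> 2 * (\<Sum>k. lev (k + N)) + rem n"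
      using a n N3[of N] N by (intro all_levels) auto
    also have "\<dots> \<le> \<eta>" using N1[of N] n1[of n] N n by auto
    finally show "prob ?T \<le> \<eta>" .
  qed
qed

end

section \<open>A central limit theorem for weighted sums\<close>

lemma (in prob_space) expectation_abs_le_sqrt:
  fixes X :: "'a \<Rightarrow> real"
  assumes [measurable]: "X \<in> borel_measurable M" and "integrable M (\<lambda>w. (X w)\<^sup>2)"
  shows "(LINT w|M. \<bar>X w\<bar>) \<le> sqrt (sq_mean X)"
proof (rule real_le_rsqrt)
  have "integrable M X" using assms by (rule square_integrable_imp_integrable)
  then have "integrable M (\<lambda>w. \<bar>X w\<bar>)" by simp
  then have "variance (\<lambda>w. \<bar>X w\<bar>) = sq_mean X - (LINT w|M. \<bar>X w\<bar>)\<^sup>2"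
    using assms by (subst variance_eq) auto
  then show "(LINT w|M. \<bar>X w\<bar>)\<^sup>2 \<le> sq_mean X"
    using variance_positive[of "\<lambda>w. \<bar>X w\<bar>"] by linarith
qed

lemma (in prob_space) expectation_iexp_diff_le:
  fixes X Y :: "'a \<Rightarrow> real"
  assumes [measurable]: "X \<in> borel_measurable M" "Y \<in> borel_measurable M" and sq: "integrable M (\<lambda>w. (Y w)\<^sup>2)"
    and le: "sq_mean Y \<le> u"
  shows "cmod ((CLINT w|M. iexp (t * (X w + Y w))) - (CLINT w|M. iexp (t * X w))) \<le> \<bar>t\<bar> * sqrt u"
proof -
  have int: "integrable M (\<lambda>w. iexp (t * Z w))" if [measurable]: "Z \<in> borel_measurable M" for Z :: "'a \<Rightarrow> real"
    by (intro integrable_const_bound[of _ 1]) auto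
  have intY: "integrable M Y" by (rule square_integrable_imp_integrable[OF assms(2) sq])
  have pt: "cmod (iexp (t * (X w + Y w)) - iexp (t * X w)) \<le> \<bar>t\<bar> * \<bar>Y w\<bar>" for w
  proof -
    have "iexp (t * (X w + Y w)) = iexp (t * X w) * iexp (t * Y w)"
      by (simp only: distrib_left of_real_add exp_add)
    then have "iexp (t * (X w + Y w)) - iexp (t * X w) = iexp (t * X w) * (iexp (t * Y w) - 1)"
      by (simp only: right_diff_distrib mult_1_right)
    also have "cmod \<dots> = cmod (iexp (t * Y w) - 1)" by (simp add: norm_mult)
    also have "\<dots> \<le> \<bar>t * Y w\<bar>" using iexp_approx1[of "t * Y w" 0] by simp
    finally show ?thesis by (simp add: abs_mult)
  qed
  have "(CLINT w|M. iexp (t * (X w + Y w))) - (CLINT w|M. iexp (t * X w)) =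
     (CLINT w|M. iexp (t * (X w + Y w)) - iexp (t * X w))"
    by (intro Bochner_Integration.integral_diff[symmetric] int) measurable
  also have "cmod \<dots> \<le> (LINT w|M. cmod (iexp (t * (X w + Y w)) - iexp (t * X w)))" by (rule integral_norm_bound)
  also have "\<dots> \<le> (LINT w|M. \<bar>t\<bar> * \<bar>Y w\<bar>)"
    using intY pt int[of "\<lambda>w. X w + Y w"] int[of X]
    by (intro integral_mono integrable_norm Bochner_Integration.integrable_diff integrable_mult_right integrable_abs) auto
  also have "\<dots> = \<bar>t\<bar> * (LINT w|M. \<bar>Y w\<bar>)" by simp
  also have "\<dots> \<le> \<bar>t\<bar> * sqrt (sq_mean Y)"
    using expectation_abs_le_sqrt[OF _ sq] by (intro mult_left_mono) auto
  also have "\<dots> \<le> \<bar>t\<bar> * sqrt u" using le by (intro mult_left_mono) auto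
  finally show ?thesis .
qed

lemma (in prob_space) expectation_sq_add_diff_le:
  fixes X Y :: "'a \<Rightarrow> real"
  assumes [measurable]: "X \<in> borel_measurable M" "Y \<in> borel_measurable M"
    and sq: "integrable M (\<lambda>w. (X w)\<^sup>2)" "integrable M (\<lambda>w. (Y w)\<^sup>2)"
    and le: "sq_mean X \<le> D" "sq_mean Y \<le> D * u" and "u \<ge> 0" "D \<ge> 0"
  shows "\<bar>(LINT w|M. (X w + Y w)\<^sup>2) - sq_mean X\<bar> \<le> D * (2 * sqrt u + u)"
proof (cases "u = 0")
  case True
  then have "sq_mean Y = 0" using le(2) by (simp add: order_antisym)
  then have "AE w in M. (Y w)\<^sup>2 = 0" using sq(2) integral_nonneg_eq_0_iff_AE[of M "\<lambda>w. (Y w)\<^sup>2"] by auto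
  then have "(LINT w|M. (X w + Y w)\<^sup>2) = sq_mean X"
    by (intro integral_cong_AE) auto
  then show ?thesis using True by simp
next
  case False
  then have u: "sqrt u > 0" using assms(7) by simp
  have pt: "\<bar>2 * (X w * Y w)\<bar> \<le> sqrt u * (X w)\<^sup>2 + (Y w)\<^sup>2 / sqrt u" for w
  proof -
    have "0 \<le> (sqrt u * \<bar>X w\<bar> - \<bar>Y w\<bar>)\<^sup>2 / sqrt u" using u by simp
    also have "\<dots> = sqrt u * (X w)\<^sup>2 + (Y w)\<^sup>2 / sqrt u - 2 * (\<bar>X w\<bar> * \<bar>Y w\<bar>)"
      using u by (simp add: power2_diff power_mult_distrib field_simps power2_eq_square)
    finally show ?thesis by (simp add: abs_mult)
  qed
  have intXY: "integrable M (\<lambda>w. 2 * (X w * Y w))"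
  proof (rule Bochner_Integration.integrable_bound[of _ "\<lambda>w. sqrt u * (X w)\<^sup>2 + (Y w)\<^sup>2 / sqrt u"])
    show "AE w in M. norm (2 * (X w * Y w)) \<le> norm (sqrt u * (X w)\<^sup>2 + (Y w)\<^sup>2 / sqrt u)"
    proof (rule AE_I2)
      fix w show "norm (2 * (X w * Y w)) \<le> norm (sqrt u * (X w)\<^sup>2 + (Y w)\<^sup>2 / sqrt u)"
        unfolding real_norm_def using pt[of w] by (rule order_trans[OF _ abs_ge_self])
    qed
  qed (use sq in simp_all)
  have "(LINT w|M. (X w + Y w)\<^sup>2) = (LINT w|M. (X w)\<^sup>2 + 2 * (X w * Y w) + (Y w)\<^sup>2)"
    by (simp add: power2_sum algebra_simps)
  also have "\<dots> = sq_mean X + (LINT w|M. 2 * (X w * Y w)) + sq_mean Y"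
    using sq intXY by (simp del: integral_mult_right_zero)
  finally have eq: "(LINT w|M. (X w + Y w)\<^sup>2) =
    sq_mean X + (LINT w|M. 2 * (X w * Y w)) + sq_mean Y" .
  have "0 \<le> sq_mean Y" by simp
  then have "\<bar>(LINT w|M. (X w + Y w)\<^sup>2) - sq_mean X\<bar> \<le>
    \<bar>LINT w|M. 2 * (X w * Y w)\<bar> + sq_mean Y"
    using eq by linarith
  also have "\<bar>LINT w|M. 2 * (X w * Y w)\<bar> \<le> (LINT w|M. sqrt u * (X w)\<^sup>2 + (Y w)\<^sup>2 / sqrt u)"
    using sq intXY pt by (intro order_trans[OF integral_abs_bound] integral_mono) auto
  also have "\<dots> = sqrt u * sq_mean X + sq_mean Y / sqrt u"
    using sq by simp
  also have "\<dots> \<le> sqrt u * D + (D * u) / sqrt u"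
    using u le by (intro add_mono mult_left_mono divide_right_mono) auto
  also have "(D * u) / sqrt u = sqrt u * D"
    unfolding times_divide_eq_right[symmetric] real_div_sqrt[OF assms(7)] by (rule mult.commute)
  finally show ?thesis using le(2) by (simp add: algebra_simps)
qed

lemma exp_minus_approx:
  fixes y :: real
  assumes "y \<ge> 0"
  shows "\<bar>exp (- y) - (1 - y)\<bar> \<le> y\<^sup>2"
proof -
  have "1 - y \<le> exp (- y)" using exp_ge_add_one_self[of "- y"] by simp
  moreover have "exp (- y) \<le> 1 - y + y\<^sup>2"
  proof (cases "y \<le> 1")
    case True
    then show ?thesis using exp_le_quadratic[of "- y"] assms by simp
  next
    case False
    then have "y * 1 \<le> y * y" by (intro mult_left_mono) auto
    moreover have "exp (- y) \<le> 1" using assms by simp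
    ultimately show ?thesis unfolding power2_eq_square by linarith
  qed
  ultimately show ?thesis by simp
qed

abbreviation gauss_char :: "real \<Rightarrow> real \<Rightarrow> complex" where
  "gauss_char v t \<equiv> complex_of_real (exp (- (t\<^sup>2 * v / 2)))"

text \<open>The error carries the factor \<open>v\<close>: summed over blocks it is the total
  variance times a quantity that vanishes with the block bound \<open>d\<close>, however many blocks
  there are.\<close>

lemma (in prob_space) char_gaussian_approx:
  fixes X :: "'a \<Rightarrow> real"
  assumes [measurable]: "X \<in> borel_measurable M" and X: "\<And>w. \<bar>X w\<bar> \<le> d" and mean: "expectation X = 0"
  defines "v \<equiv> sq_mean X"
  shows "cmod ((CLINT w|M. iexp (t * X w)) - gauss_char v t) \<le> v * (\<bar>t\<bar> ^ 3 * d + t ^ 4 * d\<^sup>2)"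
proof -
  have d: "d \<ge> 0" using X[of undefined] by linarith
  have X2: "(X w)\<^sup>2 \<le> d\<^sup>2" for w using power_mono[OF X[of w], of 2] by simp
  have int: "integrable M X" "integrable M (\<lambda>w. (X w)\<^sup>2)"
    using X X2 by (auto intro: integrable_const_bound[of _ d] integrable_const_bound[of _ "d\<^sup>2"])
  have v: "0 \<le> v" "v \<le> d\<^sup>2"
    unfolding v_def using X2 int by (auto intro!: integral_le_const)
  have "cmod (char (distr M borel X) t - (1 - t\<^sup>2 * v / 2)) \<le> (t\<^sup>2 / 6) * (LINT w|M. min (6 * (X w)\<^sup>2) (\<bar>t\<bar> * \<bar>X w\<bar> ^ 3))"
    using int mean by (intro char_approx3') (auto simp: v_def)
  also have "\<dots> \<le> (t\<^sup>2 / 6) * (LINT w|M. (\<bar>t\<bar> * d) * (X w)\<^sup>2)"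
  proof (intro mult_left_mono integral_mono)
    fix w
    have "\<bar>X w\<bar> ^ 3 = \<bar>X w\<bar> * (X w)\<^sup>2" by (simp add: power3_eq_cube power2_eq_square)
    also have "\<dots> \<le> d * (X w)\<^sup>2" using X by (intro mult_right_mono) auto
    finally have "\<bar>t\<bar> * \<bar>X w\<bar> ^ 3 \<le> \<bar>t\<bar> * d * (X w)\<^sup>2" by (simp add: mult_left_mono mult.assoc)
    then show "min (6 * (X w)\<^sup>2) (\<bar>t\<bar> * \<bar>X w\<bar> ^ 3) \<le> (\<bar>t\<bar> * d) * (X w)\<^sup>2" by linarith
    show "integrable M (\<lambda>w. min (6 * (X w)\<^sup>2) (\<bar>t\<bar> * \<bar>X w\<bar> ^ 3))"
    proof (rule Bochner_Integration.integrable_bound[of _ "\<lambda>w. 6 * (X w)\<^sup>2"])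
      show "AE w in M. norm (min (6 * (X w)\<^sup>2) (\<bar>t\<bar> * \<bar>X w\<bar> ^ 3)) \<le> norm (6 * (X w)\<^sup>2)"
        by (intro AE_I2) (auto simp: min_def abs_mult)
    qed (use int in auto)
  qed (use int in auto)
  also have "\<dots> = (t\<^sup>2 / 6) * (\<bar>t\<bar> * d) * v" by (simp add: v_def)
  also have "\<dots> \<le> v * (\<bar>t\<bar> ^ 3 * d)"
  proof -
    have "t\<^sup>2 * \<bar>t\<bar> = \<bar>t\<bar> ^ 3" by (simp add: power3_eq_cube power2_eq_square abs_mult)
    moreover have "(t\<^sup>2 / 6) * (\<bar>t\<bar> * d) * v = (v * ((t\<^sup>2 * \<bar>t\<bar>) * d)) / 6" by simp
    ultimately have "(t\<^sup>2 / 6) * (\<bar>t\<bar> * d) * v = (v * (\<bar>t\<bar> ^ 3 * d)) / 6" by simp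
    also have "\<dots> \<le> v * (\<bar>t\<bar> ^ 3 * d)" using v d mult_nonneg_nonneg[of v "\<bar>t\<bar> ^ 3 * d"] by (simp add: divide_le_eq)
    finally show ?thesis .
  qed
  finally have 1: "cmod (char (distr M borel X) t - (1 - t\<^sup>2 * v / 2)) \<le> v * (\<bar>t\<bar> ^ 3 * d)" .
  have "\<bar>exp (- (t\<^sup>2 * v / 2)) - (1 - t\<^sup>2 * v / 2)\<bar> \<le> (t\<^sup>2 * v / 2)\<^sup>2"
    using v by (intro exp_minus_approx) auto
  also have "\<dots> = (t ^ 4 * v) * v / 4" by (simp add: power2_eq_square power4_eq_xxxx)
  also have "\<dots> \<le> (t ^ 4 * d\<^sup>2) * v / 4" using v by (intro divide_right_mono mult_right_mono mult_left_mono) auto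
  also have "\<dots> \<le> v * (t ^ 4 * d\<^sup>2)" using v by simp
  finally have 2: "cmod (complex_of_real (1 - t\<^sup>2 * v / 2) - gauss_char v t) \<le> v * (t ^ 4 * d\<^sup>2)"
    by (simp only: norm_of_real abs_minus_commute flip: of_real_diff)
  have "char (distr M borel X) t = (CLINT w|M. iexp (t * X w))" unfolding char_def by (simp add: integral_distr)
  then show ?thesis
    using 1 2 norm_triangle_ineq[of "char (distr M borel X) t - (1 - t\<^sup>2 * v / 2)" "complex_of_real (1 - t\<^sup>2 * v / 2) - gauss_char v t"]
    by (simp add: distrib_left)
qed

text \<open>Real and imaginary part are integrals of functions bounded by one, each off by at most
  \<open>2 * b\<close>.\<close>

lemma (in prob_space) integral_iexp_diff_of_measure_diff_le:
  assumes Q: "prob_space Q" "prob_space R" and sets: "sets Q = sets borel" "sets R = sets borel"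
    and diff: "\<And>C. C \<in> sets borel \<Longrightarrow> \<bar>measure Q C - measure R C\<bar> \<le> b"
  shows "cmod ((CLINT x|Q. iexp (t * x)) - (CLINT x|R. iexp (t * x))) \<le> 4 * b"
proof -
  interpret Q: prob_space Q by fact
  interpret R: prob_space R by fact
  have [measurable_cong]: "sets Q = sets borel" "sets R = sets borel" by (rule sets)+
  have int: "integrable Q (\<lambda>x. iexp (t * x))" "integrable R (\<lambda>x. iexp (t * x))"
    by (auto intro!: Q.integrable_const_bound[of _ 1] R.integrable_const_bound[of _ 1])
  define z where "z = (CLINT x|Q. iexp (t * x)) - (CLINT x|R. iexp (t * x))"
  have "Re z = (LINT x|Q. cos (t * x)) - (LINT x|R. cos (t * x))" "Im z = (LINT x|Q. sin (t * x)) - (LINT x|R. sin (t * x))"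
    unfolding z_def using int by (simp_all flip: integral_Re integral_Im add: Re_exp Im_exp)
  moreover have "\<bar>(LINT x|Q. cos (t * x)) - (LINT x|R. cos (t * x))\<bar> \<le> 2 * 1 * b"
    using Q sets diff by (intro integral_diff_le_of_measure_diff_le') auto
  moreover have "\<bar>(LINT x|Q. sin (t * x)) - (LINT x|R. sin (t * x))\<bar> \<le> 2 * 1 * b"
    using Q sets diff by (intro integral_diff_le_of_measure_diff_le') auto
  ultimately show ?thesis using cmod_le[of z] by (simp add: z_def)
qed

lemma abs_exp_minus_diff_le:
  fixes x y :: real
  assumes "x \<ge> 0" "y \<ge> 0"
  shows "\<bar>exp (- x) - exp (- y)\<bar> \<le> \<bar>x - y\<bar>"
proof -
  have *: "\<bar>exp (- x) - exp (- y)\<bar> \<le> \<bar>x - y\<bar>" if "0 \<le> x" "x \<le> y" for x y :: real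
  proof -
    have "exp (- y) = exp (- x) * exp (- (y - x))" by (simp flip: exp_add)
    then have "exp (- x) - exp (- y) = exp (- x) * (1 - exp (- (y - x)))" by (simp only: right_diff_distrib mult_1_right)
    also have "\<dots> \<le> 1 * (y - x)"
    proof (intro mult_mono)
      show "1 - exp (- (y - x)) \<le> y - x" using exp_ge_add_one_self[of "- (y - x)"] by linarith
    qed (use that in auto)
    finally have "exp (- x) - exp (- y) \<le> y - x" by simp
    moreover have "exp (- y) \<le> exp (- x)" using that by simp
    ultimately show ?thesis using that by linarith
  qed
  show ?thesis using *[of x y] *[of y x] assms by (cases "x \<le> y") (auto simp: abs_minus_commute)
qed

section \<open>Bernstein blocks for bounded functionals\<close>

lemma blk_disjoint:
  assumes "q \<le> P" "i \<noteq> j"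
  shows "blk z P q i \<inter> blk z P q j = {}"
proof -
  have *: "blk z P q i \<inter> blk z P q j = {}" if "i < j" for i j
  proof -
    have "(i + 1) * P \<le> j * P" using that by (intro mult_le_mono1) simp
    then show ?thesis using assms(1) by (auto simp: blk_def)
  qed
  show ?thesis using *[of i j] *[of j i] assms(2) by (cases "i < j") auto
qed

definition blks :: "nat \<Rightarrow> nat \<Rightarrow> nat \<Rightarrow> nat \<Rightarrow> nat set" where
  "blks z P q m = (\<Union>j<m. blk z P q j)"

lemma blks_facts: "finite (blks z P q m)" "blks z P q m \<subseteq> {1..}" "card (blks z P q m) \<le> m * q"
proof -
  show "finite (blks z P q m)" "blks z P q m \<subseteq> {1..}" by (auto simp: blks_def blk_def)
  have "card (blks z P q m) \<le> (\<Sum>j<m. card (blk z P q j))" unfolding blks_def by (rule card_UN_le) simp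
  then show "card (blks z P q m) \<le> m * q" by (simp add: blk_facts)
qed

lemma sum_blks:
  assumes "q \<le> P"
  shows "(\<Sum>j<m. \<Sum>i\<in>blk z P q j. f i) = (\<Sum>i\<in>blks z P q m. f i)"
  unfolding blks_def using blk_disjoint[OF assms] by (intro sum.UNION_disjoint[symmetric]) (auto simp: blk_facts)

context mixing_sequence
begin

lemma expectation_sum_centred_mult:
  assumes I: "finite I" "I \<subseteq> {1..}" and J: "finite J" "J \<subseteq> {1..}" and g: "dominated K g"
  shows "integrable M (\<lambda>w. (csum x g I w) * (csum y g J w))" (is ?int)
    "(LINT w|M. (csum x g I w) * (csum y g J w)) =
      (\<Sum>i\<in>I. \<Sum>j\<in>J. x i * y j * ccov g i g j)" (is ?E)
proof -
  have int: "integrable M (\<lambda>w. centred g i w * centred g j w)" if "i \<in> I" "j \<in> J" for i j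
  proof -
    have "i \<ge> 1" "j \<ge> 1" using that I(2) J(2) by auto
    then show ?thesis by (rule integrable_centred_mult[OF _ _ g g])
  qed
  have eq: "(\<lambda>w. (csum x g I w) * (csum y g J w)) =
     (\<lambda>w. \<Sum>i\<in>I. \<Sum>j\<in>J. (x i * y j) * (centred g i w * centred g j w))"
    by (simp add: sum_product mult_ac)
  show ?int unfolding eq using int by (intro Bochner_Integration.integrable_sum integrable_mult_right) auto
  show ?E unfolding eq using int by (simp add: Bochner_Integration.integral_sum Bochner_Integration.integrable_sum)
qed

text \<open>Indices in different blocks are at least \<open>r\<close> apart, so the covariances of
  one index with all earlier blocks sum to at most a multiple of 2/r. Each new block adds such an
  error for its \<open>q\<close> indices, doubled by the expansion of the square.\<close>

lemma block_variance_diff: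
  assumes g: "dominated K g" and x: "\<And>i. \<bar>x i\<bar> \<le> 1" and r: "r \<ge> 1"
  shows "\<bar>sq_mean (csum x g (blks 0 (q + r) q m)) -
     (\<Sum>j<m. sq_mean (csum x g (blk 0 (q + r) q j)))\<bar> \<le> real m * (2 * (real q * (cov_const * K\<^sup>2 * (2 / real r))))"
proof (induction m)
  case 0
  then show ?case by (simp add: blks_def)
next
  case (Suc m)
  define A where "A w = (csum x g (blks 0 (q + r) q m) w)" for w
  define T where "T w = (csum x g (blk 0 (q + r) q m) w)" for w
  have AT: "(\<Sum>i\<in>blks 0 (q + r) q (Suc m). x i * centred g i w) = A w + T w" for w
    unfolding A_def T_def by (simp flip: sum_blks)
  have int: "integrable M (\<lambda>w. (A w)\<^sup>2)" "integrable M (\<lambda>w. (T w)\<^sup>2)" "integrable M (\<lambda>w. A w * T w)"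
    unfolding A_def T_def power2_eq_square by (intro expectation_sum_centred_mult(1)[OF _ _ _ _ g] blk_facts blks_facts)+
  have E: "(LINT w|M. (A w + T w)\<^sup>2) = sq_mean A + 2 * (LINT w|M. A w * T w) + sq_mean T"
  proof -
    have "(\<lambda>w. (A w + T w)\<^sup>2) = (\<lambda>w. (A w)\<^sup>2 + 2 * (A w * T w) + (T w)\<^sup>2)" by (auto simp: power2_sum)
    then show ?thesis using int by simp
  qed
  have inner: "(\<Sum>i\<in>blks 0 (q + r) q m. 1 / (real (lag i j))\<^sup>2) \<le> 2 / real r" if j: "j \<in> blk 0 (q + r) q m" for j
  proof -
    have lt: "i + r \<le> j" if i: "i \<in> blks 0 (q + r) q m" for i
    proof -
      obtain l where l: "l < m" "i \<in> blk 0 (q + r) q l" using i by (auto simp: blks_def)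
      have "(l + 1) * (q + r) \<le> m * (q + r)" using l(1) by (intro mult_le_mono1) simp
      then show ?thesis using l(2) j by (auto simp: blk_def)
    qed
    have "(\<Sum>i\<in>blks 0 (q + r) q m. 1 / (real (lag i j))\<^sup>2) = (\<Sum>i\<in>blks 0 (q + r) q m. 1 / (real (j - i))\<^sup>2)"
    proof (intro sum.cong refl)
      fix i assume "i \<in> blks 0 (q + r) q m"
      from lt[OF this] show "1 / (real (lag i j))\<^sup>2 = 1 / (real (j - i))\<^sup>2" by (simp add: lag_def)
    qed
    also have "\<dots> = (\<Sum>k\<in>(\<lambda>i. j - i) ` blks 0 (q + r) q m. 1 / (real k)\<^sup>2)"
    proof (subst sum.reindex)
      show "inj_on (\<lambda>i. j - i) (blks 0 (q + r) q m)" using lt by (intro inj_onI) (metis add_leD1 diff_diff_cancel)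
    qed simp
    also have "\<dots> \<le> (\<Sum>k\<in>{r..j}. 1 / (real k)\<^sup>2)"
    proof (intro sum_mono2)
      show "(\<lambda>i. j - i) ` blks 0 (q + r) q m \<subseteq> {r..j}"
      proof safe
        fix i assume "i \<in> blks 0 (q + r) q m"
        from lt[OF this] show "j - i \<in> {r..j}" by simp
      qed
    qed auto
    also have "\<dots> \<le> 2 / real r" by (rule sum_inverse_squares_le[OF r])
    finally show ?thesis .
  qed
  have cross: "\<bar>LINT w|M. A w * T w\<bar> \<le> real q * (cov_const * K\<^sup>2 * (2 / real r))"
  proof -
    have e: "(LINT w|M. A w * T w) = (\<Sum>i\<in>blks 0 (q + r) q m. \<Sum>j\<in>blk 0 (q + r) q m. x i * x j * ccov g i g j)"
      unfolding A_def T_def by (intro expectation_sum_centred_mult(2)[OF _ _ _ _ g] blk_facts blks_facts)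
    have "\<bar>LINT w|M. A w * T w\<bar> \<le> (\<Sum>i\<in>blks 0 (q + r) q m. \<Sum>j\<in>blk 0 (q + r) q m. cov_const * K\<^sup>2 * (1 / (real (lag i j))\<^sup>2))"
      unfolding e
    proof (intro order_trans[OF sum_abs] sum_mono)
      fix i j assume i: "i \<in> blks 0 (q + r) q m" and j: "j \<in> blk 0 (q + r) q m"
      have ij: "i \<ge> 1" "j \<ge> 1" using subsetD[OF blks_facts(2) i] subsetD[OF blk_facts(2) j] by simp_all
      have "i \<noteq> j"
      proof
        assume "i = j"
        then obtain l where l: "l < m" "j \<in> blk 0 (q + r) q l" using i by (auto simp: blks_def)
        have "blk 0 (q + r) q l \<inter> blk 0 (q + r) q m = {}" using l(1) by (intro blk_disjoint) simp_all
        then show False using l(2) j by blast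
      qed
      then have "\<bar>LINT w|M. centred g i w * centred g j w\<bar> \<le> cov_const * K\<^sup>2 / (real (lag i j))\<^sup>2"
        by (rule centred_cov_decay[OF ij _ g g])
      moreover have "\<bar>x i * x j\<bar> \<le> 1"
        unfolding abs_mult by (rule mult_le_one[OF x[of i] abs_ge_zero x[of j]])
      ultimately have "\<bar>x i * x j\<bar> * \<bar>LINT w|M. centred g i w * centred g j w\<bar> \<le> 1 * (cov_const * K\<^sup>2 / (real (lag i j))\<^sup>2)"
        by (intro mult_mono) simp_all
      then show "\<bar>x i * x j * ccov g i g j\<bar> \<le> cov_const * K\<^sup>2 * (1 / (real (lag i j))\<^sup>2)"
        unfolding abs_mult[of "x i * x j"] mult_1 by (simp only: times_divide_eq_right mult_1_right)
    qed
    also have "\<dots> = (\<Sum>j\<in>blk 0 (q + r) q m. \<Sum>i\<in>blks 0 (q + r) q m. cov_const * K\<^sup>2 * (1 / (real (lag i j))\<^sup>2))"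
      by (rule sum.swap)
    also have "\<dots> \<le> (\<Sum>j\<in>blk 0 (q + r) q m. cov_const * K\<^sup>2 * (2 / real r))"
    proof (rule sum_mono)
      fix j assume j: "j \<in> blk 0 (q + r) q m"
      have "(\<Sum>i\<in>blks 0 (q + r) q m. cov_const * K\<^sup>2 * (1 / (real (lag i j))\<^sup>2)) =
          cov_const * K\<^sup>2 * (\<Sum>i\<in>blks 0 (q + r) q m. 1 / (real (lag i j))\<^sup>2)"
        by (rule sum_distrib_left[symmetric])
      also have "\<dots> \<le> cov_const * K\<^sup>2 * (2 / real r)"
        by (rule mult_left_mono[OF inner[OF j]]) (use cov_const_nonneg in simp)
      finally show "(\<Sum>i\<in>blks 0 (q + r) q m. cov_const * K\<^sup>2 * (1 / (real (lag i j))\<^sup>2)) \<le> cov_const * K\<^sup>2 * (2 / real r)" .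
    qed
    also have "\<dots> = real q * (cov_const * K\<^sup>2 * (2 / real r))" by (simp add: blk_facts)
    finally show ?thesis .
  qed
  define x1 where "x1 = sq_mean A"
  define x2 where "x2 = (\<Sum>j<m. sq_mean (csum x g (blk 0 (q + r) q j)))"
  define x3 where "x3 = (LINT w|M. A w * T w)"
  define x4 where "x4 = sq_mean T"
  define b where "b = real q * (cov_const * K\<^sup>2 * (2 / real r))"
  have "\<bar>x1 - x2\<bar> \<le> real m * (2 * b)"
    unfolding x1_def x2_def b_def A_def by (rule Suc.IH)
  moreover have "\<bar>x3\<bar> \<le> b" using cross by (simp only: x3_def b_def)
  moreover have "real (Suc m) * (2 * b) = real m * (2 * b) + 2 * b" by (simp add: algebra_simps)
  ultimately have "\<bar>x1 + 2 * x3 + x4 - (x2 + x4)\<bar> \<le> real (Suc m) * (2 * b)" by linarith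
  then show ?case
    unfolding AT E sum.lessThan_Suc by (simp only: x1_def x2_def x3_def x4_def b_def T_def)
qed

text \<open>The four errors are those of dropping the short blocks, making the long blocks
  independent, replacing each of them by a Gaussian of its own variance, and comparing the sum of
  the block variances with the variance of the full sum. Here \<open>u\<close> is the share of the
  short blocks and \<open>d\<close> bounds a normalised long block.\<close>

lemma clt_bounded_error:
  assumes g: "dominated K g" and G: "\<And>x. \<bar>g x\<bar> \<le> G" and a: "\<And>i. \<bar>a i\<bar> \<le> 1" "\<And>i. i > n \<Longrightarrow> a i = 0"
    and n: "n \<ge> 1" and q: "q \<ge> 1" and r: "r \<ge> 1" and m: "n \<le> m * (q + r)" "m * q \<le> 2 * n"
  defines "S \<equiv> (\<lambda>w. (\<Sum>i\<in>{1..n}. a i * centred g i w) / sqrt (real n))"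
    and "u \<equiv> real m * real r / real n" and "d \<equiv> 2 * real q * G / sqrt (real n)" and "D \<equiv> 2 * cheb_const K"
  shows "cmod ((CLINT w|M. iexp (t * S w)) - gauss_char (sq_mean S) t) \<le>
    \<bar>t\<bar> * sqrt (D * u) + 4 * (real m * \<beta> r) + D * (\<bar>t\<bar> ^ 3 * d + t ^ 4 * d\<^sup>2)
     + t\<^sup>2 / 2 * (D * (2 * sqrt u + u) + 8 * cov_const * K\<^sup>2 / real r)"
proof -
  define e where "e = (LINT w|M. g (\<epsilon> 1 w))"
  have n0: "real n > 0" "sqrt (real n) > 0" using n by auto
  have D0: "D \<ge> 0" using cheb_const_nonneg by (simp add: D_def)
  have u0: "u \<ge> 0" by (simp add: u_def)
  define gi where "gi i x = a i * (g x - e) / sqrt (real n)" for i x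
  have gi: "gi i \<in> borel_measurable borel" for i unfolding gi_def using dominatedD(1)[OF g] by measurable
  have gic: "gi i (\<epsilon> i w) = a i * centred g i w / sqrt (real n)" for i w by (simp add: gi_def centred_def e_def)
  define T where "T j w = (\<Sum>i\<in>blk 0 (q + r) q j. gi i (\<epsilon> i w))" for j w
  have T: "T j w = (csum a g (blk 0 (q + r) q j) w) / sqrt (real n)" for j w
    by (simp add: T_def gic sum_divide_distrib)
  define X where "X w = (\<Sum>j<m. T j w)" for w
  have X: "X w = (csum a g (blks 0 (q + r) q m) w) / sqrt (real n)" for w
    unfolding X_def T by (simp add: sum_blks flip: sum_divide_distrib)
  define Y where "Y w = (csum a g (blks q (q + r) r m) w) / sqrt (real n)" for w
  have S: "S w = X w + Y w" for w
  proof -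
    have "(\<Sum>i\<in>{1..n}. a i * centred g i w) = (\<Sum>i\<in>{1..m * (q + r)}. a i * centred g i w)"
      using m a(2) by (intro sum.mono_neutral_left) auto
    also have "\<dots> = (csum a g (blks 0 (q + r) q m) w) + (csum a g (blks q (q + r) r m) w)"
      unfolding sum_blocks by (simp add: sum_blks)
    finally show ?thesis by (simp add: S_def X Y_def add_divide_distrib)
  qed
  have Tm[measurable]: "T j \<in> borel_measurable M" for j
    unfolding T_def by (rule blk_measurable[OF gi])
  have [measurable]: "X \<in> borel_measurable M" unfolding X_def by measurable
  have [measurable]: "Y \<in> borel_measurable M"
    unfolding Y_def using sum_centred_measurable[OF blks_facts(1,2) g] by simp
  have sqI: "integrable M (\<lambda>w. ((csum a g I w) / sqrt (real n))\<^sup>2)"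
      "(LINT w|M. ((csum a g I w) / sqrt (real n))\<^sup>2) = sq_mean (csum a g I) / real n"
    if "finite I" "I \<subseteq> {1..}" for I
    using integrable_sum_centred_sq[OF that g, of a] by (simp_all add: power_divide)
  have sqX: "integrable M (\<lambda>w. (X w)\<^sup>2)" and sqY: "integrable M (\<lambda>w. (Y w)\<^sup>2)"
    unfolding X Y_def by (intro sqI(1) blks_facts)+
  have EX: "sq_mean X \<le> D"
  proof -
    have "sq_mean X = sq_mean (csum a g (blks 0 (q + r) q m)) / real n"
      unfolding X by (intro sqI(2) blks_facts)
    also have "\<dots> \<le> cheb_const K * real (card (blks 0 (q + r) q m)) / real n"
      by (intro divide_right_mono variance_sum_le' blks_facts a g) simp
    also have "\<dots> \<le> cheb_const K * real (2 * n) / real n"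
      using blks_facts(3)[of 0 "q + r" q m] m(2) cheb_const_nonneg by (intro divide_right_mono mult_left_mono of_nat_mono) auto
    also have "\<dots> = D" using n0 by (simp add: D_def)
    finally show ?thesis .
  qed
  have EY: "sq_mean Y \<le> D * u"
  proof -
    have "sq_mean Y = sq_mean (csum a g (blks q (q + r) r m)) / real n"
      unfolding Y_def by (intro sqI(2) blks_facts)
    also have "\<dots> \<le> cheb_const K * real (card (blks q (q + r) r m)) / real n"
      by (intro divide_right_mono variance_sum_le' blks_facts a g) simp
    also have "\<dots> \<le> cheb_const K * real (m * r) / real n"
      using blks_facts(3)[of q "q + r" r m] cheb_const_nonneg by (intro divide_right_mono mult_left_mono of_nat_mono) auto
    also have "\<dots> = cheb_const K * u" by (simp add: u_def)
    also have "\<dots> \<le> D * u" using cheb_const_nonneg u0 by (intro mult_right_mono) (auto simp: D_def)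
    finally show ?thesis .
  qed
  define V where "V = sq_mean S"
  define v where "v j = sq_mean (T j)" for j
  have v0: "v j \<ge> 0" for j by (simp add: v_def)
  have V0: "V \<ge> 0" by (simp add: V_def)
  have 1: "cmod ((CLINT w|M. iexp (t * S w)) - (CLINT w|M. iexp (t * X w))) \<le> \<bar>t\<bar> * sqrt (D * u)"
    unfolding S by (intro expectation_iexp_diff_le sqY EY) simp_all
  have VX: "\<bar>V - sq_mean X\<bar> \<le> D * (2 * sqrt u + u)"
    unfolding V_def S by (intro expectation_sq_add_diff_le sqX sqY EX EY D0 u0) simp_all
  have Xv: "\<bar>sq_mean X - (\<Sum>j<m. v j)\<bar> \<le> 8 * cov_const * K\<^sup>2 / real r"
  proof -
    have e: "sq_mean X - (\<Sum>j<m. v j) = (sq_mean (csum a g (blks 0 (q + r) q m)) -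
       (\<Sum>j<m. sq_mean (csum a g (blk 0 (q + r) q j)))) / real n"
    proof -
      have "sq_mean X = sq_mean (csum a g (blks 0 (q + r) q m)) / real n"
        unfolding X by (intro sqI(2) blks_facts)
      moreover have "v j = sq_mean (csum a g (blk 0 (q + r) q j)) / real n" for j
        unfolding v_def T by (intro sqI(2) blk_facts)
      ultimately show ?thesis by (simp only: diff_divide_distrib sum_divide_distrib)
    qed
    have "\<bar>sq_mean X - (\<Sum>j<m. v j)\<bar> \<le> real m * (2 * (real q * (cov_const * K\<^sup>2 * (2 / real r)))) / real n"
      unfolding e abs_divide abs_of_nat
      by (intro divide_right_mono block_variance_diff[OF g _ r] a(1)) simp
    also have "\<dots> = (real m * real q) * (4 * cov_const * K\<^sup>2 / real r) / real n" by simp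
    also have "\<dots> \<le> (2 * real n) * (4 * cov_const * K\<^sup>2 / real r) / real n"
      using m(2) cov_const_nonneg by (intro divide_right_mono mult_right_mono) (simp_all flip: of_nat_mult)
    also have "\<dots> = 8 * cov_const * K\<^sup>2 / real r" using n0 by simp
    finally show ?thesis .
  qed
  have vsum: "(\<Sum>j<m. v j) \<le> D"
  proof -
    have "(\<Sum>j<m. v j) \<le> (\<Sum>j<m. cheb_const K * real q / real n)"
    proof (intro sum_mono)
      fix j
      have "v j = sq_mean (csum a g (blk 0 (q + r) q j)) / real n"
        unfolding v_def T by (intro sqI(2) blk_facts)
      also have "\<dots> \<le> cheb_const K * real (card (blk 0 (q + r) q j)) / real n"
        by (intro divide_right_mono variance_sum_le' blk_facts a g) simp
      finally show "v j \<le> cheb_const K * real q / real n" by (simp add: blk_facts)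
    qed
    also have "\<dots> = cheb_const K * real (m * q) / real n" by simp
    also have "\<dots> \<le> cheb_const K * real (2 * n) / real n"
      using m(2) cheb_const_nonneg by (intro divide_right_mono mult_left_mono of_nat_mono) auto
    also have "\<dots> = D" using n0 by (simp add: D_def)
    finally show ?thesis .
  qed
  interpret L: prob_space "indep_sum_law M T m" by (rule prob_space_indep_sum_law) simp
  let ?I = "(CLINT x|indep_sum_law M T m. iexp (t * x))"
  have 2: "cmod ((CLINT w|M. iexp (t * X w)) - ?I) \<le> 4 * (real m * \<beta> r)"
  proof -
    have "(CLINT w|M. iexp (t * X w)) = (CLINT x|distr M borel X. iexp (t * x))" by (simp add: integral_distr)
    moreover have "cmod ((CLINT x|distr M borel X. iexp (t * x)) - ?I) \<le> 4 * (real m * \<beta> r)"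
    proof (rule integral_iexp_diff_of_measure_diff_le)
      show "prob_space (distr M borel X)" by (rule prob_space_distr) simp
      show "prob_space (indep_sum_law M T m)" by unfold_locales
      fix C :: "real set" assume C: "C \<in> sets borel"
      have "\<bar>prob {w \<in> space M. (\<Sum>j<m. T j w) \<in> C} - measure (indep_sum_law M T m) C\<bar> \<le> real m * \<beta> r"
        unfolding T_def by (rule blk_sum_law[OF gi q C])
      moreover have "measure (distr M borel X) C = prob {w \<in> space M. (\<Sum>j<m. T j w) \<in> C}"
        using C by (subst measure_distr) (auto simp: X_def intro!: arg_cong[where f=prob])
      ultimately show "\<bar>measure (distr M borel X) C - measure (indep_sum_law M T m) C\<bar> \<le> real m * \<beta> r" by simp
    qed simp_all
    ultimately show ?thesis by simp
  qed
  have Tbound: "\<bar>T j w\<bar> \<le> d" for j w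
  proof -
    have "\<bar>e\<bar> \<le> G" unfolding e_def using G dominated_integrable[OF _ g, of 1]
      by (intro order_trans[OF integral_abs_bound] integral_le_const) auto
    then have "\<bar>centred g i w\<bar> \<le> 2 * G" for i
      using G[of "\<epsilon> i w"] unfolding centred_def e_def by linarith
    then have "\<bar>a i * centred g i w\<bar> \<le> 1 * (2 * G)" for i unfolding abs_mult using a(1)[of i] by (intro mult_mono) auto
    then have "\<bar>csum a g (blk 0 (q + r) q j) w\<bar> \<le> (\<Sum>i\<in>blk 0 (q + r) q j. 1 * (2 * G))"
      by (intro order_trans[OF sum_abs] sum_mono)
    then show ?thesis unfolding T d_def abs_divide using n0 by (simp add: blk_facts divide_right_mono)
  qed
  have Tmean: "expectation (T j) = 0" for j
  proof -
    have i1: "i \<ge> 1" if "i \<in> blk 0 (q + r) q j" for i using that by (auto simp: blk_def)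
    have "(LINT w|M. (csum a g (blk 0 (q + r) q j) w)) = (\<Sum>i\<in>blk 0 (q + r) q j. (LINT w|M. a i * centred g i w))"
      unfolding centred_def using dominated_integrable[OF i1 g]
      by (intro Bochner_Integration.integral_sum integrable_mult_right Bochner_Integration.integrable_diff integrable_const)
    also have "\<dots> = 0"
      unfolding centred_def using dominated_integrable[OF i1 g] expectation_dominated[OF i1 g] by (intro sum.neutral) (simp add: prob_space)
    finally show ?thesis unfolding T by simp
  qed
  have 3: "cmod (?I - gauss_char (\<Sum>j<m. v j) t) \<le> D * (\<bar>t\<bar> ^ 3 * d + t ^ 4 * d\<^sup>2)"
  proof -
    have d0: "d \<ge> 0" using Tbound[of 0 undefined] by linarith
    have e1: "?I = (\<Prod>j<m. CLINT w|M. iexp (t * T j w))"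
      by (rule integral_indep_sum_law) (auto simp: distrib_left exp_add)
    have e2: "gauss_char (\<Sum>j<m. v j) t = (\<Prod>j<m. gauss_char (v j) t)"
      by (simp add: sum_distrib_left sum_divide_distrib exp_sum flip: sum_negf of_real_prod)
    have "cmod (?I - gauss_char (\<Sum>j<m. v j) t) \<le>
      (\<Sum>j<m. cmod ((CLINT w|M. iexp (t * T j w)) - gauss_char (v j) t))"
      unfolding e1 e2
    proof (rule norm_prod_diff)
      fix j
      show "cmod (CLINT w|M. iexp (t * T j w)) \<le> 1"
        using integral_norm_bound[of M "\<lambda>w. iexp (t * T j w)"] by (simp add: prob_space)
      show "cmod (gauss_char (v j) t) \<le> 1" using v0[of j] by simp
    qed
    also have "\<dots> \<le> (\<Sum>j<m. v j * (\<bar>t\<bar> ^ 3 * d + t ^ 4 * d\<^sup>2))"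
      unfolding v_def by (intro sum_mono char_gaussian_approx Tbound Tmean) simp
    also have "\<dots> = (\<Sum>j<m. v j) * (\<bar>t\<bar> ^ 3 * d + t ^ 4 * d\<^sup>2)" by (simp add: sum_distrib_right)
    also have "\<dots> \<le> D * (\<bar>t\<bar> ^ 3 * d + t ^ 4 * d\<^sup>2)" using vsum d0 by (intro mult_right_mono) auto
    finally show ?thesis .
  qed
  have 4: "cmod (gauss_char (\<Sum>j<m. v j) t - gauss_char V t) \<le>
     t\<^sup>2 / 2 * (D * (2 * sqrt u + u) + 8 * cov_const * K\<^sup>2 / real r)"
  proof -
    have "cmod (gauss_char (\<Sum>j<m. v j) t - gauss_char V t) =
      \<bar>exp (- (t\<^sup>2 * (\<Sum>j<m. v j) / 2)) - exp (- (t\<^sup>2 * V / 2))\<bar>"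
      by (simp only: norm_of_real flip: of_real_diff)
    also have "\<dots> \<le> \<bar>t\<^sup>2 * (\<Sum>j<m. v j) / 2 - t\<^sup>2 * V / 2\<bar>"
      using V0 v0 by (intro abs_exp_minus_diff_le divide_nonneg_nonneg mult_nonneg_nonneg sum_nonneg) auto
    also have "t\<^sup>2 * (\<Sum>j<m. v j) / 2 - t\<^sup>2 * V / 2 = t\<^sup>2 / 2 * ((\<Sum>j<m. v j) - V)" by (simp add: right_diff_distrib diff_divide_distrib)
    also have "\<bar>\<dots>\<bar> = t\<^sup>2 / 2 * \<bar>(\<Sum>j<m. v j) - V\<bar>" by (simp add: abs_mult)
    also have "\<dots> \<le> t\<^sup>2 / 2 * (D * (2 * sqrt u + u) + 8 * cov_const * K\<^sup>2 / real r)"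
      using VX Xv by (intro mult_left_mono) auto
    finally show ?thesis .
  qed
  define A B C E where "A = (CLINT w|M. iexp (t * S w))" and "B = (CLINT w|M. iexp (t * X w))"
    and "C = ?I" and "E = gauss_char (\<Sum>j<m. v j) t"
  define F where "F = gauss_char V t"
  have "cmod (A - F) \<le> cmod (A - B) + cmod (B - C) + cmod (C - E) + cmod (E - F)"
    using norm_triangle_ineq[of "A - B" "B - F"] norm_triangle_ineq[of "B - C" "C - F"] norm_triangle_ineq[of "C - E" "E - F"] by simp
  then show ?thesis
    using 1 2 3 4 unfolding A_def B_def C_def E_def F_def V_def by linarith
qed

end

section \<open>Normal approximation for functionals of linear growth\<close>

lemma cesaro_tendsto:
  fixes f :: "nat \<Rightarrow> real"
  assumes "f \<longlonglongrightarrow> l"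
  shows "(\<lambda>n. (\<Sum>i<n. f i) / real n) \<longlonglongrightarrow> l"
proof (rule LIMSEQ_I)
  fix e :: real assume "e > 0"
  obtain N where N: "\<And>n. n \<ge> N \<Longrightarrow> norm (f n - l) < e / 2" using LIMSEQ_D[OF assms, of "e/2"] \<open>e > 0\<close> by auto
  define C where "C = (\<Sum>i<N. \<bar>f i - l\<bar>)"
  have "(\<lambda>n. C / real n) \<longlonglongrightarrow> 0" by (rule lim_const_over_n)
  then have "eventually (\<lambda>n. C / real n < e / 2) sequentially" using \<open>e > 0\<close> by (intro order_tendstoD(2)) auto
  then obtain n1 where n1: "\<And>n. n \<ge> n1 \<Longrightarrow> C / real n < e / 2" by (auto simp: eventually_sequentially)
  show "\<exists>no. \<forall>n\<ge>no. norm ((\<Sum>i<n. f i) / real n - l) < e"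
  proof (intro exI[of _ "max (max N 1) n1"] allI impI)
    fix n assume n: "max (max N 1) n1 \<le> n"
    then have n0: "real n > 0" by simp
    have "(\<Sum>i<n. f i) / real n - l = (\<Sum>i<n. f i - l) / real n"
      using n0 by (simp add: sum_subtractf diff_divide_distrib)
    then have "norm ((\<Sum>i<n. f i) / real n - l) = \<bar>\<Sum>i<n. f i - l\<bar> / real n" by simp
    also have "\<dots> \<le> (\<Sum>i<n. \<bar>f i - l\<bar>) / real n" by (intro divide_right_mono sum_abs) simp
    also have "(\<Sum>i<n. \<bar>f i - l\<bar>) = C + (\<Sum>i\<in>{N..<n}. \<bar>f i - l\<bar>)"
      unfolding C_def using n sum.atLeastLessThan_concat[of 0 N n "\<lambda>i. \<bar>f i - l\<bar>"] by (simp add: atLeast0LessThan)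
    also have "(\<Sum>i\<in>{N..<n}. \<bar>f i - l\<bar>) \<le> (\<Sum>i\<in>{N..<n}. e / 2)"
      using N by (intro sum_mono less_imp_le) auto
    also have "\<dots> \<le> real n * (e / 2)" using \<open>e > 0\<close> by (simp add: mult_right_mono)
    also have "(C + real n * (e / 2)) / real n = C / real n + e / 2" using n0 by (simp add: add_divide_distrib)
    also have "C / real n < e / 2" by (rule n1) (use n in simp)
    also have "e / 2 + e / 2 = e" by simp
    finally show "norm ((\<Sum>i<n. f i) / real n - l) < e" using n0 by (simp add: divide_right_mono)
  qed
qed

context mixing_sequence
begin

definition nsum :: "(nat \<Rightarrow> real) \<Rightarrow> (C01 \<Rightarrow> real) \<Rightarrow> nat \<Rightarrow> 'w \<Rightarrow> real" where
  "nsum a g n w = (\<Sum>i\<in>{1..n}. a i * centred g i w) / sqrt (real n)"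

text \<open>Distance to the Gaussian with the same variance, which need not converge. This separates
  asymptotic normality from the limit of the variance, which depends on the weights.\<close>

definition clt_err :: "real \<Rightarrow> (nat \<Rightarrow> real) \<Rightarrow> (C01 \<Rightarrow> real) \<Rightarrow> nat \<Rightarrow> real" where
  "clt_err t a g n = cmod ((CLINT w|M. iexp (t * nsum a g n w)) -
     gauss_char (sq_mean (nsum a g n)) t)"

lemma nsum_facts:
  assumes "dominated K g"
  shows "nsum a g n \<in> borel_measurable M" "integrable M (\<lambda>w. (nsum a g n w)\<^sup>2)"
  unfolding nsum_def using sum_centred_measurable[OF _ _ assms, of "{1..n}" a] integrable_sum_centred_sq[OF _ _ assms, of "{1..n}" a]
  by (simp_all add: power_divide)

lemma expectation_nsum_sq_le:
  assumes "dominated K g" "\<And>i. \<bar>a i\<bar> \<le> 1" "n \<ge> 1"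
  shows "sq_mean (nsum a g n) \<le> var_const K * (LINT w|M. (g (\<epsilon> 1 w))\<^sup>2) powr (1/4)"
proof -
  have "sq_mean (nsum a g n) = (LINT w|M. (\<Sum>i\<in>{1..n}. a i * centred g i w)\<^sup>2) / real n"
    by (simp add: nsum_def power_divide)
  also have "\<dots> \<le> (var_const K * real (card {1..n}) * (LINT w|M. (g (\<epsilon> 1 w))\<^sup>2) powr (1/4)) / real n"
    by (intro divide_right_mono variance_sum_le assms) auto
  finally show ?thesis using assms(3) by simp
qed

lemma expectation_nsum_sq_le':
  assumes "dominated K g" "\<And>i. \<bar>a i\<bar> \<le> 1" "n \<ge> 1"
  shows "sq_mean (nsum a g n) \<le> cheb_const K"
proof -
  have "sq_mean (nsum a g n) = (LINT w|M. (\<Sum>i\<in>{1..n}. a i * centred g i w)\<^sup>2) / real n"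
    by (simp add: nsum_def power_divide)
  also have "\<dots> \<le> (cheb_const K * real (card {1..n})) / real n"
    by (intro divide_right_mono variance_sum_le' assms) auto
  finally show ?thesis using assms(3) by simp
qed

lemma mix_exp_ge_2: "mix_exp \<delta> \<ge> 2"
proof -
  have "mix_exp \<delta> = 2 + (6 / \<delta> + 4 / \<delta>\<^sup>2)" using \<delta> by (simp add: mix_exp_def field_simps power2_eq_square)
  then show ?thesis using \<delta> by simp
qed

lemma clt_bounded:
  assumes g: "dominated K g" and G: "\<And>x. \<bar>g x\<bar> \<le> G"
    and a: "\<And>n i. \<bar>a n i\<bar> \<le> 1" "\<And>n i. i > n \<Longrightarrow> a n i = 0"
  shows "(\<lambda>n. clt_err t (a n) g n) \<longlonglongrightarrow> 0"
proof -
  \<comment> \<open>With q of order n^(9/20) and r of order n^(2/5), q is o(sqrt n), r is o(q), and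
    m * \<beta> r is at most of order n^(11/20 - 4/5), for which the rate k^(-2) of the mixing
    coefficients is enough.\<close>
  define q where "q n = nat \<lfloor>real n powr (9/20)\<rfloor>" for n
  define r where "r n = nat \<lfloor>real n powr (2/5)\<rfloor>" for n
  define m where "m n = n div (q n + r n) + 1" for n
  define u where "u n = real (m n) * real (r n) / real n" for n
  define d where "d n = 2 * real (q n) * G / sqrt (real n)" for n
  define D where "D = 2 * cheb_const K"
  define B where "B n = real (m n) * \<beta> (r n)" for n
  define E where "E n = \<bar>t\<bar> * sqrt (D * u n) + 4 * B n + D * (\<bar>t\<bar> ^ 3 * d n + t ^ 4 * (d n)\<^sup>2)
     + t\<^sup>2 / 2 * (D * (2 * sqrt (u n) + u n) + 8 * cov_const * K\<^sup>2 / real (r n))" for n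
  have qr: "q n \<ge> 1" "r n \<ge> 1" "q n \<le> n" if "n \<ge> 1" for n
  proof -
    have "real n powr (9/20) \<ge> 1" "real n powr (2/5) \<ge> 1" using that by (auto intro: ge_one_powr_ge_zero)
    then show "q n \<ge> 1" "r n \<ge> 1" unfolding q_def r_def by (simp_all add: le_nat_iff le_floor_iff)
    have "real n powr (9/20) \<le> real n powr 1" using that by (intro powr_mono) auto
    then show "q n \<le> n" unfolding q_def using that by (simp add: nat_le_iff floor_le_iff)
  qed
  have m: "n \<le> m n * (q n + r n)" "m n * q n \<le> 2 * n" "real (m n) \<le> real n / real (q n) + 1" if n: "n \<ge> 1" for n
  proof -
    have "n = (n div (q n + r n)) * (q n + r n) + n mod (q n + r n)" by (simp only: div_mult_mod_eq)
    also have "n mod (q n + r n) \<le> q n + r n" using qr[OF n] by (intro less_imp_le mod_less_divisor) auto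
    finally show "n \<le> m n * (q n + r n)" by (simp add: m_def)
    have "(n div (q n + r n)) * q n \<le> (n div (q n + r n)) * (q n + r n)" by simp
    also have "\<dots> \<le> n" by (rule div_times_less_eq_dividend)
    finally show "m n * q n \<le> 2 * n" using qr[OF n] by (simp add: m_def)
    have "real (n div (q n + r n)) \<le> real n / real (q n + r n)" by (rule of_nat_div_le_of_nat)
    also have "\<dots> \<le> real n / real (q n)" using qr[OF n] by (intro divide_left_mono) auto
    finally show "real (m n) \<le> real n / real (q n) + 1" by (simp add: m_def)
  qed
  have ev1: "eventually (\<lambda>n. n \<ge> 1) sequentially" by (rule eventually_ge_at_top)
  have u: "u \<longlonglongrightarrow> 0"
  proof (rule tendsto_sandwich[of "\<lambda>_. 0"])
    show "\<forall>\<^sub>F n in sequentially. u n \<le> real (r n) / real (q n) + real (r n) / real n"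
      using ev1
    proof eventually_elim
      case (elim n)
      have "u n \<le> (real n / real (q n) + 1) * real (r n) / real n"
        unfolding u_def using m(3)[OF elim] by (intro divide_right_mono mult_right_mono) auto
      also have "\<dots> = real (r n) / real (q n) + real (r n) / real n" using elim by (simp add: field_simps)
      finally show ?case .
    qed
    show "(\<lambda>n. real (r n) / real (q n) + real (r n) / real n) \<longlonglongrightarrow> 0" unfolding q_def r_def by real_asymp
  qed (auto simp: u_def)
  have d: "d \<longlonglongrightarrow> 0"
  proof -
    have "(\<lambda>n. 2 * G * (real (q n) / sqrt (real n))) \<longlonglongrightarrow> 2 * G * 0"
      unfolding q_def by (intro tendsto_mult tendsto_const) real_asymp
    then show ?thesis by (simp add: d_def[abs_def] mult_ac)
  qed
  have rinv: "(\<lambda>n. 8 * cov_const * K\<^sup>2 / real (r n)) \<longlonglongrightarrow> 0"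
  proof -
    have "(\<lambda>n. 8 * cov_const * K\<^sup>2 * (1 / real (r n))) \<longlonglongrightarrow> 8 * cov_const * K\<^sup>2 * 0"
      unfolding r_def by (intro tendsto_mult tendsto_const) real_asymp
    then show ?thesis by simp
  qed
  have B: "B \<longlonglongrightarrow> 0"
  proof (rule tendsto_sandwich[of "\<lambda>_. 0"])
    show "\<forall>\<^sub>F n in sequentially. B n \<le> C\<beta> * ((real n / real (q n) + 1) / (real (r n))\<^sup>2)"
      using ev1
    proof eventually_elim
      case (elim n)
      have "\<beta> (r n) \<le> C\<beta> * real (r n) powr (- mix_exp \<delta>)" by (rule beta_bound[OF qr(2)[OF elim]])
      also have "\<dots> \<le> C\<beta> * real (r n) powr (- 2)"
        using mix_exp_ge_2 qr(2)[OF elim] C\<beta>_nonneg by (intro mult_left_mono powr_mono) auto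
      also have "real (r n) powr (- 2) = 1 / (real (r n))\<^sup>2" using qr(2)[OF elim] by (simp add: powr_minus_divide)
      finally have "B n \<le> (real n / real (q n) + 1) * (C\<beta> * (1 / (real (r n))\<^sup>2))"
        unfolding B_def using m(3)[OF elim] beta_coeff_nonneg by (intro mult_mono) auto
      also have "\<dots> = C\<beta> * ((real n / real (q n) + 1) / (real (r n))\<^sup>2)" by simp
      finally show ?case .
    qed
    have "(\<lambda>n. (real n / real (q n) + 1) / (real (r n))\<^sup>2) \<longlonglongrightarrow> 0" unfolding q_def r_def by real_asymp
    then show "(\<lambda>n. C\<beta> * ((real n / real (q n) + 1) / (real (r n))\<^sup>2)) \<longlonglongrightarrow> 0"
      using tendsto_mult_right_zero by blast
  qed (auto simp: B_def beta_coeff_nonneg)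
  have "E \<longlonglongrightarrow> \<bar>t\<bar> * sqrt (D * 0) + 4 * 0 + D * (\<bar>t\<bar> ^ 3 * 0 + t ^ 4 * 0\<^sup>2) + t\<^sup>2 / 2 * (D * (2 * sqrt 0 + 0) + 0)"
    unfolding E_def by (intro tendsto_intros u d B rinv)
  then have E: "E \<longlonglongrightarrow> 0" by simp
  show ?thesis
  proof (rule tendsto_sandwich[OF _ _ tendsto_const E])
    show "\<forall>\<^sub>F n in sequentially. clt_err t (a n) g n \<le> E n"
      using ev1
    proof eventually_elim
      case (elim n)
      show ?case
        unfolding clt_err_def nsum_def E_def u_def d_def B_def D_def
        by (rule clt_bounded_error[OF g G _ _ elim qr(1)[OF elim] qr(2)[OF elim] m(1)[OF elim] m(2)[OF elim]]) (use a in auto)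
    qed
  qed (auto simp: clt_err_def)
qed

end

lemma sum_split_at:
  fixes c :: "nat \<Rightarrow> 'b::comm_monoid_add"
  assumes "k \<le> n"
  shows "(\<Sum>i\<in>{1..n}. c i) = (\<Sum>i\<in>{1..k}. c i) + (\<Sum>i\<in>{k + 1..n}. c i)"
proof -
  have "{1..n} = {1..k} \<union> {k + 1..n}" using assms by auto
  then show ?thesis by (simp only:) (rule sum.union_disjoint, auto)
qed

context mixing_sequence
begin

text \<open>The part \<open>h\<close> perturbs the characteristic function and the variance of the
  matching Gaussian; both effects are measured by \<open>u\<close>. The constant is
  \<open>cheb_const K + 1\<close> so that it is positive and \<open>u\<close> can be defined by
  division.\<close>

lemma clt_err_approx:
  assumes f: "dominated K f" and g: "dominated K g" and h: "dominated K h" and fgh: "\<And>x. f x = g x + h x"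
    and a: "\<And>i. \<bar>a i\<bar> \<le> 1" and n: "n \<ge> 1"
    and u: "var_const K * (LINT w|M. (h (\<epsilon> 1 w))\<^sup>2) powr (1/4) \<le> (cheb_const K + 1) * u" "u \<ge> 0"
  shows "clt_err t a f n \<le> clt_err t a g n + (\<bar>t\<bar> * sqrt ((cheb_const K + 1) * u) + t\<^sup>2 / 2 * ((cheb_const K + 1) * (2 * sqrt u + u)))"
proof -
  define D where "D = cheb_const K + 1"
  have D: "D \<ge> 0" using cheb_const_nonneg[of K] by (simp add: D_def)
  define X where "X = nsum a g n"
  define Y where "Y = nsum a h n"
  have [measurable]: "X \<in> borel_measurable M" "Y \<in> borel_measurable M"
    unfolding X_def Y_def by (rule nsum_facts(1)[OF g], rule nsum_facts(1)[OF h])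
  have sq: "integrable M (\<lambda>w. (X w)\<^sup>2)" "integrable M (\<lambda>w. (Y w)\<^sup>2)"
    unfolding X_def Y_def by (rule nsum_facts(2)[OF g], rule nsum_facts(2)[OF h])
  have c: "centred f i w = centred g i w + centred h i w" for i w
    unfolding centred_def fgh using dominated_integrable[OF _ g, of 1] dominated_integrable[OF _ h, of 1] by simp
  have S: "nsum a f n w = X w + Y w" for w
    unfolding nsum_def X_def Y_def c by (simp add: distrib_left sum.distrib add_divide_distrib)
  have EX: "sq_mean X \<le> D"
  proof -
    have "sq_mean X \<le> cheb_const K"
      unfolding X_def by (rule expectation_nsum_sq_le'[OF g _ n]) (rule a)
    then show ?thesis by (simp add: D_def)
  qed
  have EY: "sq_mean Y \<le> D * u"
  proof -
    have "sq_mean Y \<le> var_const K * (LINT w|M. (h (\<epsilon> 1 w))\<^sup>2) powr (1/4)"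
      unfolding Y_def by (rule expectation_nsum_sq_le[OF h _ n]) (rule a)
    then show ?thesis using u(1) unfolding D_def by (rule order_trans)
  qed
  define V where "V = (LINT w|M. (X w + Y w)\<^sup>2)"
  define V' where "V' = sq_mean X"
  have V0: "V \<ge> 0" "V' \<ge> 0" by (simp_all add: V_def V'_def)
  have 1: "cmod ((CLINT w|M. iexp (t * (X w + Y w))) - (CLINT w|M. iexp (t * X w))) \<le> \<bar>t\<bar> * sqrt (D * u)"
    by (intro expectation_iexp_diff_le sq EY) simp_all
  have 2: "\<bar>V - V'\<bar> \<le> D * (2 * sqrt u + u)"
    unfolding V_def V'_def by (intro expectation_sq_add_diff_le sq EX EY D u(2)) simp_all
  have 3: "cmod (gauss_char V' t - gauss_char V t) \<le> t\<^sup>2 / 2 * (D * (2 * sqrt u + u))"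
  proof -
    have "cmod (gauss_char V' t - gauss_char V t) = \<bar>exp (- (t\<^sup>2 * V' / 2)) - exp (- (t\<^sup>2 * V / 2))\<bar>"
      by (simp only: norm_of_real flip: of_real_diff)
    also have "\<dots> \<le> \<bar>t\<^sup>2 * V' / 2 - t\<^sup>2 * V / 2\<bar>" using V0 by (intro abs_exp_minus_diff_le) auto
    also have "t\<^sup>2 * V' / 2 - t\<^sup>2 * V / 2 = t\<^sup>2 / 2 * (V' - V)" by (simp add: right_diff_distrib diff_divide_distrib)
    also have "\<bar>\<dots>\<bar> = t\<^sup>2 / 2 * \<bar>V' - V\<bar>" by (simp add: abs_mult)
    also have "\<dots> \<le> t\<^sup>2 / 2 * (D * (2 * sqrt u + u))" using 2 by (intro mult_left_mono) auto
    finally show ?thesis .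
  qed
  define A where "A = (CLINT w|M. iexp (t * (X w + Y w)))"
  define B where "B = (CLINT w|M. iexp (t * X w))"
  define C where "C = gauss_char V' t"
  define E where "E = gauss_char V t"
  have "cmod (A - E) \<le> cmod (A - B) + cmod (B - C) + cmod (C - E)"
    using norm_triangle_ineq[of "A - B" "B - E"] norm_triangle_ineq[of "B - C" "C - E"] by simp
  moreover have "clt_err t a f n = cmod (A - E)" unfolding clt_err_def S A_def E_def V_def ..
  moreover have "clt_err t a g n = cmod (B - C)" unfolding clt_err_def X_def[symmetric] B_def C_def V'_def ..
  ultimately show ?thesis using 1 3 unfolding A_def B_def C_def E_def D_def by linarith
qed

text \<open>\<open>f\<close> is split at norm \<open>L\<close>. The bounded part obeys
  \<open>clt_bounded\<close>; the normalised sum of the rest has small variance uniformly in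
  \<open>n\<close>, because its second moment tends to zero with growing \<open>L\<close> and enters
  the variance bound with power 1/4.\<close>

lemma clt_dominated:
  assumes f: "dominated K f" and a: "\<And>n i. \<bar>a n i\<bar> \<le> 1" "\<And>n i. i > n \<Longrightarrow> a n i = 0"
  shows "(\<lambda>n. clt_err t (a n) f n) \<longlonglongrightarrow> 0"
proof (rule LIMSEQ_I)
  fix e :: real assume "e > 0"
  define D where "D = cheb_const K + 1"
  have D: "D > 0" using cheb_const_nonneg[of K] by (simp add: D_def)
  define h where "h L x = (if norm x \<le> real L then 0 else f x)" for L :: nat and x
  define g where "g L x = (if norm x \<le> real L then f x else 0)" for L :: nat and x
  have [measurable]: "f \<in> borel_measurable borel" by (rule dominatedD(1)[OF f])
  have K0: "0 \<le> K * norm x" for x :: C01 using dominatedD(2)[OF f, of x] by linarith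
  have g: "dominated K (g L)" for L unfolding dominated_def g_def using dominatedD(2)[OF f] K0 by auto
  have h: "dominated K (h L)" for L unfolding dominated_def h_def using dominatedD(2)[OF f] K0 by auto
  define v where "v L = (LINT w|M. (h L (\<epsilon> 1 w))\<^sup>2)" for L
  have v: "v \<longlonglongrightarrow> 0"
  proof -
    have "(\<lambda>L. (LINT w|M. (h L (\<epsilon> 1 w))\<^sup>2)) \<longlonglongrightarrow> (LINT w|M. 0)"
    proof (rule integral_dominated_convergence[where w="\<lambda>w. (f (\<epsilon> 1 w))\<^sup>2"])
      show "integrable M (\<lambda>w. (f (\<epsilon> 1 w))\<^sup>2)" by (rule integrable_dominated_sq[OF _ f]) simp
      show "(\<lambda>w. (h L (\<epsilon> 1 w))\<^sup>2) \<in> borel_measurable M" for L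
        using dominatedD(1)[OF h[of L]] by measurable
      show "AE w in M. (\<lambda>L. (h L (\<epsilon> 1 w))\<^sup>2) \<longlonglongrightarrow> 0"
      proof (rule AE_I2)
        fix w
        obtain L0 :: nat where "norm (\<epsilon> 1 w) \<le> real L0" using real_arch_simple by blast
        then have "eventually (\<lambda>L. (h L (\<epsilon> 1 w))\<^sup>2 = 0) sequentially"
          unfolding h_def eventually_sequentially by (intro exI[of _ L0]) auto
        then show "(\<lambda>L. (h L (\<epsilon> 1 w))\<^sup>2) \<longlonglongrightarrow> 0" by (rule tendsto_eventually)
      qed
    qed (auto simp: h_def)
    then show ?thesis by (simp add: v_def[abs_def])
  qed
  \<comment> \<open>Chosen so that the smallness hypothesis of \<open>clt_err_approx\<close> holds
    with equality.\<close>
  define u where "u L = var_const K * v L powr (1/4) / D" for L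
  have u0: "u L \<ge> 0" for L using var_const_nonneg D by (simp add: u_def)
  have "(\<lambda>L. var_const K * v L powr (1/4) / D) \<longlonglongrightarrow> var_const K * 0 powr (1/4) / D"
    using D by (intro tendsto_intros tendsto_powr' v) (auto simp: v_def)
  then have u: "u \<longlonglongrightarrow> 0" by (simp add: u_def[abs_def])
  have "(\<lambda>L. \<bar>t\<bar> * sqrt (D * u L) + t\<^sup>2 / 2 * (D * (2 * sqrt (u L) + u L))) \<longlonglongrightarrow> \<bar>t\<bar> * sqrt (D * 0) + t\<^sup>2 / 2 * (D * (2 * sqrt 0 + 0))"
    by (intro tendsto_intros u)
  then have "eventually (\<lambda>L. \<bar>t\<bar> * sqrt (D * u L) + t\<^sup>2 / 2 * (D * (2 * sqrt (u L) + u L)) < e / 2) sequentially"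
    using \<open>e > 0\<close> by (intro order_tendstoD(2)) auto
  then obtain L where L: "\<bar>t\<bar> * sqrt (D * u L) + t\<^sup>2 / 2 * (D * (2 * sqrt (u L) + u L)) < e / 2"
    by (auto simp: eventually_sequentially)
  have gG: "\<bar>g L x\<bar> \<le> \<bar>K\<bar> * real L" for x
  proof (cases "norm x \<le> real L")
    case True
    have "K * norm x \<le> \<bar>K\<bar> * norm x" by (intro mult_right_mono) auto
    then have "\<bar>f x\<bar> \<le> \<bar>K\<bar> * norm x" using dominatedD(2)[OF f, of x] by linarith
    also have "\<dots> \<le> \<bar>K\<bar> * real L" using True by (intro mult_left_mono) auto
    finally show ?thesis using True by (simp add: g_def)
  qed (simp add: g_def)
  have "(\<lambda>n. clt_err t (a n) (g L) n) \<longlonglongrightarrow> 0"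
    by (rule clt_bounded[OF g gG]) (use a in auto)
  then have "eventually (\<lambda>n. clt_err t (a n) (g L) n < e / 2) sequentially"
    using \<open>e > 0\<close> by (intro order_tendstoD(2)) auto
  then obtain n1 where n1: "\<And>n. n \<ge> n1 \<Longrightarrow> clt_err t (a n) (g L) n < e / 2" by (auto simp: eventually_sequentially)
  show "\<exists>no. \<forall>n\<ge>no. norm (clt_err t (a n) f n - 0) < e"
  proof (intro exI[of _ "max n1 1"] allI impI)
    fix n assume n: "max n1 1 \<le> n"
    have "clt_err t (a n) f n \<le> clt_err t (a n) (g L) n + (\<bar>t\<bar> * sqrt ((cheb_const K + 1) * u L) + t\<^sup>2 / 2 * ((cheb_const K + 1) * (2 * sqrt (u L) + u L)))"
    proof (rule clt_err_approx[OF f g h])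
      show "f x = g L x + h L x" for x by (simp add: g_def h_def)
      show "var_const K * (LINT w|M. (h L (\<epsilon> 1 w))\<^sup>2) powr (1/4) \<le> (cheb_const K + 1) * u L"
        using D by (simp add: u_def v_def D_def)
    qed (use a u0 n in auto)
    also have "\<dots> < e" using L n1[of n] n unfolding D_def by auto
    finally show "norm (clt_err t (a n) f n - 0) < e" by (simp add: clt_err_def)
  qed
qed

section \<open>Long run variance and the weights of the CUSUM process\<close>

definition autocov :: "(C01 \<Rightarrow> real) \<Rightarrow> nat \<Rightarrow> real" where
  "autocov f k = (LINT w|M. centred f 1 w * centred f (1 + k) w)"

definition lrvar :: "(C01 \<Rightarrow> real) \<Rightarrow> real" where
  "lrvar f = autocov f 0 + 2 * (\<Sum>k. autocov f (Suc k))"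

definition psvar :: "(C01 \<Rightarrow> real) \<Rightarrow> nat \<Rightarrow> real" where
  "psvar f m = (\<Sum>i\<in>{1..m}. \<Sum>j\<in>{1..m}. autocov f (lag i j))"

lemma expectation_centred_lag:
  assumes "i \<ge> 1" "j \<ge> 1" and [measurable]: "f \<in> borel_measurable borel"
  shows "ccov f i f j = autocov f (lag i j)"
proof -
  define e where "e = (LINT w|M. f (\<epsilon> 1 w))"
  have *: "(LINT w|M. centred f i w * centred f (i + k) w) = autocov f k" if "i \<ge> 1" for i k
    unfolding autocov_def centred_def e_def[symmetric]
    using integral_pair[OF that, of "\<lambda>x y. (f x - e) * (f y - e)" k] by simp
  show ?thesis
  proof (cases "i \<le> j")
    case True
    then show ?thesis using *[OF assms(1), of "lag i j"] by (simp add: lag_def)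
  next
    case False
    then show ?thesis using *[OF assms(2), of "lag i j"] by (simp add: lag_def mult.commute)
  qed
qed

lemma psvar_shift:
  assumes f: "dominated K f"
  shows "(LINT w|M. (\<Sum>i\<in>{k + 1..k + m}. centred f i w)\<^sup>2) = psvar f m"
proof -
  have "(LINT w|M. (\<Sum>i\<in>{k + 1..k + m}. 1 * centred f i w) * (\<Sum>i\<in>{k + 1..k + m}. 1 * centred f i w)) =
    (\<Sum>i\<in>{k + 1..k + m}. \<Sum>j\<in>{k + 1..k + m}. 1 * 1 * ccov f i f j)"
    by (rule expectation_sum_centred_mult(2)[OF _ _ _ _ f]) auto
  also have "\<dots> = (\<Sum>i\<in>{k + 1..k + m}. \<Sum>j\<in>{k + 1..k + m}. autocov f (lag i j))"
    using dominatedD(1)[OF f] by (intro sum.cong refl) (simp add: expectation_centred_lag)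
  also have "\<dots> = (\<Sum>i\<in>{1 + k..m + k}. \<Sum>j\<in>{1 + k..m + k}. autocov f (lag i j))" by (simp only: add.commute)
  also have "\<dots> = psvar f m"
    unfolding psvar_def sum.shift_bounds_cl_nat_ivl by (simp add: lag_def)
  finally show ?thesis by (simp add: power2_eq_square)
qed

lemma summable_autocov:
  assumes "dominated K f"
  shows "summable (\<lambda>k. autocov f (Suc k))"
proof (rule summable_comparison_test')
  show "summable (\<lambda>k. cov_const * K\<^sup>2 * (1 / (real (Suc k))\<^sup>2))"
    using inverse_squares_sums by (intro summable_mult) (auto simp: sums_iff add.commute)
  fix k :: nat assume "k \<ge> 0"
  show "norm (autocov f (Suc k)) \<le> cov_const * K\<^sup>2 * (1 / (real (Suc k))\<^sup>2)"
    using centred_cov_decay[of 1 "1 + Suc k" K f f] assms unfolding autocov_def by (simp add: lag_def)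
qed

text \<open>Passing from \<open>m\<close> to \<open>m + 1\<close> adds the variance and twice the
  first \<open>m\<close> autocovariances. These increments converge to \<open>lrvar f\<close>, hence
  so do their Cesaro means.\<close>

lemma psvar_tendsto:
  assumes f: "dominated K f"
  shows "(\<lambda>m. psvar f m / real m) \<longlonglongrightarrow> lrvar f"
proof -
  have inc: "psvar f (Suc m) - psvar f m = autocov f 0 + 2 * (\<Sum>k<m. autocov f (Suc k))" for m
  proof -
    have rev: "(\<Sum>i\<in>{1..m}. autocov f (lag i (Suc m))) = (\<Sum>k<m. autocov f (Suc k))"
    proof -
      have "(\<Sum>i\<in>{1..m}. autocov f (lag i (Suc m))) = (\<Sum>i\<in>{1..m}. autocov f (m + 1 - i))"
        by (intro sum.cong refl) (auto simp: lag_def)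
      also have "\<dots> = (\<Sum>i\<in>{1..m}. autocov f i)" by (rule sum.atLeastAtMost_rev[symmetric])
      also have "\<dots> = (\<Sum>k<m. autocov f (Suc k))" by (simp add: sum.atLeast1_atMost_eq)
      finally show ?thesis .
    qed
    have "(\<Sum>i\<in>{1..m}. autocov f (lag (Suc m) i)) = (\<Sum>i\<in>{1..m}. autocov f (lag i (Suc m)))"
      by (simp add: lag_def add.commute)
    then show ?thesis
      unfolding psvar_def using rev by (simp add: sum.cl_ivl_Suc sum.distrib) (simp add: lag_def)
  qed
  have "(\<lambda>m. \<Sum>k<m. autocov f (Suc k)) \<longlonglongrightarrow> (\<Sum>k. autocov f (Suc k))"
    using summable_autocov[OF f] by (rule summable_LIMSEQ)
  then have "(\<lambda>m. psvar f (Suc m) - psvar f m) \<longlonglongrightarrow> lrvar f"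
    unfolding inc lrvar_def by (intro tendsto_intros)
  from cesaro_tendsto[OF this] show ?thesis
    by (simp add: sum_lessThan_telescope) (simp add: psvar_def)
qed

text \<open>The weights of the errors in the CUSUM process at index \<open>k\<close>: the weighted
  sum is the partial sum up to \<open>k\<close> minus k/n times the full sum.\<close>

definition stepw :: "nat \<Rightarrow> nat \<Rightarrow> nat \<Rightarrow> real" where
  "stepw k n i = (if i \<le> k then 1 - real k / real n else if i \<le> n then - (real k / real n) else 0)"

lemma stepw_le:
  assumes k: "k \<le> n"
  shows "\<bar>stepw k n i\<bar> \<le> 1" "i > n \<Longrightarrow> stepw k n i = 0"
proof -
  have "0 \<le> real k / real n" "real k / real n \<le> 1" using k by (auto simp: divide_le_eq_1)
  then show "\<bar>stepw k n i\<bar> \<le> 1" unfolding stepw_def by auto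
  show "stepw k n i = 0" if "i > n" using that k by (simp add: stepw_def)
qed

lemma sum_stepw:
  fixes c :: "nat \<Rightarrow> 'b::real_vector"
  assumes "k \<le> n"
  shows "(\<Sum>i\<in>{1..n}. stepw k n i *\<^sub>R c i) = (1 - real k / real n) *\<^sub>R (\<Sum>i\<in>{1..k}. c i) - (real k / real n) *\<^sub>R (\<Sum>i\<in>{k + 1..n}. c i)"
proof -
  have "(\<Sum>i\<in>{1..n}. stepw k n i *\<^sub>R c i) = (\<Sum>i\<in>{1..k}. stepw k n i *\<^sub>R c i) + (\<Sum>i\<in>{k + 1..n}. stepw k n i *\<^sub>R c i)"
    by (rule sum_split_at[OF assms])
  also have "(\<Sum>i\<in>{1..k}. stepw k n i *\<^sub>R c i) = (\<Sum>i\<in>{1..k}. (1 - real k / real n) *\<^sub>R c i)"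
    by (intro sum.cong) (auto simp: stepw_def)
  also have "(\<Sum>i\<in>{k + 1..n}. stepw k n i *\<^sub>R c i) = (\<Sum>i\<in>{k + 1..n}. - ((real k / real n) *\<^sub>R c i))"
    by (intro sum.cong) (auto simp: stepw_def)
  finally show ?thesis by (simp add: scaleR_right.sum sum_negf)
qed

text \<open>The covariance of the sums before and after \<open>k\<close> is eliminated by
  polarisation: twice this covariance is the variance of the full sum minus those of the two parts.
  Only variances of consecutive sums remain, whose growth is known.\<close>

lemma stepw_variance:
  assumes f: "dominated K f" and k: "k \<le> n" and n: "n \<ge> 1"
  shows "(LINT w|M. (nsum (stepw k n) f n w)\<^sup>2) =
    ((1 - real k / real n) * psvar f k + real k / real n * psvar f (n - k) - real k / real n * (1 - real k / real n) * psvar f n) / real n"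
proof -
  define \<kappa> where "\<kappa> = real k / real n"
  define A where "A w = (\<Sum>i\<in>{1..k}. centred f i w)" for w
  define B where "B w = (\<Sum>i\<in>{k + 1..n}. centred f i w)" for w
  have EA: "sq_mean A = psvar f k" unfolding A_def using psvar_shift[OF f, of 0 k] by simp
  have EB: "sq_mean B = psvar f (n - k)" unfolding B_def using psvar_shift[OF f, of k "n - k"] k by simp
  have AB: "A w + B w = (\<Sum>i\<in>{1..n}. centred f i w)" for w
    unfolding A_def B_def by (rule sum_split_at[OF k, symmetric])
  have EAB: "(LINT w|M. (A w + B w)\<^sup>2) = psvar f n" unfolding AB using psvar_shift[OF f, of 0 n] by simp
  have int: "integrable M (\<lambda>w. (A w)\<^sup>2)" "integrable M (\<lambda>w. (B w)\<^sup>2)" "integrable M (\<lambda>w. A w * B w)"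
    unfolding A_def B_def power2_eq_square
    using expectation_sum_centred_mult(1)[OF _ _ _ _ f, of "{1..k}" "{1..k}" "\<lambda>_. 1" "\<lambda>_. 1"]
      expectation_sum_centred_mult(1)[OF _ _ _ _ f, of "{k + 1..n}" "{k + 1..n}" "\<lambda>_. 1" "\<lambda>_. 1"]
      expectation_sum_centred_mult(1)[OF _ _ _ _ f, of "{1..k}" "{k + 1..n}" "\<lambda>_. 1" "\<lambda>_. 1"] by simp_all
  have lin: "(LINT w|M. (x * A w + y * B w)\<^sup>2) = x\<^sup>2 * psvar f k + 2 * x * y * (LINT w|M. A w * B w) + y\<^sup>2 * psvar f (n - k)" for x y
  proof -
    have "(\<lambda>w. (x * A w + y * B w)\<^sup>2) = (\<lambda>w. x\<^sup>2 * (A w)\<^sup>2 + (2 * x * y) * (A w * B w) + y\<^sup>2 * (B w)\<^sup>2)"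
      by (auto simp: power2_sum power_mult_distrib)
    then show ?thesis using int by (simp add: EA EB)
  qed
  have cross: "2 * (LINT w|M. A w * B w) = psvar f n - psvar f k - psvar f (n - k)"
    using lin[of 1 1] EAB by simp
  have "(\<Sum>i\<in>{1..n}. stepw k n i * centred f i w) = (1 - \<kappa>) * A w + (- \<kappa>) * B w" for w
    using sum_stepw[OF k, of "\<lambda>i. centred f i w"] by (simp add: A_def B_def \<kappa>_def)
  then have "(LINT w|M. (nsum (stepw k n) f n w)\<^sup>2) = (LINT w|M. ((1 - \<kappa>) * A w + (- \<kappa>) * B w)\<^sup>2) / real n"
    by (simp add: nsum_def power_divide)
  also have "(LINT w|M. ((1 - \<kappa>) * A w + (- \<kappa>) * B w)\<^sup>2) =
     (1 - \<kappa>)\<^sup>2 * psvar f k - (1 - \<kappa>) * \<kappa> * (2 * (LINT w|M. A w * B w)) + \<kappa>\<^sup>2 * psvar f (n - k)"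
    unfolding lin by simp
  also have "\<dots> = (1 - \<kappa>) * psvar f k + \<kappa> * psvar f (n - k) - \<kappa> * (1 - \<kappa>) * psvar f n"
    unfolding cross by (simp add: algebra_simps power2_eq_square)
  finally show ?thesis by (simp add: \<kappa>_def)
qed

lemma stepw_variance_tendsto:
  assumes f: "dominated K f" and k: "\<And>n. k n \<le> n" and s: "(\<lambda>n. real (k n) / real n) \<longlonglongrightarrow> s" "0 < s" "s < 1"
  shows "(\<lambda>n. (LINT w|M. (nsum (stepw (k n) n) f n w)\<^sup>2)) \<longlonglongrightarrow> s * (1 - s) * lrvar f"
proof -
  have lim: "(\<lambda>n. psvar f (p n) / real n) \<longlonglongrightarrow> x * lrvar f" if p: "(\<lambda>n. real (p n) / real n) \<longlonglongrightarrow> x" "x > 0" for p x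
  proof -
    have "filterlim (\<lambda>n. real (p n) / real n * real n) at_top sequentially"
      by (rule filterlim_tendsto_pos_mult_at_top[OF p filterlim_real_sequentially])
    moreover have "eventually (\<lambda>n. real (p n) / real n * real n = real (p n)) sequentially"
      using eventually_gt_at_top[of 0] by eventually_elim simp
    ultimately have r: "filterlim (\<lambda>n. real (p n)) at_top sequentially" by (simp add: filterlim_cong)
    then have "filterlim p at_top sequentially"
      by (simp only: filterlim_sequentially_iff_filterlim_real)
    then have "(\<lambda>n. psvar f (p n) / real (p n)) \<longlonglongrightarrow> lrvar f" by (rule filterlim_compose[OF psvar_tendsto[OF f]])
    then have "(\<lambda>n. real (p n) / real n * (psvar f (p n) / real (p n))) \<longlonglongrightarrow> x * lrvar f"
      by (intro tendsto_mult p)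
    moreover have "eventually (\<lambda>n. real (p n) > 0) sequentially" using r unfolding filterlim_at_top_dense by blast
    then have "eventually (\<lambda>n. real (p n) / real n * (psvar f (p n) / real (p n)) = psvar f (p n) / real n) sequentially"
      by eventually_elim simp
    ultimately show ?thesis by (rule Lim_transform_eventually)
  qed
  have l2: "(\<lambda>n. real (n - k n) / real n) \<longlonglongrightarrow> 1 - s"
  proof (rule Lim_transform_eventually)
    show "(\<lambda>n. 1 - real (k n) / real n) \<longlonglongrightarrow> 1 - s" by (intro tendsto_intros s)
    show "\<forall>\<^sub>F n in sequentially. 1 - real (k n) / real n = real (n - k n) / real n"
      using eventually_gt_at_top[of 0] by eventually_elim (use k in \<open>simp add: of_nat_diff diff_divide_distrib\<close>)
  qed
  have l3: "(\<lambda>n. real n / real n) \<longlonglongrightarrow> 1"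
    by (rule tendsto_eventually) (use eventually_gt_at_top[of 0] in eventually_elim, simp)
  have lim1: "(\<lambda>n. (1 - real (k n) / real n) * (psvar f (k n) / real n) + real (k n) / real n * (psvar f (n - k n) / real n)
      - real (k n) / real n * (1 - real (k n) / real n) * (psvar f n / real n))
    \<longlonglongrightarrow> (1 - s) * (s * lrvar f) + s * ((1 - s) * lrvar f) - s * (1 - s) * (1 * lrvar f)"
    using s by (intro tendsto_intros lim l2 l3) auto
  have val: "(1 - s) * (s * lrvar f) + s * ((1 - s) * lrvar f) - s * (1 - s) * (1 * lrvar f) = s * (1 - s) * lrvar f"
    by (simp add: algebra_simps)
  have "eventually (\<lambda>n. (1 - real (k n) / real n) * (psvar f (k n) / real n) + real (k n) / real n * (psvar f (n - k n) / real n)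
      - real (k n) / real n * (1 - real (k n) / real n) * (psvar f n / real n) = (LINT w|M. (nsum (stepw (k n) n) f n w)\<^sup>2)) sequentially"
    using eventually_ge_at_top[of 1]
    by eventually_elim (simp add: stepw_variance[OF f k] add_divide_distrib diff_divide_distrib)
  with lim1 show ?thesis unfolding val by (rule Lim_transform_eventually)
qed

lemma stepw_char_tendsto:
  assumes f: "dominated K f" and k: "\<And>n. k n \<le> n" and s: "(\<lambda>n. real (k n) / real n) \<longlonglongrightarrow> s" "0 < s" "s < 1"
  shows "(\<lambda>n. CLINT w|M. iexp (t * nsum (stepw (k n) n) f n w)) \<longlonglongrightarrow> gauss_char (s * (1 - s) * lrvar f) t"
proof -
  define V where "V n = (LINT w|M. (nsum (stepw (k n) n) f n w)\<^sup>2)" for n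
  have "(\<lambda>n. clt_err t (stepw (k n) n) f n) \<longlonglongrightarrow> 0"
    by (rule clt_dominated[OF f]) (use stepw_le k in auto)
  then have "(\<lambda>n. (CLINT w|M. iexp (t * nsum (stepw (k n) n) f n w)) - gauss_char (V n) t) \<longlonglongrightarrow> 0"
    unfolding clt_err_def V_def by (rule tendsto_norm_zero_cancel)
  moreover have "(\<lambda>n. gauss_char (V n) t) \<longlonglongrightarrow> gauss_char (s * (1 - s) * lrvar f) t"
    unfolding V_def by (intro tendsto_intros stepw_variance_tendsto[OF f k s]) simp
  ultimately show ?thesis using tendsto_add by fastforce
qed

end

section \<open>Weak convergence in C([0,1])\<close>

lemma (in prob_space) abs_expectation_diff_le:
  assumes "integrable M f" "integrable M g" "\<And>w. \<bar>f w - g w\<bar> \<le> (c::real)"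
  shows "\<bar>expectation f - expectation g\<bar> \<le> c"
proof -
  have "expectation f \<le> (LINT w|M. g w + c)" "expectation g \<le> (LINT w|M. f w + c)"
    using assms(3) by (intro integral_mono Bochner_Integration.integrable_add assms; simp add: abs_le_iff algebra_simps)+
  then show ?thesis using assms(1,2) by (simp add: prob_space abs_le_iff)
qed

text \<open>A weight of at least one has a normalising constant bounded away from zero. After
  normalisation an integral against the weight is an integral under a probability law on the line,
  to which one-dimensional theory applies.\<close>

lemma (in prob_space) weighted_law:
  fixes wt U :: "'a \<Rightarrow> real"
  assumes [measurable]: "wt \<in> borel_measurable M" "U \<in> borel_measurable M"
    and wt: "\<And>w. 1 \<le> wt w" "\<And>w. wt w \<le> K"
  defines "\<nu> \<equiv> distr (density M (\<lambda>w. ennreal (wt w / expectation wt))) borel U"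
  shows "expectation wt \<ge> 1" "real_distribution \<nu>"
    "\<And>h :: real \<Rightarrow> 'b :: {banach, second_countable_topology}. h \<in> borel_measurable borel \<Longrightarrow>
       integral\<^sup>L \<nu> h = (LINT w|M. wt w *\<^sub>R h (U w)) /\<^sub>R expectation wt"
proof -
  have wi: "integrable M wt"
    by (rule integrable_const_bound[of _ K]) (use wt in \<open>auto intro!: AE_I2 simp: order_trans[OF zero_le_one wt(1)]\<close>)
  have "expectation (\<lambda>_. 1) \<le> expectation wt"
    by (intro integral_mono wi wt) simp
  then show c: "expectation wt \<ge> 1" by (simp add: prob_space)
  have pos: "0 \<le> wt w / expectation wt" for w using wt(1)[of w] c by simp
  have "(\<integral>\<^sup>+ w. ennreal (wt w / expectation wt) \<partial>M) = 1"
    using c by (subst nn_integral_eq_integral) (auto simp: wi pos)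
  then have "prob_space (density M (\<lambda>w. ennreal (wt w / expectation wt)))"
    by (intro prob_spaceI) (simp add: emeasure_density)
  then show "real_distribution \<nu>" unfolding \<nu>_def
    by (rule prob_space.real_distribution_distr) (use assms(2) in \<open>simp add: measurable_cong_sets[OF sets_density refl]\<close>)
  fix h :: "real \<Rightarrow> 'b" assume [measurable]: "h \<in> borel_measurable borel"
  have "integral\<^sup>L \<nu> h = (LINT w|M. (wt w / expectation wt) *\<^sub>R h (U w))"
    unfolding \<nu>_def by (simp add: integral_distr integral_density pos)
  also have "\<dots> = (LINT w|M. inverse (expectation wt) *\<^sub>R (wt w *\<^sub>R h (U w)))"
    by (simp add: field_simps)
  finally show "integral\<^sup>L \<nu> h = (LINT w|M. wt w *\<^sub>R h (U w)) /\<^sub>R expectation wt"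
    by (simp del: scaleR_scaleR)
qed

text \<open>The phase - pi/2 turns the cosine into the sine, so cosines with arbitrary phase carry
  the complete characteristic function while all integrals stay real.\<close>

lemma (in prob_space) integral_weighted_iexp:
  fixes wt U :: "'a \<Rightarrow> real"
  assumes [measurable]: "wt \<in> borel_measurable M" "U \<in> borel_measurable M"
    and wt: "\<And>w. \<bar>wt w\<bar> \<le> K"
  shows "(CLINT w|M. wt w *\<^sub>R iexp (t * U w)) =
    complex_of_real (LINT w|M. wt w * cos (t * U w + 0)) +
    \<i> * complex_of_real (LINT w|M. wt w * cos (t * U w + (- pi / 2)))"
proof -
  have i: "integrable M (\<lambda>w. complex_of_real (wt w * cos (t * U w + b)))" for b
    using order_trans[OF mult_mono[OF wt abs_cos_le_one]]
    by (intro integrable_of_real integrable_const_bound[of _ "K * 1"] AE_I2) (auto simp: abs_mult intro: order_trans[OF abs_ge_zero wt])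
  have "cos (x + (- pi / 2)) = sin x" for x :: real
    by (subst cos_minus[symmetric]) (simp add: sin_cos_eq)
  then have "(\<lambda>w. wt w *\<^sub>R iexp (t * U w)) = (\<lambda>w. complex_of_real (wt w * cos (t * U w + 0)) + \<i> * complex_of_real (wt w * cos (t * U w + (- pi / 2))))"
    unfolding cis_conv_exp[symmetric] by (intro ext) (simp add: complex_eq_iff)
  then show ?thesis
    by (simp only: Bochner_Integration.integral_add[OF i integrable_mult_right[OF i]] integral_mult_right_zero integral_complex_of_real)
qed

text \<open>
  Levy's continuity theorem for the laws of \<open>U n\<close> under the densities \<open>wt n\<close>, normalised to mass one.
\<close>

lemma weighted_levy:
  fixes wt U :: "nat \<Rightarrow> 'a \<Rightarrow> real" and wt' U' :: "'b \<Rightarrow> real" and g :: "real \<Rightarrow> real"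
  assumes "prob_space M" "prob_space N"
    and [measurable]: "\<And>n. wt n \<in> borel_measurable M" "\<And>n. U n \<in> borel_measurable M"
      "wt' \<in> borel_measurable N" "U' \<in> borel_measurable N"
    and wt: "\<And>n w. 1 \<le> wt n w" "\<And>n w. wt n w \<le> K" "\<And>w. 1 \<le> wt' w" "\<And>w. wt' w \<le> K"
    and conv: "\<And>r b. (\<lambda>n. LINT w|M. wt n w * cos (r * U n w + b)) \<longlonglongrightarrow> (LINT w|N. wt' w * cos (r * U' w + b))"
    and g: "continuous_on UNIV g" "\<And>x. \<bar>g x\<bar> \<le> B"
  shows "(\<lambda>n. LINT w|M. wt n w * g (U n w)) \<longlonglongrightarrow> (LINT w|N. wt' w * g (U' w))"
proof -
  interpret M: prob_space M by fact
  interpret N: prob_space N by fact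
  note wl = M.weighted_law[of "wt n" "U n" K for n, OF assms(3,4) wt(1,2)]
  note wl' = N.weighted_law[of wt' U' K, OF assms(5,6) wt(3,4)]
  have [measurable]: "g \<in> borel_measurable borel" by (rule borel_measurable_continuous_onI) fact
  have c: "(\<lambda>n. M.expectation (wt n)) \<longlonglongrightarrow> N.expectation wt'" using conv[of 0 0] by simp
  have c0: "N.expectation wt' \<noteq> 0" using wl'(1) by auto
  have abs: "\<bar>wt n w\<bar> \<le> K" "\<bar>wt' w'\<bar> \<le> K" for n w w' using wt(1)[of n w] wt(2)[of n w] wt(3,4)[of w'] by linarith+
  have "weak_conv_m (\<lambda>n. distr (density M (\<lambda>w. ennreal (wt n w / M.expectation (wt n)))) borel (U n))
     (distr (density N (\<lambda>w. ennreal (wt' w / N.expectation wt'))) borel U')" (is "weak_conv_m ?\<mu> ?\<nu>")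
  proof (rule levy_continuity)
    fix t
    have "(\<lambda>n. (CLINT w|M. wt n w *\<^sub>R iexp (t * U n w)) /\<^sub>R M.expectation (wt n)) \<longlonglongrightarrow>
        (CLINT w|N. wt' w *\<^sub>R iexp (t * U' w)) /\<^sub>R N.expectation wt'"
      unfolding M.integral_weighted_iexp[OF assms(3,4) abs(1)] N.integral_weighted_iexp[OF assms(5,6) abs(2)]
      by (intro tendsto_intros c c0 conv)
    then show "(\<lambda>n. char (?\<mu> n) t) \<longlonglongrightarrow> char ?\<nu> t"
      by (simp add: char_def wl(3) wl'(3))
  qed (rule wl(2) wl'(2))+
  then have "(\<lambda>n. integral\<^sup>L (?\<mu> n) g) \<longlonglongrightarrow> integral\<^sup>L ?\<nu> g"
    by (intro weak_conv_imp_integral_bdd_continuous_conv[where B=B] wl(2) wl'(2))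
      (use g in \<open>auto simp: continuous_on_eq_continuous_at\<close>)
  then have "(\<lambda>n. M.expectation (wt n) * integral\<^sup>L (?\<mu> n) g) \<longlonglongrightarrow> N.expectation wt' * integral\<^sup>L ?\<nu> g"
    by (intro tendsto_mult c)
  moreover have "M.expectation (wt n) \<noteq> 0" for n using wl(1)[of n] by auto
  ultimately show ?thesis using c0 by (simp add: wl(3) wl'(3) flip: mult.assoc)
qed

text \<open>The set \<open>L\<close> is a parameter because convergence of the characteristic
  functions will be available for centred linear functionals. Closure under adding multiples of
  evaluations lets a further coordinate be absorbed into the character.\<close>

locale fidi_convergence = M: prob_space M + N: prob_space N
  for M :: "'a measure" and N :: "'b measure" +
  fixes Z :: "nat \<Rightarrow> 'a \<Rightarrow> C01" and Y :: "'b \<Rightarrow> C01" and L :: "(C01 \<Rightarrow> real) set"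
  assumes Z_measurable [measurable]: "\<And>n. Z n \<in> borel_measurable M"
    and Y_measurable [measurable]: "Y \<in> borel_measurable N"
    and L_measurable: "\<And>l. l \<in> L \<Longrightarrow> l \<in> borel_measurable borel"
    and L_zero: "(\<lambda>_. 0) \<in> L"
    and L_add: "\<And>l r t. l \<in> L \<Longrightarrow> t \<in> {0..1} \<Longrightarrow> (\<lambda>x. l x + r * val_at x t) \<in> L"
    and cos_conv: "\<And>l a. l \<in> L \<Longrightarrow>
      (\<lambda>n. LINT w|M. cos (l (Z n w) + a)) \<longlonglongrightarrow> (LINT w|N. cos (l (Y w) + a))"
begin

abbreviation EZ :: "nat \<Rightarrow> (C01 \<Rightarrow> real) \<Rightarrow> real" where "EZ n f \<equiv> LINT w|M. f (Z n w)"

abbreviation EY :: "(C01 \<Rightarrow> real) \<Rightarrow> real" where "EY f \<equiv> LINT w|N. f (Y w)"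

text \<open>
  Test functions that may be multiplied with any character. Multiplying them with functions of a
  single evaluation stays in the class (\<open>weighted_levy\<close>), which replaces the multivariate continuity theorem.
\<close>

definition conv_fun :: "(C01 \<Rightarrow> real) \<Rightarrow> bool" where
  "conv_fun f \<longleftrightarrow> f \<in> borel_measurable borel \<and> (\<exists>B. \<forall>x. \<bar>f x\<bar> \<le> B) \<and>
     (\<forall>l\<in>L. \<forall>a. (\<lambda>n. EZ n (\<lambda>x. f x * cos (l x + a))) \<longlonglongrightarrow>
               EY (\<lambda>x. f x * cos (l x + a)))"

lemma conv_fun_const: "conv_fun (\<lambda>_. c)"
  unfolding conv_fun_def using cos_conv by (auto intro!: tendsto_mult)

lemma integrable_conv:
  assumes [measurable]: "f \<in> borel_measurable borel" and "\<And>x. \<bar>f x\<bar> \<le> B"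
  shows "integrable M (\<lambda>w. f (Z n w) :: real)" "integrable N (\<lambda>w. f (Y w))"
  by (rule M.integrable_const_bound[of _ B] N.integrable_const_bound[of _ B]; use assms in \<open>auto intro!: AE_I2\<close>)+

lemma abs_mult_cos_le: "\<bar>x\<bar> \<le> B \<Longrightarrow> \<bar>x * cos y\<bar> \<le> (B::real)"
  using mult_mono[of "\<bar>x\<bar>" B "\<bar>cos y\<bar>" 1] by (auto simp: abs_mult)

lemma conv_fun_add:
  assumes "conv_fun f" "conv_fun g"
  shows "conv_fun (\<lambda>x. f x + g x)"
proof -
  obtain B C where B: "\<And>x. \<bar>f x\<bar> \<le> B" "\<And>x. \<bar>g x\<bar> \<le> C" using assms by (auto simp: conv_fun_def)
  have [measurable]: "f \<in> borel_measurable borel" "g \<in> borel_measurable borel"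
    using assms by (auto simp: conv_fun_def)
  have "\<bar>f x + g x\<bar> \<le> B + C" for x using B(1)[of x] B(2)[of x] by linarith
  moreover {
    fix l a assume l: "l \<in> L"
    note [measurable] = L_measurable[OF l]
    note i = integrable_conv[of "\<lambda>x. f x * cos (l x + a)" B] integrable_conv[of "\<lambda>x. g x * cos (l x + a)" C]
    have "(\<lambda>n. EZ n (\<lambda>x. f x * cos (l x + a)) + EZ n (\<lambda>x. g x * cos (l x + a))) \<longlonglongrightarrow>
               EY (\<lambda>x. f x * cos (l x + a)) + EY (\<lambda>x. g x * cos (l x + a))"
      by (intro tendsto_add) (use assms l in \<open>auto simp: conv_fun_def\<close>)
    then have "(\<lambda>n. EZ n (\<lambda>x. (f x + g x) * cos (l x + a))) \<longlonglongrightarrow>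
               EY (\<lambda>x. (f x + g x) * cos (l x + a))"
      using i B abs_mult_cos_le by (simp add: distrib_right)
  }
  ultimately show ?thesis unfolding conv_fun_def by auto
qed

lemma conv_fun_sum:
  "finite I \<Longrightarrow> (\<And>i. i \<in> I \<Longrightarrow> conv_fun (f i)) \<Longrightarrow> conv_fun (\<lambda>x. \<Sum>i\<in>I. f i x)"
  by (induction I rule: finite_induct) (auto intro: conv_fun_add conv_fun_const)

lemma conv_fun_uniform_limit:
  assumes [measurable]: "f \<in> borel_measurable borel"
    and approx: "\<And>e. e > 0 \<Longrightarrow> \<exists>g. conv_fun g \<and> (\<forall>x. \<bar>f x - g x\<bar> \<le> e)"
  shows "conv_fun f"
proof -
  obtain g where g: "conv_fun g" "\<And>x. \<bar>f x - g x\<bar> \<le> 1" using approx[of 1] by auto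
  then obtain B where B: "\<And>x. \<bar>g x\<bar> \<le> B" by (auto simp: conv_fun_def)
  have fB: "\<bar>f x\<bar> \<le> B + 1" for x using B[of x] g(2)[of x] by linarith
  {
    fix l a assume l: "l \<in> L"
    note [measurable] = L_measurable[OF l]
    have "(\<lambda>n. EZ n (\<lambda>x. f x * cos (l x + a))) \<longlonglongrightarrow> EY (\<lambda>x. f x * cos (l x + a))"
    proof (rule LIMSEQ_I)
      fix e :: real assume e: "e > 0"
      then obtain h where h: "conv_fun h" "\<And>x. \<bar>f x - h x\<bar> \<le> e / 4" using approx[of "e/4"] by auto
      then obtain C where C: "\<And>x. \<bar>h x\<bar> \<le> C" by (auto simp: conv_fun_def)
      have [measurable]: "h \<in> borel_measurable borel" using h by (auto simp: conv_fun_def)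
      note i = integrable_conv[of "\<lambda>x. f x * cos (l x + a)" "B + 1"] integrable_conv[of "\<lambda>x. h x * cos (l x + a)" C]
      have d: "\<bar>f x * cos y - h x * cos y\<bar> \<le> e / 4" for x y
        using abs_mult_cos_le[OF h(2)] by (simp add: left_diff_distrib)
      have dM: "\<bar>EZ n (\<lambda>x. f x * cos (l x + a)) - EZ n (\<lambda>x. h x * cos (l x + a))\<bar> \<le> e / 4" for n
        using i(1,3)[of n] fB C abs_mult_cos_le d
        by (intro M.abs_expectation_diff_le) auto
      have dN: "\<bar>EY (\<lambda>x. f x * cos (l x + a)) - EY (\<lambda>x. h x * cos (l x + a))\<bar> \<le> e / 4"
        using i(2,4) fB C abs_mult_cos_le d
        by (intro N.abs_expectation_diff_le) auto
      have "(\<lambda>n. EZ n (\<lambda>x. h x * cos (l x + a))) \<longlonglongrightarrow> EY (\<lambda>x. h x * cos (l x + a))"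
        using h(1) l by (auto simp: conv_fun_def)
      from LIMSEQ_D[OF this, of "e/4"] e obtain n0 where
        n0: "\<bar>EZ n (\<lambda>x. h x * cos (l x + a)) - EY (\<lambda>x. h x * cos (l x + a))\<bar> < e / 4" if "n \<ge> n0" for n by auto
      show "\<exists>no. \<forall>n\<ge>no. norm (EZ n (\<lambda>x. f x * cos (l x + a)) - EY (\<lambda>x. f x * cos (l x + a))) < e"
      proof (intro exI[of _ n0] allI impI)
        fix n assume n: "n \<ge> n0"
        show "norm (EZ n (\<lambda>x. f x * cos (l x + a)) - EY (\<lambda>x. f x * cos (l x + a))) < e"
          using dM[of n] dN n0[OF n] e unfolding real_norm_def by linarith
      qed
    qed
  }
  then show ?thesis unfolding conv_fun_def using fB by auto
qed

text \<open>The product of the test function and a character is taken as a density for the law of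
  the evaluation at \<open>t\<close>. A product of two cosines is a sum of cosines of functionals in
  \<open>L\<close>, so these densities satisfy the hypothesis of \<open>weighted_levy\<close>, which
  then admits an arbitrary bounded continuous \<open>g\<close>.\<close>

lemma conv_fun_mult_val_at:
  assumes f: "conv_fun f" and t: "t \<in> {0..1}" and g: "continuous_on UNIV g" "\<And>x. \<bar>g x\<bar> \<le> (B::real)"
  shows "conv_fun (\<lambda>x. f x * g (val_at x t))"
proof -
  have [measurable]: "f \<in> borel_measurable borel" using f by (auto simp: conv_fun_def)
  obtain F where F: "\<And>x. \<bar>f x\<bar> \<le> F" using f by (auto simp: conv_fun_def)
  have F0: "F \<ge> 0" using F[of 0] by simp
  have [measurable]: "g \<in> borel_measurable borel" by (rule borel_measurable_continuous_onI) fact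
  have "\<bar>f x * g (val_at x t)\<bar> \<le> F * B" for x
    unfolding abs_mult by (intro mult_mono F g F0) auto
  moreover {
    fix l a assume l: "l \<in> L"
    note [measurable] = L_measurable[OF l]
    \<comment> \<open>The summand F + 1 keeps the density at least one. It is removed afterwards by
      subtracting the case s = 0 from the case s = 1.\<close>
    have key: "(\<lambda>n. EZ n (\<lambda>x. (F + 1 + s * (f x * cos (l x + a))) * g (val_at x t))) \<longlonglongrightarrow>
      EY (\<lambda>x. (F + 1 + s * (f x * cos (l x + a))) * g (val_at x t))" if s: "s = 0 \<or> s = 1" for s
    proof (rule weighted_levy[where B=B and K="F + 1 + F" and g=g and U="\<lambda>n w. val_at (Z n w) t" and U'="\<lambda>w. val_at (Y w) t"])
      have *: "\<bar>s * (f x * cos y)\<bar> \<le> F" for x y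
        using s abs_mult_cos_le[OF F[of x], of y] F0 by auto
      show "1 \<le> F + 1 + s * (f (Z n w) * cos (l (Z n w) + a))" for n w using *[of "Z n w" "l (Z n w) + a"] by linarith
      show "F + 1 + s * (f (Z n w) * cos (l (Z n w) + a)) \<le> F + 1 + F" for n w using *[of "Z n w" "l (Z n w) + a"] by linarith
      show "1 \<le> F + 1 + s * (f (Y w) * cos (l (Y w) + a))" for w using *[of "Y w" "l (Y w) + a"] by linarith
      show "F + 1 + s * (f (Y w) * cos (l (Y w) + a)) \<le> F + 1 + F" for w using *[of "Y w" "l (Y w) + a"] by linarith
      fix r b
      define p where "p x = (F + 1) * cos (0 + r * val_at x t + b)" for x
      define q where "q \<sigma> x = (s / 2) * (f x * cos (l x + (\<sigma> * r) * val_at x t + (a + \<sigma> * b)))" for \<sigma> x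
      have pm[measurable]: "p \<in> borel_measurable borel" "q \<sigma> \<in> borel_measurable borel" for \<sigma>
        unfolding p_def[abs_def] q_def[abs_def] by measurable
      have eq: "(F + 1 + s * (f x * cos (l x + a))) * cos (r * val_at x t + b) = p x + q 1 x + q (-1) x" for x
      proof -
        have e1: "l x + 1 * r * val_at x t + (a + 1 * b) = (l x + a) + (r * val_at x t + b)"
          and e2: "l x + (-1) * r * val_at x t + (a + (-1) * b) = (l x + a) - (r * val_at x t + b)" by simp_all
        have "f x * (cos (l x + a) * cos (r * val_at x t + b)) = f x * cos (l x + a + (r * val_at x t + b)) / 2 + f x * cos (l x + a - (r * val_at x t + b)) / 2"
          by (subst cos_times_cos) (simp add: distrib_left add_divide_distrib)
        then have "s * (f x * (cos (l x + a) * cos (r * val_at x t + b))) = s * (f x * cos (l x + a + (r * val_at x t + b)) / 2) + s * (f x * cos (l x + a - (r * val_at x t + b)) / 2)"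
          by (simp only: distrib_left)
        then show ?thesis unfolding p_def q_def e1 e2 by (simp add: distrib_right)
      qed
      have p: "(\<lambda>n. EZ n p) \<longlonglongrightarrow> EY p"
        using cos_conv[OF L_add[OF L_zero t], of r b] unfolding p_def by (simp add: tendsto_mult)
      have q: "(\<lambda>n. EZ n (\<lambda>x. q \<sigma> x)) \<longlonglongrightarrow> EY (\<lambda>x. q \<sigma> x)" for \<sigma>
      proof -
        have "(\<lambda>n. EZ n (\<lambda>x. f x * cos (l x + (\<sigma> * r) * val_at x t + (a + \<sigma> * b)))) \<longlonglongrightarrow>
           EY (\<lambda>x. f x * cos (l x + (\<sigma> * r) * val_at x t + (a + \<sigma> * b)))"
          by (rule spec[OF bspec[OF conjunct2[OF conjunct2[OF f[unfolded conv_fun_def]]] L_add[OF l t, of "\<sigma> * r"]]])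
        then show ?thesis unfolding q_def integral_mult_right_zero by (rule tendsto_mult[OF tendsto_const])
      qed
      have pb: "\<bar>p x\<bar> \<le> F + 1" for x unfolding p_def by (rule abs_mult_cos_le) (use F0 in auto)
      have qb: "\<bar>q \<sigma> x\<bar> \<le> 1/2 * F" for \<sigma> x
        unfolding q_def abs_mult by (intro mult_mono) (use s F0 abs_mult_cos_le[OF F] in \<open>auto simp flip: abs_mult\<close>)
      note i = integrable_conv[OF pm(1) pb] integrable_conv[OF pm(2) qb]
      have "(\<lambda>n. EZ n p + EZ n (q 1) + EZ n (\<lambda>x. q (-1) x)) \<longlonglongrightarrow>
         EY p + EY (q 1) + EY (\<lambda>x. q (-1) x)"
        by (intro tendsto_add p q)
      then show "(\<lambda>n. EZ n (\<lambda>x. (F + 1 + s * (f x * cos (l x + a))) * cos (r * val_at x t + b))) \<longlonglongrightarrow>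
        EY (\<lambda>x. (F + 1 + s * (f x * cos (l x + a))) * cos (r * val_at x t + b))"
        unfolding eq by (simp add: i)
    qed (use g in \<open>simp_all add: M.prob_space_axioms N.prob_space_axioms\<close>)
    have b: "\<bar>f x * cos (l x + a) * g (val_at x t)\<bar> \<le> F * B" for x
      unfolding abs_mult[of "f x * cos (l x + a)"] by (intro mult_mono abs_mult_cos_le F g F0) auto
    have b2: "\<bar>(F + 1) * g (val_at x t)\<bar> \<le> (F + 1) * B" for x
      unfolding abs_mult by (intro mult_mono g) (use F0 in auto)
    have m: "(\<lambda>x. f x * cos (l x + a) * g (val_at x t)) \<in> borel_measurable borel" "(\<lambda>x. (F + 1) * g (val_at x t)) \<in> borel_measurable borel"
      by measurable
    note i = integrable_conv[OF m(1) b] integrable_conv[OF m(2) b2]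
    have "(\<lambda>n. EZ n (\<lambda>x. (F + 1 + 1 * (f x * cos (l x + a))) * g (val_at x t)) -
          EZ n (\<lambda>x. (F + 1 + 0 * (f x * cos (l x + a))) * g (val_at x t))) \<longlonglongrightarrow>
      EY (\<lambda>x. (F + 1 + 1 * (f x * cos (l x + a))) * g (val_at x t)) -
      EY (\<lambda>x. (F + 1 + 0 * (f x * cos (l x + a))) * g (val_at x t))"
      by (intro tendsto_diff key) auto
    then have "(\<lambda>n. EZ n (\<lambda>x. f x * cos (l x + a) * g (val_at x t))) \<longlonglongrightarrow>
       EY (\<lambda>x. f x * cos (l x + a) * g (val_at x t))"
      unfolding mult_1_left mult_zero_left add_0_right distrib_right[of "F + 1"]
      by (simp only: Bochner_Integration.integral_add[OF i(3,1)] Bochner_Integration.integral_add[OF i(4,2)] add_diff_cancel_left')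
    then have "(\<lambda>n. EZ n (\<lambda>x. f x * g (val_at x t) * cos (l x + a))) \<longlonglongrightarrow>
       EY (\<lambda>x. f x * g (val_at x t) * cos (l x + a))"
      by (simp only: mult.assoc mult.commute[of "g _"])
  }
  ultimately show ?thesis unfolding conv_fun_def by auto
qed

end

section \<open>Bounded Lipschitz functionals of the process\<close>

definition clamp_real :: "real \<Rightarrow> real \<Rightarrow> real" where "clamp_real R y = max (- R) (min R y)"

lemma lipschitz_continuous_on:
  fixes F :: "'c::real_normed_vector \<Rightarrow> real"
  assumes "\<And>x y. \<bar>F x - F y\<bar> \<le> norm (x - y)"
  shows "continuous_on A F"
  unfolding continuous_on_iff dist_norm using assms by (metis order_le_less_trans real_norm_def)

context fidi_convergence
begin

lemma conv_fun_clamp: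
  assumes F: "\<And>x y. \<bar>F x - F y\<bar> \<le> norm (x - y)" "\<And>x. \<bar>F x\<bar> \<le> B" and R: "R > 0"
    and I: "finite I" "\<And>i. i \<in> I \<Longrightarrow> p i \<in> {0..1}"
  shows "conv_fun (\<lambda>x. F (z + (\<Sum>i\<in>I. clamp_real R (val_at x (p i)) *\<^sub>R v i)))"
  using I
proof (induction I arbitrary: z rule: finite_induct)
  case empty
  then show ?case by (simp add: conv_fun_const)
next
  case (insert j I)
  define S where "S x = (\<Sum>i\<in>I. clamp_real R (val_at x (p i)) *\<^sub>R v i)" for x
  \<comment> \<open>Maps the clamped coordinate onto [0,1], where the tents \<open>grid_pu\<close>
    act on the range of the coordinate and not on its parameter set.\<close>
  define u where "u y = (clamp_real R y / R + 1) / 2" for y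
  have cl: "continuous_on UNIV (clamp_real R)" unfolding clamp_real_def[abs_def] by (intro continuous_intros)
  have u: "continuous_on UNIV u" unfolding u_def[abs_def] by (intro continuous_intros cl) (use R in auto)
  have u01: "u y \<in> {0..1}" for y using R by (auto simp: u_def clamp_real_def field_simps)
  have cu: "clamp_real R y = R * (2 * u y - 1)" for y using R by (simp add: u_def field_simps)
  have IH: "conv_fun (\<lambda>x. F (z + S x))" for z
    unfolding S_def by (rule insert.IH) (use insert.prems in auto)
  have [measurable]: "F \<in> borel_measurable borel" by (intro borel_measurable_continuous_onI lipschitz_continuous_on F)
  have "conv_fun (\<lambda>x. F (z + (clamp_real R (val_at x (p j)) *\<^sub>R v j + S x)))"
  proof (rule conv_fun_uniform_limit)
    show "(\<lambda>x. F (z + (clamp_real R (val_at x (p j)) *\<^sub>R v j + S x))) \<in> borel_measurable borel"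
      unfolding S_def clamp_real_def
      by (intro borel_measurable_continuous_onI continuous_on_compose2[OF lipschitz_continuous_on[OF F(1), of UNIV]] continuous_intros) auto
    fix e :: real assume "e > 0"
    define C where "C = 2 * R * norm (v j) + 1"
    have C: "C > 0" using R by (simp add: C_def add_nonneg_pos)
    obtain k where k: "(1/2::real) ^ k < e / C" using real_arch_pow_inv[of "e / C" "1/2"] \<open>e > 0\<close> C by auto
    define q where "q m x = F (z + ((R * (2 * (real m / 2 ^ k) - 1)) *\<^sub>R v j + S x))" for m x
    define wt where "wt m x = val_at (grid_pu k m) (u (val_at x (p j)))" for m x
    define g where "g x = (\<Sum>m\<le>2 ^ k. q m x * wt m x)" for x
    have "conv_fun g" unfolding g_def
    proof (rule conv_fun_sum)
      fix m :: nat
      have "continuous_on UNIV (\<lambda>y. val_at (grid_pu k m) (u y))"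
        using u u01 by (intro continuous_on_compose2[OF continuous_on_val_at]) auto
      moreover have "conv_fun (q m)" using IH[of "z + (R * (2 * (real m / 2 ^ k) - 1)) *\<^sub>R v j"] unfolding q_def by (simp add: add.assoc)
      moreover have "p j \<in> {0..1}" using insert.prems by blast
      ultimately show "conv_fun (\<lambda>x. q m x * wt m x)"
        unfolding wt_def using abs_val_at_le_norm by (intro conv_fun_mult_val_at)
    qed simp
    moreover have "\<bar>F (z + (clamp_real R (val_at x (p j)) *\<^sub>R v j + S x)) - g x\<bar> \<le> e" for x
    proof -
      define y where "y = val_at x (p j)"
      have w1: "(\<Sum>m\<le>2 ^ k. wt m x) = 1" unfolding wt_def by (rule sum_grid_pu[OF u01])
      have w0: "wt m x \<ge> 0" for m unfolding wt_def by (rule grid_pu_nonneg[OF u01])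
      define a where "a = F (z + (clamp_real R y *\<^sub>R v j + S x))"
      have "a - g x = (\<Sum>m\<le>2 ^ k. (a - q m x) * wt m x)"
        unfolding g_def left_diff_distrib sum_subtractf sum_distrib_left[symmetric] w1 by simp
      also have "\<bar>\<dots>\<bar> \<le> (\<Sum>m\<le>2 ^ k. e * wt m x)"
      proof (intro order_trans[OF sum_abs] sum_mono)
        fix m
        show "\<bar>(a - q m x) * wt m x\<bar> \<le> e * wt m x"
        proof (cases "\<bar>2 ^ k * u y - real m\<bar> < 1")
          case True
          have "\<bar>a - q m x\<bar> \<le> norm ((clamp_real R y - R * (2 * (real m / 2 ^ k) - 1)) *\<^sub>R v j)"
            unfolding a_def q_def by (rule order_trans[OF F(1)]) (simp add: scaleR_left_diff_distrib algebra_simps)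
          also have "\<dots> = 2 * R * \<bar>u y - real m / 2 ^ k\<bar> * norm (v j)"
          proof -
            have "R * (2 * u y - 1) - R * (2 * (real m / 2 ^ k) - 1) = 2 * R * (u y - real m / 2 ^ k)"
              by (simp add: algebra_simps)
            then show ?thesis unfolding cu norm_scaleR using R by (simp add: abs_mult)
          qed
          also have "\<dots> \<le> 2 * R * (1/2) ^ k * norm (v j)"
          proof -
            have "\<bar>u y - real m / 2 ^ k\<bar> = \<bar>2 ^ k * u y - real m\<bar> * (1/2) ^ k"
              by (simp add: abs_if field_simps power_divide)
            also have "\<dots> \<le> 1 * (1/2) ^ k" using True by (intro mult_right_mono) auto
            finally show ?thesis using R by (intro mult_right_mono mult_left_mono) auto
          qed
          also have "\<dots> \<le> C * (1/2) ^ k" by (simp add: C_def algebra_simps)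
          also have "\<dots> \<le> e" using k C by (simp add: field_simps)
          finally show ?thesis using w0[of m] by (simp add: abs_mult mult_right_mono)
        next
          case False
          then have "wt m x = 0" unfolding wt_def y_def[symmetric] by (intro grid_pu_eq_0[OF u01]) simp
          then show ?thesis by simp
        qed
      qed
      also have "\<dots> = e" using w1 by (simp flip: sum_distrib_left)
      finally show ?thesis unfolding a_def y_def .
    qed
    ultimately show "\<exists>g. conv_fun g \<and> (\<forall>x. \<bar>F (z + (clamp_real R (val_at x (p j)) *\<^sub>R v j + S x)) - g x\<bar> \<le> e)" by blast
  qed
  then show ?case using insert.hyps unfolding S_def by simp
qed

lemma conv_fun_integral: "conv_fun f \<Longrightarrow> (\<lambda>n. EZ n f) \<longlonglongrightarrow> EY f"
  using L_zero unfolding conv_fun_def by (force dest!: bspec[where x="\<lambda>_. 0"] spec[where x=0])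

text \<open>\<open>F\<close> is compared with its value at the interpolated function by tightness,
  and that with its clamped version \<open>H\<close>, which is in the convergent class. For the
  limit \<open>Y\<close> interpolation is harmless by dominated convergence.\<close>

lemma integral_lipschitz_tendsto:
  assumes tight: "\<And>e. e > 0 \<Longrightarrow> \<exists>k0. \<forall>k\<ge>k0. \<forall>\<^sub>F n in sequentially.
      M.prob {w\<in>space M. norm (Z n w - disc k (Z n w)) > e} \<le> e"
    and F: "\<And>x y. \<bar>F x - F y\<bar> \<le> norm (x - y)" "\<And>x. \<bar>F x\<bar> \<le> B"
  shows "(\<lambda>n. EZ n F) \<longlonglongrightarrow> EY F"
proof (rule LIMSEQ_I)
  fix r :: real assume "r > 0"
  have B: "B \<ge> 0" using F(2)[of 0] by simp
  define e where "e = r / (4 + 8 * B)"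
  have e: "e > 0" using \<open>r > 0\<close> B by (simp add: e_def)
  have [measurable]: "F \<in> borel_measurable borel" by (intro borel_measurable_continuous_onI lipschitz_continuous_on F)
  obtain k0 where k0: "\<And>k. k \<ge> k0 \<Longrightarrow> \<forall>\<^sub>F n in sequentially. M.prob {w\<in>space M. norm (Z n w - disc k (Z n w)) > e} \<le> e"
    using tight[OF e] by blast
  have "(\<lambda>k. EY (\<lambda>x. F (disc k x))) \<longlonglongrightarrow> EY F"
  proof (rule integral_dominated_convergence[where w="\<lambda>_. B"])
    show "AE w in N. (\<lambda>k. F (disc k (Y w))) \<longlonglongrightarrow> F (Y w)"
      by (intro AE_I2 continuous_on_tendsto_compose[OF lipschitz_continuous_on[OF F(1), of UNIV]] disc_tendsto) auto
  qed (use F(2) in auto)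
  from LIMSEQ_D[OF this e] obtain k1 where k1: "\<bar>EY (\<lambda>x. F (disc k x)) - EY F\<bar> < e" if "k \<ge> k1" for k
    by auto
  define k where "k = max k0 k1"
  \<comment> \<open>A continuous indicator of large coordinates: zero up to \<open>R\<close>, one
    from R + 1 on. Its sum \<open>G\<close> over the grid is in the convergent class, so the
    probability that clamping acts is controlled along the sequence by the limit.\<close>
  define g where "g R y = min 1 (max 0 (\<bar>y\<bar> - real R))" for R :: nat and y :: real
  have gc: "continuous_on UNIV (g R)" for R unfolding g_def[abs_def] by (intro continuous_intros)
  have gb: "\<bar>g R y\<bar> \<le> 1" for R y by (auto simp: g_def)
  define G where "G R x = (\<Sum>i\<le>2 ^ k. 1 * g R (val_at x (grid k i)))" for R x
  have Gc: "conv_fun (G R)" for R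
    unfolding G_def using gc gb grid_mem by (intro conv_fun_sum conv_fun_mult_val_at conv_fun_const) auto
  have [measurable]: "g R \<in> borel_measurable borel" for R by (rule borel_measurable_continuous_onI[OF gc])
  have Gm[measurable]: "G R \<in> borel_measurable borel" for R unfolding G_def by measurable
  have Gb: "\<bar>G R x\<bar> \<le> real (card {..2 ^ k :: nat})" for R x
    unfolding G_def using gb by (intro order_trans[OF sum_abs] order_trans[OF sum_bounded_above[of _ _ 1]]) auto
  have G0: "G R x \<ge> 0" for R x unfolding G_def by (intro sum_nonneg) (auto simp: g_def)
  have "(\<lambda>R. EY (G R)) \<longlonglongrightarrow> (LINT w|N. 0)"
  proof (rule integral_dominated_convergence[where w="\<lambda>_. real (card {..2 ^ k :: nat})"])
    show "AE w in N. (\<lambda>R. G R (Y w)) \<longlonglongrightarrow> 0"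
    proof (intro AE_I2 tendsto_eventually)
      fix w
      obtain R0 where R0: "norm (Y w) \<le> real R0" using real_arch_simple by blast
      show "\<forall>\<^sub>F R in sequentially. G R (Y w) = 0"
        using eventually_ge_at_top[of R0]
      proof eventually_elim
        case (elim R)
        then have "\<bar>val_at (Y w) t\<bar> \<le> real R" for t using R0 abs_val_at_le_norm[of "Y w" t] by linarith
        then show ?case unfolding G_def g_def by (intro sum.neutral) auto
      qed
    qed
  qed (use Gb in auto)
  from LIMSEQ_D[OF this e] obtain R where R: "\<bar>EY (G R)\<bar> < e" by fastforce
  define H where "H x = F (0 + (\<Sum>i\<le>2 ^ k. clamp_real (real R + 1) (val_at x (grid k i)) *\<^sub>R grid_pu k i))" for x
  have Hc: "conv_fun H" unfolding H_def by (rule conv_fun_clamp[where B=B]) (use F grid_mem in auto)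
  have Hm[measurable]: "H \<in> borel_measurable borel" using Hc by (simp add: conv_fun_def)
  have Hb: "\<bar>H x\<bar> \<le> B" for x unfolding H_def by (rule F)
  have HG: "\<bar>F (disc k x) - H x\<bar> \<le> 2 * B * G R x" for x
  proof (cases "\<forall>i\<le>2 ^ k. \<bar>val_at x (grid k i)\<bar> \<le> real R + 1")
    case True
    then have "clamp_real (real R + 1) (val_at x (grid k i)) = val_at x (grid k i)" if "i \<le> 2 ^ k" for i
      using that unfolding clamp_real_def by (auto simp: abs_le_iff)
    then have "H x = F (disc k x)" unfolding H_def disc_def by simp
    then show ?thesis using B G0[of R x] by simp
  next
    case False
    then obtain i :: nat where i: "i \<le> 2 ^ k" "\<bar>val_at x (grid k i)\<bar> > real R + 1" by auto
    have "1 * g R (val_at x (grid k i)) \<le> G R x"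
      unfolding G_def by (rule member_le_sum) (use i in \<open>auto simp: g_def\<close>)
    moreover have "g R (val_at x (grid k i)) = 1" using i(2) by (simp add: g_def)
    ultimately have "2 * B * 1 \<le> 2 * B * G R x" using B by (intro mult_left_mono) auto
    then show ?thesis using F(2)[of "disc k x"] Hb[of x] by linarith
  qed
  have Fd: "\<bar>F (disc k x)\<bar> \<le> B" for x by (rule F)
  have Fm[measurable]: "(\<lambda>x. F (disc k x)) \<in> borel_measurable borel" by measurable
  note iF = integrable_conv[OF Fm Fd] and iH = integrable_conv[OF Hm Hb] and iG = integrable_conv[OF Gm[of R] Gb]
  have FH: "\<bar>EZ n (\<lambda>x. F (disc k x)) - EZ n H\<bar> \<le> 2 * B * EZ n (G R)" for n
  proof -
    have "\<bar>EZ n (\<lambda>x. F (disc k x) - H x)\<bar> \<le> EZ n (\<lambda>x. 2 * B * G R x)"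
      using HG by (intro order_trans[OF integral_abs_bound] integral_mono integrable_abs Bochner_Integration.integrable_diff integrable_mult_right iF iH iG)
    then show ?thesis by (simp add: iF iH)
  qed
  have FH': "\<bar>EY (\<lambda>x. F (disc k x)) - EY H\<bar> \<le> 2 * B * EY (G R)"
  proof -
    have "\<bar>EY (\<lambda>x. F (disc k x) - H x)\<bar> \<le> EY (\<lambda>x. 2 * B * G R x)"
      using HG by (intro order_trans[OF integral_abs_bound] integral_mono integrable_abs Bochner_Integration.integrable_diff integrable_mult_right iF iH iG)
    then show ?thesis by (simp add: iF iH)
  qed
  have FZ: "\<bar>EZ n F - EZ n (\<lambda>x. F (disc k x))\<bar> \<le> e + 2 * B * M.prob {w\<in>space M. norm (Z n w - disc k (Z n w)) > e}" for n
  proof -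
    have i: "integrable M (\<lambda>w. F (Z n w))" by (rule integrable_conv(1)[OF _ F(2)]) measurable
    have "\<bar>EZ n (\<lambda>x. F x - F (disc k x))\<bar> \<le> (LINT w|M. e + 2 * B * indicator {w\<in>space M. norm (Z n w - disc k (Z n w)) > e} w)"
    proof (intro order_trans[OF integral_abs_bound] integral_mono integrable_abs Bochner_Integration.integrable_diff i iF)
      fix w assume "w \<in> space M"
      then show "\<bar>F (Z n w) - F (disc k (Z n w))\<bar> \<le> e + 2 * B * indicator {w\<in>space M. norm (Z n w - disc k (Z n w)) > e} w"
        using F(1)[of "Z n w" "disc k (Z n w)"] F(2)[of "Z n w"] F(2)[of "disc k (Z n w)"] e
        by (auto simp: indicator_def simp del: disc_simps)
    qed (rule M.integrable_const_bound[where B="e + 2 * B"]; use B e in \<open>simp add: indicator_def\<close>)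
    moreover have "integrable M (indicat_real {w\<in>space M. norm (Z n w - disc k (Z n w)) > e})"
      by (rule M.integrable_const_bound[where B=1]) (simp_all add: indicator_def)
    ultimately show ?thesis by (simp add: i iF M.prob_space del: disc_simps)
  qed
  have ev1: "\<forall>\<^sub>F n in sequentially. M.prob {w\<in>space M. norm (Z n w - disc k (Z n w)) > e} \<le> e"
    by (rule k0) (simp add: k_def)
  have ev2: "\<forall>\<^sub>F n in sequentially. dist (EZ n (G R)) (EY (G R)) < e"
    by (rule tendstoD[OF conv_fun_integral[OF Gc] e])
  have ev3: "\<forall>\<^sub>F n in sequentially. dist (EZ n H) (EY H) < e"
    by (rule tendstoD[OF conv_fun_integral[OF Hc] e])
  have "\<forall>\<^sub>F n in sequentially. \<bar>EZ n F - EY F\<bar> < r"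
    using ev1 ev2 ev3
  proof eventually_elim
    case (elim n)
    have "EZ n (G R) \<le> 2 * e" using elim(2) R by (simp add: dist_real_def abs_if split: if_splits)
    then have 1: "2 * B * EZ n (G R) \<le> 2 * B * (2 * e)" using B by (intro mult_left_mono) auto
    have 2: "2 * B * EY (G R) \<le> 2 * B * e" using B R by (intro mult_left_mono) auto
    have 3: "2 * B * M.prob {w\<in>space M. norm (Z n w - disc k (Z n w)) > e} \<le> 2 * B * e"
      using B elim(1) by (intro mult_left_mono) auto
    have 4: "\<bar>EY (\<lambda>x. F (disc k x)) - EY F\<bar> < e" by (rule k1) (simp add: k_def)
    have 5: "\<bar>EZ n H - EY H\<bar> < e" using elim(3) by (simp add: dist_real_def)
    have "\<bar>EZ n F - EY F\<bar> < (e + 2 * B * e) + 2 * B * (2 * e) + e + 2 * B * e + e"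
      using 1 2 3 4 5 FZ[of n] FH[of n] FH' by linarith
    also have "\<dots> = e * (3 + 8 * B)" by (simp add: algebra_simps)
    also have "\<dots> \<le> r" using \<open>r > 0\<close> B by (simp add: e_def field_simps)
    finally show ?case .
  qed
  then show "\<exists>no. \<forall>n\<ge>no. norm (EZ n F - EY F) < r"
    by (simp add: eventually_sequentially)
qed

end

section \<open>The Brownian bridge at a fixed time\<close>

lemma (in prob_space) centered_gaussian_char:
  assumes "centered_gaussian M Y"
  shows "(CLINT w|M. iexp (t * Y w)) = complex_of_real (exp (- (t\<^sup>2 * sq_mean Y) / 2))"
proof -
  have [measurable]: "Y \<in> borel_measurable M" using assms by (simp add: centered_gaussian_def)
  from assms consider "AE w in M. Y w = 0" | \<sigma> where "\<sigma> > 0" "distributed M lborel Y (normal_density 0 \<sigma>)"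
    by (auto simp: centered_gaussian_def)
  then show ?thesis
  proof cases
    case 1
    have "(CLINT w|M. iexp (t * Y w)) = (CLINT w|M. 1)" "sq_mean Y = (LINT w|M. 0)"
      by (intro integral_cong_AE; use 1 in \<open>auto\<close>)+
    then show ?thesis by (simp add: prob_space)
  next
    case 2
    have d: "distributed M lborel (\<lambda>w. Y w / \<sigma>) std_normal_density"
      using 2 normal_standard_normal_convert[of \<sigma> Y 0] by simp
    have D: "distr M borel (\<lambda>w. Y w / \<sigma>) = std_normal_distribution"
      using distributed_distr_eq_density[OF d] by (simp cong: distr_cong)
    have "(CLINT w|M. iexp (t * Y w)) = char (distr M borel (\<lambda>w. Y w / \<sigma>)) (t * \<sigma>)"
      unfolding char_def using 2(1) by (subst integral_distr) auto
    moreover have "variance Y = \<sigma>\<^sup>2" "expectation Y = 0"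
      using normal_distributed_variance[OF 2] normal_distributed_expectation[OF 2] by auto
    ultimately show ?thesis by (simp add: D char_std_normal_distribution power_mult_distrib)
  qed
qed

locale brownian_C01 = prob_space N for N :: "'b measure" +
  fixes W :: "real \<Rightarrow> 'b \<Rightarrow> C01"
  assumes bm: "brownian_motion_C01 N W"
begin

lemma W_measurable: "s \<in> {0..1} \<Longrightarrow> W s \<in> borel_measurable N"
  using bm by (simp add: brownian_motion_C01_def)

lemma W_0: "w \<in> space N \<Longrightarrow> W 0 w = 0"
  using bm by (simp add: brownian_motion_C01_def)

lemma increment_char:
  assumes "0 \<le> s" "s \<le> t" "t \<le> 1" and l: "bounded_linear l"
  shows "(CLINT w|N. iexp (a * l (W t w - W s w))) =
    complex_of_real (exp (- (a\<^sup>2 * (LINT w|N. (l (W (t - s) w))\<^sup>2)) / 2))"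
proof -
  have [measurable]: "W t \<in> borel_measurable N" "W s \<in> borel_measurable N" "W (t - s) \<in> borel_measurable N"
    using assms by (auto intro!: W_measurable)
  have [measurable]: "l \<in> borel_measurable borel"
    by (intro borel_measurable_continuous_onI linear_continuous_on l)
  have "distr N borel (\<lambda>w. W t w - W s w) = distr N borel (W (t - s))"
    using bm assms by (simp add: brownian_motion_C01_def)
  then have "(LINT x|distr N borel (\<lambda>w. W t w - W s w). (l x)\<^sup>2) = (LINT x|distr N borel (W (t - s)). (l x)\<^sup>2)"
    by simp
  then have "(LINT w|N. (l (W t w - W s w))\<^sup>2) = (LINT w|N. (l (W (t - s) w))\<^sup>2)"
    by (simp add: integral_distr)
  moreover have "centered_gaussian N (\<lambda>w. l (W t w - W s w))"
    using bm assms by (simp add: brownian_motion_C01_def)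
  ultimately show ?thesis using centered_gaussian_char by simp
qed

lemma two_increments_char:
  assumes st: "0 \<le> s" "s \<le> t" "t \<le> 1" and l: "bounded_linear l"
  shows "(CLINT w|N. iexp (a * l (W s w) + b * l (W t w - W s w))) =
    complex_of_real (exp (- (a\<^sup>2 * (LINT w|N. (l (W s w))\<^sup>2) + b\<^sup>2 * (LINT w|N. (l (W (t - s) w))\<^sup>2)) / 2))"
proof -
  have lm[measurable]: "l \<in> borel_measurable borel"
    by (intro borel_measurable_continuous_onI linear_continuous_on l)
  define r where "r = (\<lambda>k::nat. if k = 0 then 0 else if k = 1 then s else t)"
  define c where "c = (\<lambda>k::nat. if k = 0 then a else b)"
  define X where "X k w = iexp (c k * l (W (r (Suc k)) w - W (r k) w))" for k w
  have "0 \<le> r 0 \<and> mono_on {..2} r \<and> r 2 \<le> 1"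
    using st by (auto simp: r_def monotone_on_def)
  then have "indep_vars (\<lambda>_. borel) (\<lambda>k w. W (r (Suc k)) w - W (r k) w) {..<2}"
    using bm by (simp add: brownian_motion_C01_def)
  then have ind: "indep_vars (\<lambda>_. borel) X {..<2}"
    unfolding X_def by (rule indep_vars_compose2) auto
  have "integrable N (X k)" if "k \<in> {..<2}" for k
    by (rule integrable_const_bound[of _ 1]) (use ind that in \<open>auto simp: indep_vars_def2\<close>, simp add: X_def)
  from indep_vars_lebesgue_integral[OF _ ind this]
  have p: "(CLINT w|N. X 0 w * X 1 w) = (CLINT w|N. X 0 w) * (CLINT w|N. X 1 w)"
    by (simp add: numeral_2_eq_2 lessThan_Suc mult.commute)
  have 1: "(CLINT w|N. X 0 w * X 1 w) = (CLINT w|N. iexp (a * l (W s w) + b * l (W t w - W s w)))"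
    by (rule Bochner_Integration.integral_cong) (simp_all add: X_def r_def c_def W_0 distrib_left exp_add)
  have 2: "(CLINT w|N. X 0 w) = complex_of_real (exp (- (a\<^sup>2 * (LINT w|N. (l (W s w))\<^sup>2)) / 2))"
    using increment_char[of 0 s l a] st l by (simp add: X_def r_def c_def)
  have 3: "(CLINT w|N. X 1 w) = complex_of_real (exp (- (b\<^sup>2 * (LINT w|N. (l (W (t - s) w))\<^sup>2)) / 2))"
    using increment_char[of s t l b] st l by (simp add: X_def r_def c_def)
  show ?thesis
    using p unfolding 1 2 3 minus_add_distrib add_divide_distrib exp_add of_real_mult .
qed

text \<open>Two expressions for the characteristic function of \<open>l (W t)\<close> give v t = v s
  + v (t - s). An additive nonnegative function is increasing, so v t is squeezed between its values
  at neighbouring multiples of 1/m, where linearity is already known.\<close>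

lemma variance_linear:
  assumes l: "bounded_linear l" and t: "t \<in> {0..1}"
  shows "(LINT w|N. (l (W t w))\<^sup>2) = t * (LINT w|N. (l (W 1 w))\<^sup>2)"
proof -
  define v where "v t = (LINT w|N. (l (W t w))\<^sup>2)" for t
  interpret l: bounded_linear l by fact
  have v0: "v t \<ge> 0" for t by (simp add: v_def)
  have add: "v t = v s + v (t - s)" if "0 \<le> s" "s \<le> t" "t \<le> 1" for s t
  proof -
    have "(CLINT w|N. iexp (1 * l (W t w - W 0 w))) = (CLINT w|N. iexp (1 * l (W s w) + 1 * l (W t w - W s w)))"
      by (rule Bochner_Integration.integral_cong) (simp_all add: W_0 l.diff)
    also have "\<dots> = complex_of_real (exp (- (1\<^sup>2 * v s + 1\<^sup>2 * v (t - s)) / 2))"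
      unfolding v_def by (rule two_increments_char[OF that l])
    finally have "complex_of_real (exp (- (1\<^sup>2 * v (t - 0)) / 2)) = complex_of_real (exp (- (1\<^sup>2 * v s + 1\<^sup>2 * v (t - s)) / 2))"
      using increment_char[of 0 t l 1] that l unfolding v_def by simp
    then show ?thesis by (simp only: of_real_eq_iff exp_inj_iff) simp
  qed
  have mono: "v s \<le> v t" if "0 \<le> s" "s \<le> t" "t \<le> 1" for s t using add[OF that] v0[of "t - s"] by simp
  have mult: "v (real j * h) = real j * v h" if "0 \<le> h" "real j * h \<le> 1" for j :: nat and h
    using that
  proof (induction j)
    case 0
    show ?case using add[of 0 0] by simp
  next
    case (Suc j)
    have "v (real (Suc j) * h) = v (real j * h) + v (real (Suc j) * h - real j * h)"
      using Suc.prems by (intro add) (auto simp: algebra_simps)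
    then show ?case using Suc by (simp add: algebra_simps)
  qed
  have frac: "v (real j / real m) = real j / real m * v 1" if "0 < m" "j \<le> m" for j m :: nat
  proof -
    have "v 1 = real m * v (1 / real m)" using mult[of "1 / real m" m] that by simp
    moreover have "v (real j / real m) = real j * v (1 / real m)" using mult[of "1 / real m" j] that by simp
    ultimately show ?thesis using that by simp
  qed
  have "\<bar>v t - t * v 1\<bar> \<le> v 1 / real m" if m: "0 < m" for m :: nat
  proof (cases "t = 1")
    case True
    then show ?thesis using v0[of 1] by simp
  next
    case False
    define j where "j = nat \<lfloor>real m * t\<rfloor>"
    have "0 \<le> real m * t" using t by simp
    then have j: "real j \<le> real m * t" "real m * t < real j + 1" unfolding j_def by linarith+
    have "real m * t < real m * 1" using t False m by (intro mult_strict_left_mono) auto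
    then have jm: "Suc j \<le> m" using j by linarith
    have 1: "real j / real m \<le> t" "t \<le> real (Suc j) / real m" using j m by (auto simp: field_simps)
    have 2: "real j / real m * v 1 \<le> v t"
      using mono[of "real j / real m" t] 1 t jm m by (simp add: frac)
    have 3: "v t \<le> real (Suc j) / real m * v 1"
      using mono[of t "real (Suc j) / real m"] frac[OF m jm] 1 t jm m by (simp del: of_nat_Suc)
    have 4: "real j / real m * v 1 \<le> t * v 1" "t * v 1 \<le> real (Suc j) / real m * v 1"
      by (rule mult_right_mono[OF 1(1) v0], rule mult_right_mono[OF 1(2) v0])
    have "real (Suc j) / real m * v 1 = real j / real m * v 1 + v 1 / real m"
      by (simp add: add_divide_distrib distrib_right)
    then show ?thesis using 2 3 4 by linarith
  qed
  then have "\<forall>\<^sub>F m in sequentially. \<bar>v t - t * v 1\<bar> \<le> v 1 / real m"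
    by (rule eventually_mono[OF eventually_gt_at_top[of 0]])
  then have "\<bar>v t - t * v 1\<bar> \<le> 0"
    by (intro tendsto_lowerbound[OF lim_const_over_n]) auto
  then show ?thesis unfolding v_def by simp
qed

text \<open>As (1 - s) W s - s (W 1 - W s) the bridge is a combination of independent increments
  with variances proportional to s and 1 - s, and (1 - s)^2 s + s^2 (1 - s) = s (1 - s).\<close>

lemma bridge_char:
  assumes s: "s \<in> {0..1}" and l: "bounded_linear l"
  shows "(CLINT w|N. iexp (l (W s w - s *\<^sub>R W 1 w))) =
    complex_of_real (exp (- (s * (1 - s) * (LINT w|N. (l (W 1 w))\<^sup>2) / 2)))"
proof -
  interpret l: bounded_linear l by fact
  define V where "V = (LINT w|N. (l (W 1 w))\<^sup>2)"
  have eq: "l (W s w - s *\<^sub>R W 1 w) = (1 - s) * l (W s w) + (- s) * l (W 1 w - W s w)" for w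
    by (simp add: l.diff l.scaleR algebra_simps)
  have "1 - s \<in> {0..1}" using s by auto
  note v = variance_linear[OF l s] variance_linear[OF l this]
  have "(1 - s)\<^sup>2 * (s * V) + (- s)\<^sup>2 * ((1 - s) * V) = s * (1 - s) * V"
    by (simp add: power2_eq_square algebra_simps)
  then show ?thesis
    unfolding eq using s two_increments_char[of s 1 l "1 - s" "- s"] l by (simp add: v V_def)
qed

end

section \<open>The CUSUM statistic\<close>

text \<open>The common structure of the three norms. Domination by the supremum norm makes each of
  them a 1-Lipschitz functional on C([0,1]).\<close>

locale C01_seminorm =
  fixes \<nu> :: "C01 \<Rightarrow> real"
  assumes triangle: "\<nu> (x + y) \<le> \<nu> x + \<nu> y"
    and scale: "\<nu> (r *\<^sub>R x) = \<bar>r\<bar> * \<nu> x"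
    and le_norm: "\<nu> x \<le> norm x"
begin

lemma nonneg: "\<nu> x \<ge> 0"
  using triangle[of x "(-1) *\<^sub>R x"] scale[of "-1" x] scale[of 0 0] by simp

lemma abs_diff_le: "\<bar>\<nu> x - \<nu> y\<bar> \<le> norm (x - y)"
  using triangle[of y "x - y"] triangle[of x "y - x"] le_norm[of "x - y"] le_norm[of "y - x"]
  by (auto simp: abs_le_iff norm_minus_commute)

lemma continuous: "continuous_on A \<nu>"
  by (rule lipschitz_continuous_on[OF abs_diff_le])

lemma measurable_seminorm [measurable]: "\<nu> \<in> borel_measurable borel"
  by (rule borel_measurable_continuous_onI[OF continuous])

end

lemma interp_sum_convex:
  assumes "0 \<le> \<theta>" "\<theta> < 1"
  shows "interp_sum a (real k + \<theta>) = (1 - \<theta>) *\<^sub>R (\<Sum>i=1..k. a i) + \<theta> *\<^sub>R (\<Sum>i=1..Suc k. a i)"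
proof -
  have "\<lfloor>real k + \<theta>\<rfloor> = int k" using assms by (intro floor_unique) auto
  then show ?thesis by (simp add: interp_sum_def algebra_simps)
qed

lemma cusum_grid: "n \<ge> 1 \<Longrightarrow> cusum X n (real k / real n) w =
    (1 / real n) *\<^sub>R ((\<Sum>i=1..k. X n i w) - (real k / real n) *\<^sub>R (\<Sum>i=1..n. X n i w))"
  using interp_sum_convex[of 0 "\<lambda>i. X n i w" k] by (simp add: cusum_def)

lemma cusum_convex:
  assumes "n \<ge> 1" "s \<in> {0..<1}"
  obtains k \<theta> where "k < n" "0 \<le> \<theta>" "\<theta> \<le> 1"
    "cusum X n s w = (1 - \<theta>) *\<^sub>R cusum X n (real k / real n) w + \<theta> *\<^sub>R cusum X n (real (Suc k) / real n) w"
proof -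
  define k where "k = nat \<lfloor>real n * s\<rfloor>"
  define \<theta> where "\<theta> = real n * s - real k"
  have "0 \<le> real n * s" using assms by simp
  then have \<theta>: "0 \<le> \<theta>" "\<theta> < 1" unfolding \<theta>_def k_def by linarith+
  have "real n * s < real n * 1" using assms by (intro mult_strict_left_mono) auto
  then have k: "k < n" using \<theta>(1) unfolding \<theta>_def by simp
  have s: "s = (real k + \<theta>) / real n" using assms(1) by (simp add: \<theta>_def)
  have ns: "real n * s = real k + \<theta>" by (simp add: \<theta>_def)
  define P where "P = (\<Sum>i=1..k. X n i w)"
  define Q where "Q = (\<Sum>i=1..Suc k. X n i w)"
  define R where "R = (\<Sum>i=1..n. X n i w)"
  have "s *\<^sub>R R = (1 - \<theta>) *\<^sub>R ((real k / real n) *\<^sub>R R) + \<theta> *\<^sub>R ((real (Suc k) / real n) *\<^sub>R R)"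
    unfolding s scaleR_scaleR scaleR_left_distrib[symmetric] using assms(1) by (intro arg_cong2[of _ _ _ _ scaleR]) (simp_all add: field_simps)
  then have "cusum X n s w = (1 - \<theta>) *\<^sub>R cusum X n (real k / real n) w + \<theta> *\<^sub>R cusum X n (real (Suc k) / real n) w"
    unfolding cusum_grid[OF assms(1)] unfolding cusum_def ns interp_sum_convex[OF \<theta>]
    unfolding P_def[symmetric] Q_def[symmetric] R_def[symmetric]
    by (simp add: scaleR_right_diff_distrib scaleR_right_distrib mult.commute)
  then show ?thesis using that k \<theta> by auto
qed

text \<open>Interpolation makes the CUSUM process piecewise linear in \<open>s\<close>, and a
  seminorm is convex, so on each piece it is largest at an endpoint.\<close>

lemma (in C01_seminorm) cusum_stat_eq:
  assumes n: "n \<ge> 1"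
  shows "cusum_stat \<nu> X n w = sqrt (real n) * (MAX k\<in>{..n}. \<nu> (cusum X n (real k / real n) w))"
proof -
  let ?m = "MAX k\<in>{..n}. \<nu> (cusum X n (real k / real n) w)"
  have le: "\<nu> (cusum X n (real k / real n) w) \<le> ?m" if "k \<le> n" for k
    using that by (intro Max_ge) auto
  have "\<nu> (cusum X n s w) \<le> ?m" if "s \<in> {0..1}" for s
  proof (cases "s = 1")
    case True
    then show ?thesis using le[of n] n by simp
  next
    case False
    then have "s \<in> {0..<1}" using that by auto
    from cusum_convex[OF n this] obtain k \<theta> where k: "k < n" "0 \<le> \<theta>" "\<theta> \<le> 1"
      "cusum X n s w = (1 - \<theta>) *\<^sub>R cusum X n (real k / real n) w + \<theta> *\<^sub>R cusum X n (real (Suc k) / real n) w" .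
    have "\<nu> (cusum X n s w) \<le> (1 - \<theta>) * \<nu> (cusum X n (real k / real n) w) + \<theta> * \<nu> (cusum X n (real (Suc k) / real n) w)"
      unfolding k(4) using k(2,3) by (intro order_trans[OF triangle]) (simp add: scale)
    also have "\<dots> \<le> (1 - \<theta>) * ?m + \<theta> * ?m"
      using k by (intro add_mono mult_left_mono le) auto
    finally show ?thesis by (simp add: algebra_simps)
  qed
  moreover have "?m \<in> (\<lambda>k. \<nu> (cusum X n (real k / real n) w)) ` {..n}" by (rule Max_in) auto
  then obtain k where "k \<le> n" "?m = \<nu> (cusum X n (real k / real n) w)" by blast
  ultimately have "(SUP s\<in>{0..1}. \<nu> (cusum X n s w)) = ?m"
    by (intro cSup_eq_maximum) (use n in \<open>auto intro!: image_eqI[of _ _ "real k / real n"] simp: field_simps\<close>)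
  then show ?thesis by (simp add: cusum_stat_def)
qed

lemma sum_change_point_means:
  fixes a b :: "'c::real_vector"
  shows "(\<Sum>i=1..k. if i \<le> m then a else b) = real k *\<^sub>R b + real (min k m) *\<^sub>R (a - b)"
proof (induction k)
  case (Suc k)
  then show ?case by (cases "Suc k \<le> m") (simp_all add: algebra_simps min_absorb1 min_absorb2)
qed simp

lemma cusum_change_point_grid:
  assumes "n \<ge> 1"
  shows "cusum (change_point_model s0 \<mu>1 \<mu>2 \<epsilon>) n (real k / real n) w = (1 / real n) *\<^sub>R
    ((\<Sum>i=1..k. \<epsilon> i w) - (real k / real n) *\<^sub>R (\<Sum>i=1..n. \<epsilon> i w)
      + (real (min k (nat \<lfloor>real n * s0\<rfloor>)) - real k / real n * real (min n (nat \<lfloor>real n * s0\<rfloor>))) *\<^sub>R (\<mu>1 - \<mu>2))"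
  unfolding cusum_grid[OF assms] change_point_model_def sum.distrib sum_change_point_means
  using assms by (simp add: algebra_simps)

section \<open>Pathwise comparison of the CUSUM process with its value at the change point\<close>

locale cusum_path = C01_seminorm +
  fixes e :: "nat \<Rightarrow> C01" and \<Phi> :: C01 and n c :: nat
  assumes c: "1 \<le> c" "c < n"
begin

definition S :: "nat \<Rightarrow> C01" where "S k = (\<Sum>i=1..k. e i)"

text \<open>\<open>n\<close> times the CUSUM process at k/n, split into noise and mean; the
  coefficient of \<Phi> is a tent in \<open>k\<close> with peak at the change index
  \<open>c\<close>.\<close>

definition U :: "nat \<Rightarrow> C01" where
  "U k = S k - (real k / real n) *\<^sub>R S n + (real (min k c) - real k / real n * real c) *\<^sub>R \<Phi>"

lemma S_diff: "k \<le> m \<Longrightarrow> S m = S k + (\<Sum>i\<in>{k<..m}. e i)"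
  unfolding S_def by (subst sum.union_disjoint[symmetric]) (auto intro!: sum.cong)

lemma U_c: "U c = S c - (real c / real n) *\<^sub>R S n + (real c * real (n - c) / real n) *\<^sub>R \<Phi>"
proof -
  have "real c - real c / real n * real c = real c * real (n - c) / real n"
    using c by (simp add: of_nat_diff field_simps)
  then show ?thesis by (simp add: U_def)
qed

text \<open>Left of the change point the mean of \<open>U k\<close> is exactly k/c times that of
  \<open>U c\<close>. Hence \<open>U k\<close> is this multiple of \<open>U c\<close> plus noise,
  and the factor 1 - k/c of \<open>\<nu> (U c)\<close> is lost.\<close>

lemma excess_left:
  assumes "k \<le> c"
  shows "\<nu> (U k) - \<nu> (U c) \<le> norm (\<Sum>i\<in>{k<..c}. e i) - real (c - k) / real c * (\<nu> (U c) - norm (S c))"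
proof -
  define \<theta> where "\<theta> = real k / real c"
  have th: "0 \<le> \<theta>" "real (c - k) / real c = 1 - \<theta>" "1 - \<theta> \<ge> 0" using c assms by (auto simp: \<theta>_def of_nat_diff field_simps)
  have r1: "real k / real n = \<theta> * (real c / real n)" using c by (simp add: \<theta>_def)
  have r2: "real (min k c) - real k / real n * real c = \<theta> * (real c * real (n - c) / real n)"
    using c assms by (simp add: \<theta>_def of_nat_diff field_simps min_def)
  have r3: "S k = S c - (\<Sum>i\<in>{k<..c}. e i)" using S_diff[OF assms] by simp
  have eq: "U k = \<theta> *\<^sub>R U c + ((1 - \<theta>) *\<^sub>R S c - (\<Sum>i\<in>{k<..c}. e i))"
    unfolding U_c unfolding U_def r2 r3 unfolding r1 by (simp add: algebra_simps)
  have "\<nu> (U k) \<le> \<theta> * \<nu> (U c) + norm ((1 - \<theta>) *\<^sub>R S c - (\<Sum>i\<in>{k<..c}. e i))"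
    unfolding eq using th by (intro order_trans[OF triangle] add_mono le_norm) (simp add: scale)
  also have "norm ((1 - \<theta>) *\<^sub>R S c - (\<Sum>i\<in>{k<..c}. e i)) \<le> (1 - \<theta>) * norm (S c) + norm (\<Sum>i\<in>{k<..c}. e i)"
    using th by (intro order_trans[OF norm_triangle_ineq4]) simp
  finally show ?thesis unfolding th(2) by (simp add: algebra_simps)
qed

text \<open>The mirror image, with the ratio (n - k)/(n - c); the noise \<open>S n - S c\<close> of
  the second segment takes over the role of \<open>S c\<close>.\<close>

lemma excess_right:
  assumes "c \<le> k" "k \<le> n"
  shows "\<nu> (U k) - \<nu> (U c) \<le> norm (\<Sum>i\<in>{c<..k}. e i) - real (k - c) / real (n - c) * (\<nu> (U c) - norm (S n - S c))"
proof -
  define \<theta> where "\<theta> = real (n - k) / real (n - c)"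
  have nc: "real (n - c) > 0" using c by simp
  have th: "0 \<le> \<theta>" "real (k - c) / real (n - c) = 1 - \<theta>" "1 - \<theta> \<ge> 0"
    using nc assms by (auto simp: \<theta>_def of_nat_diff diff_divide_distrib[symmetric] field_simps)
  have r: "real (min k c) - real k / real n * real c = \<theta> * (real c * real (n - c) / real n)"
    using nc c assms by (simp add: \<theta>_def field_simps min_def)
  have r2: "real k / real n = 1 - \<theta> + \<theta> * (real c / real n)"
    using nc c assms unfolding \<theta>_def by (simp add: of_nat_diff divide_simps) (simp add: algebra_simps)
  have eq: "U k = \<theta> *\<^sub>R U c + ((\<Sum>i\<in>{c<..k}. e i) - (1 - \<theta>) *\<^sub>R (S n - S c))"
    unfolding U_c unfolding U_def r S_diff[OF assms(1)] unfolding r2 by (simp add: algebra_simps)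
  have "\<nu> (U k) \<le> \<theta> * \<nu> (U c) + norm ((\<Sum>i\<in>{c<..k}. e i) - (1 - \<theta>) *\<^sub>R (S n - S c))"
    unfolding eq using th by (intro order_trans[OF triangle] add_mono le_norm) (simp add: scale)
  also have "norm ((\<Sum>i\<in>{c<..k}. e i) - (1 - \<theta>) *\<^sub>R (S n - S c)) \<le> norm (\<Sum>i\<in>{c<..k}. e i) + (1 - \<theta>) * norm (S n - S c)"
    using th by (intro order_trans[OF norm_triangle_ineq4]) simp
  finally show ?thesis unfolding th(2) by (simp add: algebra_simps)
qed

text \<open>
  Away from the change point the loss \<open>q m / 2\<close> at distance \<open>m\<close> dominates the noise, so that only
  the \<open>K\<close> neighbours on each side can contribute to the maximum.
\<close>

lemma excess_le:
  assumes q: "\<nu> ((real c * real (n - c) / real n) *\<^sub>R \<Phi>) \<ge> q * real n"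
    and noise: "norm (S c) \<le> q / 8 * real n" "norm (S n) \<le> q / 8 * real n" and q0: "q \<ge> 0"
    and left: "\<And>m. K \<le> m \<Longrightarrow> m \<le> c \<Longrightarrow> norm (\<Sum>i\<in>{c-m<..c}. e i) \<le> q / 2 * real m"
    and right: "\<And>m. K \<le> m \<Longrightarrow> m \<le> n - c \<Longrightarrow> norm (\<Sum>i\<in>{c<..c+m}. e i) \<le> q / 2 * real m"
    and k: "k \<le> n"
  shows "\<nu> (U k) - \<nu> (U c) \<le> (\<Sum>i\<in>{c-K<..c+K}. norm (e i))"
proof -
  define Y where "Y = (real c * real (n - c) / real n) *\<^sub>R \<Phi>"
  have "\<nu> Y \<le> \<nu> (U c) + norm (S c - (real c / real n) *\<^sub>R S n)"
    using abs_diff_le[of Y "U c"] unfolding U_c Y_def[symmetric] by (simp add: norm_minus_commute)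
  also have "norm (S c - (real c / real n) *\<^sub>R S n) \<le> norm (S c) + real c / real n * norm (S n)"
    by (rule order_trans[OF norm_triangle_ineq4]) simp
  also have "real c / real n * norm (S n) \<le> 1 * norm (S n)" using c by (intro mult_right_mono) auto
  finally have Uc: "\<nu> (U c) \<ge> q * real n - norm (S c) - norm (S n)" using q unfolding Y_def by simp
  have qn: "0 \<le> q * real n" using q0 by simp
  \<comment> \<open>From q n three noise terms of size at most q n / 8 are subtracted here and four
    in the next bound, so at least q n / 2 remains.\<close>
  have b1: "\<nu> (U c) - norm (S c) \<ge> q / 2 * real n"
    using Uc noise qn by (simp only: times_divide_eq_left)
  have b2: "\<nu> (U c) - norm (S n - S c) \<ge> q / 2 * real n"
    using Uc noise norm_triangle_ineq4[of "S n" "S c"] qn by (simp only: times_divide_eq_left)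
  have small: "norm (\<Sum>i\<in>I. e i) \<le> (\<Sum>i\<in>{c-K<..c+K}. norm (e i))" if "I \<subseteq> {c-K<..c+K}" for I
    by (rule order_trans[OF norm_sum sum_mono2]) (use that in auto)
  have big: "(x::real) / y * z \<ge> q / 2 * x" if "z \<ge> q / 2 * real n" "0 < y" "y \<le> real n" "0 \<le> x" for x y z
  proof -
    have "q / 2 * x = x / y * (q / 2 * y)" using that by simp
    also have "\<dots> \<le> x / y * z"
      using that q0 by (intro mult_left_mono order_trans[OF mult_left_mono[of y "real n" "q / 2"]]) auto
    finally show ?thesis .
  qed
  have pos: "0 \<le> q / 2 * real m" for m using q0 by simp
  show ?thesis
  proof (cases "k \<le> c")
    case True
    have b: "real (c - k) / real c * (\<nu> (U c) - norm (S c)) \<ge> q / 2 * real (c - k)"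
      using c by (intro big b1) auto
    show ?thesis
    proof (cases "c - k \<ge> K")
      case True
      then show ?thesis using left[of "c - k"] \<open>k \<le> c\<close> excess_left[OF \<open>k \<le> c\<close>] b small[of "{}"] by simp
    next
      case False
      then have "{k<..c} \<subseteq> {c-K<..c+K}" by (intro subsetI) (simp, linarith)
      from small[OF this] show ?thesis using excess_left[OF \<open>k \<le> c\<close>] b pos[of "c - k"] by linarith
    qed
  next
    case False
    then have ck: "c \<le> k" by simp
    have b: "real (k - c) / real (n - c) * (\<nu> (U c) - norm (S n - S c)) \<ge> q / 2 * real (k - c)"
      using c by (intro big b2) auto
    show ?thesis
    proof (cases "k - c \<ge> K")
      case True
      have "norm (\<Sum>i\<in>{c<..k}. e i) \<le> q / 2 * real (k - c)" using right[OF True] k ck by simp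
      moreover have "0 \<le> (\<Sum>i\<in>{c-K<..c+K}. norm (e i))" by (simp add: sum_nonneg)
      moreover have "x \<le> y" if "z \<le> wt" "x \<le> z - v" "wt \<le> v" "0 \<le> y" for x y z v wt :: real using that by linarith
      ultimately show ?thesis using excess_right[OF ck k] b by blast
    next
      case False
      then have "{c<..k} \<subseteq> {c-K<..c+K}" by (intro subsetI) (simp, linarith)
      moreover have "x \<le> y" if "wt \<le> y" "x \<le> wt - v" "u \<le> v" "0 \<le> u" for x y wt v u :: real using that by linarith
      ultimately show ?thesis using small excess_right[OF ck k] b pos[of "k - c"] by blast
    qed
  qed
qed

end

section \<open>Localisation of the maximum near the change point\<close>

definition cp_index :: "real \<Rightarrow> nat \<Rightarrow> nat" where "cp_index s n = nat \<lfloor>real n * s\<rfloor>"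

lemma cp_index_bounds:
  assumes "0 < s" "s < 1"
  shows "real n * s - 1 < real (cp_index s n)" "real (cp_index s n) \<le> real n * s" "cp_index s n \<le> n"
proof -
  have "0 \<le> real n * s" using assms by simp
  then show 1: "real n * s - 1 < real (cp_index s n)" "real (cp_index s n) \<le> real n * s"
    unfolding cp_index_def by linarith+
  have "real n * s \<le> real n * 1" using assms by (intro mult_left_mono) auto
  then show "cp_index s n \<le> n" using 1 by simp
qed

lemma cp_index_tendsto:
  assumes "0 < s" "s < 1"
  shows "(\<lambda>n. real (cp_index s n) / real n) \<longlonglongrightarrow> s"
proof (rule tendsto_sandwich[of "\<lambda>n. s - 1 / real n" _ _ "\<lambda>n. s"])
  show "(\<lambda>n. s - 1 / real n) \<longlonglongrightarrow> s"
    using tendsto_diff[OF tendsto_const lim_1_over_n, of s] by simp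
  show "\<forall>\<^sub>F n in sequentially. s - 1 / real n \<le> real (cp_index s n) / real n"
    using eventually_gt_at_top[of 0]
  proof eventually_elim
    case (elim n)
    then have "s - 1 / real n = (real n * s - 1) / real n" by (simp add: field_simps)
    also have "\<dots> \<le> real (cp_index s n) / real n"
      using cp_index_bounds(1)[OF assms, of n] by (intro divide_right_mono) auto
    finally show ?case .
  qed
  show "\<forall>\<^sub>F n in sequentially. real (cp_index s n) / real n \<le> s"
    using eventually_gt_at_top[of 0]
    by eventually_elim (use cp_index_bounds(2)[OF assms] in \<open>simp add: field_simps\<close>)
qed auto

text \<open>The coefficient of \<Phi> in sqrt n times the CUSUM process at the change point, with
  the rounded proportion in place of \<open>s\<close>; it differs from sqrt n * s (1 - s) by at most
  1 / sqrt n.\<close>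

definition cp_scale :: "real \<Rightarrow> nat \<Rightarrow> real" where
  "cp_scale s n = sqrt (real n) * (real (cp_index s n) / real n * (1 - real (cp_index s n) / real n))"

context mixing_sequence
begin

definition cp_noise :: "real \<Rightarrow> nat \<Rightarrow> 'w \<Rightarrow> C01" where
  "cp_noise s n w = (1 / sqrt (real n)) *\<^sub>R wsum (stepw (cp_index s n) n) n w"

lemma cp_noise_measurable [measurable]: "cp_noise s n \<in> borel_measurable M"
  unfolding cp_noise_def by measurable

end

context centred_mixing_sequence
begin

text \<open>Outside a small event \<open>excess_le\<close> applies pathwise, with K^2 neighbours on
  each side because the maximal inequality starts at a square. The at most 2 K^2 norms that remain
  are bounded in mean and vanish after division by sqrt n.\<close>

lemma cusum_localisation:
  assumes \<nu>: "C01_seminorm \<nu>" "\<nu> (\<mu>1 - \<mu>2) > 0" and s: "0 < s" "s < 1" and e: "e > 0" and \<eta>: "\<eta> > 0"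
  shows "\<forall>\<^sub>F n in sequentially. prob {w\<in>space M.
    \<bar>cusum_stat \<nu> (change_point_model s \<mu>1 \<mu>2 \<epsilon>) n w - \<nu> (cp_scale s n *\<^sub>R (\<mu>1 - \<mu>2) + cp_noise s n w)\<bar> > e} \<le> \<eta>"
proof -
  interpret \<nu>: C01_seminorm \<nu> by fact
  define \<Phi> where "\<Phi> = \<mu>1 - \<mu>2"
  \<comment> \<open>Half of the limit of the seminorm of the mean divided by \<open>n\<close>, so
    that the lower bound required by \<open>excess_le\<close> holds eventually.\<close>
  define q where "q = s * (1 - s) * \<nu> \<Phi> / 2"
  have q: "q > 0" using \<nu>(2) s by (simp add: q_def \<Phi>_def)
  obtain C1 where C1: "C1 \<ge> 0" "\<And>I m. finite I \<Longrightarrow> I \<subseteq> {1..} \<Longrightarrow> card I \<le> m \<Longrightarrow> m \<ge> 1 \<Longrightarrow>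
      prob {w \<in> space M. norm (\<Sum>i\<in>I. \<epsilon> i w) > q / 8 * real m} \<le> C1 / real m"
    using norm_sum_tail[of "q / 8"] q by auto
  obtain C2 where C2: "C2 \<ge> 0" "\<And>(J :: nat \<Rightarrow> nat set) K n. K \<ge> 1 \<Longrightarrow>
      (\<forall>m. finite (J m) \<and> J m \<subseteq> {1..} \<and> card (J m) \<le> m) \<Longrightarrow> (\<forall>l m. l \<le> m \<longrightarrow> J l \<subseteq> J m \<and> card (J m - J l) \<le> m - l) \<Longrightarrow>
      prob {w \<in> space M. \<exists>m\<in>{K\<^sup>2..n}. norm (\<Sum>i\<in>J m. \<epsilon> i w) > q / 2 * real m} \<le> C2 / real K"
  proof -
    have "q / 2 > 0" using q by simp
    from norm_sum_max_tail[OF this] show thesis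
    proof (elim exE conjE)
      fix C :: real
      assume C: "0 \<le> C" and *: "\<forall>(J :: nat \<Rightarrow> nat set) K n. K \<ge> 1 \<and>
        (\<forall>m. finite (J m) \<and> J m \<subseteq> {1..} \<and> card (J m) \<le> m) \<and> (\<forall>l m. l \<le> m \<longrightarrow> J l \<subseteq> J m \<and> card (J m - J l) \<le> m - l) \<longrightarrow>
        prob {w \<in> space M. \<exists>m\<in>{K\<^sup>2..n}. norm (\<Sum>i\<in>J m. \<epsilon> i w) > q / 2 * real m} \<le> C / real K"
      show thesis by (rule that[OF C]) (rule *[rule_format], intro conjI)
    qed
  qed
  obtain K :: nat where K: "K \<ge> 1" "C2 / real K \<le> \<eta> / 4"
  proof -
    obtain K :: nat where k: "4 * C2 / \<eta> + 1 \<le> real K" using real_arch_simple by blast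
    moreover have "0 \<le> 4 * C2 / \<eta>" using C2(1) \<eta> by simp
    ultimately have "real K \<ge> 1" by linarith
    moreover have "4 * C2 / \<eta> \<le> real K" using k by simp
    ultimately have "K \<ge> 1" "C2 / real K \<le> \<eta> / 4" using \<eta> by (simp_all add: divide_le_eq mult.commute)
    then show thesis by (rule that)
  qed
  define D where "D = 2 * (real K)\<^sup>2 * (1 + \<mu>p) / e"
  have "(\<lambda>n. real (cp_index s n) / real n * (1 - real (cp_index s n) / real n) * \<nu> \<Phi>) \<longlonglongrightarrow> s * (1 - s) * \<nu> \<Phi>"
    by (intro tendsto_intros cp_index_tendsto s)
  then have ev1: "\<forall>\<^sub>F n in sequentially. q < real (cp_index s n) / real n * (1 - real (cp_index s n) / real n) * \<nu> \<Phi>"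
  proof (rule order_tendstoD)
    have "s * (1 - s) * \<nu> \<Phi> = 2 * q" by (simp add: q_def)
    then show "q < s * (1 - s) * \<nu> \<Phi>" using q by linarith
  qed
  have "(\<lambda>n. 2 * (C1 / real n) + D / sqrt (real n)) \<longlonglongrightarrow> 0" by real_asymp
  then have ev2: "\<forall>\<^sub>F n in sequentially. 2 * (C1 / real n) + D / sqrt (real n) < \<eta> / 2"
    by (rule order_tendstoD) (use \<eta> in simp)
  have ev3: "\<forall>\<^sub>F n in sequentially. 0 < real (cp_index s n) / real n" "\<forall>\<^sub>F n in sequentially. real (cp_index s n) / real n < 1"
    by (rule order_tendstoD[OF cp_index_tendsto[OF s]], use s in simp)+
  show ?thesis
    using ev1 ev2 ev3 eventually_ge_at_top[of 1]
  proof eventually_elim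
    case (elim n)
    define c where "c = cp_index s n"
    have c: "1 \<le> c" "c < n" and n: "real n > 0" using elim(3,4,5) by (auto simp: c_def field_simps Suc_le_eq)
  let ?B = "{w\<in>space M. \<bar>cusum_stat \<nu> (change_point_model s \<mu>1 \<mu>2 \<epsilon>) n w - \<nu> (cp_scale s n *\<^sub>R (\<mu>1 - \<mu>2) + cp_noise s n w)\<bar> > e}"
  let ?X = "change_point_model s \<mu>1 \<mu>2 \<epsilon>"
    \<comment> \<open>\<open>A1\<close> and \<open>A2\<close> concern the global noise,
      \<open>A3\<close> and \<open>A4\<close> its linear bound to the left and right of the change
      point from distance K^2 on, \<open>A5\<close> the errors within that distance.\<close>
    define A1 where "A1 = {w \<in> space M. norm (\<Sum>i\<in>{1..c}. \<epsilon> i w) > q / 8 * real n}"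
    define A2 where "A2 = {w \<in> space M. norm (\<Sum>i\<in>{1..n}. \<epsilon> i w) > q / 8 * real n}"
    define A3 where "A3 = {w \<in> space M. \<exists>m\<in>{K\<^sup>2..n}. norm (\<Sum>i\<in>{c-m<..c}. \<epsilon> i w) > q / 2 * real m}"
    define A4 where "A4 = {w \<in> space M. \<exists>m\<in>{K\<^sup>2..n}. norm (\<Sum>i\<in>{c<..c+m}. \<epsilon> i w) > q / 2 * real m}"
    define A5 where "A5 = {w \<in> space M. (\<Sum>i\<in>{c-K\<^sup>2<..c+K\<^sup>2}. norm (\<epsilon> i w)) \<ge> e * sqrt (real n)}"
    have m: "(\<lambda>w. \<Sum>i\<in>I. \<epsilon> i w) \<in> borel_measurable M" "(\<lambda>w. \<Sum>i\<in>I. norm (\<epsilon> i w)) \<in> borel_measurable M" if "I \<subseteq> {1..}" for I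
      using that measurable_sum_\<epsilon> by (auto intro!: borel_measurable_sum borel_measurable_norm rv)
    have [measurable]: "(\<lambda>w. \<Sum>i\<in>{1..k}. \<epsilon> i w) \<in> borel_measurable M" "(\<lambda>w. \<Sum>i\<in>{c-k<..c}. \<epsilon> i w) \<in> borel_measurable M"
       "(\<lambda>w. \<Sum>i\<in>{c<..c+k}. \<epsilon> i w) \<in> borel_measurable M" "(\<lambda>w. \<Sum>i\<in>{c-K\<^sup>2<..c+K\<^sup>2}. norm (\<epsilon> i w)) \<in> borel_measurable M" for k
      by (rule m; auto)+
    have ev: "A1 \<in> events" "A2 \<in> events" "A3 \<in> events" "A4 \<in> events" "A5 \<in> events"
      unfolding A1_def A2_def A3_def A4_def A5_def by measurable
    have p1: "prob A1 \<le> C1 / real n" unfolding A1_def by (rule C1(2)) (use c in auto)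
    have p2: "prob A2 \<le> C1 / real n" unfolding A2_def by (rule C1(2)) (use c in auto)
    have p3: "prob A3 \<le> \<eta> / 4" unfolding A3_def
    proof (rule order_trans[OF C2(2)[OF K(1)] K(2)])
      show "\<forall>l m. l \<le> m \<longrightarrow> {c-l<..c} \<subseteq> {c-m<..c} \<and> card ({c-m<..c} - {c-l<..c}) \<le> m - l"
      proof (intro allI impI conjI)
        fix l m :: nat assume "l \<le> m"
        then show "{c-l<..c} \<subseteq> {c-m<..c}" by auto
        have "{c-m<..c} - {c-l<..c} = {c-m<..c-l}" using \<open>l \<le> m\<close> by auto
        then show "card ({c-m<..c} - {c-l<..c}) \<le> m - l" by simp
      qed
    qed auto
    have p4: "prob A4 \<le> \<eta> / 4" unfolding A4_def
    proof (rule order_trans[OF C2(2)[OF K(1)] K(2)])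
      show "\<forall>l m. l \<le> m \<longrightarrow> {c<..c+l} \<subseteq> {c<..c+m} \<and> card ({c<..c+m} - {c<..c+l}) \<le> m - l"
      proof (intro allI impI conjI)
        fix l m :: nat assume "l \<le> m"
        then show "{c<..c+l} \<subseteq> {c<..c+m}" by auto
        have "{c<..c+m} - {c<..c+l} = {c+l<..c+m}" using \<open>l \<le> m\<close> by auto
        then show "card ({c<..c+m} - {c<..c+l}) \<le> m - l" by simp
      qed
    qed auto
    have p5: "prob A5 \<le> D / sqrt (real n)"
    proof -
      have int: "integrable M (\<lambda>w. norm (\<epsilon> i w))" "(LINT w|M. norm (\<epsilon> i w)) \<le> 1 + \<mu>p" if "i \<in> {c-K\<^sup>2<..c+K\<^sup>2}" for i
        using that by (auto intro!: integrable_norm expectation_norm_le)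
      have "prob A5 \<le> (LINT w|M. (\<Sum>i\<in>{c-K\<^sup>2<..c+K\<^sup>2}. norm (\<epsilon> i w))) / (e * sqrt (real n))"
        unfolding A5_def using e n
        by (intro integral_Markov_inequality_measure[where A="{}"] Bochner_Integration.integrable_sum int) (auto intro!: sum_nonneg)
      also have "\<dots> \<le> (2 * (real K)\<^sup>2 * (1 + \<mu>p)) / (e * sqrt (real n))"
      proof (intro divide_right_mono)
        have "(LINT w|M. (\<Sum>i\<in>{c-K\<^sup>2<..c+K\<^sup>2}. norm (\<epsilon> i w))) = (\<Sum>i\<in>{c-K\<^sup>2<..c+K\<^sup>2}. (LINT w|M. norm (\<epsilon> i w)))"
          by (intro Bochner_Integration.integral_sum int)
        also have "\<dots> \<le> real (card {c-K\<^sup>2<..c+K\<^sup>2}) * (1 + \<mu>p)"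
          using int by (intro sum_bounded_above)
        also have "\<dots> \<le> real (2 * K\<^sup>2) * (1 + \<mu>p)"
        proof (rule mult_right_mono)
          have "card {c-K\<^sup>2<..c+K\<^sup>2} \<le> 2 * K\<^sup>2" unfolding card_greaterThanAtMost by linarith
          then show "real (card {c-K\<^sup>2<..c+K\<^sup>2}) \<le> real (2 * K\<^sup>2)" by (simp only: of_nat_le_iff)
        qed (use \<mu>p_nonneg in simp)
        finally show "(LINT w|M. (\<Sum>i\<in>{c-K\<^sup>2<..c+K\<^sup>2}. norm (\<epsilon> i w))) \<le> 2 * (real K)\<^sup>2 * (1 + \<mu>p)" by simp
      qed (use e in simp)
      also have "\<dots> = D / sqrt (real n)" by (simp add: D_def)
      finally show ?thesis .
    qed
    have "?B
       \<subseteq> A1 \<union> A2 \<union> A3 \<union> A4 \<union> A5"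
    proof (rule subsetI, rule ccontr)
      fix w assume w: "w \<in> ?B"
        and "w \<notin> A1 \<union> A2 \<union> A3 \<union> A4 \<union> A5"
      then have not: "w \<in> space M" "w \<notin> A1" "w \<notin> A2" "w \<notin> A3" "w \<notin> A4" "w \<notin> A5" by auto
      interpret cusum_path \<nu> "\<lambda>i. \<epsilon> i w" \<Phi> n c by unfold_locales (use c in auto)
      have cu: "cusum (?X) n (real k / real n) w = (1 / real n) *\<^sub>R U k" if "k \<le> n" for k
        using c that unfolding U_def S_def unfolding \<Phi>_def c_def cp_index_def by (subst cusum_change_point_grid) (auto simp: min_absorb2)
      have "\<nu> ((real c * real (n - c) / real n) *\<^sub>R \<Phi>) = real n * (real c / real n * (1 - real c / real n) * \<nu> \<Phi>)"
        using c by (simp add: \<nu>.scale of_nat_diff field_simps)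
      also have "\<dots> \<ge> real n * q" using elim(1) n unfolding c_def by (intro mult_left_mono) auto
      finally have qn: "\<nu> ((real c * real (n - c) / real n) *\<^sub>R \<Phi>) \<ge> q * real n" by (simp add: mult.commute)
      have ex: "\<nu> (U k) - \<nu> (U c) \<le> (\<Sum>i\<in>{c-K\<^sup>2<..c+K\<^sup>2}. norm (\<epsilon> i w))" if "k \<le> n" for k
      proof (rule excess_le[OF qn _ _ _ _ _ that])
        show "norm (S c) \<le> q / 8 * real n" "norm (S n) \<le> q / 8 * real n"
          using not unfolding A1_def A2_def S_def by auto
        show "norm (\<Sum>i\<in>{c-m<..c}. \<epsilon> i w) \<le> q / 2 * real m" if "K\<^sup>2 \<le> m" "m \<le> c" for m
          using not(1,4) that c unfolding A3_def by (force simp: not_less)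
        show "norm (\<Sum>i\<in>{c<..c+m}. \<epsilon> i w) \<le> q / 2 * real m" if "K\<^sup>2 \<le> m" "m \<le> n - c" for m
          using not(1,5) that c unfolding A4_def by (force simp: not_less)
      qed (use q in simp)
      have "cp_scale s n *\<^sub>R (\<mu>1 - \<mu>2) + cp_noise s n w = (1 / sqrt (real n)) *\<^sub>R U c"
      proof -
        have "{c + 1..n} = {c<..n}" by auto
        then have h: "(\<Sum>i\<in>{c + 1..n}. \<epsilon> i w) = S n - S c"
          using S_diff[of c n] c by simp
        have wt: "wsum (stepw c n) n w = S c - (real c / real n) *\<^sub>R S n"
          unfolding wsum_def sum_stepw[OF less_imp_le[OF c(2)]] h unfolding S_def[symmetric] by (simp add: algebra_simps)
        have "sqrt (real n) * (real c / real n * (1 - real c / real n)) = sqrt (real n) * (real c * real (n - c)) / (real n * real n)"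
          using c by (simp add: of_nat_diff field_simps)
        also have "\<dots> = sqrt (real n) * (real c * real (n - c)) / (sqrt (real n) * sqrt (real n) * real n)" by simp
        also have "\<dots> = 1 / sqrt (real n) * (real c * real (n - c) / real n)" using n by (simp only: mult.assoc) simp
        finally show ?thesis
          unfolding cp_scale_def cp_noise_def c_def[symmetric] wt U_c \<Phi>_def[symmetric]
          by (simp add: scaleR_right_distrib)
      qed
      then have N: "\<nu> (cp_scale s n *\<^sub>R (\<mu>1 - \<mu>2) + cp_noise s n w) = (1 / sqrt (real n)) * \<nu> (U c)"
        using n by (simp add: \<nu>.scale)
      define T where "T = (MAX k\<in>{..n}. \<nu> (U k))"
      have Tc: "T \<ge> \<nu> (U c)" unfolding T_def using c by (intro Max_ge) auto
      have "T \<le> \<nu> (U c) + (\<Sum>i\<in>{c-K\<^sup>2<..c+K\<^sup>2}. norm (\<epsilon> i w))"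
        unfolding T_def using ex by (subst Max_le_iff) (auto simp: algebra_simps)
      then have T2: "T - \<nu> (U c) < e * sqrt (real n)" using not(1,6) unfolding A5_def by simp
      have "(MAX k\<in>{..n}. \<nu> (cusum (?X) n (real k / real n) w)) = (MAX k\<in>{..n}. (1 / real n) * \<nu> (U k))"
        by (intro arg_cong[where f=Max] image_cong) (auto simp: cu \<nu>.scale)
      also have "\<dots> = (1 / real n) * T"
        unfolding T_def using n by (subst mono_Max_commute[of "\<lambda>x. (1 / real n) * x"]) (auto simp: image_image mono_def divide_right_mono)
      finally have "cusum_stat \<nu> (?X) n w = sqrt (real n) * ((1 / real n) * T)"
        using c by (subst \<nu>.cusum_stat_eq) simp_all
      also have "\<dots> = (1 / sqrt (real n)) * T" using n by (simp add: field_simps)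
      finally have "cusum_stat \<nu> (?X) n w - \<nu> (cp_scale s n *\<^sub>R (\<mu>1 - \<mu>2) + cp_noise s n w) = (T - \<nu> (U c)) / sqrt (real n)"
        unfolding N by (simp add: diff_divide_distrib)
      moreover have "\<bar>(T - \<nu> (U c)) / sqrt (real n)\<bar> < e"
        using T2 Tc n by (simp add: field_simps)
      ultimately show False using w by simp
    qed
    then have "prob ?B
      \<le> prob (A1 \<union> A2 \<union> A3 \<union> A4 \<union> A5)"
      using ev by (intro finite_measure_mono) auto
    also have "\<dots> \<le> prob A1 + prob A2 + prob A3 + prob A4 + prob A5"
      using ev measure_Un_le[of A1 M A2] measure_Un_le[of "A1 \<union> A2" M A3] measure_Un_le[of "A1 \<union> A2 \<union> A3" M A4]
        measure_Un_le[of "A1 \<union> A2 \<union> A3 \<union> A4" M A5] by auto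
    also have "\<dots> \<le> \<eta>" using p1 p2 p3 p4 p5 elim(2) by linarith
    finally show ?case .
  qed
qed

end

section \<open>Limits of centred norms along a diverging direction\<close>

lemma cts_step_props:
  assumes "a < b"
  shows "0 \<le> cts_step a b x" "cts_step a b x \<le> 1" "x \<le> y \<Longrightarrow> cts_step a b y \<le> cts_step a b x"
    "\<bar>cts_step a b x - cts_step a b y\<bar> \<le> \<bar>x - y\<bar> / (b - a)"
proof -
  have eq: "cts_step a b x = min 1 (max 0 ((b - x) / (b - a)))" for x
    using assms by (auto simp: cts_step_def field_simps min_def max_def)
  show "0 \<le> cts_step a b x" "cts_step a b x \<le> 1" by (simp_all add: eq)
  show "cts_step a b y \<le> cts_step a b x" if "x \<le> y"
  proof -
    have "(b - y) / (b - a) \<le> (b - x) / (b - a)" using assms that by (intro divide_right_mono) auto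
    then show ?thesis unfolding eq by (intro min.mono max.mono) auto
  qed
  have "\<bar>cts_step a b x - cts_step a b y\<bar> \<le> \<bar>(b - x) / (b - a) - (b - y) / (b - a)\<bar>"
    unfolding eq by linarith
  also have "\<dots> = \<bar>x - y\<bar> / (b - a)" using assms by (simp add: abs_minus_commute flip: diff_divide_distrib)
  finally show "\<bar>cts_step a b x - cts_step a b y\<bar> \<le> \<bar>x - y\<bar> / (b - a)" .
qed

lemma continuous_cts_step: "a < b \<Longrightarrow> continuous_on UNIV (cts_step a b)"
  by (rule uniformly_continuous_imp_continuous[OF cts_step_uniformly_continuous])

context C01_seminorm
begin

text \<open>For r > 0 this is the difference quotient of \<nu> at \<Phi> in direction
  \<open>z\<close> with step 1/r.\<close>

definition drift :: "C01 \<Rightarrow> real \<Rightarrow> C01 \<Rightarrow> real" where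
  "drift \<Phi> r z = \<nu> (r *\<^sub>R \<Phi> + z) - r * \<nu> \<Phi>"

lemma drift_lipschitz: "\<bar>drift \<Phi> r z - drift \<Phi> r z'\<bar> \<le> norm (z - z')"
  using abs_diff_le[of "r *\<^sub>R \<Phi> + z" "r *\<^sub>R \<Phi> + z'"] by (simp add: drift_def)

text \<open>Moving further by (r' - r) \<Phi> raises the seminorm by at most (r' - r) \<nu> \<Phi>,
  which is exactly the additional centring.\<close>

lemma drift_antimono: "r \<le> r' \<Longrightarrow> drift \<Phi> r' z \<le> drift \<Phi> r z"
proof -
  assume "r \<le> r'"
  have "r *\<^sub>R \<Phi> + z + (r' - r) *\<^sub>R \<Phi> = r' *\<^sub>R \<Phi> + z" by (simp add: algebra_simps)
  with triangle[of "r *\<^sub>R \<Phi> + z" "(r' - r) *\<^sub>R \<Phi>"] \<open>r \<le> r'\<close> show ?thesis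
    by (simp add: drift_def scale left_diff_distrib)
qed

lemma drift_limit_le:
  assumes "((\<lambda>r. drift \<Phi> r z) \<longlongrightarrow> d) at_top"
  shows "d \<le> drift \<Phi> r z"
  by (rule tendsto_upperbound[OF assms]) (auto intro: eventually_mono[OF eventually_ge_at_top[of r]] drift_antimono)

text \<open>A decreasing step function \<open>g\<close> is tested. From below, \<open>drift\<close>
  at \<open>a n\<close> is replaced by \<open>drift\<close> at a fixed m, a fixed Lipschitz
  functional, and m tends to infinity only after n. From above it is replaced by the limit
  \<open>D\<close>, which is Lipschitz as well. Both comparisons rest on monotonicity in r, so the
  divergence of \<open>a n\<close> requires no uniformity in \<open>z\<close>.\<close>

lemma weak_conv_drift:
  fixes M :: "'a measure" and N :: "'b measure"
  assumes "prob_space M" "prob_space N"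
    and [measurable]: "\<And>n. Z n \<in> borel_measurable M" "\<And>n. T n \<in> borel_measurable M" "B \<in> borel_measurable N"
    and conv: "\<And>F b. (\<And>x y. \<bar>F x - F y\<bar> \<le> norm (x - y)) \<Longrightarrow> (\<And>x. \<bar>F x\<bar> \<le> b) \<Longrightarrow>
      (\<lambda>n. LINT w|M. F (Z n w)) \<longlonglongrightarrow> (LINT w|N. F (B w))"
    and D: "\<And>z. ((\<lambda>r. drift \<Phi> r z) \<longlongrightarrow> D z) at_top"
    and a: "filterlim a at_top sequentially" and r: "(\<lambda>n. a n - sqrt (real n) * r) \<longlonglongrightarrow> 0"
    and loc: "\<And>e \<eta>. e > 0 \<Longrightarrow> \<eta> > 0 \<Longrightarrow>
      \<forall>\<^sub>F n in sequentially. measure M {w\<in>space M. \<bar>T n w - \<nu> (a n *\<^sub>R \<Phi> + Z n w)\<bar> > e} \<le> \<eta>"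
  shows "weak_conv_m (\<lambda>n. distr M borel (\<lambda>w. T n w - sqrt (real n) * (r * \<nu> \<Phi>))) (distr N borel (\<lambda>w. D (B w)))"
proof -
  interpret M: prob_space M by fact
  interpret N: prob_space N by fact
  have D_lip: "\<bar>D z - D z'\<bar> \<le> norm (z - z')" for z z'
    by (rule tendsto_upperbound[OF tendsto_rabs[OF tendsto_diff[OF D D]]]) (simp_all add: drift_lipschitz)
  have D_m[measurable]: "D \<in> borel_measurable borel"
    by (intro borel_measurable_continuous_onI lipschitz_continuous_on D_lip)
  have dr_m[measurable]: "drift \<Phi> x \<in> borel_measurable borel" for x
    by (intro borel_measurable_continuous_onI lipschitz_continuous_on drift_lipschitz)
  define R where "R n w = T n w - sqrt (real n) * (r * \<nu> \<Phi>)" for n w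
  have [measurable]: "R n \<in> borel_measurable M" for n unfolding R_def by measurable
  have distr: "real_distribution (distr M borel (R n))" "real_distribution (distr N borel (\<lambda>w. D (B w)))" for n
    by (rule M.real_distribution_distr N.real_distribution_distr, measurable)+
  have "weak_conv_m (\<lambda>n. distr M borel (R n)) (distr N borel (\<lambda>w. D (B w)))"
  proof (rule integral_cts_step_conv_imp_weak_conv[OF distr])
    fix x y :: real assume xy: "x < y"
    define g where "g = cts_step x y"
    note g = cts_step_props[OF xy, folded g_def]
    have gc: "continuous_on UNIV g" unfolding g_def by (rule continuous_cts_step[OF xy])
    then have [measurable]: "g \<in> borel_measurable borel" by (rule borel_measurable_continuous_onI)
    have iM: "integrable M (\<lambda>w. g (f w))" if [measurable]: "f \<in> borel_measurable M" for f
      by (rule M.integrable_const_bound[of _ 1]) (use g in auto)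
    have lipconv: "(\<lambda>n. LINT w|M. g (h (Z n w))) \<longlonglongrightarrow> (LINT w|N. g (h (B w)))"
      if h: "\<And>z z'. \<bar>h z - h z'\<bar> \<le> norm (z - z')" for h
    proof -
      \<comment> \<open>\<open>g\<close> has slope at most 1 / (y - x); the factor y - x makes the
        composition 1-Lipschitz, as \<open>conv\<close> demands.\<close>
      have "(\<lambda>n. LINT w|M. (y - x) * g (h (Z n w))) \<longlonglongrightarrow> (LINT w|N. (y - x) * g (h (B w)))"
      proof (rule conv[of _ "y - x"])
        fix z z'
        have "\<bar>(y - x) * g (h z) - (y - x) * g (h z')\<bar> = (y - x) * \<bar>g (h z) - g (h z')\<bar>"
          using xy by (simp add: abs_mult flip: right_diff_distrib)
        also have "\<dots> \<le> (y - x) * (\<bar>h z - h z'\<bar> / (y - x))" using xy by (intro mult_left_mono g) auto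
        also have "\<dots> \<le> norm (z - z')" using xy h by simp
        finally show "\<bar>(y - x) * g (h z) - (y - x) * g (h z')\<bar> \<le> norm (z - z')" .
        show "\<bar>(y - x) * g (h z)\<bar> \<le> y - x" using xy g by (simp add: abs_mult mult_left_le)
      qed
      then have "(\<lambda>n. inverse (y - x) * (LINT w|M. (y - x) * g (h (Z n w)))) \<longlonglongrightarrow> inverse (y - x) * (LINT w|N. (y - x) * g (h (B w)))"
        by (intro tendsto_intros)
      then show ?thesis using xy by simp
    qed
    have main: "(\<lambda>n. LINT w|M. g (drift \<Phi> (a n) (Z n w))) \<longlonglongrightarrow> (LINT w|N. g (D (B w)))"
    proof (rule order_tendstoI)
      fix u assume u: "u < (LINT w|N. g (D (B w)))"
      have "(\<lambda>m. LINT w|N. g (drift \<Phi> (real m) (B w))) \<longlonglongrightarrow> (LINT w|N. g (D (B w)))"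
      proof (rule integral_dominated_convergence[where w="\<lambda>_. 1"])
        show "AE w in N. (\<lambda>m. g (drift \<Phi> (real m) (B w))) \<longlonglongrightarrow> g (D (B w))"
          by (intro AE_I2 continuous_on_tendsto_compose[OF gc] filterlim_compose[OF D filterlim_real_sequentially]) auto
      qed (use g in auto)
      from order_tendstoD(1)[OF this u] obtain m :: nat where m: "u < (LINT w|N. g (drift \<Phi> (real m) (B w)))"
        by (auto simp: eventually_sequentially)
      have "\<forall>\<^sub>F n in sequentially. u < (LINT w|M. g (drift \<Phi> (real m) (Z n w)))"
        by (rule order_tendstoD(1)[OF lipconv m]) (rule drift_lipschitz)
      moreover have "\<forall>\<^sub>F n in sequentially. a n \<ge> real m" using a by (simp add: filterlim_at_top)
      ultimately show "\<forall>\<^sub>F n in sequentially. u < (LINT w|M. g (drift \<Phi> (a n) (Z n w)))"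
      proof eventually_elim
        case (elim n)
        have "(LINT w|M. g (drift \<Phi> (real m) (Z n w))) \<le> (LINT w|M. g (drift \<Phi> (a n) (Z n w)))"
          by (intro integral_mono iM g drift_antimono elim) measurable
        then show ?case using elim by simp
      qed
    next
      fix u assume "(LINT w|N. g (D (B w))) < u"
      then have "\<forall>\<^sub>F n in sequentially. (LINT w|M. g (D (Z n w))) < u"
        by (rule order_tendstoD(2)[OF lipconv[OF D_lip]])
      then show "\<forall>\<^sub>F n in sequentially. (LINT w|M. g (drift \<Phi> (a n) (Z n w))) < u"
      proof eventually_elim
        case (elim n)
        have "(LINT w|M. g (drift \<Phi> (a n) (Z n w))) \<le> (LINT w|M. g (D (Z n w)))"
          by (intro integral_mono iM g drift_limit_le D) measurable
        then show ?case using elim by simp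
      qed
    qed
    have "(\<lambda>n. (LINT w|M. g (R n w)) - (LINT w|M. g (drift \<Phi> (a n) (Z n w)))) \<longlonglongrightarrow> 0"
    proof (rule LIMSEQ_I)
      fix \<eta> :: real assume \<eta>: "\<eta> > 0"
      \<comment> \<open>The deviation is at most 2 e, once for the localisation and once for the
        centring, so \<open>g\<close> changes by at most 2 e / (y - x) = \<eta> / 4.\<close>
      define e where "e = \<eta> * (y - x) / 8"
      have e: "e > 0" and q: "\<eta> / 4 > 0" using xy \<eta> by (simp_all add: e_def)
      have "(\<lambda>n. (a n - sqrt (real n) * r) * \<nu> \<Phi>) \<longlonglongrightarrow> 0 * \<nu> \<Phi>" by (intro tendsto_intros r)
      from tendstoD[OF this e] have ev: "\<forall>\<^sub>F n in sequentially. \<bar>(a n - sqrt (real n) * r) * \<nu> \<Phi>\<bar> < e" by simp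
      have "\<forall>\<^sub>F n in sequentially. \<bar>(LINT w|M. g (R n w)) - (LINT w|M. g (drift \<Phi> (a n) (Z n w)))\<bar> < \<eta>"
        using ev loc[OF e q]
      proof eventually_elim
        case (elim n)
        define A where "A = {w\<in>space M. \<bar>T n w - \<nu> (a n *\<^sub>R \<Phi> + Z n w)\<bar> > e}"
        have [measurable]: "A \<in> sets M" unfolding A_def by measurable
        have dm: "(\<lambda>w. drift \<Phi> (a n) (Z n w)) \<in> borel_measurable M" by measurable
        have iA: "integrable M (indicat_real A)" by (rule M.integrable_const_bound[where B=1]) (simp_all add: indicator_def)
        have "\<bar>LINT w|M. g (R n w) - g (drift \<Phi> (a n) (Z n w))\<bar> \<le> (LINT w|M. 2 * e / (y - x) + indicat_real A w)"
        proof (intro order_trans[OF integral_abs_bound] integral_mono integrable_abs Bochner_Integration.integrable_diff Bochner_Integration.integrable_add iM iA dm)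
          fix w assume w: "w \<in> space M"
          show "\<bar>g (R n w) - g (drift \<Phi> (a n) (Z n w))\<bar> \<le> 2 * e / (y - x) + indicat_real A w"
          proof (cases "w \<in> A")
            case True
            moreover have "0 \<le> 2 * e / (y - x)" using e xy by simp
            ultimately show ?thesis using g(1,2)[of "R n w"] g(1,2)[of "drift \<Phi> (a n) (Z n w)"]
              by (simp only: indicator_simps)
          next
            case False
            then have "\<bar>T n w - \<nu> (a n *\<^sub>R \<Phi> + Z n w)\<bar> \<le> e" using w by (simp add: A_def)
            moreover have "R n w - drift \<Phi> (a n) (Z n w) = (T n w - \<nu> (a n *\<^sub>R \<Phi> + Z n w)) + (a n - sqrt (real n) * r) * \<nu> \<Phi>"
              unfolding R_def drift_def by (simp add: algebra_simps)
            ultimately have "\<bar>R n w - drift \<Phi> (a n) (Z n w)\<bar> \<le> 2 * e" using elim(1) by linarith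
            then have "\<bar>R n w - drift \<Phi> (a n) (Z n w)\<bar> / (y - x) \<le> 2 * e / (y - x)" using xy by (intro divide_right_mono) auto
            then show ?thesis using g(4)[of "R n w" "drift \<Phi> (a n) (Z n w)"] False by simp
          qed
        qed measurable
        also have "\<dots> = 2 * e / (y - x) + M.prob A" by (simp add: iA M.prob_space)
        also have "2 * e / (y - x) = \<eta> / 4" using xy by (simp add: e_def field_simps)
        also have "\<eta> / 4 + M.prob A < \<eta>" using elim(2) \<eta> unfolding A_def[symmetric] by simp
        finally show ?case by (simp add: iM dm)
      qed
      then show "\<exists>no. \<forall>n\<ge>no. norm ((LINT w|M. g (R n w)) - (LINT w|M. g (drift \<Phi> (a n) (Z n w))) - 0) < \<eta>"
        by (simp add: eventually_sequentially)
    qed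
    from tendsto_add[OF this main] have "(\<lambda>n. LINT w|M. g (R n w)) \<longlonglongrightarrow> (LINT w|N. g (D (B w)))" by simp
    then show "(\<lambda>n. LINT x|distr M borel (R n). g x) \<longlonglongrightarrow> (LINT x|distr N borel (\<lambda>w. D (B w)). g x)"
      by (simp add: integral_distr)
  qed
  then show ?thesis unfolding R_def .
qed

end

section \<open>The three norms and their directional derivatives\<close>

lemma set_integrable_val_at:
  assumes "continuous_on {0..1} f"
  shows "set_integrable lborel {0..1} (f :: real \<Rightarrow> real)"
  unfolding set_integrable_def by (rule borel_integrable_compact) (use assms in auto)

declare continuous_on_val_at [continuous_intros]

lemma set_integral_le_const:
  fixes f :: "real \<Rightarrow> real"
  assumes "continuous_on {0..1} f" "\<And>t. t \<in> {0..1} \<Longrightarrow> f t \<le> c"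
  shows "(LINT t:{0..1}|lborel. f t) \<le> c"
proof -
  have "(LINT t:{0..1}|lborel. f t) \<le> (LINT t:{0..1::real}|lborel. c)"
    using assms by (intro set_integral_mono set_integrable_val_at) auto
  then show ?thesis by (simp add: set_lebesgue_integral_def)
qed

interpretation L1: C01_seminorm L1_norm
proof
  fix x y :: C01 and r :: real
  have "L1_norm (x + y) \<le> (LINT t:{0..1}|lborel. \<bar>val_at x t\<bar> + \<bar>val_at y t\<bar>)"
    unfolding L1_norm_def by (intro set_integral_mono set_integrable_val_at continuous_intros) auto
  also have "\<dots> = L1_norm x + L1_norm y"
    unfolding L1_norm_def by (intro set_integral_add set_integrable_val_at continuous_intros)
  finally show "L1_norm (x + y) \<le> L1_norm x + L1_norm y" .
  show "L1_norm (r *\<^sub>R x) = \<bar>r\<bar> * L1_norm x"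
    by (simp add: L1_norm_def abs_mult)
  show "L1_norm x \<le> norm x"
    unfolding L1_norm_def by (intro set_integral_le_const continuous_intros abs_val_at_le_norm)
qed

lemma L2_inner_add: "L2_inner (x + y) z = L2_inner x z + L2_inner y z"
  unfolding L2_inner_def val_at_simps distrib_right
  by (intro set_integral_add set_integrable_val_at continuous_intros)

lemma L2_inner_scale: "L2_inner (r *\<^sub>R x) y = r * L2_inner x y"
  by (simp add: L2_inner_def mult.assoc)

lemma L2_inner_commute: "L2_inner x y = L2_inner y x"
  by (simp add: L2_inner_def mult.commute)

lemma L2_inner_nonneg: "L2_inner x x \<ge> 0"
  unfolding L2_inner_def set_lebesgue_integral_def by (intro integral_nonneg_AE AE_I2) (auto simp: indicator_def)

lemma L2_inner_expand:
  "L2_inner (r *\<^sub>R x + z) (r *\<^sub>R x + z) = r\<^sup>2 * L2_inner x x + 2 * r * L2_inner z x + L2_inner z z"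
proof -
  have "L2_inner (r *\<^sub>R x + z) wt = r * L2_inner x wt + L2_inner z wt"
    "L2_inner wt (r *\<^sub>R x + z) = r * L2_inner wt x + L2_inner wt z" for wt
    by (simp_all add: L2_inner_add L2_inner_scale L2_inner_commute[of wt])
  then show ?thesis by (simp add: L2_inner_commute[of x z] algebra_simps power2_eq_square)
qed

text \<open>The quadratic r^2 a + 2 r b + c is nonnegative; evaluating it at r = - b/a gives the
  inequality, and for a = 0 a nonnegative affine function forces b = 0.\<close>

lemma L2_inner_le: "L2_inner x y \<le> L2_norm x * L2_norm y"
proof -
  define a b c where "a = L2_inner y y" and "b = L2_inner x y" and "c = L2_inner x x"
  have q: "0 \<le> r\<^sup>2 * a + 2 * r * b + c" for r
    using L2_inner_nonneg[of "r *\<^sub>R y + x"] by (simp add: L2_inner_expand a_def b_def c_def)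
  have a0: "a \<ge> 0" by (simp add: a_def L2_inner_nonneg)
  have "b\<^sup>2 \<le> c * a"
  proof (cases "a = 0")
    case True
    have "b = 0"
    proof (rule ccontr)
      assume "b \<noteq> 0"
      then have "2 * (- (c + 1) / (2 * b)) * b = - (c + 1)" by simp
      then show False using q[of "- (c + 1) / (2 * b)"] True by simp
    qed
    then show ?thesis using True by simp
  next
    case False
    have "0 \<le> a * ((- b / a)\<^sup>2 * a + 2 * (- b / a) * b + c)" using a0 q by (intro mult_nonneg_nonneg)
    also have "\<dots> = c * a - b\<^sup>2" using False by (simp add: field_simps power2_eq_square)
    finally show ?thesis by simp
  qed
  then have "b \<le> sqrt (c * a)" by (rule real_le_rsqrt)
  then show ?thesis by (simp add: L2_norm_def real_sqrt_mult a_def b_def c_def)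
qed

lemma L2_norm_sq: "(L2_norm x)\<^sup>2 = L2_inner x x"
  by (simp add: L2_norm_def L2_inner_nonneg)

interpretation L2: C01_seminorm L2_norm
proof
  fix x y :: C01 and r :: real
  have "L2_inner (x + y) (x + y) = L2_inner x x + 2 * L2_inner x y + L2_inner y y"
    using L2_inner_expand[of 1 y x] by (simp add: add.commute)
  also have "\<dots> \<le> (L2_norm x + L2_norm y)\<^sup>2"
    using L2_inner_le[of x y] by (simp add: power2_sum L2_norm_sq)
  finally show "L2_norm (x + y) \<le> L2_norm x + L2_norm y"
    unfolding L2_norm_def[of "x + y"] using L2_inner_nonneg by (intro real_le_lsqrt add_nonneg_nonneg) (auto simp: L2_norm_def)
  show "L2_norm (r *\<^sub>R x) = \<bar>r\<bar> * L2_norm x"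
  proof -
    have "L2_inner (r *\<^sub>R x) (r *\<^sub>R x) = r * (r * L2_inner x x)"
      by (simp only: L2_inner_scale L2_inner_commute[of x "r *\<^sub>R x"])
    also have "\<dots> = r\<^sup>2 * L2_inner x x" by (simp add: power2_eq_square)
    finally show ?thesis by (simp add: L2_norm_def real_sqrt_mult)
  qed
  have "L2_inner x x \<le> (norm x)\<^sup>2"
    unfolding L2_inner_def
  proof (intro set_integral_le_const continuous_intros)
    fix t show "val_at x t * val_at x t \<le> (norm x)\<^sup>2"
      using power_mono[OF abs_val_at_le_norm[of x t], of 2] by (simp add: power2_eq_square)
  qed
  then show "L2_norm x \<le> norm x" unfolding L2_norm_def by (intro real_le_lsqrt) simp_all
qed

interpretation sup_norm: C01_seminorm "norm :: C01 \<Rightarrow> real"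
  by unfold_locales (auto intro: norm_triangle_ineq)

lemma val_at_nonzero:
  assumes "\<Phi> \<noteq> 0"
  obtains t where "t \<in> {0..1}" "val_at \<Phi> t \<noteq> 0"
  using assms C01_eqI[of \<Phi> 0] by auto

text \<open>A nonnegative continuous function with vanishing integral is zero; the Lebesgue integral
  is converted to the gauge integral, for which this is applied.\<close>

lemma L2_norm_pos:
  assumes "\<Phi> \<noteq> 0"
  shows "L2_norm \<Phi> > 0"
proof -
  have "L2_norm \<Phi> \<noteq> 0"
  proof
    assume "L2_norm \<Phi> = 0"
    then have "(LINT t:{0..1}|lborel. val_at \<Phi> t * val_at \<Phi> t) = 0" using L2_norm_sq[of \<Phi>] by (simp add: L2_inner_def)
    then have "integral {0..1} (\<lambda>t. val_at \<Phi> t * val_at \<Phi> t) = 0"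
      using set_borel_integral_eq_integral(2)[OF set_integrable_val_at, of "\<lambda>t. val_at \<Phi> t * val_at \<Phi> t"] by (simp add: continuous_intros)
    then have "\<forall>t\<in>{0..1}. val_at \<Phi> t * val_at \<Phi> t = 0"
      using integral_eq_0_iff[of 0 1 "\<lambda>t. val_at \<Phi> t * val_at \<Phi> t"] by (simp add: continuous_intros)
    then show False using val_at_nonzero[OF assms] by auto
  qed
  then show ?thesis using L2.nonneg[of \<Phi>] by simp
qed

lemma L1_norm_pos:
  assumes "\<Phi> \<noteq> 0"
  shows "L1_norm \<Phi> > 0"
proof -
  have "L1_norm \<Phi> \<noteq> 0"
  proof
    assume "L1_norm \<Phi> = 0"
    then have "integral {0..1} (\<lambda>t. \<bar>val_at \<Phi> t\<bar>) = 0"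
      using set_borel_integral_eq_integral(2)[OF set_integrable_val_at, of "\<lambda>t. \<bar>val_at \<Phi> t\<bar>"] by (simp add: continuous_intros L1_norm_def)
    then have "\<forall>t\<in>{0..1}. \<bar>val_at \<Phi> t\<bar> = 0"
      using integral_eq_0_iff[of 0 1 "\<lambda>t. \<bar>val_at \<Phi> t\<bar>"] by (simp add: continuous_intros)
    then show False using val_at_nonzero[OF assms] by auto
  qed
  then show ?thesis using L1.nonneg[of \<Phi>] by simp
qed

text \<open>Multiplying the difference of the two square roots by their sum removes the diverging
  part: what remains is (2 b + d/r) divided by a sum of roots that tends to 2 sqrt a.\<close>

lemma L2_drift_tendsto:
  assumes "\<Phi> \<noteq> 0"
  shows "((\<lambda>r. L2.drift \<Phi> r z) \<longlongrightarrow> L2_inner z ((1 / L2_norm \<Phi>) *\<^sub>R \<Phi>)) at_top"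
proof -
  define a b d where "a = L2_inner \<Phi> \<Phi>" and "b = L2_inner z \<Phi>" and "d = L2_inner z z"
  have "a > 0" using L2_norm_pos[OF assms] by (simp add: L2_norm_def a_def)
  have "((\<lambda>r. (2 * b + d / r) / (sqrt (a + 2 * b / r + d / r\<^sup>2) + sqrt a)) \<longlongrightarrow> (2 * b) / (sqrt a + sqrt a)) at_top"
  proof (intro tendsto_divide tendsto_add[OF tendsto_real_sqrt tendsto_const])
    show "((\<lambda>r. 2 * b + d / r) \<longlongrightarrow> 2 * b) at_top" "((\<lambda>r. a + 2 * b / r + d / r\<^sup>2) \<longlongrightarrow> a) at_top"
      by real_asymp+
  qed (use \<open>a > 0\<close> in simp)
  moreover have "\<forall>\<^sub>F r in at_top. (2 * b + d / r) / (sqrt (a + 2 * b / r + d / r\<^sup>2) + sqrt a) = sqrt (r\<^sup>2 * a + 2 * r * b + d) - r * sqrt a"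
    using eventually_gt_at_top[of 0]
  proof eventually_elim
    case (elim r)
    define X where "X = r\<^sup>2 * a + 2 * r * b + d"
    have X: "X \<ge> 0" using L2_inner_nonneg[of "r *\<^sub>R \<Phi> + z"] by (simp add: L2_inner_expand a_def b_def d_def X_def)
    have "a + 2 * b / r + d / r\<^sup>2 = X / r\<^sup>2" using elim by (simp add: X_def field_simps power2_eq_square)
    then have s: "sqrt (a + 2 * b / r + d / r\<^sup>2) = sqrt X / r" using elim by (simp add: real_sqrt_divide)
    have "(sqrt X - r * sqrt a) * (sqrt X + r * sqrt a) = X - r\<^sup>2 * a"
      using X \<open>a > 0\<close> by (simp add: algebra_simps power2_eq_square)
    also have "\<dots> = r * (2 * b + d / r)" using elim by (simp add: X_def field_simps)
    finally have 1: "(sqrt X - r * sqrt a) * (sqrt X + r * sqrt a) = r * (2 * b + d / r)" .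
    have 2: "sqrt X + r * sqrt a > 0" using X elim \<open>a > 0\<close> by (intro add_nonneg_pos) auto
    have 3: "sqrt X / r + sqrt a = (sqrt X + r * sqrt a) / r" using elim by (simp add: field_simps)
    have "(2 * b + d / r) / ((sqrt X + r * sqrt a) / r) = r * (2 * b + d / r) / (sqrt X + r * sqrt a)"
      using elim by simp
    also have "\<dots> = sqrt X - r * sqrt a" using 2 unfolding 1[symmetric] by simp
    finally show ?case unfolding s X_def[symmetric] 3 .
  qed
  ultimately have "((\<lambda>r. sqrt (r\<^sup>2 * a + 2 * r * b + d) - r * sqrt a) \<longlongrightarrow> (2 * b) / (sqrt a + sqrt a)) at_top"
    by (rule Lim_transform_eventually)
  then have "((\<lambda>r. sqrt (r\<^sup>2 * a + 2 * r * b + d) - r * sqrt a) \<longlongrightarrow> b / sqrt a) at_top" by simp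
  moreover have "L2_inner z ((1 / L2_norm \<Phi>) *\<^sub>R \<Phi>) = b / sqrt a"
    by (simp add: L2_inner_commute[of z] L2_inner_scale a_def b_def L2_norm_def)
  ultimately show ?thesis by (simp add: L2.drift_def L2_norm_def L2_inner_expand a_def b_def d_def)
qed

text \<open>At each \<open>t\<close> the integrand is constant in r from some point on, namely sgn
  \<Phi> times \<open>z\<close> where \<Phi> does not vanish, and the absolute value of
  \<open>z\<close> elsewhere. It is dominated by the absolute value of \<open>z\<close> for all r
  \<ge> 0.\<close>

lemma L1_drift_tendsto:
  "((\<lambda>r. L1.drift \<Phi> r z) \<longlongrightarrow> (LINT t:{t\<in>{0..1}. val_at \<Phi> t \<noteq> 0}|lborel. sgn (val_at \<Phi> t) * val_at z t)
              + (LINT t:{t\<in>{0..1}. val_at \<Phi> t = 0}|lborel. \<bar>val_at z t\<bar>)) at_top"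
proof -
  \<comment> \<open>Extension by zero turns all integrals into integrals over the line; outside
    [0,1] both functions vanish and the integrand contributes nothing.\<close>
  define p where "p t = (if t \<in> {0..1} then val_at \<Phi> t else 0)" for t
  define x where "x t = (if t \<in> {0..1} then val_at z t else 0)" for t
  have "(\<lambda>t. indicator {0..1} t *\<^sub>R val_at f t) \<in> borel_measurable borel" for f
    by (rule borel_measurable_continuous_on_indicator) (auto intro: continuous_on_val_at)
  moreover have "p = (\<lambda>t. indicator {0..1} t *\<^sub>R val_at \<Phi> t)" "x = (\<lambda>t. indicator {0..1} t *\<^sub>R val_at z t)"
    by (auto simp: p_def x_def)
  ultimately have [measurable]: "p \<in> borel_measurable borel" "x \<in> borel_measurable borel" by simp_all
  have "(\<lambda>t. indicat_real {0..1} t *\<^sub>R \<bar>val_at z t\<bar>) = (\<lambda>t. \<bar>x t\<bar>)" by (auto simp: x_def)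
  then have xi: "integrable lborel (\<lambda>t. \<bar>x t\<bar>)"
    using set_integrable_val_at[of "\<lambda>t. \<bar>val_at z t\<bar>"] unfolding set_integrable_def by (simp add: continuous_intros)
  have ind: "(\<lambda>t. indicat_real {0..1} t *\<^sub>R \<bar>val_at (r *\<^sub>R \<Phi> + z) t\<bar>) = (\<lambda>t. \<bar>r * p t + x t\<bar>)" for r
    by (auto simp: p_def x_def)
  have N1: "L1_norm (r *\<^sub>R \<Phi> + z) = (LINT t|lborel. \<bar>r * p t + x t\<bar>)" for r
    unfolding L1_norm_def set_lebesgue_integral_def ind ..
  have N2: "r * L1_norm \<Phi> = (LINT t|lborel. r * \<bar>p t\<bar>)" for r
    unfolding L1_norm_def set_lebesgue_integral_def integral_mult_right_zero
    by (intro arg_cong2[of _ _ _ _ "(*)"] refl Bochner_Integration.integral_cong) (auto simp: p_def)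
  have pi: "integrable lborel (\<lambda>t. r * \<bar>p t\<bar>)" for r
  proof (rule integrable_mult_right)
    have "(\<lambda>t. indicat_real {0..1} t *\<^sub>R \<bar>val_at \<Phi> t\<bar>) = (\<lambda>t. \<bar>p t\<bar>)" by (auto simp: p_def)
    then show "integrable lborel (\<lambda>t. \<bar>p t\<bar>)"
      using set_integrable_val_at[of "\<lambda>t. \<bar>val_at \<Phi> t\<bar>"] unfolding set_integrable_def by (simp add: continuous_intros)
  qed
  have si: "integrable lborel (\<lambda>t. \<bar>r * p t + x t\<bar>)" for r
    using set_integrable_val_at[of "\<lambda>t. \<bar>val_at (r *\<^sub>R \<Phi> + z) t\<bar>"] unfolding set_integrable_def ind by (simp add: continuous_intros del: val_at_simps)
  have dr: "L1.drift \<Phi> r z = (LINT t|lborel. \<bar>r * p t + x t\<bar> - r * \<bar>p t\<bar>)" for r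
    unfolding L1.drift_def N1 N2 using si pi by simp
  define y where "y t = (if p t = 0 then \<bar>x t\<bar> else sgn (p t) * x t)" for t
  have ym[measurable]: "y \<in> borel_measurable borel" unfolding y_def by measurable
  have "((\<lambda>r. LINT t|lborel. \<bar>r * p t + x t\<bar> - r * \<bar>p t\<bar>) \<longlongrightarrow> (LINT t|lborel. y t)) at_top"
  proof (rule integral_dominated_convergence_at_top[where w="\<lambda>t. \<bar>x t\<bar>"])
    show "AE t in lborel. ((\<lambda>r. \<bar>r * p t + x t\<bar> - r * \<bar>p t\<bar>) \<longlongrightarrow> y t) at_top"
    proof (intro AE_I2 tendsto_eventually)
      fix t
      have *: "\<bar>r * p t + x t\<bar> - r * \<bar>p t\<bar> = y t" if r: "r \<ge> \<bar>x t\<bar> / \<bar>p t\<bar>" "r \<ge> 0" for r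
      proof (cases "p t = 0")
        case False
        have "\<bar>x t\<bar> \<le> r * \<bar>p t\<bar>" using r False by (simp add: divide_le_eq)
        then show ?thesis using False r by (auto simp: y_def sgn_if abs_if split: if_splits)
      qed (simp add: y_def)
      show "\<forall>\<^sub>F r in at_top. \<bar>r * p t + x t\<bar> - r * \<bar>p t\<bar> = y t"
        using eventually_ge_at_top[of "\<bar>x t\<bar> / \<bar>p t\<bar>"] eventually_ge_at_top[of 0] by eventually_elim (rule *)
    qed
    show "\<forall>\<^sub>F r in at_top. AE t in lborel. norm (\<bar>r * p t + x t\<bar> - r * \<bar>p t\<bar>) \<le> \<bar>x t\<bar>"
      using eventually_ge_at_top[of 0]
    proof eventually_elim
      case (elim r)
      have "\<bar>\<bar>r * p t + x t\<bar> - r * \<bar>p t\<bar>\<bar> \<le> \<bar>x t\<bar>" for t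
        using abs_triangle_ineq3[of "r * p t + x t" "r * p t"] elim by (simp add: abs_mult)
      then show ?case by simp
    qed
  qed (use xi in auto)
  moreover have "(LINT t|lborel. y t) = (LINT t:{t\<in>{0..1}. val_at \<Phi> t \<noteq> 0}|lborel. sgn (val_at \<Phi> t) * val_at z t)
              + (LINT t:{t\<in>{0..1}. val_at \<Phi> t = 0}|lborel. \<bar>val_at z t\<bar>)"
  proof -
    have e1: "(\<lambda>t. indicat_real {t\<in>{0..1}. val_at \<Phi> t \<noteq> 0} t *\<^sub>R (sgn (val_at \<Phi> t) * val_at z t)) = (\<lambda>t. if p t = 0 then 0 else sgn (p t) * x t)"
      by (auto simp: p_def x_def indicator_def)
    have e2: "(\<lambda>t. indicat_real {t\<in>{0..1}. val_at \<Phi> t = 0} t *\<^sub>R \<bar>val_at z t\<bar>) = (\<lambda>t. if p t = 0 then \<bar>x t\<bar> else 0)"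
      by (auto simp: p_def x_def indicator_def)
    have "(LINT t|lborel. y t) = (LINT t|lborel. (if p t = 0 then 0 else sgn (p t) * x t) + (if p t = 0 then \<bar>x t\<bar> else 0))"
      by (intro Bochner_Integration.integral_cong) (auto simp: y_def)
    also have "\<dots> = (LINT t|lborel. (if p t = 0 then 0 else sgn (p t) * x t)) + (LINT t|lborel. (if p t = 0 then \<bar>x t\<bar> else 0))"
      by (intro Bochner_Integration.integral_add Bochner_Integration.integrable_bound[OF xi]) (auto simp: abs_mult sgn_if)
    finally show ?thesis unfolding set_lebesgue_integral_def e1 e2 .
  qed
  ultimately show ?thesis unfolding dr by simp
qed

lemma sup_norm_attained: "{t\<in>{0..1}. \<bar>val_at \<Phi> t\<bar> = norm \<Phi>} \<noteq> {}"
proof -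
  obtain t where t: "t \<in> {0..1}" "\<And>s. s \<in> {0..1} \<Longrightarrow> \<bar>val_at \<Phi> s\<bar> \<le> \<bar>val_at \<Phi> t\<bar>"
    using continuous_attains_sup[OF compact_Icc _ continuous_on_rabs[OF continuous_on_val_at[of \<Phi>]], simplified] by auto
  then have "norm \<Phi> \<le> \<bar>val_at \<Phi> t\<bar>" by (intro norm_C01_le)
  then show ?thesis using t(1) abs_val_at_le_norm[of \<Phi> t] by auto
qed

text \<open>Every maximiser of the absolute value of \<Phi> bounds the drift from below for each r.
  For the upper bound, points where r \<Phi> + z is large accumulate at some \<open>t\<close>;
  dividing by r shows that \<open>t\<close> is a maximiser of the absolute value of \<Phi>, and
  comparing the bounded parts yields a value of sgn \<Phi> times \<open>z\<close> above
  \<open>D\<close>, a contradiction.\<close>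

lemma sup_drift_tendsto:
  assumes "\<Phi> \<noteq> 0"
  shows "((\<lambda>r. sup_norm.drift \<Phi> r z) \<longlongrightarrow> (SUP t\<in>{t\<in>{0..1}. \<bar>val_at \<Phi> t\<bar> = norm \<Phi>}. sgn (val_at \<Phi> t) * val_at z t)) at_top"
proof -
  define E where "E = {t\<in>{0..1}. \<bar>val_at \<Phi> t\<bar> = norm \<Phi>}"
  define D where "D = (SUP t\<in>E. sgn (val_at \<Phi> t) * val_at z t)"
  have np: "norm \<Phi> > 0" using assms by simp
  have "sgn (val_at \<Phi> t) * val_at z t \<le> norm z" for t
    using abs_val_at_le_norm[of z t] by (auto simp: sgn_if)
  then have bdd: "bdd_above ((\<lambda>t. sgn (val_at \<Phi> t) * val_at z t) ` E)" by (intro bdd_aboveI[of _ "norm z"]) auto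
  have up: "sgn (val_at \<Phi> t) * val_at z t \<le> D" if "t \<in> E" for t
    unfolding D_def using that by (intro cSUP_upper bdd)
  have lower: "D \<le> sup_norm.drift \<Phi> r z" for r
    unfolding D_def
  proof (rule cSUP_least)
    show "E \<noteq> {}" unfolding E_def by (rule sup_norm_attained)
    fix t assume t: "t \<in> E"
    then have s: "sgn (val_at \<Phi> t) * val_at \<Phi> t = norm \<Phi>" "\<bar>sgn (val_at \<Phi> t)\<bar> = 1" using np by (auto simp: E_def sgn_if abs_if)
    have "r * norm \<Phi> + sgn (val_at \<Phi> t) * val_at z t = sgn (val_at \<Phi> t) * val_at (r *\<^sub>R \<Phi> + z) t"
      using s(1) by (simp add: algebra_simps)
    also have "\<dots> \<le> \<bar>sgn (val_at \<Phi> t)\<bar> * \<bar>val_at (r *\<^sub>R \<Phi> + z) t\<bar>"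
      unfolding abs_mult[symmetric] by (rule abs_ge_self)
    also have "\<dots> \<le> norm (r *\<^sub>R \<Phi> + z)" unfolding s(2) mult_1_left by (rule abs_val_at_le_norm)
    finally show "sgn (val_at \<Phi> t) * val_at z t \<le> sup_norm.drift \<Phi> r z" by (simp add: sup_norm.drift_def)
  qed
  have "((\<lambda>r. sup_norm.drift \<Phi> r z) \<longlongrightarrow> D) at_top"
  proof (rule order_tendstoI)
    fix u assume "u < D"
    then show "\<forall>\<^sub>F r in at_top. u < sup_norm.drift \<Phi> r z" using lower by (intro always_eventually) (metis less_le_trans)
  next
    fix u assume u: "D < u"
    have "\<exists>k::nat. sup_norm.drift \<Phi> (real k) z < u"
    proof (rule ccontr)
      \<comment> \<open>The midpoint leaves room on both sides: it makes the assumed lower bound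
        strict and still lies above \<open>D\<close> for the contradiction.\<close>
      define v where "v = (D + u) / 2"
      have v: "D < v" "v < u" using u by (auto simp: v_def)
      assume "\<not> (\<exists>k::nat. sup_norm.drift \<Phi> (real k) z < u)"
      then have big: "real k * norm \<Phi> + v < norm (real k *\<^sub>R \<Phi> + z)" for k :: nat
        using v unfolding sup_norm.drift_def by (smt (verit))
      have "\<exists>t\<in>{0..1}. \<bar>val_at (real k *\<^sub>R \<Phi> + z) t\<bar> > real k * norm \<Phi> + v" for k :: nat
      proof (rule ccontr)
        assume "\<not> ?thesis"
        then have "norm (real k *\<^sub>R \<Phi> + z) \<le> real k * norm \<Phi> + v" by (intro norm_C01_le) (metis not_less)
        then show False using big[of k] by simp
      qed
      then obtain s where s: "\<And>k::nat. s k \<in> {0..1}" "\<And>k::nat. \<bar>val_at (real k *\<^sub>R \<Phi> + z) (s k)\<bar> > real k * norm \<Phi> + v"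
        by metis
      have "seq_compact {0..1::real}" by (intro compact_imp_seq_compact compact_Icc)
      then obtain t \<rho> where t: "t \<in> {0..1}" "strict_mono \<rho>" "(s \<circ> \<rho>) \<longlonglongrightarrow> t"
        using s(1) unfolding seq_compact_def by metis
      define p where "p k = s (\<rho> k)" for k
      have p: "p k \<in> {0..1}" for k using s(1) by (simp add: p_def)
      have val_lim: "(\<lambda>k. val_at f (p k)) \<longlonglongrightarrow> val_at f t" for f
        using t p by (intro continuous_on_tendsto_compose[OF continuous_on_val_at[of f]] always_eventually) (auto simp: comp_def p_def[abs_def])
      have pk: "real (\<rho> k) * \<bar>val_at \<Phi> (p k)\<bar> + \<bar>val_at z (p k)\<bar> > real (\<rho> k) * norm \<Phi> + v" for k
        using s(2)[of "\<rho> k"] abs_triangle_ineq[of "real (\<rho> k) * val_at \<Phi> (p k)" "val_at z (p k)"] by (simp add: p_def abs_mult)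
      have \<rho>: "filterlim (\<lambda>k. real (\<rho> k)) at_top sequentially"
        by (intro filterlim_compose[OF filterlim_real_sequentially] filterlim_subseq t)
      have "norm \<Phi> \<le> \<bar>val_at \<Phi> t\<bar>"
      proof (rule tendsto_le[OF sequentially_bot])
        show "(\<lambda>k. \<bar>val_at \<Phi> (p k)\<bar> + (norm z - v) / real (\<rho> k)) \<longlonglongrightarrow> \<bar>val_at \<Phi> t\<bar>"
        proof -
          have "(\<lambda>k. (norm z - v) / real (\<rho> k)) \<longlonglongrightarrow> 0"
            by (rule tendsto_divide_0[OF tendsto_const filterlim_at_top_imp_at_infinity[OF \<rho>]])
          from tendsto_add[OF tendsto_rabs[OF val_lim] this] show ?thesis by simp
        qed
        show "(\<lambda>_. norm \<Phi>) \<longlonglongrightarrow> norm \<Phi>" by simp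
        have "\<forall>\<^sub>F k in sequentially. real (\<rho> k) > 0" using \<rho> unfolding filterlim_at_top_dense by blast
        then show "\<forall>\<^sub>F k in sequentially. norm \<Phi> \<le> \<bar>val_at \<Phi> (p k)\<bar> + (norm z - v) / real (\<rho> k)"
        proof eventually_elim
          case (elim k)
          have "real (\<rho> k) * norm \<Phi> \<le> real (\<rho> k) * \<bar>val_at \<Phi> (p k)\<bar> + (norm z - v)"
            using pk[of k] abs_val_at_le_norm[of z "p k"] by linarith
          then show ?case using elim by (simp add: field_simps)
        qed
      qed
      then have tE: "t \<in> E" using t(1) abs_val_at_le_norm[of \<Phi> t] by (simp add: E_def)
      define \<sigma> where "\<sigma> = sgn (val_at \<Phi> t)"
      have \<sigma>: "\<sigma> * val_at \<Phi> t = norm \<Phi>" "\<bar>\<sigma>\<bar> = 1" using tE np by (auto simp: E_def \<sigma>_def sgn_if abs_if)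
      \<comment> \<open>Close to \<open>t\<close> the sign of \<Phi> is \<sigma> and r \<Phi>
        outweighs \<open>z\<close>, so the absolute value of r \<Phi> + z can be resolved with this
        sign.\<close>
      have "(\<lambda>k. \<sigma> * val_at \<Phi> (p k)) \<longlonglongrightarrow> norm \<Phi>" unfolding \<sigma>(1)[symmetric] by (intro tendsto_intros val_lim)
      then have ev1: "\<forall>\<^sub>F k in sequentially. norm \<Phi> / 2 < \<sigma> * val_at \<Phi> (p k)"
        by (rule order_tendstoD) (use np in simp)
      have ev2: "\<forall>\<^sub>F k in sequentially. 2 * norm z / norm \<Phi> < real (\<rho> k)" using \<rho> unfolding filterlim_at_top_dense by blast
      have "v \<le> \<sigma> * val_at z t"
      proof (rule tendsto_lowerbound)
        show "(\<lambda>k. \<sigma> * val_at z (p k)) \<longlonglongrightarrow> \<sigma> * val_at z t" by (intro tendsto_intros val_lim)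
        show "\<forall>\<^sub>F k in sequentially. v \<le> \<sigma> * val_at z (p k)"
          using ev1 ev2
        proof eventually_elim
          case (elim k)
          have \<rho>0: "real (\<rho> k) \<ge> 0" by simp
          have "norm z \<le> real (\<rho> k) * (norm \<Phi> / 2)" using elim(2) np by (simp add: field_simps)
          also have "\<dots> \<le> real (\<rho> k) * (\<sigma> * val_at \<Phi> (p k))" using elim(1) by (intro mult_left_mono) auto
          finally have 1: "norm z \<le> real (\<rho> k) * (\<sigma> * val_at \<Phi> (p k))" .
          have 2: "\<bar>\<sigma> * val_at z (p k)\<bar> \<le> norm z" using \<sigma>(2) abs_val_at_le_norm[of z "p k"] by (simp add: abs_mult)
          have "\<bar>val_at (real (\<rho> k) *\<^sub>R \<Phi> + z) (p k)\<bar> = \<bar>\<sigma> * val_at (real (\<rho> k) *\<^sub>R \<Phi> + z) (p k)\<bar>"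
            using \<sigma>(2) by (simp add: abs_mult)
          also have "\<dots> = real (\<rho> k) * (\<sigma> * val_at \<Phi> (p k)) + \<sigma> * val_at z (p k)"
            using 1 2 by (simp add: algebra_simps)
          finally have 3: "real (\<rho> k) * norm \<Phi> + v < real (\<rho> k) * (\<sigma> * val_at \<Phi> (p k)) + \<sigma> * val_at z (p k)"
            using s(2)[of "\<rho> k"] by (simp add: p_def)
          have "\<sigma> * val_at \<Phi> (p k) \<le> \<bar>\<sigma>\<bar> * \<bar>val_at \<Phi> (p k)\<bar>" unfolding abs_mult[symmetric] by (rule abs_ge_self)
          then have "\<sigma> * val_at \<Phi> (p k) \<le> norm \<Phi>" using abs_val_at_le_norm[of \<Phi> "p k"] by (simp add: \<sigma>(2))
          then have "real (\<rho> k) * (\<sigma> * val_at \<Phi> (p k)) \<le> real (\<rho> k) * norm \<Phi>" by (intro mult_left_mono \<rho>0)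
          then show ?case using 3 by linarith
        qed
      qed simp
      then show False using up[OF tE] v unfolding \<sigma>_def by simp
    qed
    then obtain k :: nat where k: "sup_norm.drift \<Phi> (real k) z < u" by blast
    show "\<forall>\<^sub>F r in at_top. sup_norm.drift \<Phi> r z < u"
      using eventually_ge_at_top[of "real k"]
      by eventually_elim (use k sup_norm.drift_antimono[of "real k" _ \<Phi> z] in \<open>meson le_less_trans\<close>)
  qed
  then show ?thesis by (simp add: D_def E_def)
qed

section \<open>The limits of the three statistics\<close>

lemma cp_scale_diff_tendsto:
  assumes "0 < s" "s < 1"
  shows "(\<lambda>n. cp_scale s n - sqrt (real n) * (s * (1 - s))) \<longlonglongrightarrow> 0"
proof (rule tendsto_rabs_zero_cancel, rule tendsto_sandwich[of "\<lambda>_. 0" _ _ "\<lambda>n. 1 / sqrt (real n)"])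
  show "(\<lambda>n. 1 / sqrt (real n)) \<longlonglongrightarrow> 0" by real_asymp
  show "\<forall>\<^sub>F n in sequentially. \<bar>cp_scale s n - sqrt (real n) * (s * (1 - s))\<bar> \<le> 1 / sqrt (real n)"
    using eventually_gt_at_top[of 0]
  proof eventually_elim
    case (elim n)
    define \<kappa> where "\<kappa> = real (cp_index s n) / real n"
    have "\<kappa> - s = (real (cp_index s n) - real n * s) / real n" using elim by (simp add: \<kappa>_def field_simps)
    moreover have "\<bar>real (cp_index s n) - real n * s\<bar> \<le> 1" using cp_index_bounds[OF assms, of n] by linarith
    ultimately have \<kappa>: "\<bar>\<kappa> - s\<bar> \<le> 1 / real n" "0 \<le> \<kappa>" "\<kappa> \<le> 1"
      using cp_index_bounds[OF assms, of n] elim by (auto simp: \<kappa>_def divide_right_mono)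
    have "cp_scale s n - sqrt (real n) * (s * (1 - s)) = sqrt (real n) * ((\<kappa> - s) * (1 - \<kappa> - s))"
      unfolding cp_scale_def \<kappa>_def[symmetric] by (simp add: algebra_simps)
    also have "\<bar>\<dots>\<bar> = sqrt (real n) * (\<bar>\<kappa> - s\<bar> * \<bar>1 - \<kappa> - s\<bar>)" by (simp add: abs_mult)
    also have "\<dots> \<le> sqrt (real n) * (1 / real n * 1)"
      using \<kappa> assms by (intro mult_left_mono mult_mono) auto
    also have "\<dots> = 1 / sqrt (real n)" using elim by (simp add: field_simps)
    finally show ?case .
  qed
qed auto

lemma filterlim_cp_scale:
  assumes "0 < s" "s < 1"
  shows "filterlim (cp_scale s) at_top sequentially"
proof -
  have "filterlim (\<lambda>n. sqrt (real n) * (s * (1 - s))) at_top sequentially"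
    using assms by (intro filterlim_tendsto_pos_mult_at_top[OF tendsto_const, of "s * (1 - s)", unfolded mult.commute[of "s * (1 - s)"]]
      filterlim_compose[OF sqrt_at_top filterlim_real_sequentially]) auto
  from filterlim_tendsto_add_at_top[OF cp_scale_diff_tendsto[OF assms] this] show ?thesis by simp
qed

lemma (in prob_space) expectation_cos_shift:
  assumes [measurable]: "X \<in> borel_measurable M"
  shows "(LINT w|M. cos (X w + a)) = Re (iexp a * (CLINT w|M. iexp (X w)))"
proof -
  have "integrable M (\<lambda>w. iexp (X w))" by (rule integrable_const_bound[of _ 1]) auto
  then have "Re (iexp a * (CLINT w|M. iexp (X w))) = (LINT w|M. Re (iexp a * iexp (X w)))"
    by (simp only: integral_mult_right_zero[symmetric] integral_Re integrable_mult_right)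
  also have "(\<lambda>w. Re (iexp a * iexp (X w))) = (\<lambda>w. cos (X w + a))"
    unfolding cis_conv_exp[symmetric] by (simp add: cos_add mult.commute)
  finally show ?thesis ..
qed

context mixing_sequence
begin

lemma bounded_linear_dominated: "bounded_linear l \<Longrightarrow> dominated (onorm l) l"
  unfolding dominated_def using onorm[of l]
  by (auto intro!: borel_measurable_continuous_onI linear_continuous_on simp: mult.commute)

text \<open>For equal functionals the two covariances at each lag coincide, and the vanishing mean
  makes the centring disappear.\<close>

lemma lrvar_eq_long_run_cov:
  assumes l: "bounded_linear l" "(LINT w|M. l (\<epsilon> 1 w)) = 0"
  shows "lrvar l = long_run_cov M \<epsilon> l l"
proof -
  have "2 * (\<Sum>k. autocov l (Suc k)) = (\<Sum>k. 2 * autocov l (Suc k))"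
    by (rule suminf_mult[symmetric, OF summable_autocov[OF bounded_linear_dominated[OF l(1)]]])
  then show ?thesis
    unfolding lrvar_def long_run_cov_def by (simp add: autocov_def centred_def l(2)[simplified] mult.commute)
qed

lemma linear_cp_noise:
  assumes l: "bounded_linear l" "(LINT w|M. l (\<epsilon> 1 w)) = 0"
  shows "l (cp_noise s n w) = nsum (stepw (cp_index s n) n) l n w"
proof -
  interpret l: bounded_linear l by fact
  show ?thesis
    unfolding cp_noise_def wsum_def nsum_def centred_def l(2) by (simp add: l.scaleR l.sum)
qed

end

lemma (in hoelder_mixing_sequence) cp_noise_tight:
  assumes s: "0 < s" "s < 1" and e: "e > 0"
  shows "\<exists>k0. \<forall>k\<ge>k0. \<forall>\<^sub>F n in sequentially.
      prob {w\<in>space M. norm (cp_noise s n w - disc k (cp_noise s n w)) > e} \<le> e"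
proof -
  obtain k0 where k0: "\<forall>k\<ge>k0. \<exists>n0. \<forall>n\<ge>n0. \<forall>a. (\<forall>i. \<bar>a i\<bar> \<le> 1) \<and> (\<forall>i>n. a i = 0) \<longrightarrow>
    prob {w \<in> space M. norm (wsum a n w - disc k (wsum a n w)) > e * sqrt (real n)} \<le> e"
    using wsum_tight[OF e e] by (rule exE)
  show ?thesis
  proof (rule exI[of _ k0], intro allI impI)
    fix k assume "k \<ge> k0"
    then obtain n0 where n0: "\<And>n a. n \<ge> n0 \<Longrightarrow> (\<forall>i. \<bar>a i\<bar> \<le> 1) \<and> (\<forall>i>n. a i = 0) \<Longrightarrow>
      prob {w \<in> space M. norm (wsum a n w - disc k (wsum a n w)) > e * sqrt (real n)} \<le> e"
      using k0 by meson
    show "\<forall>\<^sub>F n in sequentially. prob {w\<in>space M. norm (cp_noise s n w - disc k (cp_noise s n w)) > e} \<le> e"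
      using eventually_ge_at_top[of n0] eventually_gt_at_top[of 0]
    proof eventually_elim
      case (elim n)
      define a where "a = stepw (cp_index s n) n"
      have "norm (cp_noise s n w - disc k (cp_noise s n w)) = norm (wsum a n w - disc k (wsum a n w)) / sqrt (real n)" for w
        unfolding cp_noise_def a_def[symmetric] by (simp flip: scaleR_right_diff_distrib)
      then have "{w\<in>space M. norm (cp_noise s n w - disc k (cp_noise s n w)) > e} =
        {w \<in> space M. norm (wsum a n w - disc k (wsum a n w)) > e * sqrt (real n)}"
        using elim(2) by (simp add: less_divide_eq)
      then show ?case
        using n0[OF elim(1), of a] stepw_le[OF cp_index_bounds(3)[OF s]] by (simp add: a_def)
    qed
  qed
qed

lemma (in C01_seminorm) measurable_cusum_stat:
  assumes [measurable]: "\<And>n i. i \<ge> 1 \<Longrightarrow> X n i \<in> borel_measurable M"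
  shows "cusum_stat \<nu> X n \<in> borel_measurable M"
proof (cases "n = 0")
  case True
  then have "cusum_stat \<nu> X n = (\<lambda>w. 0)" by (simp add: cusum_stat_def fun_eq_iff)
  then show ?thesis by simp
next
  case False
  then have n: "n \<ge> 1" by simp
  have [measurable]: "(\<lambda>w. \<Sum>i=1..k. X n i w) \<in> borel_measurable M" for k
    by (intro borel_measurable_sum) simp
  have "(\<lambda>w. \<nu> (cusum X n (real k / real n) w)) \<in> borel_measurable M" for k
    unfolding cusum_grid[OF n] by measurable
  then have "(\<lambda>w. sqrt (real n) * (MAX k\<in>{..n}. \<nu> (cusum X n (real k / real n) w))) \<in> borel_measurable M"
    by (intro borel_measurable_times borel_measurable_const borel_measurable_Max) auto
  also have "(\<lambda>w. sqrt (real n) * (MAX k\<in>{..n}. \<nu> (cusum X n (real k / real n) w))) = cusum_stat \<nu> X n"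
    by (rule ext) (rule cusum_stat_eq[OF n, symmetric])
  finally show ?thesis .
qed

text \<open>The terms of a convergent series are bounded, so \<open>b k\<close> is at most a
  constant times k^(- q (1 + 2/\<delta>)) with q = 1/(1/2 - \<tau>); the lower bound on \<tau> gives
  q \<ge> 2 + 2/\<delta>.\<close>

lemma mixing_rate_from_summable:
  fixes \<delta> \<tau> :: real
  assumes \<delta>: "\<delta> > 0" and \<tau>: "1 / (2 + 2 * \<delta>) < \<tau>" "\<tau> < 1 / 2" and b: "\<And>k. b k \<ge> (0::real)"
    and sm: "summable (\<lambda>k. real (Suc k) powr (1 / (1 / 2 - \<tau>)) * b (Suc k) powr (\<delta> / (2 + \<delta>)))"
  obtains C where "\<And>k. k \<ge> 1 \<Longrightarrow> b k \<le> C * real k powr (- mix_exp \<delta>)"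
proof -
  define q where "q = 1 / (1 / 2 - \<tau>)"
  define p where "p = \<delta> / (2 + \<delta>)"
  have p: "p > 0" "1 / p = 1 + 2 / \<delta>" using \<delta> by (auto simp: p_def field_simps)
  have "1 / 2 - \<tau> < \<delta> / (2 + 2 * \<delta>)" using \<tau>(1) \<delta> by (simp add: field_simps)
  then have "1 / (\<delta> / (2 + 2 * \<delta>)) < q" unfolding q_def using \<tau>(2) \<delta> by (intro divide_strict_left_mono) auto
  then have q: "2 + 2 / \<delta> \<le> q" using \<delta> by (simp add: field_simps)
  have "Bseq (\<lambda>k. real (Suc k) powr q * b (Suc k) powr p)"
    using summable_LIMSEQ_zero[OF sm] unfolding q_def p_def by (intro convergent_imp_Bseq convergentI)
  then obtain K where K: "K > 0" "\<And>k. norm (real (Suc k) powr q * b (Suc k) powr p) \<le> K" by (auto elim: BseqE)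
  have "b k \<le> K powr (1 / p) * real k powr (- mix_exp \<delta>)" if k: "k \<ge> 1" for k
  proof -
    have k1: "real k \<ge> 1" using k by simp
    have "real k powr q * b k powr p \<le> K" using K(2)[of "k - 1"] k by simp
    then have "b k powr p \<le> K * real k powr (- q)" using k1 by (simp add: powr_minus field_simps)
    then have "(b k powr p) powr (1 / p) \<le> (K * real k powr (- q)) powr (1 / p)" using p(1) by (intro powr_mono2) auto
    then have "b k \<le> K powr (1 / p) * real k powr (- q * (1 / p))"
      using p(1) b[of k] K(1) by (simp add: powr_powr powr_mult)
    also have "\<dots> \<le> K powr (1 / p) * real k powr (- mix_exp \<delta>)"
    proof (intro mult_left_mono powr_mono k1)
      have "(2 + 2 / \<delta>) * (1 + 2 / \<delta>) \<le> q * (1 / p)" unfolding p(2) using q \<delta> by (intro mult_right_mono) auto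
      then show "- q * (1 / p) \<le> - mix_exp \<delta>" by (simp add: mix_exp_def)
    qed auto
    finally show ?thesis .
  qed
  then show thesis by (rule that)
qed

lemma hoelder_second_moment:
  fixes x c d \<alpha> :: real
  assumes "0 \<le> x" "x powr (1 / 2) \<le> c * d powr \<alpha>"
  shows "x \<le> c\<^sup>2 * d powr (2 * \<alpha>)"
proof -
  have "x = (x powr (1 / 2))\<^sup>2" using assms(1) by (simp add: powr_half_sqrt)
  also have "\<dots> \<le> (c * d powr \<alpha>)\<^sup>2" using assms(2) by (intro power_mono) auto
  also have "\<dots> = c\<^sup>2 * d powr (2 * \<alpha>)" by (simp add: power_mult_distrib power2_eq_square flip: powr_add)
  finally show ?thesis .
qed

section \<open>Convergence of the CUSUM noise to the bridge and of the statistics\<close>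

locale change_point_limit = hoelder_mixing_sequence M \<epsilon> \<delta> C\<beta> \<alpha> c + N: brownian_C01 N W
  for M :: "'w measure" and \<epsilon> \<delta> C\<beta> \<alpha> c and N :: "'v measure" and W +
  fixes s :: real and \<mu>1 \<mu>2 \<Phi> :: C01
  assumes s: "0 < s" "s < 1" and jump: "\<mu>1 - \<mu>2 = \<Phi>"
    and W_cov: "bounded_linear l \<Longrightarrow> (LINT w|N. l (W 1 w) * l (W 1 w)) = long_run_cov M \<epsilon> l l"
begin

definition bridge :: "'v \<Rightarrow> C01" where "bridge w = W s w - s *\<^sub>R W 1 w"

lemma bridge_measurable: "bridge \<in> borel_measurable N"
  using s N.W_measurable unfolding bridge_def[abs_def] by (intro borel_measurable_diff borel_measurable_scaleR borel_measurable_const) auto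

text \<open>Mean zero is given for evaluations. Restricting to functionals with vanishing mean
  avoids interchanging a general functional with the expectation, and adding multiples of
  evaluations preserves the condition.\<close>

definition centred_functionals :: "(C01 \<Rightarrow> real) set" where
  "centred_functionals = {l. bounded_linear l \<and> (LINT w|M. l (\<epsilon> 1 w)) = 0}"

sublocale fidi_convergence M N "cp_noise s" bridge centred_functionals
proof
  show "cp_noise s n \<in> borel_measurable M" for n by (rule cp_noise_measurable)
  show "bridge \<in> borel_measurable N" by (rule bridge_measurable)
  show "l \<in> borel_measurable borel" if "l \<in> centred_functionals" for l
    using that by (auto simp: centred_functionals_def intro: borel_measurable_continuous_onI linear_continuous_on)
  show "(\<lambda>_. 0) \<in> centred_functionals" by (simp add: centred_functionals_def bounded_linear_zero)
  show "(\<lambda>x. l x + r * val_at x t) \<in> centred_functionals" if l: "l \<in> centred_functionals" and t: "t \<in> {0..1}" for l r t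
  proof -
    have bl: "bounded_linear l" "(LINT w|M. l (\<epsilon> 1 w)) = 0" using l by (auto simp: centred_functionals_def)
    have "(LINT w|M. l (\<epsilon> 1 w) + r * val_at (\<epsilon> 1 w) t) = 0"
      using bl mean_zero[OF _ t, of 1] dominated_integrable[OF _ bounded_linear_dominated[OF bl(1)], of 1] dominated_integrable[OF _ dominated_val_at[of t], of 1]
      by (subst Bochner_Integration.integral_add) auto
    moreover have "bounded_linear (\<lambda>x. l x + r * val_at x t)"
      by (intro bounded_linear_add bounded_linear_const_mult bl(1) bounded_linear_val_at)
    ultimately show ?thesis by (simp add: centred_functionals_def)
  qed
  show "(\<lambda>n. LINT w|M. cos (l (cp_noise s n w) + a)) \<longlonglongrightarrow> (LINT w|N. cos (l (bridge w) + a))"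
    if "l \<in> centred_functionals" for l a
  proof -
    have bl: "bounded_linear l" "(LINT w|M. l (\<epsilon> 1 w)) = 0" using that by (auto simp: centred_functionals_def)
    have [measurable]: "l \<in> borel_measurable borel" using bl(1) by (intro borel_measurable_continuous_onI linear_continuous_on)
    note [measurable] = bridge_measurable
    have "(\<lambda>n. CLINT w|M. iexp (1 * nsum (stepw (cp_index s n) n) l n w)) \<longlonglongrightarrow>
      complex_of_real (exp (- (1\<^sup>2 * (s * (1 - s) * lrvar l) / 2)))"
      by (rule stepw_char_tendsto[OF bounded_linear_dominated[OF bl(1)] cp_index_bounds(3)[OF s] cp_index_tendsto[OF s] s])
    also have "complex_of_real (exp (- (1\<^sup>2 * (s * (1 - s) * lrvar l) / 2))) = (CLINT w|N. iexp (l (bridge w)))"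
      unfolding bridge_def using s by (subst N.bridge_char) (simp_all add: bl lrvar_eq_long_run_cov[OF bl] power2_eq_square W_cov)
    finally have "(\<lambda>n. CLINT w|M. iexp (l (cp_noise s n w))) \<longlonglongrightarrow> (CLINT w|N. iexp (l (bridge w)))"
      using bl by (simp add: linear_cp_noise)
    then have "(\<lambda>n. Re (iexp a * (CLINT w|M. iexp (l (cp_noise s n w))))) \<longlonglongrightarrow> Re (iexp a * (CLINT w|N. iexp (l (bridge w))))"
      by (intro tendsto_intros)
    then show ?thesis
      by (simp add: expectation_cos_shift N.expectation_cos_shift del: of_real_add)
  qed
qed

lemma weak_conv_cusum_stat:
  assumes \<nu>: "C01_seminorm \<nu>" "\<nu> \<Phi> > 0" and D: "\<And>z. ((\<lambda>r. C01_seminorm.drift \<nu> \<Phi> r z) \<longlongrightarrow> D z) at_top"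
  shows "weak_conv_m (\<lambda>n. distr M borel (\<lambda>w. cusum_stat \<nu> (change_point_model s \<mu>1 \<mu>2 \<epsilon>) n w - sqrt (real n) * (s * (1 - s) * \<nu> \<Phi>)))
    (distr N borel (\<lambda>w. D (bridge w)))"
proof (rule C01_seminorm.weak_conv_drift[OF \<nu>(1) prob_space_axioms N.prob_space_axioms _ _ bridge_measurable _ D filterlim_cp_scale[OF s] cp_scale_diff_tendsto[OF s]])
  show "cp_noise s n \<in> borel_measurable M" for n by (rule cp_noise_measurable)
  have "change_point_model s \<mu>1 \<mu>2 \<epsilon> n i \<in> borel_measurable M" if "i \<ge> 1" for n i
    using rv[OF that] unfolding change_point_model_def[abs_def] by measurable
  then show "cusum_stat \<nu> (change_point_model s \<mu>1 \<mu>2 \<epsilon>) n \<in> borel_measurable M" for n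
    by (rule C01_seminorm.measurable_cusum_stat[OF \<nu>(1)])
  show "\<forall>\<^sub>F n in sequentially. measure M {w\<in>space M. \<bar>cusum_stat \<nu> (change_point_model s \<mu>1 \<mu>2 \<epsilon>) n w - \<nu> (cp_scale s n *\<^sub>R \<Phi> + cp_noise s n w)\<bar> > e} \<le> \<eta>"
    if "e > 0" "\<eta> > 0" for e \<eta>
    using cusum_localisation[OF \<nu>(1) _ s that, of \<mu>1 \<mu>2] \<nu>(2) unfolding jump by simp
qed (rule integral_lipschitz_tendsto[OF cp_noise_tight[OF s]])

end

theorem theorem5p1:
  fixes M :: "'w measure" and N :: "'v measure"
    and \<epsilon> :: "nat \<Rightarrow> 'w \<Rightarrow> C01"
    and \<mu>1 \<mu>2 \<Phi> :: C01
    and X :: "nat \<Rightarrow> nat \<Rightarrow> 'w \<Rightarrow> C01"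
    and W :: "real \<Rightarrow> 'v \<Rightarrow> C01"
    and B :: "'v \<Rightarrow> C01"
    and s0 \<delta> \<eta> \<tau> \<alpha> c :: real
  assumes "prob_space M"
    and rv: "\<And>i. i \<ge> 1 \<Longrightarrow> \<epsilon> i \<in> borel_measurable M"
    and stationary: "stationary_seq M \<epsilon>"
    and s0: "0 < s0" "s0 < 1"
    and X_def: "X = change_point_model s0 \<mu>1 \<mu>2 \<epsilon>"
    and \<Phi>: "\<mu>1 - \<mu>2 = \<Phi>" "\<Phi> \<noteq> 0"
    and A1: "\<delta> > 0" "\<And>i. i \<ge> 1 \<Longrightarrow> integrable M (\<lambda>\<omega>. norm (\<epsilon> i \<omega>) powr (2 + \<delta>))"
    and mean_zero: "\<And>i t. i \<ge> 1 \<Longrightarrow> t \<in> {0..1} \<Longrightarrow> (LINT \<omega>|M. val_at (\<epsilon> i \<omega>) t) = 0"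
    and A2: "\<eta> > 0" "1 / (2 + 2 * \<delta>) < \<tau>" "\<tau> < 1 / 2"
      "\<And>k. k \<ge> 1 \<Longrightarrow> beta_coeff M \<epsilon> k \<le> real k powr (- ((1 + \<eta>) * (1 + 2 / \<delta>)))"
      "summable (\<lambda>k. real (Suc k) powr (1 / (1 / 2 - \<tau>))
                     * beta_coeff M \<epsilon> (Suc k) powr (\<delta> / (2 + \<delta>)))"
    and A3: "\<And>i. i \<ge> 1 \<Longrightarrow>
      set_integrable lborel {0..1} (\<lambda>t. sqrt (LINT \<omega>|M. (val_at (\<epsilon> i \<omega>) t)\<^sup>2))"
    and hoelder: "\<alpha> > 1 / 2" "c > 0"
      "\<And>i s t. i \<ge> 1 \<Longrightarrow> s \<in> {0..1} \<Longrightarrow> t \<in> {0..1} \<Longrightarrow>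
         (LINT \<omega>|M. \<bar>val_at (\<epsilon> i \<omega>) s - val_at (\<epsilon> i \<omega>) t\<bar>\<^sup>2) powr (1 / 2) \<le> c * \<bar>s - t\<bar> powr \<alpha>"
    and W: "brownian_motion_C01 N W"
      "\<And>l l'. bounded_linear l \<Longrightarrow> bounded_linear l' \<Longrightarrow>
         (LINT \<omega>|N. l (W 1 \<omega>) * l' (W 1 \<omega>)) = long_run_cov M \<epsilon> l l'"
    and B_def: "B = (\<lambda>\<omega>. W s0 \<omega> - s0 *\<^sub>R W 1 \<omega>)"
  shows
    "weak_conv_m
       (\<lambda>n. distr M borel
          (\<lambda>\<omega>. cusum_stat L1_norm X n \<omega> - sqrt (real n) * (s0 * (1 - s0) * L1_norm \<Phi>)))
       (distr N borel
          (\<lambda>\<omega>. (LINT t:{t\<in>{0..1}. val_at \<Phi> t \<noteq> 0}|lborel. sgn (val_at \<Phi> t) * val_at (B \<omega>) t)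
              + (LINT t:{t\<in>{0..1}. val_at \<Phi> t = 0}|lborel. \<bar>val_at (B \<omega>) t\<bar>))) \<and>
     weak_conv_m
       (\<lambda>n. distr M borel
          (\<lambda>\<omega>. cusum_stat L2_norm X n \<omega> - sqrt (real n) * (s0 * (1 - s0) * L2_norm \<Phi>)))
       (distr N borel (\<lambda>\<omega>. L2_inner (B \<omega>) ((1 / L2_norm \<Phi>) *\<^sub>R \<Phi>))) \<and>
     weak_conv_m
       (\<lambda>n. distr M borel
          (\<lambda>\<omega>. cusum_stat norm X n \<omega> - sqrt (real n) * (s0 * (1 - s0) * norm \<Phi>)))
       (distr N borel
          (\<lambda>\<omega>. SUP t\<in>{t\<in>{0..1}. \<bar>val_at \<Phi> t\<bar> = norm \<Phi>}.
                 sgn (val_at \<Phi> t) * (val_at (W s0 \<omega>) t - s0 * val_at (W 1 \<omega>) t)))"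
proof -
  interpret P: C01_process M \<epsilon>
    using assms(1) rv by (simp add: C01_process_def C01_process_axioms_def)
  obtain C where C: "\<And>k. k \<ge> 1 \<Longrightarrow> beta_coeff M \<epsilon> k \<le> C * real k powr (- mix_exp \<delta>)"
    by (rule mixing_rate_from_summable[OF A1(1) A2(2,3) P.beta_coeff_nonneg A2(5)]) (rule that)
  interpret N: prob_space N using W(1) by (simp add: brownian_motion_C01_def)
  interpret change_point_limit M \<epsilon> \<delta> C \<alpha> c N W s0 \<mu>1 \<mu>2 \<Phi>
  proof
    show "P.expectation (\<lambda>w. (val_at (\<epsilon> 1 w) t - val_at (\<epsilon> 1 w) s)\<^sup>2) \<le> c\<^sup>2 * \<bar>t - s\<bar> powr (2 * \<alpha>)"
      if "s \<in> {0..1}" "t \<in> {0..1}" for s t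
      using hoelder(3)[of 1 t s] that by (intro hoelder_second_moment) simp_all
  qed (use assms C in auto)
  have B: "bridge = B" by (simp add: bridge_def B_def fun_eq_iff)
  show ?thesis
    using weak_conv_cusum_stat[OF L1.C01_seminorm_axioms L1_norm_pos[OF \<Phi>(2)] L1_drift_tendsto]
      weak_conv_cusum_stat[OF L2.C01_seminorm_axioms L2_norm_pos[OF \<Phi>(2)] L2_drift_tendsto[OF \<Phi>(2)]]
      weak_conv_cusum_stat[OF sup_norm.C01_seminorm_axioms _ sup_drift_tendsto[OF \<Phi>(2)]] \<Phi>(2)
    unfolding B X_def by (simp add: B_def)
qed

end
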